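(* Let $\Omega=(0,1)^2$, $1\le p,q\le 2$, $\nu_1,\nu_2>0$, $f\in L_2(\Omega)$. Let $\psi_1,\dots,\psi_J$ be tensor-product B-spline framelets with associated differential operators $D_1,\dots,D_J$ of orders $s_j\ge1$, $s=\max_js_j$, $\mathbf D'=(D_1,\dots,D_J)$, $\mathbf D''v=(D_iv_j)_{1\le i,j\le J}$. Let $A:L_2(\Omega)\to L_2(\Omega)$ be a linear operator and $\mathbf A_n$ linear operators on $\mathbb R^{\mathbf K_n}$ with $\lim_{n\to\infty}\|\mathbf T_nAu-\mathbf A_n\mathbf T_nu\|_{\ell_2(\mathbf K_n)}=0$ for all $u\in L_2(\Omega)$. For $(u,v)\in W_{2s}^p(\Omega)\times W_s^q(\Omega;\mathbb R^J)$ put $$E_n(u,v)=\nu_1\|\mathbf W_n'\mathbf T_nu-\mathbf S_nv\|^p_{\ell_p(\mathbf K_n;\ell_2(\mathbb R^J))}+\nu_2\|\mathbf W_n''\mathbf S_nv\|^q_{\ell_q(\mathbf K_n;\ell_2(\mathbb R^{J^2}))}+\tfrac12\|\mathbf A_n\mathbf T_nu-\mathbf T_nf\|^2_{\ell_2(\mathbf K_n)},$$ $$E(u,v)=\nu_1\|\mathbf D'u-v\|^p_{L_p(\Omega;\ell_2(\mathbb R^J))}+\nu_2\|\mathbf D''v\|^q_{L_q(\Omega;\ell_2(\mathbb R^{J^2}))}+\tfrac12\|Au-f\|^2_{L_2(\Omega)}.$$ Let $\epsilon>0$ and, for every $n$, let $(u_n^\star,v_n^\star)$ be an $\epsilon$-optimal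 solution of $E_n$. If the sequence $\{(u_n^\star,v_n^\star)\}_n$ has a cluster point $(u^\star,v^\star)$ in $W_{2s}^p(\Omega)\times W_s^q(\Omega;\mathbb R^J)$, then $(u^\star,v^\star)$ is an $\epsilon$-optimal solution of $E$. In particular, if $(u_n^\star,v_n^\star)$ is a minimizer of $E_n$ for every $n$ and $(u^\star,v^\star)$ is a cluster point of $\{(u_n^\star,v_n^\star)\}_n$, then $(u^\star,v^\star)$ is a minimizer of $E$.
   Context: **Optimality.** A point $(u^\star,v^\star)\in W_{2s}^p(\Omega)\times W_s^q(\Omega;\mathbb R^J)$ is an $\epsilon$-optimal solution of a functional $G$ on that space if $G(u^\star,v^\star)\le\inf G+\epsilon$, the infimum being over that space; a minimizer is a $0$-optimal solution. A cluster point of a sequence is the limit (in norm) of some subsequence. **Spaces.** $W_r^p(\Omega)$ is the Sobolev space of functions with weak derivatives up to order $r$ in $L_p(\Omega)$; $W_r^q(\Omega;\mathbb R^J)$ is its $\mathbb R^J$-valued version. $\|g\|_{L_p(\Omega;\ell_2)}=\big(\int_\Omega|g(x)|_2^p\,dx\big)^{1/p}$ with $|\cdot|_2$ the Euclidean norm. For an $\mathbb R^M$-valued array $\mathbf a$ on a finite index set $\mathbf K_n$ (below), $\|\mathbf a\|_{\ell_p(\mathbf K_n;\ell_2(\mathbb R^M))}=\big(2^{-2n}\sum_{\mathbf k\in\mathbf K_n}|\mathbf a[\mathbf k]|_2^p\big)^{1/p}$; $\ell_2(\mathbf K_n)$ is the case $M=1$, $p=2$. **B-spline framelets.** For an integer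 $m\ge1$ let $\kappa\in\{0,1\}$ have the parity of $m$, let $B_m$ be the B-spline with $\widehat B_m(\omega)=e^{-i\kappa\omega/2}\big(\tfrac{\sin(\omega/2)}{\omega/2}\big)^m$, and for $0\le r\le m$ let $q_r$ be the finite real filter with $\sum_kq_r[k]e^{-ik\omega}=i^r\sqrt{\tbinom mr}\,e^{-i\kappa\omega/2}\cos^{m-r}(\omega/2)\sin^r(\omega/2)$ (up to a sign, which is immaterial). Put $\phi=B_m\otimes B_m$, $\mathbf q^{(0)}=q_0\otimes q_0$. The framelets of the tensor-product B-spline tight wavelet frame system of order $m$ are $\psi=4\sum_{\mathbf k\in\mathbb Z^2}\mathbf q[\mathbf k]\phi(2\cdot-\mathbf k)$ with $\mathbf q=q_{r_1}\otimes q_{r_2}$, $(r_1,r_2)\ne(0,0)$, $0\le r_1,r_2\le m$; the differential operator associated with such $\psi$ is $\partial_1^{r_1}\partial_2^{r_2}$. Given framelets $\psi_1,\dots,\psi_J$ (of one fixed order $m$) with filters $\mathbf q^{(1)},\dots,\mathbf q^{(J)}$ and associated operators $D_1,\dots,D_J$ of orders $s_1,\dots,s_J$: - $\varphi_j$ is the compactly supported function with $D_j\varphi_j=\psi_j$; $c_j=\int\varphi_j\neq0$. - $\varphi_{ij}$ is the compactly supported function with $D_i\varphi_{ij}=4c_j^{-1}\sum_{\mathbf m\in\mathbb Z^2}\mathbf q^{(i)}[\mathbf m]\,\varphi_j(2\cdot-\mathbf m/2)$; $c_{ij}=\int\varphi_{ij}\ne0$. - $\phi_{n,\mathbf k}=2^n\phi(2^n\cdot-\mathbf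 k)$, $\varphi_{j,n-1,\mathbf k}=2^{n-2}\varphi_j(2^{n-1}\cdot-\mathbf k/2)$. **Index sets.** $\mathbf M_n=\{\mathbf k\in\mathbb Z^2:\operatorname{supp}\phi_{n,\mathbf k}\subset\overline\Omega\}$ and $\mathbf K_n=\{\mathbf k\in\mathbf M_n:\mathbf k+C\cdot\operatorname{supp}(\mathbf q^{(j)})\subset\mathbf M_n\text{ for all }0\le j\le J\}$, where $C$ is a fixed positive integer, independent of $n$, large enough that for $\mathbf k\in\mathbf K_n$ all sampling functions entering the formulas below are supported in $\overline\Omega$ (so no boundary condition is active in the convolutions). **Sampling.** $(\mathbf T_ng)[\mathbf k]=2^n\langle g,\phi_{n,\mathbf k}\rangle_{L_2(\Omega)}$ for $g\in L_2(\Omega)$, and $(\mathbf S_nv)[j;\mathbf k]=2^n\langle v_j,c_j^{-1}\varphi_{j,n-1,\mathbf k}\rangle_{L_2(\Omega)}$ for $v\in L_2(\Omega;\mathbb R^J)$. These are taken at all indices $\mathbf k$ whose sampling function is supported in $\overline\Omega$; where an array on $\mathbf K_n$ is needed (as an argument of $\mathbf A_n$ and inside norms) they are restricted to $\mathbf K_n$. **Weighted transforms.** For $\mathbf k\in\mathbf K_n$, $$(\mathbf W_n'\mathbf u)[j;\mathbf k]=c_j^{-1}(-1)^{s_j}2^{(n-1)s_j}\sum_{\mathbf l}\mathbf q^{(j)}[\mathbf l-\mathbf k]\mathbf u[\mathbf l],\qquad(\mathbf W_n''\mathbf v)[i,j;\mathbf k]=c_{ij}^{-1}(-1)^{s_i}2^{(n-2)s_i}\sum_{\mathbf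 l}\mathbf q^{(i)}[\mathbf l-\mathbf k]\mathbf v[j;\mathbf l],\quad 1\le i,j\le J.$$ *)

theory Defs
  imports "HOL-Analysis.Analysis" "HOL-Probability.Sinc_Integral"
begin

type_synonym point = "real \<times> real"

definition Omega :: "point set" where
  "Omega = {0<..<1} \<times> {0<..<1}"

section \<open>Lebesgue and Sobolev spaces\<close>

text \<open>Elements of \<open>L\<^sub>p(U)\<close> are represented by Borel measurable functions, read modulo
  equality almost everywhere on \<open>U\<close>; values outside \<open>U\<close> are irrelevant.\<close>

abbreviation meas_on :: "point set \<Rightarrow> point measure" where
  "meas_on U \<equiv> restrict_space lborel U"

definition Lp :: "point set \<Rightarrow> real \<Rightarrow> (point \<Rightarrow> 'a::euclidean_space) set" where
  "Lp U p = {f. f \<in> borel_measurable (meas_on U) \<and> integrable (meas_on U) (\<lambda>x. norm (f x) powr p)}"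

definition Lp_norm :: "point set \<Rightarrow> real \<Rightarrow> (point \<Rightarrow> 'a::euclidean_space) \<Rightarrow> real" where
  "Lp_norm U p f = (LINT x|meas_on U. norm (f x) powr p) powr (1 / p)"

definition dx :: "(point \<Rightarrow> real) \<Rightarrow> point \<Rightarrow> real" where
  "dx f = (\<lambda>(x, y). deriv (\<lambda>t. f (t, y)) x)"

definition dy :: "(point \<Rightarrow> real) \<Rightarrow> point \<Rightarrow> real" where
  "dy f = (\<lambda>(x, y). deriv (\<lambda>t. f (x, t)) y)"

definition partial :: "nat \<times> nat \<Rightarrow> (point \<Rightarrow> real) \<Rightarrow> point \<Rightarrow> real" where
  "partial \<alpha> f = (dx ^^ fst \<alpha>) ((dy ^^ snd \<alpha>) f)"

primrec C_k :: "nat \<Rightarrow> (point \<Rightarrow> real) \<Rightarrow> bool" where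
  "C_k 0 f \<longleftrightarrow> continuous_on UNIV f"
| "C_k (Suc k) f \<longleftrightarrow> (\<forall>z. f differentiable (at z)) \<and> C_k k (dx f) \<and> C_k k (dy f)"

definition test_function :: "point set \<Rightarrow> (point \<Rightarrow> real) \<Rightarrow> bool" where
  "test_function U \<eta> \<longleftrightarrow>
     (\<forall>k. C_k k \<eta>) \<and> compact (closure {x. \<eta> x \<noteq> 0}) \<and> closure {x. \<eta> x \<noteq> 0} \<subseteq> U"

definition locally_integrable :: "point set \<Rightarrow> (point \<Rightarrow> 'a::euclidean_space) \<Rightarrow> bool" where
  "locally_integrable U f \<longleftrightarrow> (\<forall>K. compact K \<and> K \<subseteq> U \<longrightarrow> set_integrable lborel K f)"

definition has_weak_deriv ::
  "point set \<Rightarrow> nat \<times> nat \<Rightarrow> (point \<Rightarrow> 'a::euclidean_space) \<Rightarrow> (point \<Rightarrow> 'a) \<Rightarrow> bool" where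
  "has_weak_deriv U \<alpha> f g \<longleftrightarrow>
     locally_integrable U f \<and> locally_integrable U g \<and>
     (\<forall>\<eta>. test_function U \<eta> \<longrightarrow>
        (LINT x|meas_on U. partial \<alpha> \<eta> x *\<^sub>R f x)
        = (- 1) ^ (fst \<alpha> + snd \<alpha>) *\<^sub>R (LINT x|meas_on U. \<eta> x *\<^sub>R g x))"

text \<open>Weak derivatives on an open set are unique up to a null set, so the choice made here
  only fixes a representative.\<close>

definition weak_deriv ::
  "point set \<Rightarrow> nat \<times> nat \<Rightarrow> (point \<Rightarrow> 'a::euclidean_space) \<Rightarrow> point \<Rightarrow> 'a" where
  "weak_deriv U \<alpha> f = (SOME g. has_weak_deriv U \<alpha> f g)"

definition sobolev :: "point set \<Rightarrow> nat \<Rightarrow> real \<Rightarrow> (point \<Rightarrow> 'a::euclidean_space) set" where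
  "sobolev U r p = {f. f \<in> Lp U p \<and>
     (\<forall>\<alpha>. fst \<alpha> + snd \<alpha> \<le> r \<longrightarrow> (\<exists>g \<in> Lp U p. has_weak_deriv U \<alpha> f g))}"

definition sobolev_norm :: "point set \<Rightarrow> nat \<Rightarrow> real \<Rightarrow> (point \<Rightarrow> 'a::euclidean_space) \<Rightarrow> real" where
  "sobolev_norm U r p f =
     (\<Sum>\<alpha> | fst \<alpha> + snd \<alpha> \<le> r. Lp_norm U p (weak_deriv U \<alpha> f) powr p) powr (1 / p)"

text \<open>The support of a function defined almost everywhere: the complement of the largest open
  set on which it vanishes almost everywhere. Unlike the closure of the nonvanishing set it does
  not depend on the representative.\<close>

definition ess_supp :: "(point \<Rightarrow> real) \<Rightarrow> point set" where
  "ess_supp f = - \<Union>{U. open U \<and> (AE x in lborel. x \<in> U \<longrightarrow> f x = 0)}"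

definition linear_operator_L2 :: "((point \<Rightarrow> real) \<Rightarrow> point \<Rightarrow> real) \<Rightarrow> bool" where
  "linear_operator_L2 A \<longleftrightarrow>
     (\<forall>f \<in> Lp Omega 2. A f \<in> Lp Omega 2) \<and>
     (\<forall>f \<in> Lp Omega 2. \<forall>g \<in> Lp Omega 2.
        (AE x in meas_on Omega. f x = g x) \<longrightarrow> (AE x in meas_on Omega. A f x = A g x)) \<and>
     (\<forall>f \<in> Lp Omega 2. \<forall>g \<in> Lp Omega 2.
        AE x in meas_on Omega. A (\<lambda>y. f y + g y) x = A f x + A g x) \<and>
     (\<forall>c. \<forall>f \<in> Lp Omega 2. AE x in meas_on Omega. A (\<lambda>y. c * f y) x = c * A f x)"

section \<open>Arrays\<close>

definition lp_norm :: "nat \<Rightarrow> (int \<times> int) set \<Rightarrow> real \<Rightarrow> (int \<times> int \<Rightarrow> 'a::euclidean_space) \<Rightarrow> real" where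
  "lp_norm n K p a = (2 powi (- 2 * int n) * (\<Sum>k\<in>K. norm (a k) powr p)) powr (1 / p)"

text \<open>An element of \<open>\<real>\<^sup>K\<close> is represented by any function that takes its values on \<open>K\<close>; the
  first clause says that only these values matter.\<close>

definition linear_operator_arrays ::
  "(int \<times> int) set \<Rightarrow> ((int \<times> int \<Rightarrow> real) \<Rightarrow> int \<times> int \<Rightarrow> real) \<Rightarrow> bool" where
  "linear_operator_arrays K L \<longleftrightarrow>
     (\<forall>a b. (\<forall>k\<in>K. a k = b k) \<longrightarrow> (\<forall>k\<in>K. L a k = L b k)) \<and>
     (\<forall>a b. \<forall>k\<in>K. L (\<lambda>l. a l + b l) k = L a k + L b k) \<and>
     (\<forall>c a. \<forall>k\<in>K. L (\<lambda>l. c * a l) k = c * L a k)"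

section \<open>B-spline framelets\<close>

definition is_bspline :: "nat \<Rightarrow> (real \<Rightarrow> real) \<Rightarrow> bool" where
  "is_bspline m B \<longleftrightarrow> integrable lborel B \<and>
     (\<forall>\<omega>::real. (LINT x|lborel. of_real (B x) * exp (- \<i> * of_real (\<omega> * x)))
        = exp (- \<i> * of_real (real (m mod 2) * \<omega> / 2)) * of_real (sinc (\<omega> / 2)) ^ m)"

definition is_filter :: "nat \<Rightarrow> nat \<Rightarrow> (int \<Rightarrow> real) \<Rightarrow> bool" where
  "is_filter m r h \<longleftrightarrow> finite {k. h k \<noteq> 0} \<and>
     (\<exists>\<sigma> \<in> {1, - 1}. \<forall>\<omega>::real.
        (\<Sum>k | h k \<noteq> 0. of_real (h k) * exp (- \<i> * of_real (real_of_int k * \<omega>)))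
        = \<sigma> * \<i> ^ r * of_real (sqrt (real (m choose r)))
          * exp (- \<i> * of_real (real (m mod 2) * \<omega> / 2))
          * of_real (cos (\<omega> / 2) ^ (m - r) * sin (\<omega> / 2) ^ r))"

text \<open>The data attached to framelets \<open>\<psi>\<^sub>j\<close>, indexed by a finite type \<open>'j\<close> with \<open>J\<close> elements:
  \<open>ops j = (r\<^sub>1, r\<^sub>2)\<close> gives the operator \<open>\<partial>\<^sub>1\<^bsup>r1\<^esup> \<partial>\<^sub>2\<^bsup>r2\<^esup>\<close>; \<open>bspl\<close> and \<open>filt r\<close> are
  \<open>B\<^sub>m\<close> and \<open>q\<^sub>r\<close>; \<open>prim j\<close> and \<open>prim2 i j\<close> are \<open>\<phi>\<^sub>j\<close> and \<open>\<phi>\<^sub>i\<^sub>j\<close> (curly phi); \<open>dil\<close> is the constant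
  \<open>C\<close> in the definition of the index sets. The functions are determined only almost everywhere,
  the filters only up to sign; the predicate \<open>framelet_system\<close> below allows all choices.\<close>

record 'j framelet_data =
  spline_order :: nat
  ops :: "'j \<Rightarrow> nat \<times> nat"
  bspl :: "real \<Rightarrow> real"
  filt :: "nat \<Rightarrow> int \<Rightarrow> real"
  prim :: "'j \<Rightarrow> point \<Rightarrow> real"
  prim2 :: "'j \<Rightarrow> 'j \<Rightarrow> point \<Rightarrow> real"
  dil :: nat

definition ord_of :: "'j framelet_data \<Rightarrow> 'j \<Rightarrow> nat" where
  "ord_of F j = fst (ops F j) + snd (ops F j)"

definition max_ord :: "('j::finite) framelet_data \<Rightarrow> nat" where
  "max_ord F = Max (range (ord_of F))"

definition refinable :: "'j framelet_data \<Rightarrow> point \<Rightarrow> real" where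
  "refinable F = (\<lambda>(x, y). bspl F x * bspl F y)"

definition tensor_filt :: "'j framelet_data \<Rightarrow> nat \<times> nat \<Rightarrow> int \<times> int \<Rightarrow> real" where
  "tensor_filt F \<alpha> = (\<lambda>(k, l). filt F (fst \<alpha>) k * filt F (snd \<alpha>) l)"

definition fsupp :: "(int \<times> int \<Rightarrow> real) \<Rightarrow> (int \<times> int) set" where
  "fsupp h = {k. h k \<noteq> 0}"

definition embed :: "int \<times> int \<Rightarrow> point" where
  "embed k = (real_of_int (fst k), real_of_int (snd k))"

definition framelet :: "'j framelet_data \<Rightarrow> 'j \<Rightarrow> point \<Rightarrow> real" where
  "framelet F j x = 4 * (\<Sum>k \<in> fsupp (tensor_filt F (ops F j)).
     tensor_filt F (ops F j) k * refinable F (2 *\<^sub>R x - embed k))"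

definition c1 :: "'j framelet_data \<Rightarrow> 'j \<Rightarrow> real" where
  "c1 F j = (LINT x|lborel. prim F j x)"

definition c2 :: "'j framelet_data \<Rightarrow> 'j \<Rightarrow> 'j \<Rightarrow> real" where
  "c2 F i j = (LINT x|lborel. prim2 F i j x)"

definition refinable_nk :: "'j framelet_data \<Rightarrow> nat \<Rightarrow> int \<times> int \<Rightarrow> point \<Rightarrow> real" where
  "refinable_nk F n k x = 2 ^ n * refinable F (2 ^ n *\<^sub>R x - embed k)"

text \<open>The curly \<open>\<phi>\<^bsub>j,n-1,k\<^esub>\<close> of the source is \<open>prim_nk F j n k\<close>: the level argument is \<open>n\<close>.\<close>

definition prim_nk :: "'j framelet_data \<Rightarrow> 'j \<Rightarrow> nat \<Rightarrow> int \<times> int \<Rightarrow> point \<Rightarrow> real" where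
  "prim_nk F j n k x =
     2 powi (int n - 2) * prim F j (2 powi (int n - 1) *\<^sub>R x - (1 / 2) *\<^sub>R embed k)"

definition M_set :: "'j framelet_data \<Rightarrow> nat \<Rightarrow> (int \<times> int) set" where
  "M_set F n = {k. ess_supp (refinable_nk F n k) \<subseteq> closure Omega}"

definition K_set :: "'j framelet_data \<Rightarrow> nat \<Rightarrow> (int \<times> int) set" where
  "K_set F n = {k \<in> M_set F n. \<forall>\<alpha> \<in> insert (0, 0) (range (ops F)). \<forall>l \<in> fsupp (tensor_filt F \<alpha>).
     k + (int (dil F) * fst l, int (dil F) * snd l) \<in> M_set F n}"

text \<open>The requirement on \<open>C\<close>: for \<open>k \<in> K\<^sub>n\<close>, every sampling function whose coefficient enters
  the weighted transforms or the sampling operators at \<open>k\<close> is supported in the closed square.\<close>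

definition dil_admissible :: "'j framelet_data \<Rightarrow> bool" where
  "dil_admissible F \<longleftrightarrow> 0 < dil F \<and>
     (\<forall>n. \<forall>k \<in> K_set F n. \<forall>j.
        ess_supp (prim_nk F j n k) \<subseteq> closure Omega \<and>
        (\<forall>i l. l - k \<in> fsupp (tensor_filt F (ops F i)) \<longrightarrow>
           ess_supp (refinable_nk F n l) \<subseteq> closure Omega \<and>
           ess_supp (prim_nk F j n l) \<subseteq> closure Omega))"

definition framelet_system :: "('j::finite) framelet_data \<Rightarrow> bool" where
  "framelet_system F \<longleftrightarrow>
     1 \<le> spline_order F \<and>
     (\<forall>j. fst (ops F j) \<le> spline_order F \<and> snd (ops F j) \<le> spline_order F \<and> ops F j \<noteq> (0, 0)) \<and>
     is_bspline (spline_order F) (bspl F) \<and>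
     (\<forall>r \<le> spline_order F. is_filter (spline_order F) r (filt F r)) \<and>
     (\<forall>j. compact (ess_supp (prim F j)) \<and>
        has_weak_deriv UNIV (ops F j) (prim F j) (framelet F j)) \<and>
     (\<forall>i j. compact (ess_supp (prim2 F i j)) \<and>
        has_weak_deriv UNIV (ops F i) (prim2 F i j)
          (\<lambda>x. 4 / c1 F j * (\<Sum>k \<in> fsupp (tensor_filt F (ops F i)).
             tensor_filt F (ops F i) k * prim F j (2 *\<^sub>R x - (1 / 2) *\<^sub>R embed k)))) \<and>
     dil_admissible F"

section \<open>Sampling, weighted transforms and the functionals\<close>

definition T_op :: "'j framelet_data \<Rightarrow> nat \<Rightarrow> (point \<Rightarrow> real) \<Rightarrow> int \<times> int \<Rightarrow> real" where
  "T_op F n g k = 2 ^ n * (LINT x|meas_on Omega. g x * refinable_nk F n k x)"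

definition S_op :: "('j::finite) framelet_data \<Rightarrow> nat \<Rightarrow> (point \<Rightarrow> real ^ 'j) \<Rightarrow> 'j \<Rightarrow> int \<times> int \<Rightarrow> real" where
  "S_op F n v j k = 2 ^ n * (LINT x|meas_on Omega. v x $ j * (prim_nk F j n k x / c1 F j))"

definition W1_op :: "'j framelet_data \<Rightarrow> nat \<Rightarrow> (int \<times> int \<Rightarrow> real) \<Rightarrow> 'j \<Rightarrow> int \<times> int \<Rightarrow> real" where
  "W1_op F n a j k =
     (- 1) ^ ord_of F j * 2 powi ((int n - 1) * int (ord_of F j)) / c1 F j
     * (\<Sum>l | l - k \<in> fsupp (tensor_filt F (ops F j)). tensor_filt F (ops F j) (l - k) * a l)"

definition W2_op ::
  "'j framelet_data \<Rightarrow> nat \<Rightarrow> ('j \<Rightarrow> int \<times> int \<Rightarrow> real) \<Rightarrow> 'j \<Rightarrow> 'j \<Rightarrow> int \<times> int \<Rightarrow> real" where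
  "W2_op F n a i j k =
     (- 1) ^ ord_of F i * 2 powi ((int n - 2) * int (ord_of F i)) / c2 F i j
     * (\<Sum>l | l - k \<in> fsupp (tensor_filt F (ops F i)). tensor_filt F (ops F i) (l - k) * a j l)"

definition E_n ::
  "('j::finite) framelet_data \<Rightarrow> real \<Rightarrow> real \<Rightarrow> real \<Rightarrow> real
   \<Rightarrow> (nat \<Rightarrow> (int \<times> int \<Rightarrow> real) \<Rightarrow> int \<times> int \<Rightarrow> real) \<Rightarrow> (point \<Rightarrow> real) \<Rightarrow> nat
   \<Rightarrow> (point \<Rightarrow> real) \<times> (point \<Rightarrow> real ^ 'j) \<Rightarrow> real" where
  "E_n F p q \<nu>1 \<nu>2 A\<^sub>n f n = (\<lambda>(u, v).
     \<nu>1 * lp_norm n (K_set F n) p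
            (\<lambda>k. (\<chi> j. W1_op F n (T_op F n u) j k - S_op F n v j k) :: real ^ 'j) powr p
     + \<nu>2 * lp_norm n (K_set F n) q
            (\<lambda>k. (\<chi> i j. W2_op F n (S_op F n v) i j k) :: real ^ 'j ^ 'j) powr q
     + 1 / 2 * (lp_norm n (K_set F n) 2 (\<lambda>k. A\<^sub>n n (T_op F n u) k - T_op F n f k))\<^sup>2)"

definition D1_op :: "('j::finite) framelet_data \<Rightarrow> (point \<Rightarrow> real) \<Rightarrow> point \<Rightarrow> real ^ 'j" where
  "D1_op F u x = (\<chi> j. weak_deriv Omega (ops F j) u x)"

definition D2_op :: "('j::finite) framelet_data \<Rightarrow> (point \<Rightarrow> real ^ 'j) \<Rightarrow> point \<Rightarrow> real ^ 'j ^ 'j" where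
  "D2_op F v x = (\<chi> i j. weak_deriv Omega (ops F i) (\<lambda>y. v y $ j) x)"

definition E_lim ::
  "('j::finite) framelet_data \<Rightarrow> real \<Rightarrow> real \<Rightarrow> real \<Rightarrow> real
   \<Rightarrow> ((point \<Rightarrow> real) \<Rightarrow> point \<Rightarrow> real) \<Rightarrow> (point \<Rightarrow> real)
   \<Rightarrow> (point \<Rightarrow> real) \<times> (point \<Rightarrow> real ^ 'j) \<Rightarrow> real" where
  "E_lim F p q \<nu>1 \<nu>2 A f = (\<lambda>(u, v).
     \<nu>1 * Lp_norm Omega p (\<lambda>x. D1_op F u x - v x) powr p
     + \<nu>2 * Lp_norm Omega q (D2_op F v) powr q
     + 1 / 2 * (Lp_norm Omega 2 (\<lambda>x. A u x - f x))\<^sup>2)"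

section \<open>Optimality\<close>

definition W_space ::
  "nat \<Rightarrow> real \<Rightarrow> real \<Rightarrow> ((point \<Rightarrow> real) \<times> (point \<Rightarrow> real ^ 'j::finite)) set" where
  "W_space s p q = sobolev Omega (2 * s) p \<times> sobolev Omega s q"

definition W_norm ::
  "nat \<Rightarrow> real \<Rightarrow> real \<Rightarrow> (point \<Rightarrow> real) \<times> (point \<Rightarrow> real ^ 'j::finite) \<Rightarrow> real" where
  "W_norm s p q = (\<lambda>(u, v). sobolev_norm Omega (2 * s) p u + sobolev_norm Omega s q v)"

definition eps_optimal :: "'z set \<Rightarrow> real \<Rightarrow> ('z \<Rightarrow> real) \<Rightarrow> 'z \<Rightarrow> bool" where
  "eps_optimal X \<epsilon> G z \<longleftrightarrow> z \<in> X \<and> G z \<le> (INF w\<in>X. G w) + \<epsilon>"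

abbreviation minimizer :: "'z set \<Rightarrow> ('z \<Rightarrow> real) \<Rightarrow> 'z \<Rightarrow> bool" where
  "minimizer X G z \<equiv> eps_optimal X 0 G z"

definition cluster_point ::
  "nat \<Rightarrow> real \<Rightarrow> real \<Rightarrow> (nat \<Rightarrow> (point \<Rightarrow> real) \<times> (point \<Rightarrow> real ^ 'j::finite))
   \<Rightarrow> (point \<Rightarrow> real) \<times> (point \<Rightarrow> real ^ 'j) \<Rightarrow> bool" where
  "cluster_point s p q w z \<longleftrightarrow> z \<in> W_space s p q \<and>
     (\<exists>\<rho>::nat \<Rightarrow> nat. strict_mono \<rho> \<and>
        (\<lambda>i. W_norm s p q (\<lambda>x. fst (w (\<rho> i)) x - fst z x, \<lambda>x. snd (w (\<rho> i)) x - snd z x))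
          \<longlonglongrightarrow> 0)"

end

theory Submission
  imports Defs "HOL-Probability.Levy"
begin

text \<open>The transforms are samples of derivatives: moving the primitives \<open>\<phi>\<^sub>j\<close> and \<open>\<phi>\<^sub>i\<^sub>j\<close> across the
  \<open>L\<^sub>2\<close> pairing turns \<open>W'\<^sub>n T\<^sub>n u\<close> and \<open>W''\<^sub>n S\<^sub>n v\<close> into inner products of \<open>D' u\<close> and \<open>D'' v\<close> with kernels
  \<open>4\<^bsup>n\<^esup> \<Phi>(2\<^bsup>n\<^esup> x - k)\<close>, where \<open>\<integral>\<Phi> = 1\<close>. This integration by parts needs no boundary terms because the
  kernels are supported in the closed square, but their supports may touch its boundary, so the
  primitives are approximated by mollifications whose supports are pushed into the open square.
  The sampling operators are bounded from \<open>L\<^sub>p\<close> to \<open>\<ell>\<^sub>p\<close> uniformly in \<open>n\<close> and the sampled norms of a fixed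
  function converge to its \<open>L\<^sub>p\<close> norm; the embedding of \<open>W\<^bsup>1\<^esup>\<^sub>1\<close> into \<open>L\<^sub>2\<close> puts \<open>u\<close> and \<open>v\<close> into the spaces on
  which the samples are taken. The operators \<open>A\<^sub>n T\<^sub>n\<close> are pointwise bounded, hence
  equicontinuous on \<open>L\<^sub>2\<close> by uniform boundedness. Hence \<open>E\<^sub>n(w\<^sub>n) \<longlonglongrightarrow> E(w)\<close> whenever \<open>w\<^sub>n \<longlonglongrightarrow> w\<close> in the Sobolev space, and
  the inequalities \<open>E\<^sub>n(w\<^sub>n) \<le> E\<^sub>n(y) + \<epsilon>\<close> pass to the limit along a subsequence.\<close>

section \<open>$L_p$ seminorms\<close>

text \<open>Continuity of A is not part of \<open>linear_operator_L2\<close>, so the error A_n T_n(U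
  - u) cannot be transferred to A(U - u). It must be controlled through A_n T_n alone, for which
  consistency gives bounds only at each fixed function; this forces the uniform boundedness
  argument. The embedding into L_2 has two uses: A acts on L_2 while u lies in a Sobolev space over
  L_p, and the first term of E measures v in L_p although v is controlled through L_q, where q may
  be below p. Since p is at most 2, L_2 serves both. The divisors c_j and c_ij are not declared
  nonzero in \<open>framelet_system\<close>; this is read off from the order of the zero of the
  filter symbols at the origin. \<open>prim\<close> and \<open>prim2\<close> are known only through
  a weak derivative and a compact essential support, so their boundedness is derived by duality,
  testing against products a(x) b(y). The factor 4^n is 2^n from the sampling operator times 2^n
  from the normalised sampling function; it balances the weight 2^(-2n) of the array norms.\<close>

definition LpM :: "'x measure \<Rightarrow> real \<Rightarrow> ('x \<Rightarrow> 'a::euclidean_space) set" where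
  "LpM M p = {f \<in> borel_measurable M. integrable M (\<lambda>x. norm (f x) powr p)}"

definition LpN :: "'x measure \<Rightarrow> real \<Rightarrow> ('x \<Rightarrow> 'a::euclidean_space) \<Rightarrow> real" where
  "LpN M p f = (LINT x|M. norm (f x) powr p) powr (1 / p)"

lemma Lp_eq_LpM: "Lp U p = LpM (meas_on U) p"
  by (auto simp: Lp_def LpM_def)

lemma Lp_norm_eq_LpN: "Lp_norm U p f = LpN (meas_on U) p f"
  by (simp add: Lp_norm_def LpN_def)

lemma LpM_measurable: "f \<in> LpM M p \<Longrightarrow> f \<in> borel_measurable M"
  and LpM_integrable: "f \<in> LpM M p \<Longrightarrow> integrable M (\<lambda>x. norm (f x) powr p)"
  by (auto simp: LpM_def)

lemma LpN_nonneg [simp]: "0 \<le> LpN M p f"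
  by (simp add: LpN_def)

lemma LpN_powr: "p > 0 \<Longrightarrow> LpN M p f powr p = (LINT x|M. norm (f x) powr p)"
  by (simp add: LpN_def powr_powr)

lemma LpN_le_iff:
  assumes "p > 0" "0 \<le> c"
  shows "LpN M p f \<le> c \<longleftrightarrow> (LINT x|M. norm (f x) powr p) \<le> c powr p"
proof -
  have "LpN M p f \<le> c \<longleftrightarrow> LpN M p f powr p \<le> c powr p"
    using assms powr_mono2[of p "LpN M p f" c] powr_less_mono2[of p c "LpN M p f"]
    by (smt (verit) LpN_nonneg)
  then show ?thesis using assms by (simp add: LpN_powr)
qed

lemma LpN_cong_AE:
  assumes "f \<in> borel_measurable M" "g \<in> borel_measurable M" "AE x in M. f x = g x"
  shows "LpN M p f = LpN M p g"
  unfolding LpN_def using assms by (intro arg_cong2[where f="(powr)"] integral_cong_AE) auto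

lemma LpM_cong_AE:
  assumes "f \<in> LpM M p" "g \<in> borel_measurable M" "AE x in M. f x = g x"
  shows "g \<in> LpM M p"
proof -
  have "integrable M (\<lambda>x. norm (f x) powr p) \<longleftrightarrow> integrable M (\<lambda>x. norm (g x) powr p)"
    using assms by (intro integrable_cong_AE) (auto simp: LpM_def)
  with assms show ?thesis by (auto simp: LpM_def)
qed

lemma LpM_dominated:
  assumes "g \<in> LpM M p" "f \<in> borel_measurable M" "AE x in M. norm (f x) \<le> norm (g x)" "0 \<le> p"
  shows "f \<in> LpM M p"
proof -
  have "AE x in M. norm (f x) powr p \<le> norm (g x) powr p"
    using assms(3) by eventually_elim (rule powr_mono2, use assms(4) in simp_all)
  then have "integrable M (\<lambda>x. norm (f x) powr p)"
    using LpM_integrable[OF assms(1)] assms(2)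
    by (rule_tac Bochner_Integration.integrable_bound[of M "\<lambda>x. norm (g x) powr p"]) auto
  then show ?thesis using assms by (auto simp: LpM_def)
qed

lemma LpN_mono:
  assumes "g \<in> LpM M p" "f \<in> borel_measurable M" "AE x in M. norm (f x) \<le> norm (g x)" "0 < p"
  shows "LpN M p f \<le> LpN M p g"
proof -
  have "f \<in> LpM M p" using assms by (rule_tac LpM_dominated[of g]) auto
  moreover have "AE x in M. norm (f x) powr p \<le> norm (g x) powr p"
    using assms(3) by eventually_elim (rule powr_mono2, use assms(4) in simp_all)
  ultimately have "(LINT x|M. norm (f x) powr p) \<le> (LINT x|M. norm (g x) powr p)"
    using assms(1) by (intro integral_mono_AE) (auto simp: LpM_def)
  then show ?thesis
    unfolding LpN_def using assms(4) by (intro powr_mono2) (auto intro!: Bochner_Integration.integral_nonneg)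
qed

lemma LpM_scaleR: "f \<in> LpM M p \<Longrightarrow> (\<lambda>x. c *\<^sub>R f x) \<in> LpM M p"
  by (auto simp: LpM_def powr_mult)

lemma LpN_scaleR: "p > 0 \<Longrightarrow> LpN M p (\<lambda>x. c *\<^sub>R f x) = \<bar>c\<bar> * LpN M p f"
  by (simp add: LpN_def powr_mult powr_powr)

lemma LpN_minus: "LpN M p (\<lambda>x. f x - g x) = LpN M p (\<lambda>x. g x - f x)"
  by (simp add: LpN_def norm_minus_commute)

text \<open>Convexity is taken from the open half line; if one argument is 0, the claim reduces to
  s^p \<le> s on [0,1].\<close>

lemma powr_convex_nonneg:
  fixes a b t p :: real
  assumes "1 \<le> p" "0 \<le> a" "0 \<le> b" "0 \<le> t" "t \<le> 1"
  shows "(t * a + (1 - t) * b) powr p \<le> t * a powr p + (1 - t) * b powr p"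
proof -
  have scale: "(s * c) powr p \<le> s * c powr p" if "0 \<le> s" "s \<le> 1" "0 \<le> c" for s c :: real
  proof -
    have "s powr p \<le> s powr 1" using that assms by (intro powr_mono') auto
    then have "s powr p \<le> s" using that by simp
    then show ?thesis using that by (simp add: powr_mult mult_right_mono)
  qed
  consider "a = 0" | "b = 0" | "a > 0" "b > 0" using assms by fastforce
  then show ?thesis
  proof cases
    case 3
    then show ?thesis
      using convex_onD[OF powr_convex[OF assms(1)], of "1 - t" a b] assms
      by (auto simp: algebra_simps)
  qed (use scale[of t a] scale[of "1 - t" b] assms in auto)
qed

lemma norm_add_powr_le:
  fixes a b :: "'a::real_normed_vector"
  assumes "1 \<le> p"
  shows "norm (a + b) powr p \<le> 2 powr p * (norm a powr p + norm b powr p)"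
proof -
  have "norm (a + b) powr p \<le> (2 * (1/2 * norm a + (1 - 1/2) * norm b)) powr p"
    using norm_triangle_ineq[of a b] assms by (intro powr_mono2) auto
  also have "\<dots> = 2 powr p * (1/2 * norm a + (1 - 1/2) * norm b) powr p"
    by (rule powr_mult)
  also have "\<dots> \<le> 2 powr p * (1/2 * norm a powr p + (1 - 1/2) * norm b powr p)"
    using assms by (intro mult_left_mono powr_convex_nonneg) auto
  also have "\<dots> \<le> 2 powr p * (norm a powr p + norm b powr p)"
    by (intro mult_left_mono) (auto simp: field_simps)
  finally show ?thesis .
qed

lemma LpM_add:
  assumes "f \<in> LpM M p" "g \<in> LpM M p" "1 \<le> p"
  shows "(\<lambda>x. f x + g x) \<in> LpM M p"
proof -
  have "integrable M (\<lambda>x. 2 powr p * (norm (f x) powr p + norm (g x) powr p))"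
    using assms by (auto simp: LpM_def)
  then have "integrable M (\<lambda>x. norm (f x + g x) powr p)"
    by (rule Bochner_Integration.integrable_bound)
       (use assms norm_add_powr_le[OF assms(3)] in \<open>auto simp: LpM_def\<close>)
  with assms show ?thesis by (auto simp: LpM_def)
qed

lemma LpM_diff:
  assumes "f \<in> LpM M p" "g \<in> LpM M p" "1 \<le> p"
  shows "(\<lambda>x. f x - g x) \<in> LpM M p"
  using LpM_add[OF assms(1) LpM_scaleR[OF assms(2), of "-1"] assms(3)] by simp

lemma LpM_zero [simp]: "(\<lambda>x. 0) \<in> LpM M p"
  by (simp add: LpM_def)

lemma LpN_eq_0_imp_AE:
  assumes "f \<in> LpM M p" "LpN M p f = 0"
  shows "AE x in M. f x = 0"
proof -
  have "(LINT x|M. norm (f x) powr p) = 0"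
    using assms(2) by (auto simp: LpN_def)
  then have "AE x in M. norm (f x) powr p = 0"
    using LpM_integrable[OF assms(1)] by (subst (asm) integral_nonneg_eq_0_iff_AE) auto
  then show ?thesis by eventually_elim simp
qed

text \<open>Minkowski from convexity of the p-th power: with a and b the two norms, f + g is a + b
  times the convex combination of f/a and g/b with weights a/(a+b) and b/(a+b). If one norm is 0,
  that function vanishes almost everywhere.\<close>

lemma LpN_triangle:
  assumes f: "f \<in> LpM M p" and g: "g \<in> LpM M p" and p: "1 \<le> p"
  shows "LpN M p (\<lambda>x. f x + g x) \<le> LpN M p f + LpN M p g"
proof -
  note [measurable] = LpM_measurable[OF f] LpM_measurable[OF g]
  define a where "a = LpN M p f"
  define b where "b = LpN M p g"
  consider "a = 0" | "b = 0" | "a > 0" "b > 0" unfolding a_def b_def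
    using LpN_nonneg[of M p f] LpN_nonneg[of M p g] by linarith
  then show ?thesis
  proof cases
    case 1
    then have "AE x in M. f x = 0" using LpN_eq_0_imp_AE[OF f] by (simp add: a_def)
    then have "LpN M p (\<lambda>x. f x + g x) = LpN M p g"
      by (intro LpN_cong_AE) auto
    then show ?thesis by simp
  next
    case 2
    then have "AE x in M. g x = 0" using LpN_eq_0_imp_AE[OF g] by (simp add: b_def)
    then have "LpN M p (\<lambda>x. f x + g x) = LpN M p f"
      by (intro LpN_cong_AE) auto
    then show ?thesis by simp
  next
    case 3
    define s where "s = a + b"
    define t where "t = a / s"
    have s: "s > 0" and t: "0 \<le> t" "t \<le> 1" "1 - t = b / s"
      using 3 by (auto simp: s_def t_def field_simps)
    have pt: "norm (f x + g x) powr p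
        \<le> s powr p * (t / a powr p * norm (f x) powr p + (1 - t) / b powr p * norm (g x) powr p)" for x
    proof -
      have "norm (f x + g x) powr p \<le> (s * (t * (norm (f x) / a) + (1 - t) * (norm (g x) / b))) powr p"
      proof (intro powr_mono2)
        have "s * (t * (norm (f x) / a) + (1 - t) * (norm (g x) / b)) = norm (f x) + norm (g x)"
          using 3 s t(3) by (simp add: t_def distrib_left)
        then show "norm (f x + g x) \<le> s * (t * (norm (f x) / a) + (1 - t) * (norm (g x) / b))"
          using norm_triangle_ineq[of "f x" "g x"] by simp
      qed (use p in auto)
      also have "\<dots> = s powr p * (t * (norm (f x) / a) + (1 - t) * (norm (g x) / b)) powr p"
        by (rule powr_mult)
      also have "\<dots> \<le> s powr p * (t * (norm (f x) / a) powr p + (1 - t) * (norm (g x) / b) powr p)"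
        using 3 t p by (intro mult_left_mono powr_convex_nonneg) auto
      finally show ?thesis using 3 by (simp add: powr_divide)
    qed
    have "(LINT x|M. norm (f x + g x) powr p)
        \<le> (LINT x|M. s powr p * (t / a powr p * norm (f x) powr p + (1 - t) / b powr p * norm (g x) powr p))"
      using LpM_integrable[OF LpM_add[OF f g p]] LpM_integrable[OF f] LpM_integrable[OF g] pt
      by (intro integral_mono) auto
    also have "\<dots> = s powr p * (t / a powr p * a powr p + (1 - t) / b powr p * b powr p)"
      using LpM_integrable[OF f] LpM_integrable[OF g] p
      by (simp add: a_def b_def LpN_powr)
    also have "\<dots> = s powr p" using 3 by simp
    finally show ?thesis
      using p s by (subst LpN_le_iff) (auto simp: s_def a_def b_def)
  qed
qed

lemma LpN_triangle_diff:
  assumes f: "f \<in> LpM M p" and g: "g \<in> LpM M p" and p: "1 \<le> p"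
  shows "\<bar>LpN M p f - LpN M p g\<bar> \<le> LpN M p (\<lambda>x. f x - g x)"
proof -
  have "LpN M p f \<le> LpN M p (\<lambda>x. f x - g x) + LpN M p g"
    using LpN_triangle[OF LpM_diff[OF f g p] g p] by simp
  moreover have "LpN M p g \<le> LpN M p (\<lambda>x. g x - f x) + LpN M p f"
    using LpN_triangle[OF LpM_diff[OF g f p] f p] by simp
  ultimately show ?thesis using LpN_minus[of M p f g] by linarith
qed

lemma LpM_sum:
  assumes "\<And>i. i \<in> I \<Longrightarrow> f i \<in> LpM M p" "1 \<le> p"
  shows "(\<lambda>x. \<Sum>i\<in>I. f i x) \<in> LpM M p"
  using assms(1) by (induction I rule: infinite_finite_induct) (auto intro!: LpM_add assms(2))

lemma LpN_sum_le:
  assumes "\<And>i. i \<in> I \<Longrightarrow> f i \<in> LpM M p" "1 \<le> p"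
  shows "LpN M p (\<lambda>x. \<Sum>i\<in>I. f i x) \<le> (\<Sum>i\<in>I. LpN M p (f i))"
  using assms(1)
proof (induction I rule: infinite_finite_induct)
  case (insert i I)
  then have "LpN M p (\<lambda>x. f i x + (\<Sum>i\<in>I. f i x)) \<le> LpN M p (f i) + LpN M p (\<lambda>x. \<Sum>i\<in>I. f i x)"
    by (intro LpN_triangle LpM_sum assms(2)) auto
  with insert show ?case by auto
qed (use assms in \<open>auto simp: LpN_def\<close>)

text \<open>Integrate Young's inequality
  \<open>f \<le> \<lambda> ((f/\<lambda>)\<^bsup>p\<^esup>/p + 1 - 1/p)\<close> and choose \<open>\<lambda>\<close>.\<close>

lemma weighted_power_mean:
  fixes f w :: "'x \<Rightarrow> real"
  assumes p: "1 \<le> p" and [measurable]: "f \<in> borel_measurable M"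
    and f: "\<And>x. 0 \<le> f x" and w: "\<And>x. 0 \<le> w x" "integrable M w" "(LINT x|M. w x) \<le> C" "0 < C"
    and fw: "integrable M (\<lambda>x. f x powr p * w x)"
  shows "integrable M (\<lambda>x. f x * w x)"
    and "(LINT x|M. f x * w x) powr p \<le> C powr (p - 1) * (LINT x|M. f x powr p * w x)"
proof -
  note [measurable] = borel_measurable_integrable[OF w(2)]
  have young: "f x \<le> l * ((f x / l) powr p / p + (1 - 1 / p))" if "l > 0" for x l
  proof (cases "f x = 0")
    case True then show ?thesis using that p by (simp add: divide_simps)
  next
    case False
    then have "f x > 0" using f[of x] by simp
    then have "((f x / l) powr p) powr (1 / p) * 1 powr (1 - 1 / p) \<le> 1 / p * (f x / l) powr p + (1 - 1 / p) * 1"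
      using that p by (intro Youngs_inequality_0) auto
    then have "f x / l \<le> (f x / l) powr p / p + (1 - 1 / p)"
      using p \<open>f x > 0\<close> that by (simp add: powr_powr)
    then show ?thesis using that by (simp add: field_simps)
  qed
  have "f x \<le> f x powr p + 1" for x
  proof -
    have "f x powr p / p \<le> f x powr p" using p by (simp add: divide_le_eq mult_le_cancel_left1)
    moreover have "0 \<le> 1 / p" using p by simp
    moreover have "f x \<le> f x powr p / p + (1 - 1 / p)" using young[of 1 x] f[of x] by simp
    ultimately show ?thesis by linarith
  qed
  then have "f x * w x \<le> f x powr p * w x + w x" for x
    using mult_right_mono[of "f x" "f x powr p + 1" "w x"] w(1)[of x] by (simp add: algebra_simps)
  then show int: "integrable M (\<lambda>x. f x * w x)"
    using f w(1)
    by (intro Bochner_Integration.integrable_bound[OF Bochner_Integration.integrable_add[OF fw w(2)]])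
       (auto simp: abs_mult)
  define I where "I = (LINT x|M. f x powr p * w x)"
  have I0: "I \<ge> 0" unfolding I_def using w(1) by (intro Bochner_Integration.integral_nonneg) auto
  show "(LINT x|M. f x * w x) powr p \<le> C powr (p - 1) * (LINT x|M. f x powr p * w x)"
  proof (cases "I = 0")
    case True
    then have "AE x in M. f x powr p * w x = 0"
      unfolding I_def using w(1) fw by (subst (asm) integral_nonneg_eq_0_iff_AE) auto
    then have "AE x in M. f x * w x = 0" by eventually_elim auto
    then have "(LINT x|M. f x * w x) = 0" by (simp add: integral_eq_zero_AE)
    then show ?thesis using I0 by (simp add: I_def)
  next
    case False
    define l where "l = (I / C) powr (1 / p)"
    have l: "l > 0" "l powr p = I / C" using False I0 w p by (auto simp: l_def powr_powr)
    have "(LINT x|M. f x * w x) \<le> (LINT x|M. l / (l powr p * p) * (f x powr p * w x) + l * (1 - 1 / p) * w x)"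
    proof (intro integral_mono int)
      show "integrable M (\<lambda>x. l / (l powr p * p) * (f x powr p * w x) + l * (1 - 1 / p) * w x)"
        using fw w by auto
      fix x
      have "f x * w x \<le> l * ((f x / l) powr p / p + (1 - 1 / p)) * w x"
        using young[OF l(1), of x] w(1) by (intro mult_right_mono) auto
      also have "\<dots> = l / (l powr p * p) * (f x powr p * w x) + l * (1 - 1 / p) * w x"
        using f l(1) by (simp add: powr_divide algebra_simps)
      finally show "f x * w x \<le> l / (l powr p * p) * (f x powr p * w x) + l * (1 - 1 / p) * w x" .
    qed
    also have "\<dots> = l / (l powr p * p) * I + l * (1 - 1 / p) * (LINT x|M. w x)"
      using fw w(2) by (simp add: I_def)
    also have "\<dots> \<le> l / (l powr p * p) * I + l * (1 - 1 / p) * C"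
      using w(3) l p by (intro add_left_mono mult_left_mono) auto
    also have "\<dots> = l * C" using l False w(4) p by (simp add: field_simps)
    finally have "(LINT x|M. f x * w x) powr p \<le> (l * C) powr p"
      using f w(1) p by (intro powr_mono2 Bochner_Integration.integral_nonneg) auto
    also have "\<dots> = I / C * C powr p" using l by (simp add: powr_mult)
    also have "\<dots> = C powr (p - 1) * I" using w(4) by (simp add: powr_diff)
    finally show ?thesis by (simp add: I_def)
  qed
qed

text \<open>Jensen's inequality for the exponent q/p applied to |f|^p, that is, the weighted power
  mean with weight 1 of total mass 1.\<close>

lemma LpM_mono_exponent:
  assumes f: "f \<in> LpM M q" and pq: "1 \<le> p" "p \<le> q" and M: "prob_space M"
  shows "f \<in> LpM M p" "LpN M p f \<le> LpN M q f"
proof -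
  interpret prob_space M by fact
  note [measurable] = LpM_measurable[OF f]
  have eq: "(norm (f x) powr p) powr (q / p) = norm (f x) powr q" for x
    using pq by (simp add: powr_powr)
  have qp: "1 \<le> q / p" using pq by simp
  have fw: "integrable M (\<lambda>x. (norm (f x) powr p) powr (q / p) * 1)"
    using LpM_integrable[OF f] by (simp add: eq)
  note * = weighted_power_mean[of "q / p" "\<lambda>x. norm (f x) powr p" M "\<lambda>_. 1" 1, OF qp _ _ _ _ _ _ fw,
      simplified prob_space, simplified]
  show "f \<in> LpM M p" using *(1) by (auto simp: LpM_def)
  have "(LINT x|M. norm (f x) powr p) powr (q / p) \<le> (LINT x|M. norm (f x) powr q)"
    using *(2) by (simp add: eq)
  then have "((LINT x|M. norm (f x) powr p) powr (q / p)) powr (1 / q) \<le> (LINT x|M. norm (f x) powr q) powr (1 / q)"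
    using pq by (intro powr_mono2) auto
  then show "LpN M p f \<le> LpN M q f" using pq by (simp add: LpN_def powr_powr)
qed

lemma LpN_dominated_tendsto_0:
  fixes f :: "nat \<Rightarrow> 'x \<Rightarrow> 'a::euclidean_space"
  assumes [measurable]: "\<And>i. f i \<in> borel_measurable M" and p: "0 < p"
    and lim: "AE x in M. (\<lambda>i. f i x) \<longlonglongrightarrow> 0"
    and dom: "\<And>i. AE x in M. norm (f i x) \<le> g x" and g: "integrable M (\<lambda>x. g x powr p)"
  shows "(\<lambda>i. LpN M p (f i)) \<longlonglongrightarrow> 0"
proof -
  have "(\<lambda>i. LINT x|M. norm (f i x) powr p) \<longlonglongrightarrow> (LINT x|M. 0)"
  proof (rule integral_dominated_convergence[where w="\<lambda>x. g x powr p"])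
    show "AE x in M. (\<lambda>i. norm (f i x) powr p) \<longlonglongrightarrow> 0"
      using lim
    proof eventually_elim
      case (elim x)
      then have "(\<lambda>i. norm (f i x)) \<longlonglongrightarrow> 0" by (rule tendsto_norm_zero)
      then show ?case using p by (intro tendsto_zero_powrI) auto
    qed
    show "AE x in M. norm (norm (f i x) powr p) \<le> g x powr p" for i
      using dom[of i] by eventually_elim (use p in \<open>auto intro: powr_mono2\<close>)
  qed (use g in auto)
  then show ?thesis
    unfolding LpN_def using p
    by (intro tendsto_zero_powrI[where b="1/p"]) (auto intro!: Bochner_Integration.integral_nonneg)
qed

text \<open>With the weight 2^(-2n) built into the measure, \<open>lp_norm\<close> becomes an
  instance of \<open>LpN\<close>, so the triangle inequalities for arrays and for functions are the
  same lemmas.\<close>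

definition scaled_count :: "nat \<Rightarrow> 'k set \<Rightarrow> 'k measure" where
  "scaled_count n K = density (count_space K) (\<lambda>_. ennreal (2 powi (- 2 * int n)))"

lemma lp_norm_eq_LpN:
  assumes "finite K"
  shows "lp_norm n K p a = LpN (scaled_count n K) p a"
  using assms
  by (simp add: lp_norm_def LpN_def scaled_count_def integral_density
      lebesgue_integral_count_space_finite sum_distrib_left)

lemma LpM_scaled_count: "finite K \<Longrightarrow> a \<in> LpM (scaled_count n K) p"
  by (auto simp: LpM_def scaled_count_def integrable_density integrable_count_space)

section \<open>Density of bounded continuous functions\<close>

definition clamp_vec :: "real \<Rightarrow> 'a::euclidean_space \<Rightarrow> 'a" where
  "clamp_vec m y = (\<Sum>b\<in>Basis. max (- m) (min m (y \<bullet> b)) *\<^sub>R b)"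

lemma clamp_vec_inner: "b \<in> Basis \<Longrightarrow> clamp_vec m y \<bullet> b = max (- m) (min m (y \<bullet> b))"
  by (simp add: clamp_vec_def inner_sum_left inner_Basis if_distrib cong: if_cong)

lemma norm_clamp_vec_le: "0 \<le> m \<Longrightarrow> norm (clamp_vec m y) \<le> norm y"
  by (rule norm_le_componentwise) (auto simp: clamp_vec_inner)

lemma norm_clamp_vec_bound: "0 \<le> m \<Longrightarrow> norm (clamp_vec m (y::'a::euclidean_space)) \<le> real DIM('a) * m"
  using sum_bounded_above[of "Basis::'a set" "\<lambda>b. \<bar>clamp_vec m y \<bullet> b\<bar>" m] norm_le_l1[of "clamp_vec m y"]
  by (fastforce simp: clamp_vec_inner)

lemma clamp_vec_id: "norm y \<le> m \<Longrightarrow> clamp_vec m y = y"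
  by (rule euclidean_eqI) (use Basis_le_norm[of _ y] in \<open>fastforce simp: clamp_vec_inner\<close>)

lemma continuous_clamp_vec: "continuous_on UNIV (clamp_vec m)"
  unfolding clamp_vec_def by (intro continuous_intros)

lemma borel_measurable_clamp_vec [measurable]: "clamp_vec m \<in> borel_measurable borel"
  by (rule borel_measurable_continuous_onI[OF continuous_clamp_vec])

text \<open>A measurable function is an almost everywhere limit of continuous functions g_n, but
  without domination. Both G and g_n are therefore truncated coordinatewise at one level m; the
  truncations are dominated by a constant on the bounded set S.\<close>

lemma continuous_dense_LpM:
  fixes G :: "'b::euclidean_space \<Rightarrow> 'a::euclidean_space"
  assumes G: "G \<in> LpM lborel p" and p: "1 \<le> p" and S: "bounded S" "S \<in> sets borel"
    and supp: "\<And>x. x \<notin> S \<Longrightarrow> G x = 0" and "\<epsilon> > 0"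
  obtains H where "continuous_on UNIV H" "bounded (range H)"
    "(\<lambda>x. indicator S x *\<^sub>R H x) \<in> LpM lborel p"
    "LpN lborel p (\<lambda>x. G x - indicator S x *\<^sub>R H x) < \<epsilon>"
proof -
  note [measurable] = LpM_measurable[OF G] S(2)
  have "G measurable_on UNIV"
    using LpM_measurable[OF G] by (intro lebesgue_measurable_imp_measurable_on measurable_completion) auto
  then have "\<exists>N g. negligible N \<and> (\<forall>n. continuous_on UNIV (g n)) \<and> (\<forall>x. x \<notin> N \<longrightarrow> (\<lambda>n. g n x) \<longlonglongrightarrow> G x)"
    unfolding measurable_on_def by simp
  then obtain N g where N: "negligible N" and g: "\<And>n. continuous_on UNIV (g n)"
    and lim: "\<And>x. x \<notin> N \<Longrightarrow> (\<lambda>n. g n x) \<longlonglongrightarrow> G x"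
    by metis
  have [measurable]: "g n \<in> borel_measurable borel" for n
    by (rule borel_measurable_continuous_onI[OF g])
  have lim_AE: "AE x in lborel. (\<lambda>n. g n x) \<longlonglongrightarrow> G x"
  proof -
    have "AE x in lebesgue. x \<notin> N" using N by (simp add: negligible_iff_null_sets AE_not_in)
    then have "AE x in lebesgue. (\<lambda>n. g n x) \<longlonglongrightarrow> G x" by eventually_elim (rule lim)
    then show ?thesis by (simp add: AE_completion_iff)
  qed
  have int_S: "integrable lborel (\<lambda>x. (indicator S x * c) powr p)" for c
  proof -
    have "emeasure lborel S < \<infinity>" using emeasure_bounded_finite[OF S(1)] by simp
    then have "integrable lborel (\<lambda>x. indicator S x * c powr p)" by simp
    moreover have "indicator S x * c powr p = (indicator S x * c) powr p" for x
      using p by (auto simp: indicator_def)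
    ultimately show ?thesis by simp
  qed
  have bd: "(\<lambda>x. indicator S x *\<^sub>R clamp_vec (real m) (g n x)) \<in> LpM lborel p" for m n
  proof -
    have "integrable lborel (\<lambda>x. norm (indicator S x *\<^sub>R clamp_vec (real m) (g n x)) powr p)"
      by (rule Bochner_Integration.integrable_bound[OF int_S[of "real DIM('a) * real m"]])
         (use p in \<open>auto intro!: powr_mono2 norm_clamp_vec_bound simp: indicator_def\<close>)
    then show ?thesis by (auto simp: LpM_def)
  qed
  \<comment> \<open>The level m is fixed first, at the cost of half of the tolerance; only then is n
    chosen, with the other half.\<close>
  have "(\<lambda>m. LpN lborel p (\<lambda>x. G x - clamp_vec (real m) (G x))) \<longlonglongrightarrow> 0"
  proof (rule LpN_dominated_tendsto_0[where g="\<lambda>x. 2 * norm (G x)"])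
    show "AE x in lborel. (\<lambda>m. G x - clamp_vec (real m) (G x)) \<longlonglongrightarrow> 0"
    proof (intro AE_I2 tendsto_eventually)
      fix x
      obtain m0 where "norm (G x) \<le> real m0" using real_arch_simple by blast
      then show "\<forall>\<^sub>F m in sequentially. G x - clamp_vec (real m) (G x) = 0"
        by (intro eventually_sequentiallyI[of m0]) (auto simp: clamp_vec_id)
    qed
    show "AE x in lborel. norm (G x - clamp_vec (real m) (G x)) \<le> 2 * norm (G x)" for m
      using norm_clamp_vec_le[of "real m" "G _"]
      by (intro AE_I2) (smt (verit) norm_triangle_ineq4 of_nat_0_le_iff)
    show "integrable lborel (\<lambda>x. (2 * norm (G x)) powr p)"
      using LpM_integrable[OF G] by (simp add: powr_mult)
  qed (use p in auto)
  then obtain m where m: "LpN lborel p (\<lambda>x. G x - clamp_vec (real m) (G x)) < \<epsilon> / 2"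
    using \<open>\<epsilon> > 0\<close> by (metis (no_types, lifting) LpN_nonneg half_gt_zero LIMSEQ_D abs_of_nonneg
        diff_zero le_refl real_norm_def)
  have c0: "clamp_vec (real m) (0::'a) = 0"
    by (simp add: clamp_vec_id)
  have "(\<lambda>n. LpN lborel p (\<lambda>x. clamp_vec (real m) (G x) - indicator S x *\<^sub>R clamp_vec (real m) (g n x))) \<longlonglongrightarrow> 0"
  proof (rule LpN_dominated_tendsto_0[where g="\<lambda>x. indicator S x * (2 * (real DIM('a) * real m))"])
    show "AE x in lborel. (\<lambda>n. clamp_vec (real m) (G x) - indicator S x *\<^sub>R clamp_vec (real m) (g n x)) \<longlonglongrightarrow> 0"
      using lim_AE
    proof eventually_elim
      case (elim x)
      have "(\<lambda>n. clamp_vec (real m) (g n x)) \<longlonglongrightarrow> clamp_vec (real m) (G x)"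
        using continuous_on_tendsto_compose[OF continuous_clamp_vec elim] by auto
      then show ?case
        using supp[of x] c0 by (cases "x \<in> S") (auto intro!: tendsto_eq_intros)
    qed
    show "AE x in lborel. norm (clamp_vec (real m) (G x) - indicator S x *\<^sub>R clamp_vec (real m) (g n x))
        \<le> indicator S x * (2 * (real DIM('a) * real m))" for n
    proof (rule AE_I2)
      fix x
      show "norm (clamp_vec (real m) (G x) - indicator S x *\<^sub>R clamp_vec (real m) (g n x))
        \<le> indicator S x * (2 * (real DIM('a) * real m))"
        using supp[of x] c0 norm_triangle_ineq4[of "clamp_vec (real m) (G x)" "clamp_vec (real m) (g n x)"]
          norm_clamp_vec_bound[of "real m" "G x"] norm_clamp_vec_bound[of "real m" "g n x"]
        by (cases "x \<in> S") auto
    qed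
    show "integrable lborel (\<lambda>x. (indicator S x * (2 * (real DIM('a) * real m))) powr p)" by (rule int_S)
  qed (use p in auto)
  then obtain n where n: "LpN lborel p (\<lambda>x. clamp_vec (real m) (G x) - indicator S x *\<^sub>R clamp_vec (real m) (g n x)) < \<epsilon> / 2"
    using \<open>\<epsilon> > 0\<close> by (metis (no_types, lifting) LpN_nonneg half_gt_zero LIMSEQ_D abs_of_nonneg
        diff_zero le_refl real_norm_def)
  have cG: "(\<lambda>x. clamp_vec (real m) (G x)) \<in> LpM lborel p"
    using p by (rule_tac LpM_dominated[OF G]) (auto intro!: norm_clamp_vec_le)
  have "LpN lborel p (\<lambda>x. (G x - clamp_vec (real m) (G x))
      + (clamp_vec (real m) (G x) - indicator S x *\<^sub>R clamp_vec (real m) (g n x))) < \<epsilon> / 2 + \<epsilon> / 2"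
    using m n by (intro order_le_less_trans[OF LpN_triangle] LpM_diff G cG bd p add_strict_mono)
  then have 1: "LpN lborel p (\<lambda>x. G x - indicator S x *\<^sub>R clamp_vec (real m) (g n x)) < \<epsilon>" by simp
  have 2: "bounded (range (\<lambda>x. clamp_vec (real m) (g n x)))"
    using norm_clamp_vec_bound[of "real m"] by (auto simp: bounded_iff)
  have 3: "continuous_on UNIV (\<lambda>x. clamp_vec (real m) (g n x))"
    using continuous_on_compose2[OF continuous_clamp_vec g[of n]] by auto
  show ?thesis using that[OF 3 2 bd 1] .
qed

section \<open>Affine changes of variables\<close>

lemma lborel_affine_diff:
  fixes t :: "'a::euclidean_space"
  assumes "c > 0"
  shows "lborel = density (distr lborel borel (\<lambda>x. c *\<^sub>R x - t)) (\<lambda>_. ennreal (c ^ DIM('a)))"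
  using lborel_affine[of c "- t"] assms by simp

lemma integral_affine_diff:
  fixes f :: "'a::euclidean_space \<Rightarrow> 'b::euclidean_space"
  assumes "c > 0" and [measurable]: "f \<in> borel_measurable borel"
  shows "(LINT x|lborel. f (c *\<^sub>R x - t)) = (1 / c ^ DIM('a)) *\<^sub>R (LINT x|lborel. f x)"
proof -
  have "(LINT x|lborel. f x) = (LINT x|density (distr lborel borel (\<lambda>x. c *\<^sub>R x - t)) (\<lambda>_. ennreal (c ^ DIM('a))). f x)"
    using lborel_affine_diff[OF assms(1), of t] by simp
  also have "\<dots> = c ^ DIM('a) *\<^sub>R (LINT x|lborel. f (c *\<^sub>R x - t))"
    using assms(1) by (simp add: integral_density integral_distr)
  finally show ?thesis using assms(1) by simp
qed

lemma integrable_affine_diff_iff: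
  fixes f :: "'a::euclidean_space \<Rightarrow> 'b::euclidean_space"
  assumes "c > 0" and [measurable]: "f \<in> borel_measurable borel"
  shows "integrable lborel (\<lambda>x. f (c *\<^sub>R x - t)) \<longleftrightarrow> integrable lborel f"
proof -
  have "integrable lborel f \<longleftrightarrow> integrable (density (distr lborel borel (\<lambda>x. c *\<^sub>R x - t)) (\<lambda>_. ennreal (c ^ DIM('a)))) f"
    using lborel_affine_diff[OF assms(1), of t] by simp
  also have "\<dots> \<longleftrightarrow> integrable lborel (\<lambda>x. f (c *\<^sub>R x - t))"
    using assms(1) integrable_scaleR_right[of "inverse (c ^ DIM('a))" lborel "\<lambda>x. c ^ DIM('a) *\<^sub>R f (c *\<^sub>R x - t)"]
    by (auto simp add: integrable_density integrable_distr_eq)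
  finally show ?thesis by simp
qed

text \<open>The exceptional set is enlarged to a Borel null set N, since P itself need not be
  measurable.\<close>

lemma AE_affine_diff:
  fixes t :: "'a::euclidean_space"
  assumes "c > 0" "AE x in lborel. P x"
  shows "AE x in lborel. P (c *\<^sub>R x - t)"
proof -
  from assms(2) obtain N where N: "{x \<in> space lborel. \<not> P x} \<subseteq> N" "N \<in> null_sets lborel"
    by (auto elim!: AE_E simp: null_sets_def)
  then have [measurable]: "N \<in> sets borel" by auto
  have nN: "AE x in lborel. x \<notin> N" using N(2) by (rule AE_not_in)
  have "AE x in density (distr lborel borel (\<lambda>x. c *\<^sub>R x - t)) (\<lambda>_. ennreal (c ^ DIM('a))). x \<notin> N"
    using nN unfolding lborel_affine_diff[OF assms(1), of t, symmetric] .
  then have "AE x in lborel. c *\<^sub>R x - t \<notin> N"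
    using assms(1) by (simp add: AE_density AE_distr_iff)
  then show ?thesis by eventually_elim (use N(1) in auto)
qed

section \<open>Convergence of sampling operators\<close>

lemma Omega_eq_box: "Omega = box (0, 0) (1, 1)"
  by (auto simp: Omega_def box_def Basis_prod_def)

lemma closure_Omega: "closure Omega = cbox (0, 0) (1, 1)"
  unfolding Omega_eq_box by (rule closure_box) (auto simp: box_ne_empty Basis_prod_def)

lemma open_Omega: "open Omega"
  by (simp add: Omega_eq_box open_box)

lemma Omega_borel [measurable]: "Omega \<in> sets borel"
  using open_Omega by simp

lemma bounded_Omega: "bounded Omega"
  by (simp add: Omega_eq_box)

lemma mem_cbox_point: "x \<in> cbox (a, b) (c, d) \<longleftrightarrow> a \<le> fst x \<and> fst x \<le> c \<and> b \<le> snd x \<and> snd x \<le> d"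
  for a b c d :: real
  by (cases x) (auto simp: mem_box Basis_prod_def)

lemma emeasure_lborel_Omega: "emeasure lborel Omega = 1"
  unfolding Omega_eq_box by (subst emeasure_lborel_box_eq) (auto simp: Basis_prod_def)

lemma AE_Omega_or_outside: "AE x in lborel. x \<in> Omega \<or> x \<notin> closure Omega"
proof -
  have "emeasure lborel (closure Omega - Omega) = emeasure lborel (closure Omega) - emeasure lborel Omega"
    using closure_subset[of Omega] by (intro emeasure_Diff) (auto simp: emeasure_lborel_Omega)
  also have "\<dots> = 0"
    unfolding closure_Omega emeasure_lborel_Omega
    by (subst emeasure_lborel_cbox_eq) (auto simp: Basis_prod_def)
  finally have "closure Omega - Omega \<in> null_sets lborel" by (auto simp: null_sets_def)
  from AE_not_in[OF this] show ?thesis by eventually_elim auto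
qed

section \<open>Dyadic cells and sums as integrals of step functions\<close>

definition cell :: "nat \<Rightarrow> point \<Rightarrow> int \<times> int" where
  "cell n x = (\<lfloor>2 ^ n * fst x\<rfloor>, \<lfloor>2 ^ n * snd x\<rfloor>)"

lemma cell_bounds:
  "real_of_int (fst (cell n x)) \<le> 2 ^ n * fst x" "2 ^ n * fst x < real_of_int (fst (cell n x)) + 1"
  "real_of_int (snd (cell n x)) \<le> 2 ^ n * snd x" "2 ^ n * snd x < real_of_int (snd (cell n x)) + 1"
  by (auto simp: cell_def)

lemma four_power: "(4::real) ^ n = (2 ^ n)\<^sup>2"
  by (simp add: power2_eq_square flip: power_mult_distrib)

lemma cell_vimage:
  "cell n -` {k} = {real_of_int (fst k) / 2 ^ n ..< (real_of_int (fst k) + 1) / 2 ^ n}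
     \<times> {real_of_int (snd k) / 2 ^ n ..< (real_of_int (snd k) + 1) / 2 ^ n}"
proof -
  have "\<lfloor>2 ^ n * t\<rfloor> = j \<longleftrightarrow> t \<in> {j / 2 ^ n ..< (j + 1) / 2 ^ n}" for t :: real and j :: int
    by (auto simp: floor_eq_iff field_simps)
  then show ?thesis by (cases k) (auto simp: cell_def)
qed

lemma emeasure_cell_vimage: "emeasure lborel (cell n -` {k}) = ennreal (2 powi (- 2 * int n))"
proof -
  have len: "emeasure lborel {j / 2 ^ n ..< (j + 1) / 2 ^ n} = ennreal (1 / 2 ^ n)" for j :: real
  proof -
    have "(j + 1) / 2 ^ n - j / 2 ^ n = 1 / 2 ^ n" by (simp add: field_simps)
    then show ?thesis by (simp add: divide_right_mono)
  qed
  have "emeasure lborel (cell n -` {k}) = emeasure (lborel \<Otimes>\<^sub>M lborel) (cell n -` {k})"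
    by (simp add: lborel_prod)
  also have "\<dots> = ennreal (1 / 2 ^ n) * ennreal (1 / 2 ^ n)"
    unfolding cell_vimage by (subst lborel.emeasure_pair_measure_Times) (auto simp: len)
  also have "\<dots> = ennreal (1 / 2 ^ n * (1 / 2 ^ n))"
    by (rule ennreal_mult[symmetric]) auto
  also have "1 / 2 ^ n * (1 / 2 ^ n) = (2::real) powi (- 2 * int n)"
    by (simp add: power_int_minus power_int_mult power_mult four_power power2_eq_square divide_inverse)
  finally show ?thesis .
qed

lemma cell_vimage_sets [measurable]: "cell n -` {k} \<in> sets borel"
  unfolding cell_vimage borel_prod[symmetric] by auto

text \<open>Every cell of level n has area 2^(-2n), so the normalised sum is the integral of the
  step function x -> h(cell n x). This lets dominated convergence act on sums whose index sets
  change with n.\<close>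

lemma sum_eq_integral_cell:
  fixes h :: "int \<times> int \<Rightarrow> real"
  assumes "finite K"
  shows "2 powi (- 2 * int n) * (\<Sum>k\<in>K. h k) = (LINT x|lborel. (if cell n x \<in> K then h (cell n x) else 0))"
    and "(\<lambda>x. if cell n x \<in> K then h (cell n x) else 0) \<in> borel_measurable borel"
proof -
  have eq: "(\<lambda>x. if cell n x \<in> K then h (cell n x) else 0) = (\<lambda>x. \<Sum>k\<in>K. h k * indicator (cell n -` {k}) x)"
  proof
    fix x
    have "(\<Sum>k\<in>K. h k * indicator (cell n -` {k}) x) = (\<Sum>k\<in>K. if cell n x = k then h k else 0)"
      by (intro sum.cong) (auto simp: indicator_def)
    then show "(if cell n x \<in> K then h (cell n x) else 0) = (\<Sum>k\<in>K. h k * indicator (cell n -` {k}) x)"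
      using assms by simp
  qed
  have m: "measure lborel (cell n -` {k}) = 2 powi (- 2 * int n)" for k
    by (simp add: measure_def emeasure_cell_vimage)
  show "2 powi (- 2 * int n) * (\<Sum>k\<in>K. h k) = (LINT x|lborel. (if cell n x \<in> K then h (cell n x) else 0))"
    unfolding eq
    by (subst Bochner_Integration.integral_sum)
       (auto simp: m sum_distrib_left sum_distrib_right emeasure_cell_vimage mult.commute)
  show "(\<lambda>x. if cell n x \<in> K then h (cell n x) else 0) \<in> borel_measurable borel"
    unfolding eq by measurable
qed

lemma floor_dyadic_tendsto: "(\<lambda>n. (\<lfloor>2 ^ n * t\<rfloor> :: real) / 2 ^ n) \<longlonglongrightarrow> t"
proof (rule tendsto_sandwich)
  show "\<forall>\<^sub>F n in sequentially. t - (1 / 2) ^ n \<le> \<lfloor>2 ^ n * t\<rfloor> / 2 ^ n"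
  proof (rule always_eventually, rule allI)
    fix n
    have "2 ^ n * t - 1 \<le> \<lfloor>2 ^ n * t\<rfloor>" by linarith
    then have "(2 ^ n * t - 1) / 2 ^ n \<le> \<lfloor>2 ^ n * t\<rfloor> / 2 ^ n" by (intro divide_right_mono) auto
    then show "t - (1 / 2) ^ n \<le> \<lfloor>2 ^ n * t\<rfloor> / 2 ^ n" by (simp add: diff_divide_distrib power_one_over)
  qed
  show "\<forall>\<^sub>F n in sequentially. \<lfloor>2 ^ n * t\<rfloor> / 2 ^ n \<le> t"
    by (rule always_eventually) (auto simp: divide_le_eq mult.commute)
  have "(\<lambda>n. t - (1 / 2) ^ n) \<longlonglongrightarrow> t - 0" by (intro tendsto_intros LIMSEQ_realpow_zero) auto
  then show "(\<lambda>n. t - (1 / 2) ^ n) \<longlonglongrightarrow> t" by simp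
qed auto

text \<open>Common form of T_n g and of the arrays inside E_n. The kernel depends on the basis
  vector b because each component of the vector or matrix valued arrays has its own
  primitive.\<close>

definition sample :: "('a::euclidean_space \<Rightarrow> point \<Rightarrow> real) \<Rightarrow> nat \<Rightarrow> (point \<Rightarrow> 'a) \<Rightarrow> int \<times> int \<Rightarrow> 'a" where
  "sample \<Phi> n G k = (\<Sum>b\<in>Basis. (4 ^ n * (LINT x|lborel. (G x \<bullet> b) * \<Phi> b (2 ^ n *\<^sub>R x - embed k))) *\<^sub>R b)"

locale sampling_sets =
  fixes K :: "nat \<Rightarrow> (int \<times> int) set" and R :: real
  assumes R: "1 \<le> R"
    and K_near: "\<And>n k. k \<in> K n \<Longrightarrow>
      \<exists>y\<in>closure Omega. \<bar>2 ^ n * fst y - real_of_int (fst k)\<bar> \<le> R \<and> \<bar>2 ^ n * snd y - real_of_int (snd k)\<bar> \<le> R"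
    and K_inner: "\<And>x. x \<in> Omega \<Longrightarrow> \<forall>\<^sub>F n in sequentially. cell n x \<in> K n"
begin

lemma K_bounds:
  assumes "k \<in> K n"
  shows "- R \<le> real_of_int (fst k)" "real_of_int (fst k) \<le> 2 ^ n + R"
    "- R \<le> real_of_int (snd k)" "real_of_int (snd k) \<le> 2 ^ n + R"
proof -
  obtain y where y: "0 \<le> fst y" "fst y \<le> 1" "0 \<le> snd y" "snd y \<le> 1"
    "\<bar>2 ^ n * fst y - real_of_int (fst k)\<bar> \<le> R" "\<bar>2 ^ n * snd y - real_of_int (snd k)\<bar> \<le> R"
    using K_near[OF assms] unfolding closure_Omega by (auto simp: mem_cbox_point)
  have "0 \<le> 2 ^ n * fst y" "2 ^ n * fst y \<le> 2 ^ n" "0 \<le> 2 ^ n * snd y" "2 ^ n * snd y \<le> 2 ^ n"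
    using y by auto
  with y show "- R \<le> real_of_int (fst k)" "real_of_int (fst k) \<le> 2 ^ n + R"
    "- R \<le> real_of_int (snd k)" "real_of_int (snd k) \<le> 2 ^ n + R" by linarith+
qed

lemma finite_K: "finite (K n)"
proof (rule finite_subset)
  show "K n \<subseteq> {\<lfloor>- R\<rfloor>..\<lceil>2 ^ n + R\<rceil>} \<times> {\<lfloor>- R\<rfloor>..\<lceil>2 ^ n + R\<rceil>}"
    using K_bounds[of _ n] by (force simp: floor_le_iff le_ceiling_iff)
qed auto

lemma K_outer:
  assumes "x \<notin> closure Omega"
  shows "\<forall>\<^sub>F n in sequentially. cell n x \<notin> K n"
proof -
  obtain d where d: "d > 0" "ball x d \<subseteq> - closure Omega"
    using assms by (meson ComplI closed_closure open_Compl open_contains_ball)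
  \<comment> \<open>R is the allowed offset of an index, 1 is the rounding error of the floor, and
    the factor 2 comes from bounding the distance by the sum of the two coordinate
    distances.\<close>
  have "(\<lambda>n. 2 * (R + 1) * (1 / 2) ^ n) \<longlonglongrightarrow> 2 * (R + 1) * 0"
    by (intro tendsto_intros LIMSEQ_realpow_zero) auto
  then have "\<forall>\<^sub>F n in sequentially. 2 * (R + 1) * (1 / 2) ^ n < d"
    using d(1) by (intro order_tendstoD) auto
  then show ?thesis
  proof eventually_elim
    case (elim n)
    show ?case
    proof
      assume "cell n x \<in> K n"
      then obtain y where y: "y \<in> closure Omega" "\<bar>2 ^ n * fst y - real_of_int (fst (cell n x))\<bar> \<le> R"
        "\<bar>2 ^ n * snd y - real_of_int (snd (cell n x))\<bar> \<le> R" using K_near by blast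
      have "\<bar>2 ^ n * fst y - 2 ^ n * fst x\<bar> \<le> R + 1" "\<bar>2 ^ n * snd y - 2 ^ n * snd x\<bar> \<le> R + 1"
        using y(2,3) cell_bounds[of n x] by linarith+
      then have "2 ^ n * \<bar>fst y - fst x\<bar> \<le> R + 1" "2 ^ n * \<bar>snd y - snd x\<bar> \<le> R + 1"
        by (simp_all add: abs_mult flip: right_diff_distrib)
      then have "\<bar>fst y - fst x\<bar> \<le> (R + 1) * (1 / 2) ^ n" "\<bar>snd y - snd x\<bar> \<le> (R + 1) * (1 / 2) ^ n"
        by (simp_all add: field_simps power_one_over)
      moreover have "dist x y \<le> \<bar>fst y - fst x\<bar> + \<bar>snd y - snd x\<bar>"
        by (cases x, cases y) (auto simp: dist_norm norm_Pair intro!: order_trans[OF sqrt_sum_squares_le_sum_abs])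
      ultimately have "dist x y < d" using elim by linarith
      with d(2) y(1) show False by auto
    qed
  qed
qed

text \<open>Supplies a box independent of n on which all step functions live, hence an integrable
  majorant. The bound R + 2 absorbs the rounding error: 2^n + R + 1 \<le> 2^n (R + 2).\<close>

lemma cell_in_K_bounded:
  assumes "cell n x \<in> K n"
  shows "x \<in> cbox (- R, - R) (R + 2, R + 2)"
proof -
  have [simp]: "(1::real) \<le> 2 ^ n" by simp
  note b = K_bounds[OF assms] cell_bounds[of n x]
  have "2 ^ n * (- R) \<le> - R" "2 ^ n + R + 1 \<le> 2 ^ n * (R + 2)"
    using R mult_right_mono[of 1 "2 ^ n" R] mult_right_mono[of 1 "2 ^ n" "R + 1"]
    by (auto simp: algebra_simps)
  then have "2 ^ n * (- R) \<le> 2 ^ n * fst x" "2 ^ n * fst x \<le> 2 ^ n * (R + 2)"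
     "2 ^ n * (- R) \<le> 2 ^ n * snd x" "2 ^ n * snd x \<le> 2 ^ n * (R + 2)"
    using b by linarith+
  then show ?thesis unfolding mem_cbox_point
    by (meson mult_left_le_imp_le zero_less_numeral zero_less_power)
qed

end

locale sampling = sampling_sets K R for K R +
  fixes \<Phi> :: "'a::euclidean_space \<Rightarrow> point \<Rightarrow> real" and M :: real
  assumes \<Phi>_measurable [measurable]: "\<And>b. b \<in> Basis \<Longrightarrow> \<Phi> b \<in> borel_measurable borel"
    and M: "0 \<le> M"
    and \<Phi>_bound: "\<And>b. b \<in> Basis \<Longrightarrow> AE y in lborel. \<bar>\<Phi> b y\<bar> \<le> M * indicator (cbox (- R, - R) (R, R)) y"
    and \<Phi>_integral: "\<And>b. b \<in> Basis \<Longrightarrow> (LINT y|lborel. \<Phi> b y) = 1"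
begin

definition Q :: "point set" where "Q = cbox (- R, - R) (R, R)"

lemma Q_borel [measurable]: "Q \<in> sets borel"
  by (simp add: Q_def)

lemma emeasure_Q: "emeasure lborel Q = ennreal ((2 * R)\<^sup>2)"
  unfolding Q_def using R by (subst emeasure_lborel_cbox_eq) (auto simp: Basis_prod_def power2_eq_square)

lemma integrable_Q: "integrable lborel (\<lambda>y. indicator Q y * (c::real))"
  by (simp add: emeasure_Q)

lemma \<Phi>_integrable: "b \<in> Basis \<Longrightarrow> integrable lborel (\<Phi> b)"
  using integrable_Q[of M]
  by (rule Bochner_Integration.integrable_bound)
     (use \<Phi>_bound[of b] M in \<open>auto elim!: eventually_mono simp: Q_def mult.commute\<close>)

text \<open>Nonnegative majorant of the scaled kernel up to the factor M. Its mass (2R)^2 is the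
  same for all n and k, which makes it a weight for the power mean inequality.\<close>

definition W :: "nat \<Rightarrow> int \<times> int \<Rightarrow> point \<Rightarrow> real" where
  "W n k x = 4 ^ n * indicator Q (2 ^ n *\<^sub>R x - embed k)"

lemma W_nonneg: "0 \<le> W n k x" by (simp add: W_def)

lemma W_integrable: "integrable lborel (W n k)" and W_integral: "(LINT x|lborel. W n k x) = (2 * R)\<^sup>2"
proof -
  have "integrable lborel (\<lambda>x. indicator Q (2 ^ n *\<^sub>R x - embed k) :: real)"
    using integrable_affine_diff_iff[of "2 ^ n" "\<lambda>x. indicator Q x :: real" "embed k"] integrable_Q[of 1] by simp
  then show "integrable lborel (W n k)" unfolding W_def by simp
  have "(LINT x|lborel. W n k x) = 4 ^ n * (LINT x|lborel. indicator Q (2 ^ n *\<^sub>R x - embed k))"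
    by (simp add: W_def)
  also have "\<dots> = 4 ^ n * (1 / (2 ^ n) ^ 2 * (2 * R)\<^sup>2)"
    using integral_affine_diff[of "2 ^ n" "\<lambda>x. indicator Q x :: real" "embed k"] R
    by (simp add: measure_def emeasure_Q power2_eq_square)
  also have "\<dots> = (2 * R)\<^sup>2"
    by (simp add: four_power)
  finally show "(LINT x|lborel. W n k x) = (2 * R)\<^sup>2" .
qed

lemma \<Phi>_le_W:
  assumes "b \<in> Basis"
  shows "AE x in lborel. 4 ^ n * \<bar>\<Phi> b (2 ^ n *\<^sub>R x - embed k)\<bar> \<le> M * W n k x"
  using AE_affine_diff[OF _ \<Phi>_bound[OF assms], of "2 ^ n" "embed k"]
  by (auto simp: W_def Q_def mult.left_commute)

text \<open>The coefficient is at most M times the integral of |g| against \<open>W n k\<close>; the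
  weighted power mean then moves the p-th power inside at the price of the mass to the power p -
  1.\<close>

lemma sample_coeff:
  fixes g :: "point \<Rightarrow> real"
  assumes g: "g \<in> LpM lborel p" and p: "1 \<le> p" and b: "b \<in> Basis"
  shows "integrable lborel (\<lambda>x. g x * \<Phi> b (2 ^ n *\<^sub>R x - embed k))"
    and "\<bar>4 ^ n * (LINT x|lborel. g x * \<Phi> b (2 ^ n *\<^sub>R x - embed k))\<bar> powr p
      \<le> M powr p * (2 * R)\<^sup>2 powr (p - 1) * (LINT x|lborel. \<bar>g x\<bar> powr p * W n k x)"
    and "integrable lborel (\<lambda>x. \<bar>g x\<bar> powr p * W n k x)"
proof -
  note [measurable] = LpM_measurable[OF g] \<Phi>_measurable[OF b]
  have "integrable lborel (\<lambda>x. 4 ^ n * \<bar>g x\<bar> powr p)"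
    using LpM_integrable[OF g] by simp
  then show gW: "integrable lborel (\<lambda>x. \<bar>g x\<bar> powr p * W n k x)"
    by (rule Bochner_Integration.integrable_bound) (auto simp: W_def indicator_def)
  note J = weighted_power_mean[OF p, of "\<lambda>x. \<bar>g x\<bar>" lborel "W n k" "(2 * R)\<^sup>2",
      OF _ _ W_nonneg W_integrable _ _ gW]
  have i: "integrable lborel (\<lambda>x. \<bar>g x\<bar> * W n k x)"
    and l: "(LINT x|lborel. \<bar>g x\<bar> * W n k x) powr p
      \<le> (2 * R)\<^sup>2 powr (p - 1) * (LINT x|lborel. \<bar>g x\<bar> powr p * W n k x)"
    using J W_integral R by auto
  have le: "AE x in lborel. \<bar>4 ^ n * (g x * \<Phi> b (2 ^ n *\<^sub>R x - embed k))\<bar> \<le> M * (\<bar>g x\<bar> * W n k x)"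
    using \<Phi>_le_W[OF b, of n k]
  proof eventually_elim
    case (elim x)
    have "\<bar>4 ^ n * (g x * \<Phi> b (2 ^ n *\<^sub>R x - embed k))\<bar> = \<bar>g x\<bar> * (4 ^ n * \<bar>\<Phi> b (2 ^ n *\<^sub>R x - embed k)\<bar>)"
      by (simp add: abs_mult)
    also have "\<dots> \<le> \<bar>g x\<bar> * (M * W n k x)" using elim by (intro mult_left_mono) auto
    finally show ?case by (simp add: ac_simps)
  qed
  have i2: "integrable lborel (\<lambda>x. 4 ^ n * (g x * \<Phi> b (2 ^ n *\<^sub>R x - embed k)))"
    by (rule Bochner_Integration.integrable_bound[of _ "\<lambda>x. M * (\<bar>g x\<bar> * W n k x)"])
       (use i le M W_nonneg in \<open>auto elim!: eventually_mono simp: abs_mult\<close>)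
  then show "integrable lborel (\<lambda>x. g x * \<Phi> b (2 ^ n *\<^sub>R x - embed k))" by simp
  have "\<bar>4 ^ n * (LINT x|lborel. g x * \<Phi> b (2 ^ n *\<^sub>R x - embed k))\<bar>
      = \<bar>LINT x|lborel. 4 ^ n * (g x * \<Phi> b (2 ^ n *\<^sub>R x - embed k))\<bar>" by simp
  also have "\<dots> \<le> (LINT x|lborel. \<bar>4 ^ n * (g x * \<Phi> b (2 ^ n *\<^sub>R x - embed k))\<bar>)"
    by (rule integral_abs_bound)
  also have "\<dots> \<le> (LINT x|lborel. M * (\<bar>g x\<bar> * W n k x))"
    using i i2 le by (intro integral_mono_AE integrable_abs) auto
  also have "\<dots> = M * (LINT x|lborel. \<bar>g x\<bar> * W n k x)" by simp
  finally have "\<bar>4 ^ n * (LINT x|lborel. g x * \<Phi> b (2 ^ n *\<^sub>R x - embed k))\<bar> powr p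
      \<le> (M * (LINT x|lborel. \<bar>g x\<bar> * W n k x)) powr p"
    using p by (intro powr_mono2) auto
  also have "\<dots> \<le> M powr p * ((2 * R)\<^sup>2 powr (p - 1) * (LINT x|lborel. \<bar>g x\<bar> powr p * W n k x))"
    unfolding powr_mult by (intro mult_left_mono l) auto
  finally show "\<bar>4 ^ n * (LINT x|lborel. g x * \<Phi> b (2 ^ n *\<^sub>R x - embed k))\<bar> powr p
      \<le> M powr p * (2 * R)\<^sup>2 powr (p - 1) * (LINT x|lborel. \<bar>g x\<bar> powr p * W n k x)"
    by (simp add: mult.assoc)
qed

text \<open>Bounded overlap: in each coordinate at most 2R + 1 integers lie within R of a given real
  number.\<close>

lemma sum_W_le: "(\<Sum>k\<in>K n. W n k x) \<le> 4 ^ n * (2 * R + 1)\<^sup>2"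
proof -
  have card: "real (card {j::int. \<bar>t - j\<bar> \<le> R}) \<le> 2 * R + 1" "finite {j::int. \<bar>t - j\<bar> \<le> R}" for t
  proof -
    have eq: "{j::int. \<bar>t - j\<bar> \<le> R} = {\<lceil>t - R\<rceil>..\<lfloor>t + R\<rfloor>}"
      by (auto simp: ceiling_le_iff le_floor_iff abs_le_iff)
    show "finite {j::int. \<bar>t - j\<bar> \<le> R}" unfolding eq by simp
    have "real_of_int (\<lfloor>t + R\<rfloor> + 1 - \<lceil>t - R\<rceil>) \<le> 2 * R + 1" by simp linarith
    then show "real (card {j::int. \<bar>t - j\<bar> \<le> R}) \<le> 2 * R + 1"
      unfolding eq using R by (simp add: of_nat_nat)
  qed
  let ?A = "{j::int. \<bar>2 ^ n * fst x - j\<bar> \<le> R}" and ?B = "{j::int. \<bar>2 ^ n * snd x - j\<bar> \<le> R}"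
  have ind: "indicator Q (2 ^ n *\<^sub>R x - embed k) = (indicator (?A \<times> ?B) k :: real)" for k
    by (cases k) (auto simp: indicator_def Q_def mem_cbox_point embed_def abs_le_iff)
  have "(\<Sum>k\<in>K n. indicator (?A \<times> ?B) k :: real) = real (card (K n \<inter> ?A \<times> ?B))"
    using finite_K[of n] by (simp add: indicator_def sum.If_cases)
  also have "\<dots> \<le> real (card (?A \<times> ?B))"
    using card(2) by (intro of_nat_mono card_mono) auto
  also have "\<dots> \<le> (2 * R + 1)\<^sup>2"
    unfolding power2_eq_square card_cartesian_product of_nat_mult using card(1) R by (intro mult_mono) auto
  finally have "(\<Sum>k\<in>K n. indicator (?A \<times> ?B) k :: real) \<le> (2 * R + 1)\<^sup>2" .
  then show ?thesis
    by (simp add: W_def ind flip: sum_distrib_left)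
qed

definition op_bound :: "real \<Rightarrow> real" where
  "op_bound p = (M powr p * (2 * R)\<^sup>2 powr (p - 1) * (2 * R + 1)\<^sup>2) powr (1 / p)"

text \<open>Summing the coefficient bounds, the overlap estimate contributes 4^n and the norm
  contributes 2^(-2n). They cancel, so the operator bound does not depend on n.\<close>

lemma sample_coeff_lp_norm:
  fixes g :: "point \<Rightarrow> real"
  assumes g: "g \<in> LpM lborel p" and p: "1 \<le> p" and b: "b \<in> Basis"
  shows "lp_norm n (K n) p (\<lambda>k. 4 ^ n * (LINT x|lborel. g x * \<Phi> b (2 ^ n *\<^sub>R x - embed k)))
    \<le> op_bound p * LpN lborel p g"
proof -
  let ?c = "M powr p * (2 * R)\<^sup>2 powr (p - 1)"
  note s = sample_coeff[OF g p b]
  have "2 powi (- 2 * int n) * (\<Sum>k\<in>K n. norm (4 ^ n * (LINT x|lborel. g x * \<Phi> b (2 ^ n *\<^sub>R x - embed k))) powr p)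
      \<le> 2 powi (- 2 * int n) * (\<Sum>k\<in>K n. ?c * (LINT x|lborel. \<bar>g x\<bar> powr p * W n k x))"
    using s(2)[of n] by (intro mult_left_mono sum_mono) auto
  also have "\<dots> = 2 powi (- 2 * int n) * (?c * (LINT x|lborel. (\<Sum>k\<in>K n. \<bar>g x\<bar> powr p * W n k x)))"
    using s(3)[of n] by (subst Bochner_Integration.integral_sum) (auto simp: sum_distrib_left)
  also have "\<dots> = 2 powi (- 2 * int n) * (?c * (LINT x|lborel. \<bar>g x\<bar> powr p * (\<Sum>k\<in>K n. W n k x)))"
    by (simp add: sum_distrib_left)
  also have "\<dots> \<le> 2 powi (- 2 * int n) * (?c * (LINT x|lborel. \<bar>g x\<bar> powr p * (4 ^ n * (2 * R + 1)\<^sup>2)))"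
  proof (intro mult_left_mono integral_mono sum_W_le)
    show "integrable lborel (\<lambda>x. \<bar>g x\<bar> powr p * (\<Sum>k\<in>K n. W n k x))"
      using s(3)[of n] by (auto simp: sum_distrib_left)
    show "integrable lborel (\<lambda>x. \<bar>g x\<bar> powr p * (4 ^ n * (2 * R + 1)\<^sup>2))"
      using LpM_integrable[OF g] by simp
  qed (use M in auto)
  also have "\<dots> = 2 powi (- 2 * int n) * 4 ^ n * (?c * (2 * R + 1)\<^sup>2 * (LINT x|lborel. \<bar>g x\<bar> powr p))"
    by simp
  also have "(2::real) powi (- 2 * int n) * 4 ^ n = 1"
    by (simp add: power_int_minus power_int_mult power_mult four_power)
  finally have "2 powi (- 2 * int n) * (\<Sum>k\<in>K n. norm (4 ^ n * (LINT x|lborel. g x * \<Phi> b (2 ^ n *\<^sub>R x - embed k))) powr p)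
      \<le> ?c * (2 * R + 1)\<^sup>2 * (LINT x|lborel. \<bar>g x\<bar> powr p)" by simp
  then have "lp_norm n (K n) p (\<lambda>k. 4 ^ n * (LINT x|lborel. g x * \<Phi> b (2 ^ n *\<^sub>R x - embed k)))
    \<le> (?c * (2 * R + 1)\<^sup>2 * (LINT x|lborel. \<bar>g x\<bar> powr p)) powr (1 / p)"
    unfolding lp_norm_def using p by (intro powr_mono2 mult_nonneg_nonneg sum_nonneg) auto
  also have "\<dots> = op_bound p * LpN lborel p g"
    unfolding op_bound_def LpN_def powr_mult[of "?c * (2 * R + 1)\<^sup>2"] by simp
  finally show ?thesis .
qed

lemma LpM_inner: "G \<in> LpM lborel p \<Longrightarrow> 0 \<le> p \<Longrightarrow> b \<in> Basis \<Longrightarrow> (\<lambda>x. G x \<bullet> b) \<in> LpM lborel p"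
  by (rule LpM_dominated) (auto simp: LpM_def Basis_le_norm)

lemma sample_bound:
  assumes G: "G \<in> LpM lborel p" and p: "1 \<le> p"
  shows "lp_norm n (K n) p (sample \<Phi> n G) \<le> real DIM('a) * op_bound p * LpN lborel p G"
proof -
  let ?f = "\<lambda>b k. (4 ^ n * (LINT x|lborel. (G x \<bullet> b) * \<Phi> b (2 ^ n *\<^sub>R x - embed k))) *\<^sub>R b"
  have "lp_norm n (K n) p (sample \<Phi> n G) = LpN (scaled_count n (K n)) p (\<lambda>k. \<Sum>b\<in>Basis. ?f b k)"
    using finite_K by (simp add: lp_norm_eq_LpN sample_def[abs_def])
  also have "\<dots> \<le> (\<Sum>b\<in>Basis. LpN (scaled_count n (K n)) p (?f b))"
    using finite_K p by (intro LpN_sum_le LpM_scaled_count)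
  also have "\<dots> \<le> (\<Sum>b\<in>(Basis::'a set). op_bound p * LpN lborel p G)"
  proof (rule sum_mono)
    fix b :: 'a assume b: "b \<in> Basis"
    have "LpN (scaled_count n (K n)) p (?f b)
        = LpN (scaled_count n (K n)) p (\<lambda>k. 4 ^ n * (LINT x|lborel. (G x \<bullet> b) * \<Phi> b (2 ^ n *\<^sub>R x - embed k)))"
      using b by (simp add: LpN_def)
    also have "\<dots> \<le> op_bound p * LpN lborel p (\<lambda>x. G x \<bullet> b)"
      using sample_coeff_lp_norm[OF LpM_inner[OF G _ b] p b, of n] p finite_K by (simp add: lp_norm_eq_LpN)
    also have "\<dots> \<le> op_bound p * LpN lborel p G"
      using G p b by (intro mult_left_mono LpN_mono) (auto simp: op_bound_def LpM_def Basis_le_norm)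
    finally show "LpN (scaled_count n (K n)) p (?f b) \<le> op_bound p * LpN lborel p G" .
  qed
  finally show ?thesis by (simp add: mult.assoc)
qed

lemma sample_diff:
  assumes "G \<in> LpM lborel p" "H \<in> LpM lborel p" "1 \<le> p"
  shows "sample \<Phi> n (\<lambda>x. G x - H x) k = sample \<Phi> n G k - sample \<Phi> n H k"
proof -
  have "(LINT x|lborel. ((G x - H x) \<bullet> b) * \<Phi> b (2 ^ n *\<^sub>R x - embed k))
    = (LINT x|lborel. (G x \<bullet> b) * \<Phi> b (2 ^ n *\<^sub>R x - embed k)) - (LINT x|lborel. (H x \<bullet> b) * \<Phi> b (2 ^ n *\<^sub>R x - embed k))"
    if "b \<in> Basis" for b
    using sample_coeff(1)[OF LpM_inner[OF assms(1) _ that] assms(3) that]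
      sample_coeff(1)[OF LpM_inner[OF assms(2) _ that] assms(3) that] assms(3)
    by (simp add: inner_diff_left left_diff_distrib)
  then show ?thesis
    by (simp add: sample_def right_diff_distrib scaleR_diff_left sum_subtractf)
qed

text \<open>The substitution z -> (z + k)/2^n with k = \<open>cell n x\<close> turns the sample into
  an average of H over points tending to x, weighted by a kernel of total mass 1.\<close>

lemma sample_continuous_tendsto:
  assumes H: "continuous_on UNIV H" and bd: "\<And>x. norm (H x) \<le> B" and x: "x \<in> Omega"
  shows "(\<lambda>n. sample \<Phi> n (\<lambda>x. indicator Omega x *\<^sub>R H x) (cell n x)) \<longlonglongrightarrow> H x"
proof -
  have [measurable]: "H \<in> borel_measurable borel" by (rule borel_measurable_continuous_onI[OF H])
  let ?G = "\<lambda>x. indicator Omega x *\<^sub>R H x"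
  let ?y = "\<lambda>n z. (1 / 2 ^ n) *\<^sub>R (z + embed (cell n x))"
  have y: "(\<lambda>n. ?y n z) \<longlonglongrightarrow> x" for z
  proof -
    note 1 = floor_dyadic_tendsto
    have 2: "(\<lambda>n. (1 / 2 ^ n) *\<^sub>R z) \<longlonglongrightarrow> 0"
    proof -
      have "(\<lambda>n. (1 / 2) ^ n *\<^sub>R z) \<longlonglongrightarrow> 0 *\<^sub>R z" by (intro tendsto_intros LIMSEQ_realpow_zero) auto
      then show ?thesis by (simp add: power_one_over)
    qed
    have 3: "(1 / 2 ^ n) *\<^sub>R embed (cell n x) = (\<lfloor>2 ^ n * fst x\<rfloor> / 2 ^ n, \<lfloor>2 ^ n * snd x\<rfloor> / 2 ^ n)" for n
      by (simp add: embed_def cell_def)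
    have "(\<lambda>n. (1 / 2 ^ n) *\<^sub>R z + (1 / 2 ^ n) *\<^sub>R embed (cell n x)) \<longlonglongrightarrow> 0 + (fst x, snd x)"
      unfolding 3 by (intro tendsto_intros 2 1)
    then show ?thesis by (simp add: scaleR_add_right)
  qed
  have coeff: "(\<lambda>n. 4 ^ n * (LINT z|lborel. (?G z \<bullet> b) * \<Phi> b (2 ^ n *\<^sub>R z - embed (cell n x)))) \<longlonglongrightarrow> H x \<bullet> b"
    if b: "b \<in> Basis" for b
  proof -
    note [measurable] = \<Phi>_measurable[OF b]
    have "4 ^ n * (LINT z|lborel. (?G z \<bullet> b) * \<Phi> b (2 ^ n *\<^sub>R z - embed (cell n x)))
        = (LINT z|lborel. (?G (?y n z) \<bullet> b) * \<Phi> b z)" for n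
    proof -
      have "(LINT z|lborel. (?G z \<bullet> b) * \<Phi> b (2 ^ n *\<^sub>R z - embed (cell n x)))
        = (LINT z|lborel. (\<lambda>w. (?G (?y n w) \<bullet> b) * \<Phi> b w) (2 ^ n *\<^sub>R z - embed (cell n x)))"
        by simp
      also have "\<dots> = (1 / (2 ^ n) ^ 2) * (LINT z|lborel. (?G (?y n z) \<bullet> b) * \<Phi> b z)"
        by (subst integral_affine_diff) (auto simp: power2_eq_square)
      finally show ?thesis by (simp add: four_power power2_eq_square)
    qed
    moreover have "(\<lambda>n. LINT z|lborel. (?G (?y n z) \<bullet> b) * \<Phi> b z) \<longlonglongrightarrow> (LINT z|lborel. (H x \<bullet> b) * \<Phi> b z)"
    proof (rule integral_dominated_convergence[where w="\<lambda>z. B * \<bar>\<Phi> b z\<bar>"])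
      show "AE z in lborel. (\<lambda>n. (?G (?y n z) \<bullet> b) * \<Phi> b z) \<longlonglongrightarrow> (H x \<bullet> b) * \<Phi> b z"
      proof (intro AE_I2 tendsto_intros)
        fix z
        have "(\<lambda>n. H (?y n z)) \<longlonglongrightarrow> H x"
          using continuous_on_tendsto_compose[OF H y[of z]] by simp
        \<comment> \<open>As \<open>Omega\<close> is open, the points tending to x are eventually
          inside, so the cut at the boundary does not affect the limit.\<close>
        moreover have "\<forall>\<^sub>F n in sequentially. H (?y n z) = ?G (?y n z)"
          using topological_tendstoD[OF y[of z] open_Omega x] by eventually_elim simp
        ultimately show "(\<lambda>n. ?G (?y n z)) \<longlonglongrightarrow> H x"
          by (rule Lim_transform_eventually)
      qed
      show "AE z in lborel. norm ((?G (?y n z) \<bullet> b) * \<Phi> b z) \<le> B * \<bar>\<Phi> b z\<bar>" for n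
      proof (intro AE_I2)
        fix z
        have "\<bar>?G (?y n z) \<bullet> b\<bar> \<le> norm (?G (?y n z))" by (rule Basis_le_norm[OF b])
        also have "\<dots> \<le> B" using bd[of "?y n z"] norm_ge_zero[of "H x"] bd[of x]
          by (auto simp: indicator_def intro: order_trans[OF norm_ge_zero bd])
        finally show "norm ((?G (?y n z) \<bullet> b) * \<Phi> b z) \<le> B * \<bar>\<Phi> b z\<bar>"
          by (simp add: abs_mult mult_right_mono)
      qed
      show "integrable lborel (\<lambda>z. B * \<bar>\<Phi> b z\<bar>)" using \<Phi>_integrable[OF b] by auto
    qed auto
    ultimately show ?thesis using \<Phi>_integral[OF b] by simp
  qed
  have "(\<lambda>n. sample \<Phi> n ?G (cell n x)) \<longlonglongrightarrow> (\<Sum>b\<in>Basis. (H x \<bullet> b) *\<^sub>R b)"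
    unfolding sample_def using coeff by (intro tendsto_sum tendsto_scaleR tendsto_const) auto
  then show ?thesis by (simp add: euclidean_representation)
qed

text \<open>Dominated convergence for the step functions: they converge at points of the open
  square, vanish eventually at points outside the closed square, and the boundary is a null
  set.\<close>

lemma sample_continuous_norm_tendsto:
  assumes H: "continuous_on UNIV H" and "bounded (range H)" and p: "1 \<le> p"
  shows "(\<lambda>n. lp_norm n (K n) p (sample \<Phi> n (\<lambda>x. indicator Omega x *\<^sub>R H x)))
    \<longlonglongrightarrow> LpN lborel p (\<lambda>x. indicator Omega x *\<^sub>R H x)"
proof -
  let ?G = "\<lambda>x. indicator Omega x *\<^sub>R H x"
  obtain B where B: "\<And>x. norm (H x) \<le> B" using assms(2) by (auto simp: bounded_iff)
  have B0: "B \<ge> 0" using B[of 0] norm_ge_zero order_trans by blast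
  have [measurable]: "H \<in> borel_measurable borel" by (rule borel_measurable_continuous_onI[OF H])
  define C where "C = real DIM('a) * (B * (M * (2 * R)\<^sup>2))"
  have bound: "norm (sample \<Phi> n ?G k) \<le> C" for n k
  proof -
    have "norm (sample \<Phi> n ?G k) \<le> (\<Sum>b\<in>(Basis::'a set). B * (M * (2 * R)\<^sup>2))"
      unfolding sample_def
    proof (rule order_trans[OF norm_sum], rule sum_mono)
      fix b :: 'a assume b: "b \<in> Basis"
      note [measurable] = \<Phi>_measurable[OF b]
      have le: "AE x in lborel. \<bar>4 ^ n * ((?G x \<bullet> b) * \<Phi> b (2 ^ n *\<^sub>R x - embed k))\<bar> \<le> B * (M * W n k x)"
        using \<Phi>_le_W[OF b, of n k]
      proof eventually_elim
        case (elim x)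
        have "\<bar>?G x \<bullet> b\<bar> \<le> B"
          using Basis_le_norm[OF b, of "H x"] B[of x] B0 by (auto simp: indicator_def)
        then have "\<bar>?G x \<bullet> b\<bar> * (4 ^ n * \<bar>\<Phi> b (2 ^ n *\<^sub>R x - embed k)\<bar>) \<le> B * (M * W n k x)"
          using elim B0 by (intro mult_mono[of _ B]) auto
        then show ?case by (simp add: abs_mult ac_simps)
      qed
      have "\<bar>4 ^ n * (LINT x|lborel. (?G x \<bullet> b) * \<Phi> b (2 ^ n *\<^sub>R x - embed k))\<bar>
         = \<bar>LINT x|lborel. 4 ^ n * ((?G x \<bullet> b) * \<Phi> b (2 ^ n *\<^sub>R x - embed k))\<bar>" by simp
      also have "\<dots> \<le> (LINT x|lborel. \<bar>4 ^ n * ((?G x \<bullet> b) * \<Phi> b (2 ^ n *\<^sub>R x - embed k))\<bar>)"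
        by (rule integral_abs_bound)
      also have "\<dots> \<le> (LINT x|lborel. B * (M * W n k x))"
      proof (rule integral_mono_AE)
        show "integrable lborel (\<lambda>x. \<bar>4 ^ n * ((?G x \<bullet> b) * \<Phi> b (2 ^ n *\<^sub>R x - embed k))\<bar>)"
          by (rule Bochner_Integration.integrable_bound[of _ "\<lambda>x. B * (M * W n k x)"])
             (use le W_integrable B0 M W_nonneg in \<open>auto elim!: eventually_mono\<close>)
      qed (use le W_integrable in auto)
      also have "\<dots> = B * (M * (2 * R)\<^sup>2)" by (simp add: W_integral)
      finally show "norm ((4 ^ n * (LINT x|lborel. (?G x \<bullet> b) * \<Phi> b (2 ^ n *\<^sub>R x - embed k))) *\<^sub>R b) \<le> B * (M * (2 * R)\<^sup>2)"
        using b by simp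
    qed
    then show ?thesis by (simp add: C_def)
  qed
  have C0: "C \<ge> 0" using bound[of 0 "(0, 0)"] norm_ge_zero order_trans by blast
  let ?h = "\<lambda>n k. norm (sample \<Phi> n ?G k) powr p"
  let ?Z = "cbox (- R, - R) (R + 2, R + 2) :: point set"
  have "(\<lambda>n. LINT x|lborel. (if cell n x \<in> K n then ?h n (cell n x) else 0)) \<longlonglongrightarrow> (LINT x|lborel. norm (?G x) powr p)"
  proof (rule integral_dominated_convergence[where w="\<lambda>x. indicator ?Z x * C powr p"])
    show "AE x in lborel. (\<lambda>n. if cell n x \<in> K n then ?h n (cell n x) else 0) \<longlonglongrightarrow> norm (?G x) powr p"
      using AE_Omega_or_outside
    proof eventually_elim
      case (elim x)
      show ?case
      proof (cases "x \<in> Omega")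
        case True
        have "(\<lambda>n. ?h n (cell n x)) \<longlonglongrightarrow> norm (H x) powr p"
          using p by (intro tendsto_powr' tendsto_norm sample_continuous_tendsto[OF H B True] tendsto_const) auto
        moreover have "\<forall>\<^sub>F n in sequentially. ?h n (cell n x) = (if cell n x \<in> K n then ?h n (cell n x) else 0)"
          using K_inner[OF True] by eventually_elim simp
        ultimately have "(\<lambda>n. if cell n x \<in> K n then ?h n (cell n x) else 0) \<longlonglongrightarrow> norm (H x) powr p"
          by (rule Lim_transform_eventually)
        then show ?thesis using True by simp
      next
        case False
        then have "x \<notin> closure Omega" using elim by simp
        from K_outer[OF this]
        have "\<forall>\<^sub>F n in sequentially. (if cell n x \<in> K n then ?h n (cell n x) else 0) = 0"
          by eventually_elim simp
        then show ?thesis using False by (simp add: tendsto_eventually)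
      qed
    qed
    show "AE x in lborel. norm (if cell n x \<in> K n then ?h n (cell n x) else 0) \<le> indicator ?Z x * C powr p" for n
    proof (rule AE_I2)
      fix x
      show "norm (if cell n x \<in> K n then ?h n (cell n x) else 0) \<le> indicator ?Z x * C powr p"
        using cell_in_K_bounded[of n x] powr_mono2[OF _ norm_ge_zero bound[of n "cell n x"], of p] p
        by (cases "cell n x \<in> K n") (auto simp: indicator_def)
    qed
    show "(\<lambda>x. if cell n x \<in> K n then ?h n (cell n x) else 0) \<in> borel_measurable lborel" for n
      using sum_eq_integral_cell(2)[OF finite_K[of n], where h="?h n"] by simp
    have "emeasure lborel ?Z < \<infinity>" using emeasure_bounded_finite[of ?Z] by simp
    then show "integrable lborel (\<lambda>x. indicator ?Z x * C powr p)" by simp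
  qed (use p in auto)
  then have "(\<lambda>n. (LINT x|lborel. (if cell n x \<in> K n then ?h n (cell n x) else 0)) powr (1 / p))
      \<longlonglongrightarrow> (LINT x|lborel. norm (?G x) powr p) powr (1 / p)"
    using p by (intro tendsto_powr' tendsto_const) (auto intro!: always_eventually Bochner_Integration.integral_nonneg)
  then show ?thesis
    unfolding LpN_def lp_norm_def by (subst sum_eq_integral_cell(1)[OF finite_K])
qed

text \<open>Density: the norm differences between G and a continuous approximation are controlled
  uniformly in n by \<open>sample_bound\<close>.\<close>

theorem sample_norm_tendsto:
  assumes G: "G \<in> LpM lborel p" and p: "1 \<le> p" and supp: "\<And>x. x \<notin> Omega \<Longrightarrow> G x = 0"
  shows "(\<lambda>n. lp_norm n (K n) p (sample \<Phi> n G)) \<longlonglongrightarrow> LpN lborel p G"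
proof (rule LIMSEQ_I)
  fix e :: real assume "e > 0"
  define C where "C = real DIM('a) * op_bound p"
  have C: "C \<ge> 0" by (simp add: C_def op_bound_def)
  \<comment> \<open>Chosen so that C d + d = e/2: C d bounds the sampled difference and d the
    difference of the L_p norms, leaving e/2 for the continuous approximation.\<close>
  define d where "d = e / (2 * (C + 1))"
  have d: "d > 0" using \<open>e > 0\<close> C by (simp add: d_def)
  from continuous_dense_LpM[OF G p bounded_Omega Omega_borel supp d]
  obtain H where H: "continuous_on UNIV H" "bounded (range H)"
    "(\<lambda>x. indicator Omega x *\<^sub>R H x) \<in> LpM lborel p"
    "LpN lborel p (\<lambda>x. G x - indicator Omega x *\<^sub>R H x) < d" by blast
  let ?H = "\<lambda>x. indicator Omega x *\<^sub>R H x"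
  obtain N where N: "\<And>n. n \<ge> N \<Longrightarrow> norm (lp_norm n (K n) p (sample \<Phi> n ?H) - LpN lborel p ?H) < e / 2"
    using LIMSEQ_D[OF sample_continuous_norm_tendsto[OF H(1,2) p], of "e / 2"] \<open>e > 0\<close> by auto
  have "norm (lp_norm n (K n) p (sample \<Phi> n G) - LpN lborel p G) < e" if "n \<ge> N" for n
  proof -
    have "\<bar>lp_norm n (K n) p (sample \<Phi> n G) - lp_norm n (K n) p (sample \<Phi> n ?H)\<bar>
      \<le> lp_norm n (K n) p (sample \<Phi> n (\<lambda>x. G x - ?H x))"
      unfolding sample_diff[OF G H(3) p, abs_def] lp_norm_eq_LpN[OF finite_K]
      by (intro LpN_triangle_diff LpM_scaled_count finite_K p)
    also have "\<dots> \<le> C * LpN lborel p (\<lambda>x. G x - ?H x)"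
      unfolding C_def by (intro sample_bound LpM_diff G H(3) p)
    also have "\<dots> \<le> C * d" using H(4) C by (intro mult_left_mono) auto
    finally have 1: "\<bar>lp_norm n (K n) p (sample \<Phi> n G) - lp_norm n (K n) p (sample \<Phi> n ?H)\<bar> \<le> C * d" .
    have 2: "\<bar>LpN lborel p G - LpN lborel p ?H\<bar> < d"
      using LpN_triangle_diff[OF G H(3) p] H(4) by linarith
    have "C * d + d = (C + 1) * d" by (simp add: algebra_simps)
    also have "\<dots> = e / 2" using C unfolding d_def by (simp add: divide_simps)
    finally have "C * d + d = e / 2" .
    with 1 2 N[OF that] show ?thesis unfolding real_norm_def by linarith
  qed
  then show "\<exists>N. \<forall>n\<ge>N. norm (lp_norm n (K n) p (sample \<Phi> n G) - LpN lborel p G) < e" by blast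
qed

end

section \<open>Smooth functions of one variable\<close>

text \<open>Level 0 demands nothing. \<open>smooth\<close> ranges over all levels, and
  differentiability at the next level already gives continuity.\<close>

primrec CK :: "nat \<Rightarrow> (real \<Rightarrow> real) \<Rightarrow> bool" where
  "CK 0 f \<longleftrightarrow> True"
| "CK (Suc k) f \<longleftrightarrow> (\<forall>x. (f has_real_derivative deriv f x) (at x)) \<and> CK k (deriv f)"

definition smooth :: "(real \<Rightarrow> real) \<Rightarrow> bool" where
  "smooth f \<longleftrightarrow> (\<forall>k. CK k f)"

lemma CK_Suc_imp: "CK (Suc k) f \<Longrightarrow> CK k f"
  by (induction k arbitrary: f) auto

lemma CK_SucI:
  assumes "\<And>x. (f has_real_derivative f' x) (at x)" "CK k f'"
  shows "CK (Suc k) f"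
proof -
  have "deriv f = f'" using assms(1) by (intro ext DERIV_imp_deriv)
  with assms show ?thesis by simp
qed

lemma smooth_iff: "smooth f \<longleftrightarrow> (\<forall>x. (f has_real_derivative deriv f x) (at x)) \<and> smooth (deriv f)"
  unfolding smooth_def by (metis CK.simps(1) CK.simps(2) not0_implies_Suc)

lemma smooth_deriv: "smooth f \<Longrightarrow> smooth (deriv f)"
  and smooth_has_deriv: "smooth f \<Longrightarrow> (f has_real_derivative deriv f x) (at x)"
  using smooth_iff by blast+

lemma smoothI:
  assumes "\<And>x. (f has_real_derivative f' x) (at x)" "smooth f'"
  shows "smooth f"
  unfolding smooth_def
proof
  fix k
  have "CK (Suc k) f" by (rule CK_SucI[OF assms(1)]) (use assms(2) in \<open>auto simp: smooth_def\<close>)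
  then show "CK k f" by (rule CK_Suc_imp)
qed

lemma smooth_continuous: "smooth f \<Longrightarrow> continuous_on S f"
  by (rule continuous_at_imp_continuous_on) (auto intro: DERIV_isCont[OF smooth_has_deriv])

lemma smooth_measurable: "smooth f \<Longrightarrow> f \<in> borel_measurable borel"
  by (rule borel_measurable_continuous_onI[OF smooth_continuous])

lemma smooth_const [simp]: "smooth (\<lambda>x. c)"
proof -
  have "CK k (\<lambda>x. c)" for k c
  proof (induction k arbitrary: c)
    case (Suc k) then show ?case by (intro CK_SucI[where f'="\<lambda>x. 0"]) auto
  qed simp
  then show ?thesis by (auto simp: smooth_def)
qed

lemma smooth_ident: "smooth (\<lambda>x. x)"
  by (rule smoothI[where f'="\<lambda>x. 1"]) auto

lemma CK_add: "CK k f \<Longrightarrow> CK k g \<Longrightarrow> CK k (\<lambda>x. f x + g x)"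
proof (induction k arbitrary: f g)
  case (Suc k)
  then show ?case
    by (intro CK_SucI[where f'="\<lambda>x. deriv f x + deriv g x"]) (auto intro!: derivative_eq_intros)
qed simp

lemma CK_mult: "CK k f \<Longrightarrow> CK k g \<Longrightarrow> CK k (\<lambda>x. f x * g x)"
proof (induction k arbitrary: f g)
  case (Suc k)
  then show ?case
    by (intro CK_SucI[where f'="\<lambda>x. deriv f x * g x + f x * deriv g x"] CK_add Suc.IH)
       (auto intro!: derivative_eq_intros dest: CK_Suc_imp simp del: CK.simps(2), auto)
qed simp

lemma smooth_add: "smooth f \<Longrightarrow> smooth g \<Longrightarrow> smooth (\<lambda>x. f x + g x)"
  and smooth_mult: "smooth f \<Longrightarrow> smooth g \<Longrightarrow> smooth (\<lambda>x. f x * g x)"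
  by (auto simp: smooth_def CK_add CK_mult)

lemma smooth_cmult: "smooth f \<Longrightarrow> smooth (\<lambda>x. c * f x)"
  using smooth_mult[OF smooth_const] by blast

lemma smooth_diff: "smooth f \<Longrightarrow> smooth g \<Longrightarrow> smooth (\<lambda>x. f x - g x)"
  using smooth_add[OF _ smooth_cmult[of g "-1"], of f] by simp

lemma smooth_power: "smooth f \<Longrightarrow> smooth (\<lambda>x. f x ^ n)"
  by (induction n) (auto intro: smooth_mult)

lemma DERIV_affine:
  assumes "smooth f"
  shows "((\<lambda>x. f (c * x + d)) has_real_derivative c * deriv f (c * x + d)) (at x)"
  by (rule DERIV_cong[OF DERIV_chain'[OF _ smooth_has_deriv[OF assms]]])
     (auto intro!: derivative_eq_intros)

lemma smooth_affine:
  assumes "smooth f"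
  shows "smooth (\<lambda>x. f (c * x + d))"
proof -
  \<comment> \<open>The free factor e closes the induction, since every differentiation produces a
    factor c.\<close>
  have "CK k (\<lambda>x. e * f (c * x + d))" if "smooth f" for k e f
    using that
  proof (induction k arbitrary: e f)
    case (Suc k)
    show ?case
    proof (rule CK_SucI)
      show "((\<lambda>x. e * f (c * x + d)) has_real_derivative (e * c) * deriv f (c * x + d)) (at x)" for x
        unfolding mult.assoc by (rule DERIV_cmult[OF DERIV_affine[OF Suc.prems]])
      show "CK k (\<lambda>x. (e * c) * deriv f (c * x + d))"
        by (rule Suc.IH[OF smooth_deriv[OF Suc.prems]])
    qed
  qed simp
  from this[OF assms, of _ 1] show ?thesis by (auto simp: smooth_def)
qed

lemma smooth_funpow_deriv: "smooth f \<Longrightarrow> smooth ((deriv ^^ r) f)"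
  by (induction r) (auto intro: smooth_deriv)

lemma funpow_deriv_affine:
  assumes "smooth f"
  shows "(deriv ^^ r) (\<lambda>x. f (c * x + d)) = (\<lambda>x. c ^ r * (deriv ^^ r) f (c * x + d))"
proof (induction r)
  case (Suc r)
  have "deriv (\<lambda>x. c ^ r * (deriv ^^ r) f (c * x + d)) x = c ^ r * (c * deriv ((deriv ^^ r) f) (c * x + d))" for x
    by (rule DERIV_imp_deriv[OF DERIV_cmult[OF DERIV_affine[OF smooth_funpow_deriv[OF assms]]]])
  then have "deriv (\<lambda>x. c ^ r * (deriv ^^ r) f (c * x + d)) = (\<lambda>x. c ^ Suc r * (deriv ^^ Suc r) f (c * x + d))"
    by (simp add: ac_simps fun_eq_iff)
  then show ?case using Suc by simp
qed simp

lemma deriv_cong_open: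
  assumes "open S" "x \<in> S" "\<And>y. y \<in> S \<Longrightarrow> f y = g y"
  shows "deriv f x = deriv g x"
proof (rule deriv_cong_ev)
  show "\<forall>\<^sub>F x in nhds x. f x = g x"
    using assms by (auto simp: eventually_nhds)
qed simp

lemma funpow_deriv_cong_open:
  fixes f g :: "real \<Rightarrow> real"
  assumes "open S" "\<And>y. y \<in> S \<Longrightarrow> f y = g y" "x \<in> S"
  shows "(deriv ^^ r) f x = (deriv ^^ r) g x"
  using assms(3)
proof (induction r arbitrary: x)
  case (Suc r)
  have "deriv ((deriv ^^ r) f) x = deriv ((deriv ^^ r) g) x"
    by (rule deriv_cong_open[OF assms(1) Suc.prems Suc.IH])
  then show ?case by simp
qed (use assms in auto)

text \<open>The interval is carried explicitly so that boxes for products can be compared with U. It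
  may be empty (u < l), in which case a is the zero function; later proofs split off this
  case.\<close>

definition tst :: "real \<Rightarrow> real \<Rightarrow> (real \<Rightarrow> real) \<Rightarrow> bool" where
  "tst l u a \<longleftrightarrow> smooth a \<and> (\<forall>x. a x \<noteq> 0 \<longrightarrow> l \<le> x \<and> x \<le> u)"

lemma tst_smooth: "tst l u a \<Longrightarrow> smooth a"
  by (simp add: tst_def)

lemma tst_funpow_deriv: "tst l u a \<Longrightarrow> tst l u ((deriv ^^ r) a)"
proof -
  assume a: "tst l u a"
  have "(deriv ^^ r) a x = 0" if "\<not> (l \<le> x \<and> x \<le> u)" for x
  proof -
    have "(deriv ^^ r) a x = (deriv ^^ r) (\<lambda>x. 0) x"
      by (rule funpow_deriv_cong_open[where S="- {l..u}"]) (use a that in \<open>auto simp: tst_def\<close>)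
    also have "(deriv ^^ r) (\<lambda>x. 0 :: real) = (\<lambda>x. 0)"
      by (induction r) auto
    finally show ?thesis .
  qed
  then show ?thesis using a smooth_funpow_deriv by (auto simp: tst_def)
qed

lemma tst_bounded: "tst l u a \<Longrightarrow> \<exists>B. \<forall>x. \<bar>a x\<bar> \<le> B"
proof -
  assume a: "tst l u a"
  have "bounded (a ` {l..u})"
    by (intro compact_imp_bounded compact_continuous_image smooth_continuous tst_smooth[OF a]) auto
  then obtain B where B: "\<And>x. x \<in> {l..u} \<Longrightarrow> \<bar>a x\<bar> \<le> B"
    unfolding bounded_iff by (metis imageI real_norm_def)
  have "\<bar>a x\<bar> \<le> max B 0" for x
    using B[of x] a by (cases "a x = 0") (auto simp: tst_def)
  then show ?thesis by blast
qed

lemma tst_integrable: "tst l u a \<Longrightarrow> integrable lborel a"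
proof -
  assume a: "tst l u a"
  have [measurable]: "a \<in> borel_measurable borel" by (rule smooth_measurable[OF tst_smooth[OF a]])
  obtain B where B: "\<And>x. \<bar>a x\<bar> \<le> B" using tst_bounded[OF a] by blast
  have "emeasure lborel {l..u} < \<infinity>" by (rule emeasure_bounded_finite) simp
  then have "integrable lborel (\<lambda>x. indicator {l..u} x * B)" by simp
  then show ?thesis
    by (rule Bochner_Integration.integrable_bound)
       (use a B in \<open>auto simp: tst_def indicator_def intro: order_trans[OF B abs_ge_self]\<close>)
qed

lemma tst_mono: "tst l u a \<Longrightarrow> l' \<le> l \<Longrightarrow> u \<le> u' \<Longrightarrow> tst l' u' a"
  by (fastforce simp: tst_def)

lemma tst_mult_smooth: "tst l u a \<Longrightarrow> smooth b \<Longrightarrow> tst l u (\<lambda>x. a x * b x)"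
  by (auto simp: tst_def smooth_mult)

text \<open>The polynomial factor makes this family closed under differentiation.\<close>

definition flat :: "real poly \<Rightarrow> real \<Rightarrow> real" where
  "flat P x = (if x > 0 then poly P (1 / x) * exp (- (1 / x)) else 0)"

lemma poly_div_exp_tendsto_0: "((\<lambda>t. poly P t / exp t) \<longlongrightarrow> (0::real)) at_top"
proof -
  have "((\<lambda>t. \<Sum>i\<le>degree P. coeff P i * (t ^ i / exp t)) \<longlongrightarrow> (\<Sum>i\<le>degree P. coeff P i * 0)) at_top"
    by (intro tendsto_intros tendsto_power_div_exp_0)
  then show ?thesis by (simp add: poly_altdef sum_divide_distrib)
qed

text \<open>\<open>[:0, 0, 1:]\<close> is the polynomial X^2. With t = 1/x the derivative of P(t)
  exp(-t) in x is t^2 (P(t) - P'(t)) exp(-t). At 0 the difference quotient from the right is t P(t)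
  / exp(t), which tends to 0 as t grows.\<close>

lemma flat_deriv: "(flat P has_real_derivative flat ([:0, 0, 1:] * (P - pderiv P)) x) (at x)"
proof (cases "x = 0")
  case False
  show ?thesis
  proof (cases "x > 0")
    case True
    have "((\<lambda>x. poly P (1 / x) * exp (- (1 / x))) has_real_derivative flat ([:0, 0, 1:] * (P - pderiv P)) x) (at x)"
      using True by (auto intro!: derivative_eq_intros simp: flat_def field_simps power2_eq_square)
    then show ?thesis
      by (rule has_field_derivative_transform_within_open[where S="{0<..}"]) (use True in \<open>auto simp: flat_def\<close>)
  next
    case xneg: False
    have "((\<lambda>x. 0) has_real_derivative flat ([:0, 0, 1:] * (P - pderiv P)) x) (at x)"
      using xneg by (auto simp: flat_def)
    then show ?thesis
      by (rule has_field_derivative_transform_within_open[where S="{..<0}"]) (use False xneg in \<open>auto simp: flat_def\<close>)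
  qed
next
  case True
  have "((\<lambda>h. flat P h / h) \<longlongrightarrow> 0) (at_right 0)"
  proof -
    have "filterlim (\<lambda>h::real. inverse h) at_top (at_right 0)"
      by (rule filterlim_inverse_at_top_right)
    from filterlim_compose[OF poly_div_exp_tendsto_0[of "[:0, 1:] * P"] this]
    have "((\<lambda>h. inverse h * poly P (inverse h) / exp (inverse h)) \<longlongrightarrow> 0) (at_right 0)" by simp
    moreover have "\<forall>\<^sub>F h in at_right 0. inverse h * poly P (inverse h) / exp (inverse h) = flat P h / h"
      by (rule eventually_at_rightI[of 0 1]) (auto simp: flat_def exp_minus field_simps)
    ultimately show ?thesis by (rule Lim_transform_eventually)
  qed
  moreover have "((\<lambda>h. flat P h / h) \<longlongrightarrow> 0) (at_left 0)"
  proof (rule tendsto_eventually)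
    show "\<forall>\<^sub>F h in at_left 0. flat P h / h = 0"
      by (rule eventually_at_leftI[of "-1" 0]) (auto simp: flat_def)
  qed
  ultimately have "((\<lambda>h. flat P h / h) \<longlongrightarrow> 0) (at 0)" by (simp add: filterlim_split_at)
  then show ?thesis unfolding True DERIV_def by (simp add: flat_def)
qed

lemma smooth_flat: "smooth (flat P)"
proof -
  have "CK k (flat P)" for k P
    by (induction k arbitrary: P) (auto intro!: CK_SucI[OF flat_deriv] simp del: CK.simps(2))
  then show ?thesis by (auto simp: smooth_def)
qed

section \<open>Smooth steps and cutoffs\<close>

lemma antiderivative_exists:
  assumes "smooth a"
  obtains A where "smooth A" "deriv A = a" "A L = 0"
proof -
  have "\<exists>F. \<forall>x. (-\<infinity>::ereal) < ereal x \<longrightarrow> ereal x < \<infinity> \<longrightarrow> (F has_vector_derivative a x) (at x)"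
    by (rule einterval_antiderivative) (auto intro!: DERIV_isCont smooth_has_deriv[OF assms])
  then obtain F where F: "\<And>x. (F has_real_derivative a x) (at x)"
    by (auto simp: has_real_derivative_iff_has_vector_derivative)
  have d: "((\<lambda>x. F x - F L) has_real_derivative a x) (at x)" for x
    using F by (auto intro!: derivative_eq_intros)
  show ?thesis
    by (rule that[of "\<lambda>x. F x - F L"])
       (use assms d in \<open>auto intro!: smoothI[OF d] DERIV_imp_deriv\<close>)
qed

lemma FTC_smooth:
  assumes "smooth A" "x \<le> y"
  shows "(LINT t|lborel. indicator {x..y} t * deriv A t) = A y - A x"
  using integral_FTC_atLeastAtMost[OF assms(2), of A "deriv A"]
    smooth_has_deriv[OF assms(1)] smooth_continuous[OF smooth_deriv[OF assms(1)]]
  by (auto simp: has_real_derivative_iff_has_vector_derivative intro: has_vector_derivative_at_within)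

text \<open>The normalised antiderivative of b(x) = \<open>flat 1 x\<close> times
  \<open>flat 1 (1 - x)\<close>, which is positive exactly on (0,1).\<close>

lemma smooth_step_exists:
  obtains S :: "real \<Rightarrow> real" where "smooth S" "\<And>x. x \<le> 0 \<Longrightarrow> S x = 0" "\<And>x. x \<ge> 1 \<Longrightarrow> S x = 1"
    "\<And>x. 0 \<le> S x" "\<And>x. S x \<le> 1" "tst 0 1 (deriv S)" "\<And>x. 0 \<le> deriv S x"
proof -
  define b where "b x = flat 1 x * flat 1 (-1 * x + 1)" for x
  have b: "smooth b" unfolding b_def by (intro smooth_mult smooth_affine smooth_flat)
  have b0: "b x \<ge> 0" for x by (auto simp: b_def flat_def)
  have bz: "b x = 0" if "x \<le> 0 \<or> x \<ge> 1" for x using that by (auto simp: b_def flat_def)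
  obtain B where B: "smooth B" "deriv B = b" "B 0 = 0" using antiderivative_exists[OF b] by blast
  have dB: "(B has_real_derivative b x) (at x)" for x using smooth_has_deriv[OF B(1)] B(2) by simp
  have mono: "B x \<le> B y" if "x \<le> y" for x y
    using DERIV_nonneg_imp_nondecreasing[OF that] dB b0 by blast
  have const: "B x = B y" if "\<And>z. min x y \<le> z \<Longrightarrow> z \<le> max x y \<Longrightarrow> b z = 0" for x y
  proof (cases "x \<le> y")
    case True then show ?thesis using DERIV_isconst2[of x y B] dB that
      by (metis DERIV_isconst_end DERIV_isCont continuous_at_imp_continuous_on less_eq_real_def max_def min_def order.strict_implies_order)
  next
    case False then show ?thesis using DERIV_isconst2[of y x B] dB that
      by (metis DERIV_isconst_end DERIV_isCont continuous_at_imp_continuous_on less_eq_real_def max_def min_def linorder_not_le)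
  qed
  have "B 1 > B 0"
  proof -
    obtain z where z: "0 < z" "z < 1" "B 1 - B 0 = (1 - 0) * b z"
      using MVT2[of 0 1 B b] dB by auto
    have "b z > 0" using z by (auto simp: b_def flat_def)
    with z show ?thesis by simp
  qed
  then have c: "B 1 > 0" using B(3) by simp
  have B_neg: "B x = 0" if "x \<le> 0" for x
    using const[of x 0] bz that B(3) by auto
  have B_pos: "B x = B 1" if "x \<ge> 1" for x
    using const[of x 1] bz that by auto
  define S where "S x = (1 / B 1) * B x" for x
  have dS: "(S has_real_derivative (1 / B 1) * b x) (at x)" for x
    unfolding S_def by (rule DERIV_cmult[OF dB])
  have dS': "deriv S = (\<lambda>x. (1 / B 1) * b x)" using dS by (auto intro!: DERIV_imp_deriv)
  show ?thesis
  proof (rule that[of S])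
    show "smooth S" unfolding S_def by (intro smooth_cmult B)
    show "0 \<le> S x" for x
      using mono[of "min x 0" x] B_neg[of "min x 0"] c by (auto simp: S_def)
    show "S x \<le> 1" for x
      using mono[of x "max x 1"] B_pos[of "max x 1"] c by (auto simp: S_def)
    show "tst 0 1 (deriv S)" unfolding dS' tst_def
      using smooth_cmult[OF b] bz by (metis linorder_le_cases mult_zero_right)
    show "0 \<le> deriv S x" for x unfolding dS' using c b0[of x] by simp
    show "S x = 0" if "x \<le> 0" for x using B_neg[OF that] by (simp add: S_def)
    show "S x = 1" if "x \<ge> 1" for x using B_pos[OF that] c by (simp add: S_def)
  qed
qed

definition step :: "real \<Rightarrow> real" where
  "step = (SOME S. smooth S \<and> (\<forall>x\<le>0. S x = 0) \<and> (\<forall>x\<ge>1. S x = 1) \<and> (\<forall>x. 0 \<le> S x \<and> S x \<le> 1)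
     \<and> tst 0 1 (deriv S) \<and> (\<forall>x. 0 \<le> deriv S x))"

lemma step_spec: "smooth step \<and> (\<forall>x\<le>0. step x = 0) \<and> (\<forall>x\<ge>1. step x = 1)
  \<and> (\<forall>x. 0 \<le> step x \<and> step x \<le> 1) \<and> tst 0 1 (deriv step) \<and> (\<forall>x. 0 \<le> deriv step x)"
proof -
  have "\<exists>S. smooth S \<and> (\<forall>x\<le>0. S x = 0) \<and> (\<forall>x\<ge>1. S x = 1) \<and> (\<forall>x. 0 \<le> S x \<and> S x \<le> 1)
     \<and> tst 0 1 (deriv S) \<and> (\<forall>x. 0 \<le> deriv S x)"
    by (rule smooth_step_exists) blast
  then show ?thesis unfolding step_def by (rule someI_ex)
qed

lemma step_smooth: "smooth step"
  and step_0: "x \<le> 0 \<Longrightarrow> step x = 0"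
  and step_1: "x \<ge> 1 \<Longrightarrow> step x = 1"
  and step_nonneg: "0 \<le> step x"
  and step_le_1: "step x \<le> 1"
  and tst_deriv_step: "tst 0 1 (deriv step)"
  and deriv_step_nonneg: "0 \<le> deriv step x"
  using step_spec by auto

lemma integral_tst:
  assumes "tst l u a" "smooth A" "deriv A = a" "l \<le> u"
  shows "(LINT x|lborel. a x) = A u - A l"
proof -
  have "(LINT x|lborel. a x) = (LINT x|lborel. indicator {l..u} x * deriv A x)"
    using assms(1) by (intro Bochner_Integration.integral_cong) (auto simp: tst_def assms(3) indicator_def)
  then show ?thesis using FTC_smooth[OF assms(2,4)] by simp
qed

lemma integral_deriv_step: "(LINT x|lborel. deriv step x) = 1"
  by (subst integral_tst[OF tst_deriv_step step_smooth refl]) (auto simp: step_0 step_1)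

definition cutoff :: "real \<Rightarrow> real \<Rightarrow> real" where
  "cutoff R x = step (x + (R + 1)) * step ((-1) * x + (R + 1))"

lemma tst_cutoff: "tst (- (R + 1)) (R + 1) (cutoff R)"
proof -
  have "smooth (cutoff R)" unfolding cutoff_def
    using smooth_affine[OF step_smooth, of 1 "R + 1"] smooth_affine[OF step_smooth, of "-1" "R + 1"]
    by (intro smooth_mult) auto
  moreover have "- (R + 1) \<le> x \<and> x \<le> R + 1" if "cutoff R x \<noteq> 0" for x
  proof -
    have "\<not> x + (R + 1) \<le> 0" "\<not> (-1) * x + (R + 1) \<le> 0"
      using that step_0 unfolding cutoff_def by (metis mult_zero_left mult_zero_right)+
    then show ?thesis by auto
  qed
  ultimately show ?thesis by (auto simp: tst_def)
qed

lemma cutoff_1: "- R \<le> x \<Longrightarrow> x \<le> R \<Longrightarrow> cutoff R x = 1"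
  by (simp add: cutoff_def step_1)

section \<open>Tensor product test functions\<close>

text \<open>Weak derivatives are exploited only through products a(x) b(y). Their partial
  derivatives are again products of one-variable derivatives, and they still separate integrable
  functions because rectangles generate the Borel sets.\<close>

definition tens :: "(real \<Rightarrow> real) \<Rightarrow> (real \<Rightarrow> real) \<Rightarrow> point \<Rightarrow> real" where
  "tens a b z = a (fst z) * b (snd z)"

lemma tens_support: "tst l1 u1 a \<Longrightarrow> tst l2 u2 b \<Longrightarrow> tens a b z \<noteq> 0 \<Longrightarrow> z \<in> cbox (l1, l2) (u1, u2)"
  by (auto simp: tens_def tst_def mem_cbox_point)

lemma dx_tens: "smooth a \<Longrightarrow> dx (tens a b) = tens (deriv a) b"
  by (auto simp: dx_def tens_def fun_eq_iff intro!: DERIV_imp_deriv DERIV_cmult_right smooth_has_deriv)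

lemma dy_tens: "smooth b \<Longrightarrow> dy (tens a b) = tens a (deriv b)"
  by (auto simp: dy_def tens_def fun_eq_iff intro!: DERIV_imp_deriv DERIV_cmult smooth_has_deriv)

lemma partial_tens:
  assumes "smooth a" "smooth b"
  shows "partial \<alpha> (tens a b) = tens ((deriv ^^ fst \<alpha>) a) ((deriv ^^ snd \<alpha>) b)"
proof -
  have y: "(dy ^^ r) (tens a b) = tens a ((deriv ^^ r) b)" for r
    by (induction r) (use assms in \<open>auto simp: dy_tens smooth_funpow_deriv\<close>)
  have "(dx ^^ r) (tens a c) = tens ((deriv ^^ r) a) c" for r c
    by (induction r) (use assms in \<open>auto simp: dx_tens smooth_funpow_deriv\<close>)
  with y show ?thesis by (simp add: partial_def)
qed

lemma continuous_on_tens: "smooth a \<Longrightarrow> smooth b \<Longrightarrow> continuous_on S (tens a b)"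
  unfolding tens_def
  by (rule continuous_on_mult; rule continuous_on_compose2[OF smooth_continuous[of _ UNIV]])
     (auto intro: continuous_on_fst continuous_on_snd continuous_on_id)

lemma tens_measurable: "smooth a \<Longrightarrow> smooth b \<Longrightarrow> tens a b \<in> borel_measurable borel"
  by (rule borel_measurable_continuous_onI[OF continuous_on_tens])

lemma tens_differentiable:
  assumes "smooth a" "smooth b"
  shows "tens a b differentiable (at z)"
proof -
  have d: "f differentiable (at x)" if "smooth f" for f and x :: real
    using smooth_has_deriv[OF that] real_differentiable_def by blast
  have 1: "(\<lambda>z. a (fst z)) differentiable (at z)"
    by (rule differentiable_compose[OF d[OF assms(1)]])
       (rule bounded_linear_imp_differentiable[OF bounded_linear_fst])
  have 2: "(\<lambda>z. b (snd z)) differentiable (at z)"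
    by (rule differentiable_compose[OF d[OF assms(2)]])
       (rule bounded_linear_imp_differentiable[OF bounded_linear_snd])
  show ?thesis unfolding tens_def[abs_def] by (intro differentiable_mult 1 2)
qed

lemma C_k_tens: "smooth a \<Longrightarrow> smooth b \<Longrightarrow> C_k k (tens a b)"
  by (induction k arbitrary: a b)
     (auto simp: continuous_on_tens tens_differentiable dx_tens dy_tens smooth_deriv)

lemma test_function_tens:
  assumes a: "tst l1 u1 a" and b: "tst l2 u2 b" and U: "cbox (l1, l2) (u1, u2) \<subseteq> U"
  shows "test_function U (tens a b)"
proof -
  have "{z. tens a b z \<noteq> 0} \<subseteq> cbox (l1, l2) (u1, u2)"
    using a b by (auto simp: tens_def tst_def mem_cbox_point)
  then have "closure {z. tens a b z \<noteq> 0} \<subseteq> cbox (l1, l2) (u1, u2)"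
    by (rule closure_minimal) (rule closed_cbox)
  moreover from this have "compact (closure {z. tens a b z \<noteq> 0})"
    by (metis closed_closure compact_cbox compact_Int_closed inf.absorb_iff2)
  ultimately show ?thesis
    using U C_k_tens[OF tst_smooth[OF a] tst_smooth[OF b]] by (auto simp: test_function_def)
qed

text \<open>The integral runs over the whole plane; for a product supported in U it agrees with the
  integral over U, whatever f is outside U.\<close>

definition tint :: "(real \<Rightarrow> real) \<Rightarrow> (real \<Rightarrow> real) \<Rightarrow> (point \<Rightarrow> real) \<Rightarrow> real" where
  "tint a b f = (LINT z|lborel. tens a b z * f z)"

lemma tens_bounded:
  assumes "tst l1 u1 a" "tst l2 u2 b"
  shows "\<exists>B. \<forall>z. \<bar>tens a b z\<bar> \<le> B"
proof -
  obtain A B where "\<And>x. \<bar>a x\<bar> \<le> A" "\<And>x. \<bar>b x\<bar> \<le> B"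
    using tst_bounded[OF assms(1)] tst_bounded[OF assms(2)] by blast
  then have "\<bar>tens a b z\<bar> \<le> A * B" for z
    unfolding tens_def abs_mult by (intro mult_mono) (auto intro: order_trans[OF abs_ge_zero])
  then show ?thesis by blast
qed

lemma tens_integrable:
  fixes f :: "point \<Rightarrow> real"
  assumes "tst l1 u1 a" "tst l2 u2 b" "cbox (l1, l2) (u1, u2) \<subseteq> U"
    "integrable lborel (\<lambda>z. indicator U z * f z)"
  shows "integrable lborel (\<lambda>z. tens a b z * f z)"
proof -
  obtain B where B: "\<And>z. \<bar>tens a b z\<bar> \<le> B" using tens_bounded[OF assms(1,2)] by blast
  have eq: "tens a b z * f z = tens a b z * (indicator U z * f z)" for z
  proof -
    have "z \<in> U" if "tens a b z \<noteq> 0"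
      using tens_support[OF assms(1,2) that] assms(3) by blast
    then show ?thesis by (auto simp: indicator_def)
  qed
  have [measurable]: "tens a b \<in> borel_measurable borel"
    using assms by (intro tens_measurable tst_smooth)
  note [measurable] = borel_measurable_integrable[OF assms(4)]
  have "integrable lborel (\<lambda>z. B * (indicator U z * f z))" using assms(4) by simp
  then show ?thesis
    unfolding eq
  proof (rule Bochner_Integration.integrable_bound)
    show "AE z in lborel. norm (tens a b z * (indicator U z * f z)) \<le> norm (B * (indicator U z * f z))"
      unfolding norm_mult using B by (intro AE_I2 mult_right_mono) (auto intro: order_trans[OF B abs_ge_self])
  qed measurable
qed

lemma has_weak_deriv_tint:
  fixes f g :: "point \<Rightarrow> real"
  assumes "has_weak_deriv U \<alpha> f g" and U: "U \<in> sets borel"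
    and ab: "tst l1 u1 a" "tst l2 u2 b" "cbox (l1, l2) (u1, u2) \<subseteq> U"
  shows "tint ((deriv ^^ fst \<alpha>) a) ((deriv ^^ snd \<alpha>) b) f = (-1) ^ (fst \<alpha> + snd \<alpha>) * tint a b g"
proof -
  have ext: "(LINT x|meas_on U. tens c d x * h x) = tint c d h" if "tst l1 u1 c" "tst l2 u2 d" for c d h
  proof -
    have "z \<in> U" if "tens c d z \<noteq> 0" for z
      using tens_support[OF \<open>tst l1 u1 c\<close> \<open>tst l2 u2 d\<close> that] ab(3) by blast
    then have eq: "indicator U z *\<^sub>R (tens c d z * h z) = tens c d z * h z" for z
      by (cases "z \<in> U"; cases "tens c d z = 0") simp_all
    have "(LINT x|meas_on U. tens c d x * h x) = (LINT x|lborel. indicator U x *\<^sub>R (tens c d x * h x))"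
      using U by (intro integral_restrict_space) auto
    then show ?thesis unfolding tint_def eq .
  qed
  have "(LINT x|meas_on U. partial \<alpha> (tens a b) x *\<^sub>R f x)
        = (- 1) ^ (fst \<alpha> + snd \<alpha>) *\<^sub>R (LINT x|meas_on U. tens a b x *\<^sub>R g x)"
    using assms(1) test_function_tens[OF ab] unfolding has_weak_deriv_def by blast
  then show ?thesis
    unfolding partial_tens[OF tst_smooth[OF ab(1)] tst_smooth[OF ab(2)]] real_scaleR_def
    using ext ab tst_funpow_deriv by simp
qed

section \<open>Positivity tested on tensor products\<close>

lemma rect_borel [measurable]:
  "A \<in> sets borel \<Longrightarrow> B \<in> sets borel \<Longrightarrow> A \<times> B \<in> sets (borel :: point measure)"
  unfolding borel_prod[symmetric] by auto

lemma bump_indicator_tendsto: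
  obtains a :: "nat \<Rightarrow> real \<Rightarrow> real"
  where "\<And>i. tst (c + 1 / Suc i) (d - 1 / Suc i) (a i)" "\<And>i x. 0 \<le> a i x" "\<And>i x. a i x \<le> 1"
    "\<And>x. (\<lambda>i. a i x) \<longlonglongrightarrow> indicator {c<..<d} x"
proof -
  \<comment> \<open>The first factor vanishes up to c + 1/(i+1) and equals 1 from c + 2/(i+1) on;
    the second mirrors this at d. The support thus keeps away from the endpoints, so closed boxes
    built from it fit into the open rectangle.\<close>
  define a where "a i x = step (real (Suc i) * x + (- real (Suc i) * c - 1))
      * step (- real (Suc i) * x + (real (Suc i) * d - 1))" for i x
  have tst: "tst (c + 1 / Suc i) (d - 1 / Suc i) (a i)" for i
    unfolding tst_def
  proof (intro conjI allI impI)
    show "smooth (a i)" unfolding a_def by (intro smooth_mult smooth_affine step_smooth)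
    fix x assume "a i x \<noteq> 0"
    then have "real (Suc i) * x + (- real (Suc i) * c - 1) > 0" "- real (Suc i) * x + (real (Suc i) * d - 1) > 0"
      using step_0[of "real (Suc i) * x + (- real (Suc i) * c - 1)"]
        step_0[of "- real (Suc i) * x + (real (Suc i) * d - 1)"] unfolding a_def by fastforce+
    then show "c + 1 / Suc i \<le> x" "x \<le> d - 1 / Suc i"
      by (simp_all add: field_simps)
  qed
  have lim: "(\<lambda>i. a i x) \<longlonglongrightarrow> indicator {c<..<d} x" for x
  proof (cases "x \<in> {c<..<d}")
    case True
    then obtain N where N: "real N > 2 / (x - c)" "real N > 2 / (d - x)"
      using reals_Archimedean2[of "max (2 / (x - c)) (2 / (d - x))"] by auto
    have "\<forall>\<^sub>F i in sequentially. a i x = 1"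
    proof (rule eventually_sequentiallyI[of N])
      fix i assume "N \<le> i"
      then have i: "real (Suc i) > 2 / (x - c)" "real (Suc i) > 2 / (d - x)" using N by linarith+
      then have "2 < real (Suc i) * (x - c)" "2 < real (Suc i) * (d - x)"
        using True by (simp_all add: divide_less_eq)
      then have "real (Suc i) * x + (- real (Suc i) * c - 1) \<ge> 1" "- real (Suc i) * x + (real (Suc i) * d - 1) \<ge> 1"
        by (simp_all add: algebra_simps)
      then show "a i x = 1" unfolding a_def using step_1 by simp
    qed
    then show ?thesis using True by (simp add: tendsto_eventually)
  next
    case False
    have "a i x = 0" for i
    proof (rule ccontr)
      assume "a i x \<noteq> 0"
      then have "c + 1 / Suc i \<le> x" "x \<le> d - 1 / Suc i" using tst[of i] by (auto simp: tst_def)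
      moreover have "0 < 1 / real (Suc i)" by simp
      ultimately have "c < x" "x < d" by linarith+
      with False show False by simp
    qed
    then show ?thesis using False by simp
  qed
  show ?thesis
    by (rule that[OF tst _ _ lim]) (auto simp: a_def step_nonneg step_le_1 mult_le_one)
qed

lemma tint_indicator_nonneg:
  fixes h :: "point \<Rightarrow> real"
  assumes h: "integrable lborel h"
    and U: "{s1<..<t1} \<times> {s2<..<t2} \<subseteq> U"
    and pos: "\<And>a b l1 u1 l2 u2. tst l1 u1 a \<Longrightarrow> tst l2 u2 b \<Longrightarrow> cbox (l1, l2) (u1, u2) \<subseteq> U \<Longrightarrow>
      (\<And>x. 0 \<le> a x) \<Longrightarrow> (\<And>x. 0 \<le> b x) \<Longrightarrow> 0 \<le> tint a b h"
  shows "0 \<le> (LINT z|lborel. indicator ({s1<..<t1} \<times> {s2<..<t2}) z * h z)"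
proof -
  obtain a where a: "\<And>i. tst (s1 + 1 / Suc i) (t1 - 1 / Suc i) (a i)" "\<And>i x. 0 \<le> a i x" "\<And>i x. a i x \<le> 1"
    "\<And>x. (\<lambda>i. a i x) \<longlonglongrightarrow> indicator {s1<..<t1} x" using bump_indicator_tendsto[of s1 t1] by metis
  obtain b where b: "\<And>i. tst (s2 + 1 / Suc i) (t2 - 1 / Suc i) (b i)" "\<And>i x. 0 \<le> b i x" "\<And>i x. b i x \<le> 1"
    "\<And>x. (\<lambda>i. b i x) \<longlonglongrightarrow> indicator {s2<..<t2} x" using bump_indicator_tendsto[of s2 t2] by metis
  note [measurable] = borel_measurable_integrable[OF h]
  have [measurable]: "tens (a i) (b i) \<in> borel_measurable borel" for i
    using a(1) b(1) by (intro tens_measurable tst_smooth)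
  have "(\<lambda>i. tint (a i) (b i) h) \<longlonglongrightarrow> (LINT z|lborel. indicator ({s1<..<t1} \<times> {s2<..<t2}) z * h z)"
    unfolding tint_def
  proof (rule integral_dominated_convergence[where w="\<lambda>z. \<bar>h z\<bar>"])
    show "AE z in lborel. (\<lambda>i. tens (a i) (b i) z * h z) \<longlonglongrightarrow> indicator ({s1<..<t1} \<times> {s2<..<t2}) z * h z"
      using a(4) b(4) by (intro AE_I2) (auto simp: tens_def indicator_times intro!: tendsto_intros)
    show "AE z in lborel. norm (tens (a i) (b i) z * h z) \<le> \<bar>h z\<bar>" for i
      using a(2,3) b(2,3) by (intro AE_I2) (auto simp: tens_def abs_mult intro!: mult_left_le_one_le mult_le_one)
  qed (use h in auto)
  moreover have "0 \<le> tint (a i) (b i) h" for i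
  proof (rule pos[OF a(1) b(1) _ a(2) b(2)])
    have i: "1 / real (Suc i) > 0" by simp
    show "cbox (s1 + 1 / real (Suc i), s2 + 1 / real (Suc i)) (t1 - 1 / real (Suc i), t2 - 1 / real (Suc i)) \<subseteq> U"
    proof (rule subset_trans[OF _ U], rule subsetI)
      fix z assume "z \<in> cbox (s1 + 1 / real (Suc i), s2 + 1 / real (Suc i)) (t1 - 1 / real (Suc i), t2 - 1 / real (Suc i))"
      then have "s1 < fst z" "fst z < t1" "s2 < snd z" "snd z < t2"
        unfolding mem_cbox_point using i by linarith+
      then show "z \<in> {s1<..<t1} \<times> {s2<..<t2}" by (cases z) auto
    qed
  qed
  ultimately show ?thesis using LIMSEQ_le_const by blast
qed

text \<open>Positivity is passed on from products to indicators of open rectangles, then to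
  half-open dyadic cells, to continuous functions with values in [0,1] as limits of step functions,
  and finally to the indicator of {h < 0} as an almost everywhere limit of continuous functions. A
  nonnegative integral of h over {h < 0} makes that set null.\<close>

theorem AE_nonneg_if_tint_nonneg:
  fixes f :: "point \<Rightarrow> real"
  assumes U: "U = {a1<..<b1} \<times> {a2<..<b2}"
    and f: "integrable lborel (\<lambda>z. indicator U z * f z)"
    and pos: "\<And>a b l1 u1 l2 u2. tst l1 u1 a \<Longrightarrow> tst l2 u2 b \<Longrightarrow> cbox (l1, l2) (u1, u2) \<subseteq> U \<Longrightarrow>
      (\<And>x. 0 \<le> a x) \<Longrightarrow> (\<And>x. 0 \<le> b x) \<Longrightarrow> 0 \<le> tint a b f"
  shows "AE z in lborel. z \<in> U \<longrightarrow> 0 \<le> f z"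
proof -
  define h where "h z = indicator U z * f z" for z
  have h: "integrable lborel h" using f by (simp add: h_def[abs_def])
  note [measurable] = borel_measurable_integrable[OF h]
  have U_borel [measurable]: "U \<in> sets borel" unfolding U borel_prod[symmetric] by auto
  have pos_h: "0 \<le> tint a b h" if "tst l1 u1 a" "tst l2 u2 b" "cbox (l1, l2) (u1, u2) \<subseteq> U"
      "\<And>x. 0 \<le> a x" "\<And>x. 0 \<le> b x" for a b l1 u1 l2 u2
  proof -
    have "z \<in> U" if "tens a b z \<noteq> 0" for z
      using tens_support[OF \<open>tst l1 u1 a\<close> \<open>tst l2 u2 b\<close> that] \<open>cbox (l1, l2) (u1, u2) \<subseteq> U\<close> by blast
    then have eq: "tens a b z * h z = tens a b z * f z" for z
      by (cases "z \<in> U"; cases "tens a b z = 0") (simp_all add: h_def)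
    show ?thesis using pos[OF that] unfolding tint_def eq .
  qed
  have rect: "0 \<le> (LINT z|lborel. indicator ({s1<..<t1} \<times> {s2<..<t2}) z * h z)" for s1 t1 s2 t2
  proof -
    \<comment> \<open>Since h vanishes off U, the rectangle can be intersected with U; the result is
      again an open rectangle.\<close>
    have eq: "indicator ({s1<..<t1} \<times> {s2<..<t2}) z * h z
      = indicator ({max s1 a1<..<min t1 b1} \<times> {max s2 a2<..<min t2 b2}) z * h z" for z
      by (auto simp: h_def U indicator_def)
    have sub: "{max s1 a1<..<min t1 b1} \<times> {max s2 a2<..<min t2 b2} \<subseteq> U"
      by (auto simp: U)
    show ?thesis unfolding eq by (rule tint_indicator_nonneg[OF h sub]) (rule pos_h)
  qed
  have halfopen: "0 \<le> (LINT z|lborel. indicator ({s1..<t1} \<times> {s2..<t2}) z * h z)" for s1 t1 s2 t2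
  proof -
    \<comment> \<open>Half-open rectangles are decreasing limits of open ones whose lower and left
      sides are pushed outwards.\<close>
    let ?R = "\<lambda>i. {s1 - 1 / real (Suc i)<..<t1} \<times> {s2 - 1 / real (Suc i)<..<t2}"
    have ind: "(\<lambda>i. indicator {c - 1 / real (Suc i)<..<d} x :: real) \<longlonglongrightarrow> indicator {c..<d} x" for c d x :: real
    proof (cases "c \<le> x")
      case True
      then have "x > c - 1 / real (Suc i)" for i by (smt (verit) divide_pos_pos of_nat_0_less_iff zero_less_Suc)
      then show ?thesis using True by (auto simp: indicator_def)
    next
      case False
      then obtain N where N: "real N > 1 / (c - x)" using reals_Archimedean2 by blast
      have "\<forall>\<^sub>F i in sequentially. indicator {c - 1 / real (Suc i)<..<d} x = (0::real)"
      proof (rule eventually_sequentiallyI[of N])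
        fix i assume "N \<le> i"
        then have "real (Suc i) > 1 / (c - x)" using N by linarith
        then have "c - 1 / real (Suc i) \<ge> x" using False by (simp add: field_simps)
        then show "indicator {c - 1 / real (Suc i)<..<d} x = (0::real)" by (auto simp: indicator_def)
      qed
      then show ?thesis using False by (simp add: tendsto_eventually)
    qed
    have "(\<lambda>i. LINT z|lborel. indicator (?R i) z * h z) \<longlonglongrightarrow> (LINT z|lborel. indicator ({s1..<t1} \<times> {s2..<t2}) z * h z)"
    proof (rule integral_dominated_convergence[where w="\<lambda>z. \<bar>h z\<bar>"])
      show "AE z in lborel. (\<lambda>i. indicator (?R i) z * h z) \<longlonglongrightarrow> indicator ({s1..<t1} \<times> {s2..<t2}) z * h z"
        using ind by (intro AE_I2) (auto simp: indicator_times intro!: tendsto_intros)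
      show "AE z in lborel. norm (indicator (?R i) z * h z) \<le> \<bar>h z\<bar>" for i
        by (intro AE_I2) (auto simp: indicator_def)
    qed (use h in auto)
    then show ?thesis by (rule LIMSEQ_le_const) (use rect in auto)
  qed
  have cell: "0 \<le> (LINT z|lborel. indicator (cell n -` {k}) z * h z)" for n k
    unfolding cell_vimage by (rule halfopen)
  have cont: "0 \<le> (LINT z|lborel. g z * h z)"
    if g: "continuous_on UNIV g" "\<And>z. 0 \<le> g z" "\<And>z. g z \<le> 1" for g :: "point \<Rightarrow> real"
  proof -
    \<comment> \<open>Lower left corner of the dyadic cell of z: g evaluated there is a step
      function, and only finitely many cells meet the bounded set U.\<close>
    let ?y = "\<lambda>n z. (1 / 2 ^ n) *\<^sub>R embed (cell n z)"
    have fin: "finite (cell n ` U)" for n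
    proof (rule finite_subset)
      show "cell n ` U \<subseteq> {\<lfloor>2 ^ n * a1\<rfloor>..\<lfloor>2 ^ n * b1\<rfloor>} \<times> {\<lfloor>2 ^ n * a2\<rfloor>..\<lfloor>2 ^ n * b2\<rfloor>}"
        by (auto simp: U cell_def intro!: floor_mono)
    qed auto
    have eq: "g (?y n z) * h z = (\<Sum>k\<in>cell n ` U. g ((1 / 2 ^ n) *\<^sub>R embed k) * (indicator (cell n -` {k}) z * h z))" for n z
    proof (cases "z \<in> U")
      case True
      have "(\<Sum>k\<in>cell n ` U. g ((1 / 2 ^ n) *\<^sub>R embed k) * (indicator (cell n -` {k}) z * h z))
        = (\<Sum>k\<in>cell n ` U. if k = cell n z then g ((1 / 2 ^ n) *\<^sub>R embed k) * h z else 0)"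
        by (intro sum.cong) (auto simp: indicator_def)
      then show ?thesis using True fin by simp
    qed (simp add: h_def)
    have int: "integrable lborel (\<lambda>z. indicator (cell n -` {k}) z * h z)" for n k
      using integrable_mult_indicator[OF cell_vimage_sets[folded sets_lborel] h] unfolding real_scaleR_def .
    have nn: "0 \<le> (LINT z|lborel. g (?y n z) * h z)" for n
    proof -
      have "(LINT z|lborel. g (?y n z) * h z)
          = (\<Sum>k\<in>cell n ` U. g ((1 / 2 ^ n) *\<^sub>R embed k) * (LINT z|lborel. indicator (cell n -` {k}) z * h z))"
        unfolding eq
        by (subst Bochner_Integration.integral_sum, intro integrable_mult_right int)
           (simp only: integral_mult_right_zero)
      then show ?thesis using cell g(2) by (simp only:) (intro sum_nonneg mult_nonneg_nonneg)
    qed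
    have y: "(\<lambda>n. ?y n z) \<longlonglongrightarrow> z" for z
    proof -
      have 1: "(\<lambda>n. (\<lfloor>2 ^ n * t\<rfloor> :: real) / 2 ^ n) \<longlonglongrightarrow> t" for t :: real
        by (rule floor_dyadic_tendsto)
      have "(\<lambda>n. (\<lfloor>2 ^ n * fst z\<rfloor> / 2 ^ n, \<lfloor>2 ^ n * snd z\<rfloor> / 2 ^ n)) \<longlonglongrightarrow> (fst z, snd z)"
        by (intro tendsto_intros 1)
      then show ?thesis by (simp add: embed_def cell_def)
    qed
    have [measurable]: "(\<lambda>z. g (?y n z) * h z) \<in> borel_measurable borel" for n
      unfolding eq by measurable
    have [measurable]: "g \<in> borel_measurable borel" by (rule borel_measurable_continuous_onI[OF g(1)])
    have "(\<lambda>n. LINT z|lborel. g (?y n z) * h z) \<longlonglongrightarrow> (LINT z|lborel. g z * h z)"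
    proof (rule integral_dominated_convergence[where w="\<lambda>z. \<bar>h z\<bar>"])
      show "AE z in lborel. (\<lambda>n. g (?y n z) * h z) \<longlonglongrightarrow> g z * h z"
        using continuous_on_tendsto_compose[OF g(1) y] by (intro AE_I2 tendsto_intros) auto
      show "AE z in lborel. norm (g (?y n z) * h z) \<le> \<bar>h z\<bar>" for n
        unfolding real_norm_def abs_mult
        by (intro AE_I2 mult_left_le_one_le) (simp_all add: abs_of_nonneg[OF g(2)] g)
    qed (use h in auto)
    then show ?thesis by (rule LIMSEQ_le_const) (use nn in auto)
  qed
  define E where "E = {z. h z < 0}"
  have [measurable]: "E \<in> sets borel" unfolding E_def by measurable
  have "(indicator E :: point \<Rightarrow> real) measurable_on UNIV"
    by (intro lebesgue_measurable_imp_measurable_on measurable_completion) auto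
  then have "\<exists>N g. negligible N \<and> (\<forall>n. continuous_on UNIV (g n)) \<and> (\<forall>x. x \<notin> N \<longrightarrow> (\<lambda>n. g n x) \<longlonglongrightarrow> (indicator E x :: real))"
    unfolding measurable_on_def by simp
  then obtain N g where N: "negligible N" and g: "\<And>n. continuous_on UNIV (g n)"
    and lim: "\<And>x. x \<notin> N \<Longrightarrow> (\<lambda>n. g n x) \<longlonglongrightarrow> (indicator E x :: real)"
    by metis
  have lim_AE: "AE x in lborel. (\<lambda>n. g n x) \<longlonglongrightarrow> (indicator E x :: real)"
  proof -
    have [measurable]: "g n \<in> borel_measurable borel" for n
      by (rule borel_measurable_continuous_onI[OF g])
    have "AE x in lebesgue. x \<notin> N" using N by (simp add: negligible_iff_null_sets AE_not_in)
    then have "AE x in lebesgue. (\<lambda>n. g n x) \<longlonglongrightarrow> (indicator E x :: real)" by eventually_elim (rule lim)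
    then show ?thesis by (simp add: AE_completion_iff)
  qed
  \<comment> \<open>Clipping to [0,1] keeps the approximations continuous, makes |h| a majorant, and
    leaves the limit unchanged because an indicator takes only the values 0 and 1.\<close>
  let ?g = "\<lambda>n x. max 0 (min 1 (g n x))"
  have [measurable]: "?g n \<in> borel_measurable borel" for n
    using borel_measurable_continuous_onI[OF g[of n]] by measurable
  have "(\<lambda>n. LINT z|lborel. ?g n z * h z) \<longlonglongrightarrow> (LINT z|lborel. indicator E z * h z)"
  proof (rule integral_dominated_convergence[where w="\<lambda>z. \<bar>h z\<bar>"])
    show "AE z in lborel. (\<lambda>n. ?g n z * h z) \<longlonglongrightarrow> indicator E z * h z"
      using lim_AE
    proof eventually_elim
      case (elim z)
      have "(\<lambda>n. ?g n z) \<longlonglongrightarrow> max 0 (min 1 (indicator E z))"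
        by (intro tendsto_intros elim)
      then show ?case by (intro tendsto_intros) (auto simp: indicator_def split: if_splits)
    qed
    show "AE z in lborel. norm (?g n z * h z) \<le> \<bar>h z\<bar>" for n
      by (intro AE_I2) (auto simp: abs_mult intro!: mult_left_le_one_le)
  qed (use h in auto)
  then have ge: "0 \<le> (LINT z|lborel. indicator E z * h z)"
    by (rule LIMSEQ_le_const) (auto intro!: cont continuous_on_max continuous_on_min g continuous_on_const)
  have hE: "integrable lborel (\<lambda>z. - (indicator E z * h z))"
    by (rule Bochner_Integration.integrable_bound[OF h]) (auto simp: indicator_def)
  have "(LINT z|lborel. - (indicator E z * h z)) = 0"
    using ge by (intro antisym Bochner_Integration.integral_nonneg) (auto simp: E_def indicator_def)
  then have "AE z in lborel. - (indicator E z * h z) = 0"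
    using hE by (subst (asm) integral_nonneg_eq_0_iff_AE) (auto simp: E_def indicator_def)
  then show ?thesis
    by eventually_elim (auto simp: E_def h_def indicator_def not_less split: if_splits)
qed

section \<open>Weak derivatives on the unit square\<close>

lemma measurable_fst_borel [measurable]: "(fst :: point \<Rightarrow> real) \<in> borel_measurable borel"
  and measurable_snd_borel [measurable]: "(snd :: point \<Rightarrow> real) \<in> borel_measurable borel"
  by (intro borel_measurable_continuous_onI continuous_intros)+

lemma C_all_dx: "(\<And>k. C_k k f) \<Longrightarrow> C_k k (dx f)" and C_all_dy: "(\<And>k. C_k k f) \<Longrightarrow> C_k k (dy f)"
  by (metis C_k.simps(2))+

lemma C_all_partial: "(\<And>k. C_k k f) \<Longrightarrow> C_k k (partial \<alpha> f)"
proof -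
  assume f: "\<And>k. C_k k f"
  have "C_k k ((dy ^^ r) f)" for k r
    by (induction r arbitrary: k) (auto intro: f C_all_dy)
  then have "C_k k ((dx ^^ r) ((dy ^^ r') f))" for k r r'
    by (induction r arbitrary: k) (auto intro: C_all_dx)
  then show ?thesis by (simp add: partial_def)
qed

lemma dx_zero_open:
  assumes "open S" "\<And>z. z \<in> S \<Longrightarrow> f z = 0" "z \<in> S"
  shows "dx f z = 0" "dy f z = 0"
proof -
  obtain x y where z: "z = (x, y)" by (cases z)
  have "deriv (\<lambda>t. f (t, y)) x = deriv (\<lambda>t. 0) x"
  proof (rule deriv_cong_open[where S="(\<lambda>t. (t, y)) -` S"])
    show "open ((\<lambda>t. (t, y)) -` S)" by (intro open_vimage assms continuous_intros)
  qed (use assms z in auto)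
  then show "dx f z = 0" by (simp add: dx_def z)
  have "deriv (\<lambda>t. f (x, t)) y = deriv (\<lambda>t. 0) y"
  proof (rule deriv_cong_open[where S="(\<lambda>t. (x, t)) -` S"])
    show "open ((\<lambda>t. (x, t)) -` S)" by (intro open_vimage assms continuous_intros)
  qed (use assms z in auto)
  then show "dy f z = 0" by (simp add: dy_def z)
qed

lemma partial_zero_open:
  assumes "open S" "\<And>z. z \<in> S \<Longrightarrow> f z = 0" "z \<in> S"
  shows "partial \<alpha> f z = 0"
proof -
  have "(dy ^^ r) f z = 0" if "z \<in> S" for z r
    using that by (induction r arbitrary: z) (auto intro: assms dx_zero_open(2)[OF assms(1)])
  then have "(dx ^^ r) ((dy ^^ r') f) z = 0" if "z \<in> S" for z r r'
    using that by (induction r arbitrary: z) (auto intro: dx_zero_open(1)[OF assms(1)])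
  then show ?thesis using assms(3) by (simp add: partial_def)
qed

text \<open>Integrals of sums and of inner products may be split only for integrable functions. Here
  a partial derivative of the test function is continuous, hence bounded on the compact support, and
  it vanishes off that support.\<close>

lemma test_function_integrable:
  fixes f :: "point \<Rightarrow> 'a::euclidean_space"
  assumes \<eta>: "test_function U \<eta>" and f: "locally_integrable U f" and U: "U \<in> sets borel"
  shows "integrable (meas_on U) (\<lambda>x. partial \<alpha> \<eta> x *\<^sub>R f x)"
proof -
  let ?K = "closure {x. \<eta> x \<noteq> 0}"
  have K: "compact ?K" "?K \<subseteq> U" using \<eta> by (auto simp: test_function_def)
  have cont: "continuous_on UNIV (partial \<alpha> \<eta>)"
    using C_all_partial[of \<eta> 0 \<alpha>] \<eta> by (auto simp: test_function_def)
  have [measurable]: "partial \<alpha> \<eta> \<in> borel_measurable borel" by (rule borel_measurable_continuous_onI[OF cont])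
  have zero: "partial \<alpha> \<eta> x = 0" if "x \<notin> ?K" for x
  proof (rule partial_zero_open[where S="- ?K"])
    show "\<eta> z = 0" if "z \<in> - ?K" for z using that closure_subset[of "{x. \<eta> x \<noteq> 0}"] by auto
  qed (use that in auto)
  have "bounded (partial \<alpha> \<eta> ` ?K)"
    using K cont by (intro compact_imp_bounded compact_continuous_image continuous_on_subset[OF cont]) auto
  then obtain B where B: "\<And>x. x \<in> ?K \<Longrightarrow> \<bar>partial \<alpha> \<eta> x\<bar> \<le> B"
    unfolding bounded_iff by (metis imageI real_norm_def)
  have fK: "integrable lborel (\<lambda>x. indicator ?K x *\<^sub>R f x)"
    using f K unfolding locally_integrable_def set_integrable_def by auto
  note [measurable] = borel_measurable_integrable[OF fK]
  have eq: "indicator U x *\<^sub>R (partial \<alpha> \<eta> x *\<^sub>R f x) = partial \<alpha> \<eta> x *\<^sub>R (indicator ?K x *\<^sub>R f x)" for x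
    using zero[of x] K(2) by (cases "x \<in> ?K") auto
  have "integrable lborel (\<lambda>x. B *\<^sub>R (indicator ?K x *\<^sub>R f x))" by (rule integrable_scaleR_right) (rule fK)
  then have "integrable lborel (\<lambda>x. indicator U x *\<^sub>R (partial \<alpha> \<eta> x *\<^sub>R f x))"
    unfolding eq
  proof (rule Bochner_Integration.integrable_bound)
    show "AE x in lborel. norm (partial \<alpha> \<eta> x *\<^sub>R (indicator ?K x *\<^sub>R f x)) \<le> norm (B *\<^sub>R (indicator ?K x *\<^sub>R f x))"
    proof (rule AE_I2)
      fix x
      show "norm (partial \<alpha> \<eta> x *\<^sub>R (indicator ?K x *\<^sub>R f x)) \<le> norm (B *\<^sub>R (indicator ?K x *\<^sub>R f x))"
      proof (cases "x \<in> ?K")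
        case True
        have "\<bar>partial \<alpha> \<eta> x\<bar> \<le> \<bar>B\<bar>" using B[OF True] by linarith
        then show ?thesis unfolding norm_scaleR by (rule mult_right_mono) simp
      qed simp
    qed
  qed measurable
  then show ?thesis using U by (simp add: integrable_restrict_space)
qed

lemma partial_0: "partial (0, 0) f = f"
  by (simp add: partial_def)

lemma test_function_integrable0:
  fixes f :: "point \<Rightarrow> 'a::euclidean_space"
  assumes "test_function U \<eta>" "locally_integrable U f" "U \<in> sets borel"
  shows "integrable (meas_on U) (\<lambda>x. \<eta> x *\<^sub>R f x)"
  using test_function_integrable[OF assms, of "(0, 0)"] by (simp add: partial_0)

lemma locally_integrable_inner:
  "locally_integrable U f \<Longrightarrow> locally_integrable U (\<lambda>x. f x \<bullet> b)"
  unfolding locally_integrable_def set_integrable_def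
  by (auto dest!: spec intro: integrable_inner_left simp flip: inner_scaleR_left)

lemma has_weak_deriv_inner:
  fixes f g :: "point \<Rightarrow> 'a::euclidean_space"
  assumes fg: "has_weak_deriv U \<alpha> f g" and U: "U \<in> sets borel"
  shows "has_weak_deriv U \<alpha> (\<lambda>x. f x \<bullet> b) (\<lambda>x. g x \<bullet> b)"
  unfolding has_weak_deriv_def
proof (intro conjI allI impI)
  have li: "locally_integrable U f" "locally_integrable U g" using fg by (auto simp: has_weak_deriv_def)
  then show "locally_integrable U (\<lambda>x. f x \<bullet> b)" "locally_integrable U (\<lambda>x. g x \<bullet> b)"
    by (auto intro: locally_integrable_inner)
  fix \<eta> assume \<eta>: "test_function U \<eta>"
  have "(LINT x|meas_on U. partial \<alpha> \<eta> x *\<^sub>R f x) \<bullet> b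
      = ((- 1) ^ (fst \<alpha> + snd \<alpha>) *\<^sub>R (LINT x|meas_on U. \<eta> x *\<^sub>R g x)) \<bullet> b"
    using fg \<eta> by (auto simp: has_weak_deriv_def)
  then show "(LINT x|meas_on U. partial \<alpha> \<eta> x *\<^sub>R (f x \<bullet> b)) = (- 1) ^ (fst \<alpha> + snd \<alpha>) *\<^sub>R (LINT x|meas_on U. \<eta> x *\<^sub>R (g x \<bullet> b))"
    using integral_inner_left[where c=b, OF test_function_integrable[OF \<eta> li(1) U, of \<alpha>]]
      integral_inner_left[where c=b, OF test_function_integrable0[OF \<eta> li(2) U]]
    by simp
qed

lemma locally_integrable_diff:
  "locally_integrable U f \<Longrightarrow> locally_integrable U g \<Longrightarrow> locally_integrable U (\<lambda>x. f x - g x)"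
  unfolding locally_integrable_def by (auto intro: set_integral_diff)

lemma has_weak_deriv_diff:
  fixes f g f' g' :: "point \<Rightarrow> 'a::euclidean_space"
  assumes fg: "has_weak_deriv U \<alpha> f g" "has_weak_deriv U \<alpha> f' g'" and U: "U \<in> sets borel"
  shows "has_weak_deriv U \<alpha> (\<lambda>x. f x - f' x) (\<lambda>x. g x - g' x)"
  unfolding has_weak_deriv_def
proof (intro conjI allI impI)
  have li: "locally_integrable U f" "locally_integrable U g" "locally_integrable U f'" "locally_integrable U g'"
    using fg by (auto simp: has_weak_deriv_def)
  then show "locally_integrable U (\<lambda>x. f x - f' x)" "locally_integrable U (\<lambda>x. g x - g' x)"
    by (auto intro: locally_integrable_diff)
  fix \<eta> assume \<eta>: "test_function U \<eta>"
  then have "(LINT x|meas_on U. partial \<alpha> \<eta> x *\<^sub>R f x) = (- 1) ^ (fst \<alpha> + snd \<alpha>) *\<^sub>R (LINT x|meas_on U. \<eta> x *\<^sub>R g x)"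
    "(LINT x|meas_on U. partial \<alpha> \<eta> x *\<^sub>R f' x) = (- 1) ^ (fst \<alpha> + snd \<alpha>) *\<^sub>R (LINT x|meas_on U. \<eta> x *\<^sub>R g' x)"
    using fg by (auto simp: has_weak_deriv_def)
  moreover have "(LINT x|meas_on U. partial \<alpha> \<eta> x *\<^sub>R (f x - f' x))
      = (LINT x|meas_on U. partial \<alpha> \<eta> x *\<^sub>R f x) - (LINT x|meas_on U. partial \<alpha> \<eta> x *\<^sub>R f' x)"
    unfolding scaleR_diff_right
    by (rule Bochner_Integration.integral_diff) (intro test_function_integrable[OF \<eta>] li U)+
  moreover have "(LINT x|meas_on U. \<eta> x *\<^sub>R (g x - g' x))
      = (LINT x|meas_on U. \<eta> x *\<^sub>R g x) - (LINT x|meas_on U. \<eta> x *\<^sub>R g' x)"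
    unfolding scaleR_diff_right
    by (rule Bochner_Integration.integral_diff) (intro test_function_integrable0[OF \<eta>] li U)+
  ultimately show "(LINT x|meas_on U. partial \<alpha> \<eta> x *\<^sub>R (f x - f' x)) = (- 1) ^ (fst \<alpha> + snd \<alpha>) *\<^sub>R (LINT x|meas_on U. \<eta> x *\<^sub>R (g x - g' x))"
    by (simp add: scaleR_diff_right)
qed

text \<open>Open squares exhausting \<open>Omega\<close>, each inside a compact square of
  \<open>Omega\<close>. A locally integrable function is integrable on each of them, so the
  positivity theorem applies there.\<close>

definition shrunk :: "nat \<Rightarrow> point set" where
  "shrunk n = {1 / real (Suc n)<..<1 - 1 / real (Suc n)} \<times> {1 / real (Suc n)<..<1 - 1 / real (Suc n)}"

lemma shrunk_borel [measurable]: "shrunk n \<in> sets borel"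
  unfolding shrunk_def by (rule rect_borel) auto

lemma shrunk_subset_cbox:
  "shrunk n \<subseteq> cbox (1 / real (Suc n), 1 / real (Suc n)) (1 - 1 / real (Suc n), 1 - 1 / real (Suc n))"
  by (auto simp: shrunk_def mem_cbox_point)

lemma cbox_shrunk_subset: "cbox (1 / real (Suc n), 1 / real (Suc n)) (1 - 1 / real (Suc n), 1 - 1 / real (Suc n)) \<subseteq> Omega"
proof
  fix z assume z: "z \<in> cbox (1 / real (Suc n), 1 / real (Suc n)) (1 - 1 / real (Suc n), 1 - 1 / real (Suc n))"
  have "0 < 1 / real (Suc n)" by simp
  with z have "0 < fst z" "fst z < 1" "0 < snd z" "snd z < 1" unfolding mem_cbox_point by linarith+
  then show "z \<in> Omega" by (cases z) (auto simp: Omega_def)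
qed

lemma shrunk_subset: "shrunk n \<subseteq> Omega"
  using shrunk_subset_cbox cbox_shrunk_subset by blast

lemma eventually_shrunk:
  assumes "z \<in> Omega"
  shows "\<forall>\<^sub>F n in sequentially. z \<in> shrunk n"
proof -
  have z: "0 < fst z" "fst z < 1" "0 < snd z" "snd z < 1" using assms by (auto simp: Omega_def)
  have "(\<lambda>n. 1 / real (Suc n)) \<longlonglongrightarrow> 0" using LIMSEQ_inverse_real_of_nat by (simp add: inverse_eq_divide)
  moreover define d where "d = min (min (fst z) (1 - fst z)) (min (snd z) (1 - snd z))"
  moreover have "0 < d" using z by (auto simp: d_def)
  ultimately have "\<forall>\<^sub>F n in sequentially. 1 / real (Suc n) < d" by (intro order_tendstoD)
  then show ?thesis
    by eventually_elim (cases z, auto simp: shrunk_def d_def)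
qed

lemma locally_integrable_shrunk:
  fixes f :: "point \<Rightarrow> 'a::euclidean_space"
  assumes "locally_integrable Omega f"
  shows "integrable lborel (\<lambda>z. indicator (shrunk n) z *\<^sub>R f z)"
proof -
  let ?K = "cbox (1 / real (Suc n), 1 / real (Suc n)) (1 - 1 / real (Suc n), 1 - 1 / real (Suc n)) :: point set"
  have i: "integrable lborel (\<lambda>z. indicator ?K z *\<^sub>R f z)"
    using assms cbox_shrunk_subset unfolding locally_integrable_def set_integrable_def by auto
  have "integrable lborel (\<lambda>z. indicator (shrunk n) z *\<^sub>R (indicator ?K z *\<^sub>R f z))"
    by (rule integrable_mult_indicator[OF _ i]) simp
  moreover have "indicator (shrunk n) z *\<^sub>R (indicator ?K z *\<^sub>R f z) = indicator (shrunk n) z *\<^sub>R f z" for z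
    using subsetD[OF shrunk_subset_cbox[of n], of z] by (cases "z \<in> shrunk n") (simp_all del: of_nat_Suc)
  ultimately show ?thesis by (simp only:)
qed

text \<open>Local integrability yields measurability only after restriction to compact sets; the
  exhaustion carries it to the whole square.\<close>

lemma locally_integrable_measurable:
  fixes f :: "point \<Rightarrow> 'a::euclidean_space"
  assumes "locally_integrable Omega f"
  shows "(\<lambda>z. indicator Omega z *\<^sub>R f z) \<in> borel_measurable borel" "f \<in> borel_measurable (meas_on Omega)"
proof -
  have "(\<lambda>n. indicator (shrunk n) z *\<^sub>R f z) \<longlonglongrightarrow> indicator Omega z *\<^sub>R f z" for z
  proof (cases "z \<in> Omega")
    case True
    have "\<forall>\<^sub>F n in sequentially. indicator (shrunk n) z *\<^sub>R f z = indicator Omega z *\<^sub>R f z"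
      using eventually_shrunk[OF True] by eventually_elim (use True in simp)
    then show ?thesis by (rule tendsto_eventually)
  next
    case False
    then have "z \<notin> shrunk n" for n using shrunk_subset by blast
    with False show ?thesis by simp
  qed
  then show *: "(\<lambda>z. indicator Omega z *\<^sub>R f z) \<in> borel_measurable borel"
    using borel_measurable_integrable[OF locally_integrable_shrunk[OF assms]]
    by (rule_tac borel_measurable_LIMSEQ_metric[where f="\<lambda>n z. indicator (shrunk n) z *\<^sub>R f z"]) auto
  then show "f \<in> borel_measurable (meas_on Omega)"
    by (subst borel_measurable_restrict_space_iff) auto
qed

text \<open>Positivity is applied to f - g and to g - f on each square of the exhaustion; countably
  many null sets are collected.\<close>

lemma AE_Omega_eq_if_tint_eq:
  fixes f g :: "point \<Rightarrow> real"
  assumes li: "locally_integrable Omega f" "locally_integrable Omega g"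
    and eq: "\<And>a b l1 u1 l2 u2. tst l1 u1 a \<Longrightarrow> tst l2 u2 b \<Longrightarrow> cbox (l1, l2) (u1, u2) \<subseteq> Omega \<Longrightarrow>
      tint a b f = tint a b g"
  shows "AE z in lborel. z \<in> Omega \<longrightarrow> f z = g z"
proof -
  have le: "AE z in lborel. z \<in> shrunk n \<longrightarrow> 0 \<le> f z - g z"
    if li: "locally_integrable Omega f" "locally_integrable Omega g"
    and eq: "\<And>a b l1 u1 l2 u2. tst l1 u1 a \<Longrightarrow> tst l2 u2 b \<Longrightarrow> cbox (l1, l2) (u1, u2) \<subseteq> Omega \<Longrightarrow>
      tint a b f = tint a b g" for n and f g :: "point \<Rightarrow> real"
  proof (rule AE_nonneg_if_tint_nonneg[OF shrunk_def])
    have i: "integrable lborel (\<lambda>z. indicator (shrunk n) z * f z)" "integrable lborel (\<lambda>z. indicator (shrunk n) z * g z)"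
      using li locally_integrable_shrunk by fastforce+
    then show "integrable lborel (\<lambda>z. indicator (shrunk n) z * (f z - g z))"
      by (simp add: right_diff_distrib)
    fix a b l1 u1 l2 u2 assume t: "tst l1 u1 a" "tst l2 u2 b" "cbox (l1, l2) (u1, u2) \<subseteq> shrunk n"
    have "tint a b (\<lambda>z. f z - g z) = tint a b f - tint a b g"
      using tens_integrable[OF t i(1)] tens_integrable[OF t i(2)]
      by (simp add: tint_def right_diff_distrib)
    then show "0 \<le> tint a b (\<lambda>z. f z - g z)"
      using eq[OF t(1,2)] t(3) shrunk_subset[of n] by auto
  qed
  have "AE z in lborel. \<forall>n. (z \<in> shrunk n \<longrightarrow> 0 \<le> f z - g z) \<and> (z \<in> shrunk n \<longrightarrow> 0 \<le> g z - f z)"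
    using le[OF li eq] le[OF li(2,1) eq[symmetric]] by (auto simp: AE_all_countable)
  then show ?thesis
  proof eventually_elim
    case (elim z)
    show ?case
    proof
      assume "z \<in> Omega"
      then obtain n where "z \<in> shrunk n"
        using eventually_shrunk by (meson eventually_sequentially order_refl)
      with elim show "f z = g z" by force
    qed
  qed
qed

lemma has_weak_deriv_locally_integrable:
  "has_weak_deriv U \<alpha> f g \<Longrightarrow> locally_integrable U f" "has_weak_deriv U \<alpha> f g \<Longrightarrow> locally_integrable U g"
  by (auto simp: has_weak_deriv_def)

lemma weak_deriv_unique_real:
  fixes f g g' :: "point \<Rightarrow> real"
  assumes "has_weak_deriv Omega \<alpha> f g" "has_weak_deriv Omega \<alpha> f g'"
  shows "AE z in lborel. z \<in> Omega \<longrightarrow> g z = g' z"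
proof (rule AE_Omega_eq_if_tint_eq)
  fix a b l1 u1 l2 u2 assume t: "tst l1 u1 a" "tst l2 u2 b" "cbox (l1, l2) (u1, u2) \<subseteq> Omega"
  show "tint a b g = tint a b g'"
    using has_weak_deriv_tint[OF assms(1) Omega_borel t] has_weak_deriv_tint[OF assms(2) Omega_borel t] by simp
qed (use assms has_weak_deriv_locally_integrable in blast)+

lemma weak_deriv_unique:
  fixes f g g' :: "point \<Rightarrow> 'a::euclidean_space"
  assumes "has_weak_deriv Omega \<alpha> f g" "has_weak_deriv Omega \<alpha> f g'"
  shows "AE z in lborel. z \<in> Omega \<longrightarrow> g z = g' z"
proof -
  have "AE z in lborel. \<forall>b\<in>Basis. z \<in> Omega \<longrightarrow> g z \<bullet> b = g' z \<bullet> b"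
    using weak_deriv_unique_real[OF has_weak_deriv_inner[OF assms(1) Omega_borel] has_weak_deriv_inner[OF assms(2) Omega_borel]]
    by (intro AE_finite_allI) auto
  then show ?thesis by eventually_elim (auto intro: euclidean_eqI)
qed

lemma AE_meas_on_Omega: "(AE z in meas_on Omega. P z) \<longleftrightarrow> (AE z in lborel. z \<in> Omega \<longrightarrow> P z)"
  by (subst AE_restrict_space_iff) auto

text \<open>The derivative picked by \<open>SOME\<close> need not be the p-integrable one granted by
  membership in the space; uniqueness almost everywhere makes it p-integrable as well.\<close>

lemma sobolev_weak_deriv:
  fixes u :: "point \<Rightarrow> 'a::euclidean_space"
  assumes u: "u \<in> sobolev Omega r p" and \<alpha>: "fst \<alpha> + snd \<alpha> \<le> r"
  shows "has_weak_deriv Omega \<alpha> u (weak_deriv Omega \<alpha> u)" "weak_deriv Omega \<alpha> u \<in> LpM (meas_on Omega) p"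
proof -
  obtain g where g: "g \<in> LpM (meas_on Omega) p" "has_weak_deriv Omega \<alpha> u g"
    using u \<alpha> unfolding sobolev_def Lp_eq_LpM by blast
  show *: "has_weak_deriv Omega \<alpha> u (weak_deriv Omega \<alpha> u)"
    unfolding weak_deriv_def by (rule someI[of _ g]) (rule g)
  show "weak_deriv Omega \<alpha> u \<in> LpM (meas_on Omega) p"
    using locally_integrable_measurable(2)[OF has_weak_deriv_locally_integrable(2)[OF *]] weak_deriv_unique[OF g(2) *]
    by (intro LpM_cong_AE[OF g(1)]) (auto simp: AE_meas_on_Omega)
qed

lemma sobolev_diff:
  fixes u v :: "point \<Rightarrow> 'a::euclidean_space"
  assumes u: "u \<in> sobolev Omega r p" and v: "v \<in> sobolev Omega r p" and p: "1 \<le> p"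
  shows "(\<lambda>x. u x - v x) \<in> sobolev Omega r p"
  unfolding sobolev_def Lp_eq_LpM
proof (intro CollectI conjI allI impI)
  show "(\<lambda>x. u x - v x) \<in> LpM (meas_on Omega) p"
    using u v p by (intro LpM_diff) (auto simp: sobolev_def Lp_eq_LpM)
  fix \<alpha> :: "nat \<times> nat" assume \<alpha>: "fst \<alpha> + snd \<alpha> \<le> r"
  show "\<exists>g\<in>LpM (meas_on Omega) p. has_weak_deriv Omega \<alpha> (\<lambda>x. u x - v x) g"
  proof (rule bexI)
    show "has_weak_deriv Omega \<alpha> (\<lambda>x. u x - v x) (\<lambda>x. weak_deriv Omega \<alpha> u x - weak_deriv Omega \<alpha> v x)"
      by (rule has_weak_deriv_diff[OF sobolev_weak_deriv(1)[OF u \<alpha>] sobolev_weak_deriv(1)[OF v \<alpha>] Omega_borel])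
    show "(\<lambda>x. weak_deriv Omega \<alpha> u x - weak_deriv Omega \<alpha> v x) \<in> LpM (meas_on Omega) p"
      by (intro LpM_diff sobolev_weak_deriv(2)[OF u \<alpha>] sobolev_weak_deriv(2)[OF v \<alpha>] p)
  qed
qed

lemma finite_multi_indices: "finite {\<alpha>::nat \<times> nat. fst \<alpha> + snd \<alpha> \<le> r}"
  by (rule finite_subset[of _ "{..r} \<times> {..r}"]) auto

lemma LpN_weak_deriv_le_sobolev_norm:
  assumes "fst \<alpha> + snd \<alpha> \<le> r" "1 \<le> p"
  shows "LpN (meas_on Omega) p (weak_deriv Omega \<alpha> f) \<le> sobolev_norm Omega r p f"
proof -
  have "Lp_norm Omega p (weak_deriv Omega \<alpha> f) powr p
      \<le> (\<Sum>\<alpha> | fst \<alpha> + snd \<alpha> \<le> r. Lp_norm Omega p (weak_deriv Omega \<alpha> f) powr p)"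
    using finite_multi_indices assms(1) by (intro member_le_sum) auto
  then have "(Lp_norm Omega p (weak_deriv Omega \<alpha> f) powr p) powr (1 / p) \<le> sobolev_norm Omega r p f"
    unfolding sobolev_norm_def using assms by (intro powr_mono2) auto
  then show ?thesis using assms(2) by (simp add: Lp_norm_eq_LpN powr_powr)
qed

text \<open>The Sobolev norm involves a separately chosen derivative of the difference; by
  uniqueness it agrees almost everywhere with the difference of the given derivatives.\<close>

lemma LpN_diff_weak_deriv_le:
  fixes u v :: "point \<Rightarrow> 'a::euclidean_space"
  assumes u: "u \<in> sobolev Omega r p" and v: "v \<in> sobolev Omega r p" and p: "1 \<le> p"
    and \<alpha>: "fst \<alpha> + snd \<alpha> \<le> r"
    and du: "has_weak_deriv Omega \<alpha> u du" "du \<in> LpM (meas_on Omega) p"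
    and dv: "has_weak_deriv Omega \<alpha> v dv" "dv \<in> LpM (meas_on Omega) p"
  shows "LpN (meas_on Omega) p (\<lambda>x. du x - dv x) \<le> sobolev_norm Omega r p (\<lambda>x. u x - v x)"
proof -
  note uv = sobolev_weak_deriv[OF sobolev_diff[OF u v p] \<alpha>]
  have "LpN (meas_on Omega) p (\<lambda>x. du x - dv x) = LpN (meas_on Omega) p (weak_deriv Omega \<alpha> (\<lambda>x. u x - v x))"
    using weak_deriv_unique[OF has_weak_deriv_diff[OF du(1) dv(1) Omega_borel] uv(1)]
      LpM_measurable[OF du(2)] LpM_measurable[OF dv(2)] LpM_measurable[OF uv(2)]
    by (intro LpN_cong_AE) (auto simp: AE_meas_on_Omega)
  then show ?thesis using LpN_weak_deriv_le_sobolev_norm[OF \<alpha> p] by simp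
qed

lemma has_weak_deriv_0:
  "locally_integrable U u \<Longrightarrow> has_weak_deriv U (0, 0) u u"
  by (simp add: has_weak_deriv_def partial_0)

lemma sobolev_LpM: "u \<in> sobolev Omega r p \<Longrightarrow> u \<in> LpM (meas_on Omega) p"
  by (auto simp: sobolev_def Lp_eq_LpM)

lemma sobolev_locally_integrable: "u \<in> sobolev Omega r p \<Longrightarrow> locally_integrable Omega u"
  using sobolev_weak_deriv(1)[of u r p "(0, 0)"] has_weak_deriv_locally_integrable(1) by force

lemma prob_space_Omega: "prob_space (meas_on Omega)"
  by (rule prob_spaceI) (simp add: space_restrict_space emeasure_restrict_space emeasure_lborel_Omega)

section \<open>The embedding of $W^1_1$ into $L_2$\<close>

lemma integral_tensor:
  fixes f g :: "real \<Rightarrow> real"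
  assumes f: "integrable lborel f" and g: "integrable lborel g"
  shows "integrable lborel (\<lambda>z. f (fst z) * g (snd z))"
    "(LINT z|lborel. f (fst z) * g (snd z)) = (LINT x|lborel. f x) * (LINT y|lborel. g y)"
proof -
  note [measurable] = borel_measurable_integrable[OF f] borel_measurable_integrable[OF g]
  have i: "integrable (lborel \<Otimes>\<^sub>M lborel) (\<lambda>z. f (fst z) * g (snd z))"
  proof (rule lborel_pair.Fubini_integrable)
    show "integrable lborel (\<lambda>x. (LINT y|lborel. norm (f (fst (x, y)) * g (snd (x, y)))))"
      using f g by (simp add: abs_mult)
  qed (use g in auto)
  then show "integrable lborel (\<lambda>z. f (fst z) * g (snd z))" by (simp add: lborel_prod)
  have "(LINT z|lborel. f (fst z) * g (snd z)) = (LINT z|(lborel \<Otimes>\<^sub>M lborel). f (fst z) * g (snd z))"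
    by (simp add: lborel_prod)
  also have "\<dots> = (LINT x|lborel. (LINT y|lborel. f x * g y))"
    using lborel_pair.integral_fst'[OF i] by simp
  finally show "(LINT z|lborel. f (fst z) * g (snd z)) = (LINT x|lborel. f x) * (LINT y|lborel. g y)" by simp
qed

text \<open>A fixed weight with unit integral; \<open>primitive_defect a\<close> is the compactly supported primitive
  of \<open>(\<integral>a) \<cdot> unit_bump - a\<close>.\<close>

definition unit_bump :: "real \<Rightarrow> real" where "unit_bump x = 2 * deriv step (2 * x + (- 1 / 2))"

lemma tst_unit_bump: "tst (1/4) (3/4) unit_bump"
  and unit_bump_nonneg: "0 \<le> unit_bump x"
  and deriv_unit_step: "deriv (\<lambda>x. step (2 * x + (- 1 / 2))) = unit_bump"
proof -
  show "deriv (\<lambda>x. step (2 * x + (- 1 / 2))) = unit_bump"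
    by (rule ext, unfold unit_bump_def) (rule DERIV_imp_deriv[OF DERIV_affine[OF step_smooth]])
  have "smooth unit_bump"
    unfolding unit_bump_def by (intro smooth_cmult smooth_affine smooth_deriv step_smooth)
  moreover have "1/4 \<le> x \<and> x \<le> 3/4" if "unit_bump x \<noteq> 0" for x
    using that tst_deriv_step unfolding unit_bump_def tst_def by (force simp: field_simps)
  ultimately show "tst (1/4) (3/4) unit_bump" by (auto simp: tst_def)
  show "0 \<le> unit_bump x" by (simp add: unit_bump_def deriv_step_nonneg)
qed

lemma primitive_defect:
  assumes a: "tst l u a" "0 < l" "u < 1" "\<And>x. 0 \<le> a x"
  obtains k l' u' where "tst l' u' k" "0 < l'" "u' < 1"
    "deriv k = (\<lambda>x. (LINT x|lborel. a x) * unit_bump x - a x)" "\<And>x. \<bar>k x\<bar> \<le> (LINT x|lborel. a x)"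
proof -
  define I where "I = (LINT x|lborel. a x)"
  obtain A where A: "smooth A" "deriv A = a" "A 0 = 0" using antiderivative_exists[OF tst_smooth[OF a(1)]] by blast
  let ?s = "\<lambda>x. step (2 * x + (- 1 / 2))"
  \<comment> \<open>Both I times the step and the antiderivative A rise from 0 to I inside (0,1), so
    they cancel to the left and to the right of the two supports. Both stay in [0,I], hence |k|
    \<le> I.\<close>
  define k where "k x = I * ?s x - A x" for x
  have dA: "(A has_real_derivative a x) (at x)" for x using smooth_has_deriv[OF A(1)] A(2) by simp
  have ss: "smooth ?s" by (rule smooth_affine[OF step_smooth])
  have sk: "smooth k" unfolding k_def by (intro smooth_diff smooth_cmult ss A)
  have Aconst: "A x = A y" if "x \<le> y" "y \<le> l \<or> u \<le> x" for x y
  proof -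
    have "(LINT t|lborel. indicator {x..y} t * deriv A t) = 0"
    proof (rule integral_eq_zero_AE)
      have "AE t in lborel. t \<noteq> l \<and> t \<noteq> u" by (auto intro: AE_lborel_singleton)
      then show "AE t in lborel. indicator {x..y} t * deriv A t = 0"
        by eventually_elim (use that a(1) in \<open>auto simp: A(2) tst_def indicator_def\<close>)
    qed
    then show ?thesis using FTC_smooth[OF A(1) that(1)] by simp
  qed
  have I: "I = A 1"
  proof -
    have "tst 0 1 a" by (rule tst_mono[OF a(1)]) (use a in auto)
    from integral_tst[OF this A(1,2)] show ?thesis by (simp add: I_def A(3))
  qed
  have Alow: "A x = 0" if "x \<le> l" for x
  proof (cases "x \<le> 0")
    case True then show ?thesis using Aconst[of x 0] a A(3) by auto
  next
    case False then show ?thesis using Aconst[of 0 x] that A(3) by auto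
  qed
  have Ahigh: "A x = I" if "u \<le> x" for x
  proof (cases "x \<le> 1")
    case True then show ?thesis using Aconst[of x 1] that I by auto
  next
    case False then show ?thesis using Aconst[of 1 x] a I by auto
  qed
  have mono: "A x \<le> A y" if "x \<le> y" for x y
    using DERIV_nonneg_imp_nondecreasing[OF that] dA a(4) by blast
  have A_range: "0 \<le> A x" "A x \<le> I" for x
    using mono[of "min x l" x] Alow[of "min x l"] mono[of x "max x u"] Ahigh[of "max x u"] by auto
  show ?thesis
  proof (rule that[of "min l (1/4)" "max u (3/4)" k])
    show "tst (min l (1/4)) (max u (3/4)) k"
      unfolding tst_def
    proof (intro conjI sk allI impI)
      fix x assume k: "k x \<noteq> 0"
      show "min l (1/4) \<le> x"
      proof (rule ccontr)
        assume "\<not> min l (1/4) \<le> x"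
        then have "x \<le> l" "2 * x + (- 1 / 2) \<le> 0" by auto
        then show False using k unfolding k_def by (simp only: Alow step_0)
      qed
      show "x \<le> max u (3/4)"
      proof (rule ccontr)
        assume "\<not> x \<le> max u (3/4)"
        then have "u \<le> x" "1 \<le> 2 * x + (- 1 / 2)" by auto
        then show False using k unfolding k_def by (simp only: Ahigh step_1)
      qed
    qed
    show "deriv k = (\<lambda>x. (LINT x|lborel. a x) * unit_bump x - a x)"
    proof
      fix x
      have "(k has_real_derivative I * deriv ?s x - a x) (at x)"
        unfolding k_def by (intro DERIV_diff DERIV_cmult smooth_has_deriv ss dA)
      then show "deriv k x = (LINT x|lborel. a x) * unit_bump x - a x"
        unfolding deriv_unit_step I_def by (rule DERIV_imp_deriv)
    qed
    have I0: "0 \<le> I" using A_range(1)[of 0] A_range(2)[of 0] by simp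
    show "\<bar>k x\<bar> \<le> (LINT x|lborel. a x)" for x
    proof -
      have "0 \<le> I * ?s x" "I * ?s x \<le> I"
        using I0 step_nonneg step_le_1 by (auto simp: mult_left_le)
      then show ?thesis using A_range[of x] unfolding k_def I_def[symmetric] by linarith
    qed
  qed (use a in auto)
qed

lemma unit_bump_bounded: "\<exists>W\<ge>1. \<forall>x. unit_bump x \<le> W"
proof -
  obtain B where "\<And>x. \<bar>unit_bump x\<bar> \<le> B" using tst_bounded[OF tst_unit_bump] by blast
  then have "unit_bump x \<le> max 1 B" for x by (meson abs_ge_self max.coboundedI2 order_trans)
  then show ?thesis by (intro exI[of _ "max 1 B"]) auto
qed

lemma integrable_prod_swap:
  fixes f :: "point \<Rightarrow> real"
  assumes "integrable lborel f"
  shows "integrable lborel (\<lambda>z. f (snd z, fst z))"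
    "(LINT z|lborel. f (snd z, fst z)) = (LINT z|lborel. f z)"
proof -
  have i: "integrable (lborel \<Otimes>\<^sub>M lborel) f" using assms by (simp add: lborel_prod)
  have "integrable (lborel \<Otimes>\<^sub>M lborel) (\<lambda>(x, y). f (y, x))"
    by (rule lborel_pair.integrable_product_swap[OF i])
  then show "integrable lborel (\<lambda>z. f (snd z, fst z))" by (simp add: lborel_prod case_prod_beta')
  have "f \<in> borel_measurable (lborel \<Otimes>\<^sub>M lborel)" using i by (rule borel_measurable_integrable)
  from lborel_pair.integral_product_swap[OF this]
  show "(LINT z|lborel. f (snd z, fst z)) = (LINT z|lborel. f z)" by (simp add: lborel_prod case_prod_beta')
qed

lemma integral_fst_lborel:
  fixes h :: "point \<Rightarrow> real"
  assumes h: "integrable lborel h"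
  shows "integrable lborel (\<lambda>y. LINT s|lborel. h (s, y))"
    "(LINT y|lborel. (LINT s|lborel. h (s, y))) = (LINT z|lborel. h z)"
proof -
  have i: "integrable (lborel \<Otimes>\<^sub>M lborel) (\<lambda>(s, y). h (s, y))"
    using h by (simp add: lborel_prod)
  show "integrable lborel (\<lambda>y. LINT s|lborel. h (s, y))" by (rule lborel_pair.integrable_snd[OF i])
  show "(LINT y|lborel. (LINT s|lborel. h (s, y))) = (LINT z|lborel. h z)"
    using lborel_pair.integral_snd[OF i] by (simp add: lborel_prod)
qed

text \<open>The weak derivative gives no inequality on single lines, so the one-dimensional estimate is tested
  against nonnegative tensor products.\<close>

lemma AE_bound_by_line_integral:
  fixes u d :: "point \<Rightarrow> real"
  assumes u: "integrable lborel (\<lambda>z. indicator Omega z * u z)" and d: "integrable lborel (\<lambda>z. indicator Omega z * d z)"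
    and W: "1 \<le> W" "\<And>x. unit_bump x \<le> W"
    and ibp: "\<And>a b l1 u1 l2 u2. tst l1 u1 a \<Longrightarrow> tst l2 u2 b \<Longrightarrow> cbox (l1, l2) (u1, u2) \<subseteq> Omega \<Longrightarrow>
      tint (deriv a) b u = - tint a b d"
  defines "h \<equiv> \<lambda>z. indicator Omega z * (W * \<bar>u z\<bar> + \<bar>d z\<bar>)"
  shows "AE z in lborel. z \<in> Omega \<longrightarrow> \<bar>u z\<bar> \<le> (LINT s|lborel. h (s, snd z))"
proof -
  define g where "g y = (LINT s|lborel. h (s, y))" for y
  have h: "integrable lborel h"
  proof -
    have "integrable lborel (\<lambda>z. W * \<bar>indicator Omega z * u z\<bar> + \<bar>indicator Omega z * d z\<bar>)"
      using u d by auto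
    moreover have "(\<lambda>z. W * \<bar>indicator Omega z * u z\<bar> + \<bar>indicator Omega z * d z\<bar>) = h"
      by (auto simp: h_def abs_mult indicator_def fun_eq_iff)
    ultimately show ?thesis by simp
  qed
  have h0: "0 \<le> h z" for z using W by (auto simp: h_def)
  have g: "integrable lborel g" unfolding g_def by (rule integral_fst_lborel[OF h])
  have key: "\<bar>tint a b u\<bar> \<le> tint a b (\<lambda>z. g (snd z))"
    if a: "tst l1 u1 a" and b: "tst l2 u2 b" and sub: "cbox (l1, l2) (u1, u2) \<subseteq> Omega"
      and a0: "\<And>x. 0 \<le> a x" and b0: "\<And>x. 0 \<le> b x" for a b l1 u1 l2 u2
  proof (cases "l1 \<le> u1 \<and> l2 \<le> u2")
    case False
    then have "a = (\<lambda>x. 0) \<or> b = (\<lambda>x. 0)" using a b unfolding tst_def by fastforce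
    then have "tens a b = (\<lambda>z. 0)" by (auto simp: tens_def fun_eq_iff)
    then show ?thesis by (simp add: tint_def)
  next
    case True
    have "(l1, l2) \<in> Omega" "(u1, u2) \<in> Omega" using sub True by (auto simp: mem_cbox_point subset_iff)
    then have lu: "0 < l1" "u1 < 1" "0 < l2" "u2 < 1" using True by (auto simp: Omega_def)
    define I where "I = (LINT x|lborel. a x)"
    obtain k l' u' where k: "tst l' u' k" "0 < l'" "u' < 1" "deriv k = (\<lambda>x. I * unit_bump x - a x)" "\<And>x. \<bar>k x\<bar> \<le> I"
      using primitive_defect[OF a lu(1,2) a0] unfolding I_def by metis
    have I0: "0 \<le> I" using k(5)[of 0] by simp
    have sub': "cbox (l', l2) (u', u2) \<subseteq> Omega" "cbox (1/4, l2) (3/4, u2) \<subseteq> Omega"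
      using k lu by (auto simp: Omega_def mem_cbox_point)
    have i1: "integrable lborel (\<lambda>z. tens unit_bump b z * u z)"
      by (rule tens_integrable[OF tst_unit_bump b sub'(2) u])
    have i2: "integrable lborel (\<lambda>z. tens (deriv k) b z * u z)"
      using tst_funpow_deriv[OF k(1), of 1] by (intro tens_integrable[OF _ b sub'(1) u]) simp
    have i3: "integrable lborel (\<lambda>z. tens k b z * d z)"
      by (rule tens_integrable[OF k(1) b sub'(1) d])
    \<comment> \<open>As a is I times the bump minus k', testing u against a is replaced by testing
      it against a fixed weight and testing d against k. Both are bounded by I times an integral
      that depends on b alone.\<close>
    have "tint a b u = (LINT z|lborel. I * (tens unit_bump b z * u z) - tens (deriv k) b z * u z)"
      unfolding tint_def by (intro Bochner_Integration.integral_cong) (auto simp: tens_def k(4) algebra_simps)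
    also have "\<dots> = I * tint unit_bump b u - tint (deriv k) b u"
      using i1 i2 by (simp add: tint_def)
    also have "\<dots> = I * tint unit_bump b u + tint k b d"
      using ibp[OF k(1) b sub'(1)] by simp
    also have "\<dots> = (LINT z|lborel. I * (tens unit_bump b z * u z) + tens k b z * d z)"
      using i1 i3 by (simp add: tint_def)
    finally have "\<bar>tint a b u\<bar> \<le> (LINT z|lborel. \<bar>I * (tens unit_bump b z * u z) + tens k b z * d z\<bar>)"
      using integral_abs_bound by metis
    also have "\<dots> \<le> (LINT z|lborel. I * (b (snd z) * h z))"
    proof (rule integral_mono)
      show "integrable lborel (\<lambda>z. \<bar>I * (tens unit_bump b z * u z) + tens k b z * d z\<bar>)"
        using i1 i3 by auto
      obtain B where B: "\<And>x. \<bar>b x\<bar> \<le> B" using tst_bounded[OF b] by blast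
      have [measurable]: "b \<in> borel_measurable borel" by (rule smooth_measurable[OF tst_smooth[OF b]])
      note [measurable] = borel_measurable_integrable[OF h]
      have "integrable lborel (\<lambda>z. B * h z)" using h by simp
      then have "integrable lborel (\<lambda>z. b (snd z) * h z)"
        by (rule Bochner_Integration.integrable_bound)
           (auto simp: abs_mult intro!: mult_right_mono order_trans[OF B abs_ge_self])
      then show "integrable lborel (\<lambda>z. I * (b (snd z) * h z))" by simp
      fix z
      show "\<bar>I * (tens unit_bump b z * u z) + tens k b z * d z\<bar> \<le> I * (b (snd z) * h z)"
      proof (cases "z \<in> Omega")
        case True
        have "\<bar>I * (tens unit_bump b z * u z) + tens k b z * d z\<bar>
            \<le> I * (unit_bump (fst z) * b (snd z) * \<bar>u z\<bar>) + \<bar>k (fst z)\<bar> * b (snd z) * \<bar>d z\<bar>"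
          using I0 b0 unit_bump_nonneg
          by (intro order_trans[OF abs_triangle_ineq]) (simp add: tens_def abs_mult)
        also have "\<dots> \<le> I * (W * b (snd z) * \<bar>u z\<bar>) + I * b (snd z) * \<bar>d z\<bar>"
          using I0 b0 k(5) W(2) by (intro add_mono mult_left_mono mult_right_mono) auto
        also have "\<dots> = I * (b (snd z) * h z)" using True by (simp add: h_def algebra_simps)
        finally show ?thesis .
      next
        case False
        then have "tens unit_bump b z = 0" "tens k b z = 0"
          using tens_support[OF tst_unit_bump b, of z] tens_support[OF k(1) b, of z] sub' by blast+
        then show ?thesis using False by (simp add: h_def)
      qed
    qed
    \<comment> \<open>Integrating out the first coordinate and writing I as the integral of a turns
      the bound into a test of the function g(y) against the same product.\<close>
    also have "\<dots> = I * (LINT y|lborel. (LINT s|lborel. b y * h (s, y)))"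
    proof -
      obtain B where B: "\<And>x. \<bar>b x\<bar> \<le> B" using tst_bounded[OF b] by blast
      have [measurable]: "b \<in> borel_measurable borel" by (rule smooth_measurable[OF tst_smooth[OF b]])
      note [measurable] = borel_measurable_integrable[OF h]
      have "integrable lborel (\<lambda>z. B * h z)" using h by simp
      then have "integrable lborel (\<lambda>z. b (snd z) * h z)"
        by (rule Bochner_Integration.integrable_bound)
           (auto simp: abs_mult intro!: mult_right_mono order_trans[OF B abs_ge_self])
      from integral_fst_lborel(2)[OF this] show ?thesis by simp
    qed
    also have "\<dots> = I * (LINT y|lborel. b y * g y)" by (simp add: g_def)
    also have "\<dots> = tint a b (\<lambda>z. g (snd z))"
    proof -
      obtain B where B: "\<And>x. \<bar>b x\<bar> \<le> B" using tst_bounded[OF b] by blast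
      have [measurable]: "b \<in> borel_measurable borel" by (rule smooth_measurable[OF tst_smooth[OF b]])
      note [measurable] = borel_measurable_integrable[OF g]
      have "integrable lborel (\<lambda>z. B * g z)" using g by simp
      then have "integrable lborel (\<lambda>z. b z * g z)"
        by (rule Bochner_Integration.integrable_bound)
           (auto simp: abs_mult intro!: mult_right_mono order_trans[OF B abs_ge_self])
      from integral_tensor(2)[OF tst_integrable[OF a] this] show ?thesis
        by (simp add: I_def tint_def tens_def mult.assoc)
    qed
    finally show ?thesis .
  qed
  have ig: "integrable lborel (\<lambda>z. indicator Omega z * g (snd z))"
  proof -
    have "emeasure lborel {0<..<1::real} < \<infinity>" by (rule emeasure_bounded_finite) simp
    then have "integrable lborel (indicator {0<..<1::real} :: real \<Rightarrow> real)" by simp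
    moreover have "integrable lborel (\<lambda>y. indicator {0<..<1::real} y * g y)"
      using integrable_mult_indicator[OF _ g, of "{0<..<1}"] by simp
    ultimately have "integrable lborel (\<lambda>z. indicator {0<..<1::real} (fst z) * (indicator {0<..<1::real} (snd z) * g (snd z)))"
      by (rule integral_tensor)
    moreover have "indicator {0<..<1::real} (fst z) * (indicator {0<..<1::real} (snd z) * g (snd z)) = indicator Omega z * g (snd z)" for z
      by (cases z) (auto simp: Omega_def indicator_def)
    ultimately show ?thesis by simp
  qed
  have sgn: "AE z in lborel. z \<in> Omega \<longrightarrow> 0 \<le> g (snd z) + c * u z" if c: "c = 1 \<or> c = - 1" for c
  proof (rule AE_nonneg_if_tint_nonneg[OF Omega_def])
    show "integrable lborel (\<lambda>z. indicator Omega z * (g (snd z) + c * u z))"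
      using ig integrable_mult_right[OF u, of c] by (simp add: distrib_left mult.left_commute)
    fix a b l1 u1 l2 u2 assume t: "tst l1 u1 a" "tst l2 u2 b" "cbox (l1, l2) (u1, u2) \<subseteq> Omega"
      and nn: "\<And>x. 0 \<le> a x" "\<And>x. 0 \<le> b x"
    have "tint a b (\<lambda>z. g (snd z) + c * u z) = tint a b (\<lambda>z. g (snd z)) + c * tint a b u"
      using tens_integrable[OF t ig] tens_integrable[OF t u] by (simp add: tint_def distrib_left mult.left_commute)
    then show "0 \<le> tint a b (\<lambda>z. g (snd z) + c * u z)" using key[OF t nn] c by auto
  qed
  have "AE z in lborel. (z \<in> Omega \<longrightarrow> 0 \<le> g (snd z) + 1 * u z) \<and> (z \<in> Omega \<longrightarrow> 0 \<le> g (snd z) + (- 1) * u z)"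
    using sgn[of 1] sgn[of "-1"] by auto
  then show ?thesis by eventually_elim (auto simp: g_def)
qed

text \<open>The argument of Gagliardo and Nirenberg: |u| is bounded by a function of y alone and by
  a function of x alone, each of integral at most N. The product of the two bounds dominates u^2 and
  integrates to at most N^2.\<close>

theorem W11_embeds_L2:
  fixes u d1 d2 :: "point \<Rightarrow> real"
  assumes u: "u \<in> LpM (meas_on Omega) 1" and d1: "d1 \<in> LpM (meas_on Omega) 1" and d2: "d2 \<in> LpM (meas_on Omega) 1"
    and wd: "has_weak_deriv Omega (1, 0) u d1" "has_weak_deriv Omega (0, 1) u d2"
    and W: "1 \<le> W" "\<And>x. unit_bump x \<le> W"
  shows "u \<in> LpM (meas_on Omega) 2"
    "LpN (meas_on Omega) 2 u \<le> W * LpN (meas_on Omega) 1 u + LpN (meas_on Omega) 1 d1 + LpN (meas_on Omega) 1 d2"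
proof -
  have L1: "integrable lborel (\<lambda>z. indicator Omega z * f z)" "LpN (meas_on Omega) 1 f = (LINT z|lborel. indicator Omega z * \<bar>f z\<bar>)"
    if "f \<in> LpM (meas_on Omega) 1" for f :: "point \<Rightarrow> real"
  proof -
    have "integrable (meas_on Omega) (\<lambda>z. \<bar>f z\<bar>)" "f \<in> borel_measurable (meas_on Omega)"
      using that by (auto simp: LpM_def)
    then have "integrable (meas_on Omega) f" by (simp add: integrable_abs_iff)
    then show "integrable lborel (\<lambda>z. indicator Omega z * f z)" by (simp add: integrable_restrict_space)
    show "LpN (meas_on Omega) 1 f = (LINT z|lborel. indicator Omega z * \<bar>f z\<bar>)"
      by (simp add: LpN_def integral_restrict_space)
  qed
  let ?u = "\<lambda>z. indicator Omega z * u z"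
  define h1 where "h1 z = indicator Omega z * (W * \<bar>u z\<bar> + \<bar>d1 z\<bar>)" for z
  define h2 where "h2 z = indicator Omega z * (W * \<bar>u z\<bar> + \<bar>d2 z\<bar>)" for z
  define N where "N = W * LpN (meas_on Omega) 1 u + LpN (meas_on Omega) 1 d1 + LpN (meas_on Omega) 1 d2"
  have ai: "integrable lborel (\<lambda>z. indicator Omega z * \<bar>f z\<bar>)" if "f \<in> LpM (meas_on Omega) 1" for f :: "point \<Rightarrow> real"
    using integrable_abs[OF L1(1)[OF that]] by (simp add: abs_mult)
  have h1: "integrable lborel h1" "(LINT z|lborel. h1 z) \<le> N"
    and h2: "integrable lborel h2" "(LINT z|lborel. h2 z) \<le> N"
  proof -
    have eq: "h1 = (\<lambda>z. W * (indicator Omega z * \<bar>u z\<bar>) + indicator Omega z * \<bar>d1 z\<bar>)"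
      "h2 = (\<lambda>z. W * (indicator Omega z * \<bar>u z\<bar>) + indicator Omega z * \<bar>d2 z\<bar>)"
      by (auto simp: h1_def h2_def fun_eq_iff algebra_simps)
    show "integrable lborel h1" "integrable lborel h2"
      unfolding eq using ai[OF u] ai[OF d1] ai[OF d2] by auto
    show "(LINT z|lborel. h1 z) \<le> N" "(LINT z|lborel. h2 z) \<le> N"
      unfolding eq N_def using ai[OF u] ai[OF d1] ai[OF d2] L1(2)[OF u] L1(2)[OF d1] L1(2)[OF d2]
        LpN_nonneg[of "meas_on Omega" 1 d1] LpN_nonneg[of "meas_on Omega" 1 d2]
      by auto
  qed
  have h0: "0 \<le> h1 z" "0 \<le> h2 z" for z using W by (auto simp: h1_def h2_def)
  define g1 where "g1 y = (LINT s|lborel. h1 (s, y))" for y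
  define g2 where "g2 x = (LINT s|lborel. h2 (x, s))" for x
  have g0: "0 \<le> g1 y" "0 \<le> g2 y" for y
    unfolding g1_def g2_def by (auto intro!: Bochner_Integration.integral_nonneg h0)
  have g1: "integrable lborel g1" "(LINT y|lborel. g1 y) \<le> N"
    unfolding g1_def using integral_fst_lborel[OF h1(1)] h1(2) by auto
  have g2: "integrable lborel g2" "(LINT y|lborel. g2 y) \<le> N"
    unfolding g2_def using integral_fst_lborel[OF integrable_prod_swap(1)[OF h2(1)]] integrable_prod_swap(2)[OF h2(1)] h2(2)
    by auto
  have b1: "AE z in lborel. z \<in> Omega \<longrightarrow> \<bar>u z\<bar> \<le> g1 (snd z)"
    unfolding g1_def h1_def
  proof (rule AE_bound_by_line_integral[OF L1(1)[OF u] L1(1)[OF d1] W])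
    fix a b l1 u1 l2 u2 assume t: "tst l1 u1 a" "tst l2 u2 b" "cbox (l1, l2) (u1, u2) \<subseteq> Omega"
    show "tint (deriv a) b u = - tint a b d1"
      using has_weak_deriv_tint[OF wd(1) Omega_borel t] by simp
  qed
  have sw: "indicator Omega (snd z, fst z) = (indicator Omega z :: real)" for z
    by (cases z) (auto simp: Omega_def indicator_def)
  \<comment> \<open>The bound along the second coordinate is the first one applied to u with
    coordinates exchanged; the square is symmetric, and the exchange preserves null sets.\<close>
  have "AE z in lborel. z \<in> Omega \<longrightarrow> \<bar>u (snd z, fst z)\<bar> \<le> (LINT s|lborel. indicator Omega (s, snd z) *
      (W * \<bar>u (snd (s, snd z), fst (s, snd z))\<bar> + \<bar>d2 (snd (s, snd z), fst (s, snd z))\<bar>))"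
  proof (rule AE_bound_by_line_integral[OF _ _ W])
    show "integrable lborel (\<lambda>z. indicator Omega z * u (snd z, fst z))"
      "integrable lborel (\<lambda>z. indicator Omega z * d2 (snd z, fst z))"
      using integrable_prod_swap(1)[OF L1(1)[OF u]] integrable_prod_swap(1)[OF L1(1)[OF d2]] by (simp_all add: sw)
    fix a b l1 u1 l2 u2 assume t: "tst l1 u1 a" "tst l2 u2 b" "cbox (l1, l2) (u1, u2) \<subseteq> Omega"
    have t': "cbox (l2, l1) (u2, u1) \<subseteq> Omega"
    proof
      fix z assume "z \<in> cbox (l2, l1) (u2, u1)"
      then have "(snd z, fst z) \<in> Omega" using t(3) by (auto simp: mem_cbox_point)
      then show "z \<in> Omega" by (cases z) (auto simp: Omega_def)
    qed
    have swap: "tint a b (\<lambda>z. f (snd z, fst z)) = tint b a f"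
      if "integrable lborel (\<lambda>z. tens b a z * f z)" for a b f
    proof -
      have "tint a b (\<lambda>z. f (snd z, fst z)) = (LINT z|lborel. tens b a (snd z, fst z) * f (snd z, fst z))"
        by (simp add: tint_def tens_def ac_simps)
      then show ?thesis using integrable_prod_swap(2)[OF that] by (simp add: tint_def)
    qed
    have i: "integrable lborel (\<lambda>z. tens b (deriv a) z * u z)" "integrable lborel (\<lambda>z. tens b a z * d2 z)"
      using tst_funpow_deriv[OF t(1), of 1] t
      by (auto intro!: tens_integrable[OF t(2) _ t' L1(1)[OF u]] tens_integrable[OF t(2) _ t' L1(1)[OF d2]])
    show "tint (deriv a) b (\<lambda>z. u (snd z, fst z)) = - tint a b (\<lambda>z. d2 (snd z, fst z))"
      using has_weak_deriv_tint[OF wd(2) Omega_borel t(2,1) t'] swap[OF i(1)] swap[OF i(2)] by simp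
  qed
  then have "AE z in lborel. z \<in> Omega \<longrightarrow> \<bar>u (snd z, fst z)\<bar> \<le> g2 (snd z)"
    using sw by (simp add: g2_def h2_def sw[of "(_, _)", simplified])
  then have b2: "AE z in lborel. z \<in> Omega \<longrightarrow> \<bar>u z\<bar> \<le> g2 (fst z)"
  proof -
    assume *: "AE z in lborel. z \<in> Omega \<longrightarrow> \<bar>u (snd z, fst z)\<bar> \<le> g2 (snd z)"
    have D: "distr lborel lborel (\<lambda>(x, y). (y, x)) = (lborel :: point measure)"
      using lborel_pair.distr_pair_swap[symmetric, where ?'a=real and ?'b=real] by (simp add: lborel_prod)
    have "AE z in distr lborel lborel (\<lambda>(x, y). (y, x)). z \<in> Omega \<longrightarrow> \<bar>u (snd z, fst z)\<bar> \<le> g2 (snd z)"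
      unfolding D by (rule *)
    then have "AE z in lborel. (case z of (x, y) \<Rightarrow> (y, x)) \<in> Omega \<longrightarrow>
        \<bar>u (snd (case z of (x, y) \<Rightarrow> (y, x)), fst (case z of (x, y) \<Rightarrow> (y, x)))\<bar> \<le> g2 (snd (case z of (x, y) \<Rightarrow> (y, x)))"
      by (rule AE_distrD[rotated]) (auto simp: case_prod_beta' borel_prod[symmetric])
    then show ?thesis by eventually_elim (auto simp: Omega_def split: prod.splits)
  qed
  have gg: "integrable lborel (\<lambda>z. g2 (fst z) * g1 (snd z))"
    "(LINT z|lborel. g2 (fst z) * g1 (snd z)) \<le> N * N"
  proof -
    show "integrable lborel (\<lambda>z. g2 (fst z) * g1 (snd z))" by (rule integral_tensor(1)[OF g2(1) g1(1)])
    have "0 \<le> (LINT x|lborel. g1 x)" "0 \<le> (LINT x|lborel. g2 x)"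
      using g0 by (auto intro!: Bochner_Integration.integral_nonneg)
    then show "(LINT z|lborel. g2 (fst z) * g1 (snd z)) \<le> N * N"
      unfolding integral_tensor(2)[OF g2(1) g1(1)] using g1(2) g2(2) by (intro mult_mono) auto
  qed
  note [measurable] = borel_measurable_integrable[OF L1(1)[OF u]]
  have le: "AE z in lborel. (?u z)\<^sup>2 \<le> g2 (fst z) * g1 (snd z)"
    using b1 b2
  proof eventually_elim
    case (elim z)
    show ?case
    proof (cases "z \<in> Omega")
      case True
      then have "\<bar>u z\<bar> * \<bar>u z\<bar> \<le> g2 (fst z) * g1 (snd z)" using elim g0 by (intro mult_mono) auto
      then show ?thesis using True by (simp add: power2_eq_square)
    qed (use g0 in simp)
  qed
  have i2: "integrable lborel (\<lambda>z. (?u z)\<^sup>2)"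
    by (rule Bochner_Integration.integrable_bound[OF gg(1)]) (use le g0 in \<open>auto elim!: eventually_mono\<close>)
  have sq: "indicator Omega z * (u z)\<^sup>2 = (?u z)\<^sup>2" for z by (auto simp: indicator_def)
  have "integrable (meas_on Omega) (\<lambda>z. (u z)\<^sup>2)"
    using i2 by (simp add: integrable_restrict_space sq)
  then show "u \<in> LpM (meas_on Omega) 2"
    using u by (auto simp: LpM_def powr_numeral)
  have "(LINT z|meas_on Omega. norm (u z) powr 2) = (LINT z|lborel. (?u z)\<^sup>2)"
    by (simp add: integral_restrict_space sq powr_numeral)
  also have "\<dots> \<le> (LINT z|lborel. g2 (fst z) * g1 (snd z))"
    by (intro integral_mono_AE i2 gg(1) le)
  also have "\<dots> \<le> N powr 2" using gg(2) W by (simp add: powr_numeral power2_eq_square N_def)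
  finally show "LpN (meas_on Omega) 2 u \<le> W * LpN (meas_on Omega) 1 u + LpN (meas_on Omega) 1 d1 + LpN (meas_on Omega) 1 d2"
    using W unfolding N_def by (subst LpN_le_iff) auto
qed

section \<open>The Fourier transform and B-splines\<close>

definition ft :: "(real \<Rightarrow> real) \<Rightarrow> real \<Rightarrow> complex" where
  "ft f \<omega> = (LINT x|lborel. of_real (f x) * exp (- \<i> * of_real (\<omega> * x)))"

lemma ft_integrable:
  assumes "integrable lborel f"
  shows "integrable lborel (\<lambda>x. of_real (f x) * exp (- (\<i> * of_real (\<omega> * x))))"
proof -
  note [measurable] = borel_measurable_integrable[OF assms]
  show ?thesis
    by (rule Bochner_Integration.integrable_bound[OF assms]) (auto simp: norm_mult)
qed

lemma ft_0: "ft f 0 = of_real (LINT x|lborel. f x)"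
  by (simp add: ft_def)

text \<open>Reduction to Levy's uniqueness theorem, which concerns probability measures: the
  positive and negative parts of f - g have equal transforms, hence equal mass C, and dividing by C
  gives densities with equal characteristic functions.\<close>

lemma ft_unique:
  assumes f: "integrable lborel f" and g: "integrable lborel g" and eq: "\<And>\<omega>. ft f \<omega> = ft g \<omega>"
  shows "AE x in lborel. f x = g x"
proof -
  define h where "h x = f x - g x" for x
  define hp where "hp x = max 0 (h x)" for x
  define hn where "hn x = max 0 (- h x)" for x
  have h: "integrable lborel h" unfolding h_def using f g by auto
  note [measurable] = borel_measurable_integrable[OF h]
  have [measurable]: "hp \<in> borel_measurable borel" "hn \<in> borel_measurable borel"
    unfolding hp_def hn_def by measurable
  have hp: "integrable lborel hp" and hn: "integrable lborel hn"
    by (rule Bochner_Integration.integrable_bound[OF h]; auto simp: hp_def hn_def)+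
  have h_eq: "h x = hp x - hn x" for x by (simp add: hp_def hn_def)
  have ft_eq: "ft hp \<omega> = ft hn \<omega>" for \<omega>
  proof -
    have "ft hp \<omega> - ft hn \<omega> = (LINT x|lborel. of_real (hp x) * exp (- (\<i> * of_real (\<omega> * x))) - of_real (hn x) * exp (- (\<i> * of_real (\<omega> * x))))"
      using ft_integrable[OF hp] ft_integrable[OF hn] by (simp add: ft_def)
    also have "\<dots> = (LINT x|lborel. of_real (f x) * exp (- (\<i> * of_real (\<omega> * x))) - of_real (g x) * exp (- (\<i> * of_real (\<omega> * x))))"
      by (simp add: h_def h_eq[symmetric] flip: left_diff_distrib of_real_diff)
    also have "\<dots> = ft f \<omega> - ft g \<omega>"
      using ft_integrable[OF f] ft_integrable[OF g] by (simp add: ft_def)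
    finally show ?thesis using eq by simp
  qed
  define C where "C = (LINT x|lborel. hp x)"
  have Cn: "C = (LINT x|lborel. hn x)"
    using ft_eq[of 0] unfolding ft_0 C_def by (simp only: of_real_eq_iff)
  have C0: "C \<ge> 0" unfolding C_def by (intro Bochner_Integration.integral_nonneg) (auto simp: hp_def)
  show ?thesis
  \<comment> \<open>Without mass there is nothing to normalise, but then both parts vanish almost
    everywhere.\<close>
  proof (cases "C = 0")
    case True
    have "AE x in lborel. hp x = 0"
      using True hp unfolding C_def by (subst (asm) integral_nonneg_eq_0_iff_AE) (auto simp: hp_def)
    moreover have "AE x in lborel. hn x = 0"
      using True hn unfolding Cn by (subst (asm) integral_nonneg_eq_0_iff_AE) (auto simp: hn_def)
    ultimately show ?thesis
    proof eventually_elim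
      case (elim x)
      then show ?case using h_eq[of x] by (simp add: h_def)
    qed
  next
    case False
    then have C: "C > 0" using C0 by simp
    define M where "M k = density lborel (\<lambda>x. ennreal (k x / C))" for k :: "real \<Rightarrow> real"
    have M: "real_distribution (M k)" "char (M k) t = (1 / C) *\<^sub>R ft k (- t)"
      if k: "integrable lborel k" "\<And>x. 0 \<le> k x" "(LINT x|lborel. k x) = C" for k t
    proof -
      note [measurable] = borel_measurable_integrable[OF k(1)]
      have "(\<integral>\<^sup>+x. ennreal (k x / C) \<partial>lborel) = ennreal (LINT x|lborel. k x / C)"
        using k C by (intro nn_integral_eq_integral) auto
      also have "\<dots> = 1" using k C by simp
      finally have "prob_space (M k)"
        unfolding M_def by (intro prob_spaceI) (simp add: emeasure_density)
      then show "real_distribution (M k)"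
        by (simp add: real_distribution_def real_distribution_axioms_def M_def)
      have "char (M k) t = (LINT x|lborel. (k x / C) *\<^sub>R exp (\<i> * of_real (t * x)))"
        unfolding char_def M_def using k C by (subst integral_density) auto
      also have "\<dots> = (LINT x|lborel. (1 / C) *\<^sub>R (of_real (k x) * exp (- (\<i> * of_real (- t * x)))))"
        by (intro Bochner_Integration.integral_cong) (auto simp: scaleR_conv_of_real)
      also have "\<dots> = (1 / C) *\<^sub>R ft k (- t)"
        unfolding ft_def by (subst Bochner_Integration.integral_scaleR_right) simp
      finally show "char (M k) t = (1 / C) *\<^sub>R ft k (- t)" .
    qed
    have p: "0 \<le> hp x" "0 \<le> hn x" for x by (auto simp: hp_def hn_def)
    have "char (M hp) = char (M hn)"
      using M(2)[OF hp p(1) C_def[symmetric]] M(2)[OF hn p(2) Cn[symmetric]] ft_eq by auto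
    then have "M hp = M hn"
      using Levy_uniqueness M(1)[OF hp p(1) C_def[symmetric]] M(1)[OF hn p(2) Cn[symmetric]] by blast
    then have "AE x in lborel. ennreal (hp x / C) = ennreal (hn x / C)"
      unfolding M_def by (subst (asm) sigma_finite_measure.density_unique_iff[OF sigma_finite_lborel]) auto
    then show ?thesis
    proof eventually_elim
      case (elim x)
      then have "hp x / C = hn x / C" using p C by (subst (asm) ennreal_inj) auto
      then show "f x = g x" using C h_eq[of x] by (simp add: h_def)
    qed
  qed
qed

lemma ft_shift:
  shows "ft (\<lambda>x. f (x - c)) \<omega> = exp (- (\<i> * of_real (\<omega> * c))) * ft f \<omega>"
proof -
  have "ft (\<lambda>x. f (x - c)) \<omega> = (LINT x|lborel. of_real (f x) * exp (- (\<i> * of_real (\<omega> * (c + x)))))"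
    unfolding ft_def by (subst lborel_integral_real_affine[where c=1 and t=c]) auto
  also have "\<dots> = (LINT x|lborel. exp (- (\<i> * of_real (\<omega> * c))) * (of_real (f x) * exp (- (\<i> * of_real (\<omega> * x)))))"
  proof (rule Bochner_Integration.integral_cong[OF refl])
    fix x
    have "exp (- (\<i> * of_real (\<omega> * (c + x)))) = exp (- (\<i> * of_real (\<omega> * c))) * exp (- (\<i> * of_real (\<omega> * x)))"
      by (simp add: exp_add[symmetric] algebra_simps)
    then show "complex_of_real (f x) * exp (- (\<i> * of_real (\<omega> * (c + x))))
        = exp (- (\<i> * of_real (\<omega> * c))) * (of_real (f x) * exp (- (\<i> * of_real (\<omega> * x))))" by simp
  qed
  also have "\<dots> = exp (- (\<i> * of_real (\<omega> * c))) * ft f \<omega>" by (simp add: ft_def)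
  finally show ?thesis .
qed

section \<open>Centred B-splines as iterated convolutions\<close>

definition box1 :: "real \<Rightarrow> real" where "box1 x = indicator {-(1/2)..1/2} x"

text \<open>The index is one less than the order: \<open>cbspline m\<close> is the centred B-spline
  of order m + 1, with transform the (m+1)-st power of the sinc.\<close>

primrec cbspline :: "nat \<Rightarrow> real \<Rightarrow> real" where
  "cbspline 0 = box1"
| "cbspline (Suc m) = (\<lambda>x. LINT t|lborel. box1 (x - t) * cbspline m t)"

lemma box1_measurable [measurable]: "box1 \<in> borel_measurable borel"
  unfolding box1_def by measurable

lemma box1_integrable: "integrable lborel box1" and box1_integral: "(LINT x|lborel. box1 x) = 1"
  by (auto simp: box1_def[abs_def])

lemma ft_box1: "ft box1 \<omega> = of_real (sinc (\<omega> / 2))"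
proof (cases "\<omega> = 0")
  case True
  then show ?thesis by (simp add: ft_0 box1_integral)
next
  case False
  have "ft box1 \<omega> = (LINT x|lborel. indicator {-(1/2)..1/2} x *\<^sub>R exp (- (\<i> * of_real (\<omega> * x))))"
    unfolding ft_def by (intro Bochner_Integration.integral_cong) (auto simp: box1_def indicator_def)
  also have "\<dots> = exp (- (\<i> * of_real (\<omega> * (1/2)))) / (- \<i> * of_real \<omega>) - exp (- (\<i> * of_real (\<omega> * (-(1/2))))) / (- \<i> * of_real \<omega>)"
  proof (rule integral_FTC_atLeastAtMost)
    show "((\<lambda>x. exp (- (\<i> * of_real (\<omega> * x))) / (- \<i> * of_real \<omega>)) has_vector_derivative exp (- (\<i> * of_real (\<omega> * x)))) (at x within {-(1/2)..1/2})" for x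
    proof -
      have "((\<lambda>z. exp (- (\<i> * (of_real \<omega> * z))) / (- \<i> * of_real \<omega>)) has_field_derivative exp (- (\<i> * (of_real \<omega> * of_real x)))) (at (of_real x))"
      proof -
        have ii: "- (\<i> * (X * \<i>)) = X" for X by (simp add: complex_eq_iff)
        show ?thesis using False by (auto intro!: derivative_eq_intros simp: ii)
      qed
      from has_vector_derivative_real_field[OF this]
      show ?thesis by simp
    qed
  qed (auto intro!: continuous_intros)
  also have "\<dots> = of_real (sinc (\<omega> / 2))"
    using False by (simp add: exp_eq_polar cis_conv_exp[symmetric] complex_eq_iff Re_divide Im_divide power2_eq_square field_simps)
  finally show ?thesis .
qed

lemma convolution_integrable:
  fixes f g :: "real \<Rightarrow> real"
  assumes f: "integrable lborel f" and g: "integrable lborel g"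
  shows "integrable lborel (\<lambda>x. LINT t|lborel. f (x - t) * g t)"
    and "ft (\<lambda>x. LINT t|lborel. f (x - t) * g t) \<omega> = ft f \<omega> * ft g \<omega>"
proof -
  note [measurable] = borel_measurable_integrable[OF f] borel_measurable_integrable[OF g]
  have sh: "integrable lborel (\<lambda>x. f (x - t))" "(LINT x|lborel. \<bar>f (x - t)\<bar>) = (LINT x|lborel. \<bar>f x\<bar>)" for t
  proof -
    show "integrable lborel (\<lambda>x. f (x - t))"
      using lborel_integrable_real_affine[OF f, of 1 "- t"] by simp
    show "(LINT x|lborel. \<bar>f (x - t)\<bar>) = (LINT x|lborel. \<bar>f x\<bar>)"
      using lborel_integral_real_affine[of 1 "\<lambda>x. \<bar>f x\<bar>" "- t"] by simp
  qed
  have i: "integrable (lborel \<Otimes>\<^sub>M lborel) (\<lambda>(t, x). f (x - t) * g t)"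
  proof (rule lborel_pair.Fubini_integrable)
    show "integrable lborel (\<lambda>t. (LINT x|lborel. norm (case (t, x) of (t, x) \<Rightarrow> f (x - t) * g t)))"
      using g by (simp add: abs_mult sh(2))
    show "AE t in lborel. integrable lborel (\<lambda>x. case (t, x) of (t, x) \<Rightarrow> f (x - t) * g t)"
      using sh(1) by (intro AE_I2) simp
  qed measurable
  show "integrable lborel (\<lambda>x. LINT t|lborel. f (x - t) * g t)"
    by (rule lborel_pair.integrable_snd[OF i])
  let ?e = "\<lambda>x. exp (- (\<i> * complex_of_real (\<omega> * x)))"
  have i2: "integrable (lborel \<Otimes>\<^sub>M lborel) (\<lambda>(t, x). of_real (f (x - t) * g t) * ?e x)"
    by (rule Bochner_Integration.integrable_bound[OF i]) (auto simp: norm_mult)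
  have "ft (\<lambda>x. LINT t|lborel. f (x - t) * g t) \<omega> = (LINT x|lborel. (LINT t|lborel. of_real (f (x - t) * g t) * ?e x))"
    unfolding ft_def by (intro Bochner_Integration.integral_cong) (auto simp flip: integral_complex_of_real)
  also have "\<dots> = (LINT t|lborel. (LINT x|lborel. of_real (f (x - t) * g t) * ?e x))"
    by (rule lborel_pair.Fubini_integral[OF i2])
  also have "\<dots> = (LINT t|lborel. of_real (g t) * ft (\<lambda>x. f (x - t)) \<omega>)"
    unfolding ft_def
    by (intro Bochner_Integration.integral_cong refl, subst integral_mult_right_zero[symmetric]) (auto simp: ac_simps)
  also have "\<dots> = (LINT t|lborel. ft f \<omega> * (of_real (g t) * ?e t))"
    by (simp add: ft_shift ac_simps)
  also have "\<dots> = ft f \<omega> * ft g \<omega>" by (simp add: ft_def)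
  finally show "ft (\<lambda>x. LINT t|lborel. f (x - t) * g t) \<omega> = ft f \<omega> * ft g \<omega>" .
qed

lemma cbspline_integrable: "integrable lborel (cbspline m)"
  by (induction m) (auto simp: box1_integrable convolution_integrable(1)[OF box1_integrable])

lemma ft_cbspline: "ft (cbspline m) \<omega> = of_real (sinc (\<omega> / 2)) ^ Suc m"
  by (induction m) (simp_all only: cbspline.simps ft_box1 convolution_integrable(2)[OF box1_integrable cbspline_integrable] power_Suc power_0 mult_1_right)

text \<open>Each convolution with the box averages values of modulus at most 1 and widens the
  support by 1/2. The half-width m + 1 is generous; only boundedness and compact support are
  used.\<close>

lemma cbspline_bound: "\<bar>cbspline m x\<bar> \<le> indicator {- (real m + 1)..real m + 1} x"
proof (induction m arbitrary: x)
  case 0 then show ?case by (auto simp: box1_def indicator_def)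
next
  case (Suc m)
  note [measurable] = borel_measurable_integrable[OF cbspline_integrable[of m]]
  have b: "integrable lborel (\<lambda>t. box1 (x - t))" "(LINT t|lborel. box1 (x - t)) = 1"
    using lborel_integrable_real_affine[OF box1_integrable, of "-1" x]
      lborel_integral_real_affine[of "-1" box1 x] box1_integral by simp_all
  have b1: "0 \<le> box1 t" for t by (simp add: box1_def)
  show ?case
  proof (cases "x \<in> {- (real (Suc m) + 1)..real (Suc m) + 1}")
    case True
    have "\<bar>cbspline (Suc m) x\<bar> \<le> (LINT t|lborel. \<bar>box1 (x - t) * cbspline m t\<bar>)"
      unfolding cbspline.simps by (rule integral_abs_bound)
    also have "\<dots> \<le> (LINT t|lborel. box1 (x - t))"
    proof (rule integral_mono)
      have le: "\<bar>box1 (x - t) * cbspline m t\<bar> \<le> box1 (x - t)" for t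
        unfolding abs_mult using order_trans[OF Suc.IH indicator_le_1] b1[of "x - t"] by (simp add: mult_left_le)
      then show "\<bar>box1 (x - t) * cbspline m t\<bar> \<le> box1 (x - t)" for t .
      show "integrable lborel (\<lambda>t. \<bar>box1 (x - t) * cbspline m t\<bar>)"
        by (rule Bochner_Integration.integrable_bound[OF b(1)]) (use le b1 in auto)
    qed (rule b(1))
    finally show ?thesis using b(2) True by simp
  next
    case False
    have zero: "box1 (x - t) * cbspline m t = 0" for t
    proof (rule ccontr)
      assume "box1 (x - t) * cbspline m t \<noteq> 0"
      then have "box1 (x - t) \<noteq> 0" "cbspline m t \<noteq> 0" by auto
      then have "x - t \<in> {-(1/2)..1/2}" "t \<in> {- (real m + 1)..real m + 1}"
        using Suc.IH[of t]
        by (simp add: box1_def indicator_def split: if_splits, cases "t \<in> {- (real m + 1)..real m + 1}", simp_all)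
      then have "x \<in> {- (real (Suc m) + 1)..real (Suc m) + 1}" by auto
      with False show False by simp
    qed
    have "cbspline (Suc m) x = 0" unfolding cbspline.simps zero by simp
    with False show ?thesis by simp
  qed
qed

text \<open>B is known only by its Fourier transform. Uniqueness identifies it almost everywhere
  with the centred spline of order m, translated by c, which is half the parity of m.\<close>

lemma bspline_properties:
  assumes B: "is_bspline m B" and m: "1 \<le> m"
  shows "integrable lborel B" "(LINT x|lborel. B x) = 1"
    "AE x in lborel. \<bar>B x\<bar> \<le> indicator {- (real m + 1)..real m + 1} x"
proof -
  show i: "integrable lborel B" using B by (simp add: is_bspline_def)
  have ft: "ft B \<omega> = exp (- \<i> * of_real (real (m mod 2) * \<omega> / 2)) * of_real (sinc (\<omega> / 2)) ^ m" for \<omega>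
    using B unfolding is_bspline_def ft_def by blast
  have "complex_of_real (LINT x|lborel. B x) = 1"
    unfolding ft_0[symmetric] ft by simp
  then show "(LINT x|lborel. B x) = 1" by (simp only: of_real_eq_1_iff)
  define c where "c = real (m mod 2) / 2"
  have c: "0 \<le> c" "c \<le> 1 / 2" by (auto simp: c_def)
  let ?N = "\<lambda>x. cbspline (m - 1) (x - c)"
  have "AE x in lborel. B x = ?N x"
  proof (rule ft_unique[OF i])
    show "integrable lborel ?N"
      using lborel_integrable_real_affine[OF cbspline_integrable, of 1 "m - 1" "- c"] by simp
    show "ft B \<omega> = ft ?N \<omega>" for \<omega>
      using m by (simp add: ft_shift ft_cbspline ft c_def ac_simps)
  qed
  then show "AE x in lborel. \<bar>B x\<bar> \<le> indicator {- (real m + 1)..real m + 1} x"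
  proof eventually_elim
    case (elim x)
    have "\<bar>?N x\<bar> \<le> indicator {- (real (m - 1) + 1)..real (m - 1) + 1} (x - c)" by (rule cbspline_bound)
    also have "\<dots> \<le> indicator {- (real m + 1)..real m + 1} x"
      using c m by (auto simp: indicator_def of_nat_diff)
    finally show ?case using elim by simp
  qed
qed

section \<open>Vanishing moments of the filters\<close>

definition moment :: "(int \<Rightarrow> real) \<Rightarrow> nat \<Rightarrow> real" where
  "moment h i = (\<Sum>k | h k \<noteq> 0. h k * real_of_int k ^ i)"

text \<open>Taylor expansion of the exponentials: the coefficient of \<omega>^j is a multiple of the
  j-th moment, so with the lower moments gone the i-th is the leading term. The arguments are purely
  imaginary, which keeps the remainder polynomial in \<omega>.\<close>

lemma trig_sum_expansion:
  assumes fin: "finite {k. h k \<noteq> 0}" and vanish: "\<And>j. j < i \<Longrightarrow> moment h j = 0"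
  shows "((\<lambda>\<omega>::real. (\<Sum>k | h k \<noteq> 0. of_real (h k) * exp (- \<i> * of_real (real_of_int k * \<omega>))) / of_real \<omega> ^ i)
     \<longlongrightarrow> (- \<i>) ^ i / fact i * of_real (moment h i)) (at 0)"
proof -
  let ?S = "{k. h k \<noteq> 0}"
  let ?G = "\<lambda>\<omega>::real. \<Sum>k\<in>?S. of_real (h k) * exp (- \<i> * of_real (real_of_int k * \<omega>))"
  let ?c = "(- \<i>) ^ i / fact i * of_real (moment h i)"
  define C where "C = (\<Sum>k\<in>?S. \<bar>h k\<bar> * \<bar>real_of_int k\<bar> ^ Suc i)"
  have bound: "norm (?G \<omega> / of_real \<omega> ^ i - ?c) \<le> C * \<bar>\<omega>\<bar>" if w: "\<omega> \<noteq> 0" for \<omega>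
  proof -
    let ?z = "\<lambda>k. - \<i> * of_real (real_of_int k * \<omega>)"
    have zp: "?z k ^ j = (- \<i>) ^ j * of_real \<omega> ^ j * of_real (real_of_int k ^ j)" for k j
      unfolding power_mult_distrib of_real_mult of_real_power by (simp only: ac_simps)
    have "(\<Sum>k\<in>?S. of_real (h k) * (\<Sum>j\<le>i. ?z k ^ j / fact j))
        = (\<Sum>j\<le>i. \<Sum>k\<in>?S. of_real (h k) * (?z k ^ j / fact j))"
      unfolding sum_distrib_left by (rule sum.swap)
    also have "\<dots> = (\<Sum>j\<le>i. (- \<i>) ^ j * of_real \<omega> ^ j / fact j * of_real (moment h j))"
      unfolding zp unfolding moment_def of_real_sum sum_distrib_left of_real_mult
      by (intro sum.cong refl) (simp add: ac_simps)
    also have "\<dots> = (\<Sum>j\<in>{i}. (- \<i>) ^ j * of_real \<omega> ^ j / fact j * of_real (moment h j))"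
      using vanish by (intro sum.mono_neutral_right) auto
    also have "\<dots> = ?c * of_real \<omega> ^ i" by simp
    finally have T: "(\<Sum>k\<in>?S. of_real (h k) * (\<Sum>j\<le>i. ?z k ^ j / fact j)) = ?c * of_real \<omega> ^ i" .
    have "?G \<omega> - ?c * of_real \<omega> ^ i = (\<Sum>k\<in>?S. of_real (h k) * (exp (?z k) - (\<Sum>j\<le>i. ?z k ^ j / fact j)))"
      unfolding T[symmetric] by (simp add: right_diff_distrib sum_subtractf)
    then have "norm (?G \<omega> - ?c * of_real \<omega> ^ i) \<le> (\<Sum>k\<in>?S. norm (of_real (h k) * (exp (?z k) - (\<Sum>j\<le>i. ?z k ^ j / fact j))))"
      by (simp only: norm_sum)
    also have "\<dots> \<le> (\<Sum>k\<in>?S. \<bar>h k\<bar> * \<bar>real_of_int k\<bar> ^ Suc i * \<bar>\<omega>\<bar> ^ Suc i)"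
    proof (rule sum_mono)
      fix k assume "k \<in> ?S"
      have "norm (exp (?z k) - (\<Sum>j\<le>i. ?z k ^ j / fact j)) \<le> exp \<bar>Re (?z k)\<bar> * norm (?z k) ^ Suc i / fact i"
        by (rule Taylor_exp)
      also have "\<dots> = (\<bar>real_of_int k\<bar> * \<bar>\<omega>\<bar>) ^ Suc i / fact i"
        by (simp add: norm_mult)
      also have "\<dots> \<le> (\<bar>real_of_int k\<bar> * \<bar>\<omega>\<bar>) ^ Suc i / 1"
        by (intro divide_left_mono) (auto simp: fact_ge_1)
      finally have "norm (exp (?z k) - (\<Sum>j\<le>i. ?z k ^ j / fact j)) \<le> \<bar>real_of_int k\<bar> ^ Suc i * \<bar>\<omega>\<bar> ^ Suc i"
        by (simp only: power_mult_distrib div_by_1)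
      from mult_left_mono[OF this, of "\<bar>h k\<bar>"]
      show "norm (of_real (h k) * (exp (?z k) - (\<Sum>j\<le>i. ?z k ^ j / fact j))) \<le> \<bar>h k\<bar> * \<bar>real_of_int k\<bar> ^ Suc i * \<bar>\<omega>\<bar> ^ Suc i"
        unfolding norm_mult norm_of_real by (simp only: mult.assoc abs_ge_zero simp_thms)
    qed
    also have "\<dots> = C * \<bar>\<omega>\<bar> ^ Suc i" by (simp add: C_def sum_distrib_right)
    finally have le: "norm (?G \<omega> - ?c * of_real \<omega> ^ i) \<le> C * \<bar>\<omega>\<bar> ^ Suc i" .
    have "?G \<omega> / of_real \<omega> ^ i - ?c = (?G \<omega> - ?c * of_real \<omega> ^ i) / of_real \<omega> ^ i"
      using w by (simp only: diff_divide_distrib) simp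
    then have "norm (?G \<omega> / of_real \<omega> ^ i - ?c) = norm (?G \<omega> - ?c * of_real \<omega> ^ i) / \<bar>\<omega>\<bar> ^ i"
      by (simp only: norm_divide norm_power norm_of_real)
    also have "\<dots> \<le> C * \<bar>\<omega>\<bar> ^ Suc i / \<bar>\<omega>\<bar> ^ i" by (intro divide_right_mono le) simp
    also have "\<dots> = C * \<bar>\<omega>\<bar>" using w by simp
    finally show ?thesis .
  qed
  have "((\<lambda>\<omega>. ?G \<omega> / of_real \<omega> ^ i - ?c) \<longlongrightarrow> 0) (at 0)"
  proof (rule Lim_null_comparison[where g="\<lambda>\<omega>. C * \<bar>\<omega>\<bar>"])
    show "\<forall>\<^sub>F \<omega> in at 0. norm (?G \<omega> / of_real \<omega> ^ i - ?c) \<le> C * \<bar>\<omega>\<bar>"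
      using bound by (auto simp: eventually_at intro!: exI[of _ 1])
    have "((\<lambda>\<omega>. C * \<bar>\<omega>\<bar>) \<longlongrightarrow> C * \<bar>0\<bar>) (at (0::real))" by (intro tendsto_intros)
    then show "((\<lambda>\<omega>. C * \<bar>\<omega>\<bar>) \<longlongrightarrow> 0) (at (0::real))" by simp
  qed
  then show ?thesis by (rule LIM_zero_cancel)
qed

text \<open>The symbol of the filter has a zero of order exactly r at the origin, from the factor
  sin(\<omega>/2)^r. Comparing its leading term with the moment expansion, by induction on the
  order, gives the moments.\<close>

lemma filter_moments:
  assumes h: "is_filter m r h" and r: "r \<le> m"
  shows "\<And>i. i < r \<Longrightarrow> moment h i = 0" "moment h r \<noteq> 0" "finite {k. h k \<noteq> 0}"
proof -
  show fin: "finite {k. h k \<noteq> 0}" using h by (simp add: is_filter_def)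
  let ?G = "\<lambda>\<omega>::real. \<Sum>k | h k \<noteq> 0. of_real (h k) * exp (- \<i> * of_real (real_of_int k * \<omega>))"
  obtain \<sigma> :: complex where \<sigma>: "\<sigma> \<in> {1, - 1}" and G: "\<And>\<omega>. ?G \<omega> = \<sigma> * \<i> ^ r * of_real (sqrt (real (m choose r)))
          * exp (- \<i> * of_real (real (m mod 2) * \<omega> / 2))
          * of_real (cos (\<omega> / 2) ^ (m - r) * sin (\<omega> / 2) ^ r)"
    using h unfolding is_filter_def by blast
  let ?K = "\<sigma> * \<i> ^ r * of_real (sqrt (real (m choose r)))"
  have K: "?K \<noteq> 0" using \<sigma> r by (auto simp: binomial_eq_0_iff)
  have sin_lim: "((\<lambda>\<omega>::real. sin (\<omega> / 2) / \<omega>) \<longlongrightarrow> 1 / 2) (at 0)"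
  proof -
    have "((\<lambda>\<omega>::real. sin (\<omega> / 2)) has_real_derivative 1 / 2) (at 0)"
      by (auto intro!: derivative_eq_intros)
    then show ?thesis by (simp add: has_field_derivative_iff)
  qed
  have sin0: "((\<lambda>\<omega>::real. sin (\<omega> / 2)) \<longlongrightarrow> 0) (at 0)"
  proof -
    have "((\<lambda>\<omega>::real. sin (\<omega> / 2)) \<longlongrightarrow> sin (0 / 2)) (at 0)" by (intro tendsto_intros) auto
    then show ?thesis by simp
  qed
  have cos1: "((\<lambda>\<omega>::real. cos (\<omega> / 2)) \<longlongrightarrow> 1) (at 0)"
  proof -
    have "((\<lambda>\<omega>::real. cos (\<omega> / 2)) \<longlongrightarrow> cos (0 / 2)) (at 0)" by (intro tendsto_intros) auto
    then show ?thesis by simp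
  qed
  have exp1: "((\<lambda>\<omega>::real. exp (- \<i> * of_real (real (m mod 2) * \<omega> / 2))) \<longlongrightarrow> (1::complex)) (at 0)"
  proof -
    have "((\<lambda>\<omega>::real. exp (- \<i> * of_real (real (m mod 2) * \<omega> / 2))) \<longlongrightarrow> (exp (- \<i> * of_real (real (m mod 2) * 0 / 2)) :: complex)) (at 0)"
      by (intro tendsto_intros) auto
    then show ?thesis by simp
  qed
  \<comment> \<open>One formula for all i up to r: the power 0^(r - i) is 0 for i < r and 1 for i =
    r.\<close>
  have lim: "((\<lambda>\<omega>. ?G \<omega> / of_real \<omega> ^ i) \<longlongrightarrow> ?K * of_real ((1/2) ^ i * 0 ^ (r - i))) (at 0)" if i: "i \<le> r" for i
  proof -
    have "((\<lambda>\<omega>. ?K * exp (- \<i> * of_real (real (m mod 2) * \<omega> / 2))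
        * of_real (cos (\<omega> / 2) ^ (m - r) * ((sin (\<omega> / 2) / \<omega>) ^ i * sin (\<omega> / 2) ^ (r - i))))
        \<longlongrightarrow> ?K * 1 * of_real (1 ^ (m - r) * ((1/2) ^ i * 0 ^ (r - i)))) (at 0)"
      by (intro tendsto_intros sin_lim sin0 cos1 exp1)
    moreover have "?K * exp (- \<i> * of_real (real (m mod 2) * \<omega> / 2))
        * of_real (cos (\<omega> / 2) ^ (m - r) * ((sin (\<omega> / 2) / \<omega>) ^ i * sin (\<omega> / 2) ^ (r - i))) = ?G \<omega> / of_real \<omega> ^ i" for \<omega>
    proof -
      have "sin (\<omega> / 2) ^ r = sin (\<omega> / 2) ^ i * sin (\<omega> / 2) ^ (r - i)"
        using i by (simp flip: power_add)
      then show ?thesis unfolding G by (simp add: power_divide)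
    qed
    ultimately show ?thesis by simp
  qed
  have vanish: "moment h i = 0" if "i < r" for i
    using that
  proof (induction i rule: less_induct)
    case (less i)
    have "(- \<i>) ^ i / fact i * of_real (moment h i) = ?K * of_real ((1/2) ^ i * 0 ^ (r - i))"
      by (rule tendsto_unique[OF _ trig_sum_expansion[OF fin] lim]) (use less in auto)
    then show ?case using less.prems by (simp add: power_0_left)
  qed
  then show "\<And>i. i < r \<Longrightarrow> moment h i = 0" .
  have "(- \<i>) ^ r / fact r * of_real (moment h r) = ?K * of_real ((1/2) ^ r * 0 ^ (r - r))"
    by (rule tendsto_unique[OF _ trig_sum_expansion[OF fin] lim]) (use vanish in auto)
  then show "moment h r \<noteq> 0" using K by auto
qed

text \<open>In the binomial expansion all moments below r vanish, so the sum does not depend on the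
  offset z.\<close>

lemma shifted_moment:
  assumes h: "is_filter m r h" and r: "r \<le> m"
  shows "(\<Sum>k | h k \<noteq> 0. h k * (z + t * real_of_int k) ^ r) = t ^ r * moment h r"
proof -
  note f = filter_moments[OF h r]
  have "(\<Sum>k | h k \<noteq> 0. h k * (z + t * real_of_int k) ^ r)
      = (\<Sum>k | h k \<noteq> 0. \<Sum>j\<le>r. of_nat (r choose j) * z ^ (r - j) * t ^ j * (h k * real_of_int k ^ j))"
    by (subst add.commute, subst binomial_ring)
       (simp add: sum_distrib_left power_mult_distrib ac_simps)
  also have "\<dots> = (\<Sum>j\<le>r. of_nat (r choose j) * z ^ (r - j) * t ^ j * moment h j)"
    unfolding moment_def by (subst sum.swap) (simp add: sum_distrib_left)
  also have "\<dots> = (\<Sum>j\<in>{r}. of_nat (r choose j) * z ^ (r - j) * t ^ j * moment h j)"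
    using f(1) by (intro sum.mono_neutral_right) auto
  finally show ?thesis by simp
qed

section \<open>Compactly supported weak primitives\<close>

text \<open>The complement of the essential support is an uncountable union of sets where f vanishes
  almost everywhere; Lindelof reduces it to a countable one.\<close>

lemma ess_supp_AE: "AE x in lborel. x \<notin> ess_supp f \<longrightarrow> f x = 0"
proof -
  let ?F = "{U. open U \<and> (AE x in lborel. x \<in> U \<longrightarrow> f x = 0)}"
  obtain F' where F': "F' \<subseteq> ?F" "countable F'" "\<Union>F' = \<Union>?F"
    using Lindelof[of ?F] by auto
  have "AE x in lborel. \<forall>U\<in>F'. x \<in> U \<longrightarrow> f x = 0"
    using F' by (subst AE_ball_countable) auto
  then show ?thesis
    by eventually_elim (use F'(3) in \<open>auto simp: ess_supp_def\<close>)
qed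

lemma ess_supp_subset:
  assumes "closed S" "AE x in lborel. x \<notin> S \<longrightarrow> f x = 0"
  shows "ess_supp f \<subseteq> S"
  using assms by (auto simp: ess_supp_def open_Compl intro!: exI[of _ "- S"])

abbreviation Qbox :: "real \<Rightarrow> point set" where "Qbox R \<equiv> cbox (- R, - R) (R, R)"

text \<open>Bounded with compact support, both up to null sets because the framelet data are
  determined only almost everywhere. The constants are explicit so that finitely many functions can
  share them.\<close>

definition bcs :: "real \<Rightarrow> real \<Rightarrow> (point \<Rightarrow> real) \<Rightarrow> bool" where
  "bcs R M f \<longleftrightarrow> f \<in> borel_measurable borel \<and> 0 \<le> R \<and> 0 \<le> M \<and>
     (AE y in lborel. \<bar>f y\<bar> \<le> M * indicator (Qbox R) y)"

lemma Qbox_mono: "R \<le> R' \<Longrightarrow> Qbox R \<subseteq> Qbox R'"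
  by (auto simp: mem_cbox_point)

lemma bcs_mono:
  assumes "bcs R M f" "R \<le> R'" "M \<le> M'"
  shows "bcs R' M' f"
  unfolding bcs_def
proof (intro conjI)
  show "AE y in lborel. \<bar>f y\<bar> \<le> M' * indicator (Qbox R') y"
  proof -
    have "AE y in lborel. \<bar>f y\<bar> \<le> M * indicator (Qbox R) y" using assms(1) by (simp add: bcs_def)
    then show ?thesis
  proof (eventually_elim)
    case (elim y)
    then show ?case
      using assms(1,3) subsetD[OF Qbox_mono[OF assms(2)], of y]
      by (cases "y \<in> Qbox R"; cases "y \<in> Qbox R'") (simp_all add: bcs_def)
  qed
  qed
qed (use assms in \<open>auto simp: bcs_def\<close>)

lemma bcs_measurable: "bcs R M f \<Longrightarrow> f \<in> borel_measurable borel"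
  by (simp add: bcs_def)

lemma bcs_vanish: "bcs R M f \<Longrightarrow> AE y in lborel. y \<notin> Qbox R \<longrightarrow> f y = 0"
proof -
  assume "bcs R M f"
  then have "AE y in lborel. \<bar>f y\<bar> \<le> M * indicator (Qbox R) y" by (simp add: bcs_def)
  then show ?thesis
  proof eventually_elim
    case (elim y)
    then show ?case by (cases "y \<in> Qbox R") simp_all
  qed
qed

lemma integrable_Qbox: "integrable lborel (\<lambda>y. c * indicator (Qbox R) y :: real)"
proof -
  have "emeasure lborel (Qbox R) < \<infinity>" by (rule emeasure_bounded_finite) simp
  then show ?thesis by simp
qed

lemma bcs_integrable: "bcs R M f \<Longrightarrow> integrable lborel f"
  by (rule Bochner_Integration.integrable_bound[OF integrable_Qbox[of M R]])
     (auto simp: bcs_def elim!: eventually_mono)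

lemma bcs_cmult: "bcs R M f \<Longrightarrow> bcs R (\<bar>c\<bar> * M) (\<lambda>x. c * f x)"
  by (auto simp: bcs_def abs_mult mult.assoc intro!: mult_left_mono elim!: eventually_mono)

lemma bcs_affine:
  assumes f: "bcs R M f" and c: "c > 0"
  shows "\<exists>R'. bcs R' M (\<lambda>x. f (c *\<^sub>R x - t))"
proof -
  define R' where "R' = (R + \<bar>fst t\<bar> + \<bar>snd t\<bar>) / c"
  have [measurable]: "f \<in> borel_measurable borel" using f by (simp add: bcs_def)
  have "AE x in lborel. \<bar>f (c *\<^sub>R x - t)\<bar> \<le> M * indicator (Qbox R) (c *\<^sub>R x - t)"
    using f by (intro AE_affine_diff[OF c]) (auto simp: bcs_def)
  moreover have "indicator (Qbox R) (c *\<^sub>R x - t) \<le> (indicator (Qbox R') x :: real)" for x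
  proof (cases "c *\<^sub>R x - t \<in> Qbox R")
    case True
    then have "\<bar>c * fst x - fst t\<bar> \<le> R" "\<bar>c * snd x - snd t\<bar> \<le> R" by (auto simp: mem_cbox_point)
    then have "- (R + \<bar>fst t\<bar> + \<bar>snd t\<bar>) \<le> c * fst x \<and> c * fst x \<le> R + \<bar>fst t\<bar> + \<bar>snd t\<bar>
      \<and> - (R + \<bar>fst t\<bar> + \<bar>snd t\<bar>) \<le> c * snd x \<and> c * snd x \<le> R + \<bar>fst t\<bar> + \<bar>snd t\<bar>" by linarith
    then have "x \<in> Qbox R'"
      using c by (auto simp: mem_cbox_point R'_def field_simps)
    then show ?thesis using True by simp
  qed simp
  ultimately have "AE x in lborel. \<bar>f (c *\<^sub>R x - t)\<bar> \<le> M * indicator (Qbox R') x"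
    using f by (auto simp: bcs_def elim!: eventually_mono intro: order_trans[OF _ mult_left_mono])
  then have "bcs R' M (\<lambda>x. f (c *\<^sub>R x - t))"
    using f c by (auto simp: bcs_def R'_def)
  then show ?thesis by blast
qed

lemma bcs_0: "bcs 0 0 (\<lambda>x. 0)"
  by (simp add: bcs_def)

lemma bcs_add:
  assumes "bcs R M f" "bcs R' M' g"
  shows "bcs (max R R') (M + M') (\<lambda>x. f x + g x)"
proof -
  have "bcs (max R R') M f" "bcs (max R R') M' g"
    using assms by (auto intro: bcs_mono)
  note fg = this[unfolded bcs_def]
  have "AE y in lborel. \<bar>f y + g y\<bar> \<le> (M + M') * indicator (Qbox (max R R')) y"
    using fg(1)[THEN conjunct2, THEN conjunct2, THEN conjunct2] fg(2)[THEN conjunct2, THEN conjunct2, THEN conjunct2]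
    by eventually_elim (simp only: distrib_right, linarith)
  then show ?thesis unfolding bcs_def using fg by (intro conjI borel_measurable_add) auto
qed

lemma bcs_sum:
  assumes "\<And>i. i \<in> I \<Longrightarrow> \<exists>R M. bcs R M (f i)"
  shows "\<exists>R M. bcs R M (\<lambda>x. \<Sum>i\<in>I. f i x)"
  using assms
proof (induction I rule: infinite_finite_induct)
  case (insert i I)
  then obtain R M R' M' where "bcs R M (f i)" "bcs R' M' (\<lambda>x. \<Sum>i\<in>I. f i x)" by force
  from bcs_add[OF this] insert show ?case by auto
qed (use bcs_0 in auto)

lemma bcs_continuous_mult_integrable:
  assumes w: "bcs R M w" and p: "continuous_on UNIV p"
  shows "integrable lborel (\<lambda>z. p z * w z)"
proof -
  have "bounded (p ` Qbox R)"
    by (intro compact_imp_bounded compact_continuous_image continuous_on_subset[OF p]) auto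
  then obtain B where B: "\<And>z. z \<in> Qbox R \<Longrightarrow> \<bar>p z\<bar> \<le> B" unfolding bounded_iff by (metis imageI real_norm_def)
  have [measurable]: "p \<in> borel_measurable borel" "w \<in> borel_measurable borel"
    using w p by (auto simp: bcs_def borel_measurable_continuous_onI)
  have "integrable lborel (\<lambda>z. B * w z)" using bcs_integrable[OF w] by simp
  then show ?thesis
  proof (rule Bochner_Integration.integrable_bound)
    show "AE z in lborel. norm (p z * w z) \<le> norm (B * w z)"
      using bcs_vanish[OF w]
    proof eventually_elim
      case (elim z)
      show ?case
      proof (cases "z \<in> Qbox R")
        case True
        have "\<bar>p z\<bar> \<le> \<bar>B\<bar>" using B[OF True] by linarith
        then show ?thesis by (simp add: abs_mult mult_right_mono)
      qed (use elim in simp)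
    qed
  qed simp
qed

text \<open>The weak derivative on the plane as seen by products alone. In this form a dilation or
  translation is a substitution in each one-variable factor.\<close>

definition tensor_weak_deriv :: "nat \<times> nat \<Rightarrow> (point \<Rightarrow> real) \<Rightarrow> (point \<Rightarrow> real) \<Rightarrow> bool" where
  "tensor_weak_deriv \<alpha> w g \<longleftrightarrow> (\<forall>a b l1 u1 l2 u2. tst l1 u1 a \<longrightarrow> tst l2 u2 b \<longrightarrow>
     tint ((deriv ^^ fst \<alpha>) a) ((deriv ^^ snd \<alpha>) b) w = (-1) ^ (fst \<alpha> + snd \<alpha>) * tint a b g)"

lemma has_weak_deriv_UNIV_tensor: "has_weak_deriv UNIV \<alpha> w g \<Longrightarrow> tensor_weak_deriv \<alpha> w g"
  unfolding tensor_weak_deriv_def by (intro allI impI) (rule has_weak_deriv_tint, auto)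

lemma tint_affine:
  assumes c: "c > 0" and [measurable]: "w \<in> borel_measurable borel" and ab: "smooth a" "smooth b"
  shows "tint a b (\<lambda>x. w (c *\<^sub>R x - t))
    = 1 / c\<^sup>2 * tint (\<lambda>s. a (1 / c * s + fst t / c)) (\<lambda>s. b (1 / c * s + snd t / c)) w"
proof -
  have [measurable]: "a \<in> borel_measurable borel" "b \<in> borel_measurable borel"
    using ab by (auto intro: smooth_measurable)
  let ?G = "\<lambda>y. a (1 / c * fst y + fst t / c) * b (1 / c * snd y + snd t / c) * w y"
  have "tint a b (\<lambda>x. w (c *\<^sub>R x - t)) = (LINT x|lborel. ?G (c *\<^sub>R x - t))"
    unfolding tint_def tens_def using c
    by (intro Bochner_Integration.integral_cong refl) (simp add: diff_divide_distrib)
  also have "\<dots> = 1 / c\<^sup>2 * (LINT y|lborel. ?G y)"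
    by (subst integral_affine_diff[OF c]) (auto simp: power2_eq_square)
  finally show ?thesis by (simp add: tint_def tens_def)
qed

lemma tensor_weak_deriv_affine:
  assumes wg: "tensor_weak_deriv \<alpha> w g" and c: "c > 0"
    and m: "w \<in> borel_measurable borel" "g \<in> borel_measurable borel"
  shows "tensor_weak_deriv \<alpha> (\<lambda>x. w (c *\<^sub>R x - t)) (\<lambda>x. c ^ (fst \<alpha> + snd \<alpha>) * g (c *\<^sub>R x - t))"
  unfolding tensor_weak_deriv_def
proof (intro allI impI)
  fix a b l1 u1 l2 u2 assume ab: "tst l1 u1 a" "tst l2 u2 b"
  let ?a = "\<lambda>s. a (1 / c * s + fst t / c)" and ?b = "\<lambda>s. b (1 / c * s + snd t / c)"
  let ?r = "fst \<alpha> + snd \<alpha>"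
  have sm: "smooth a" "smooth b" using ab by (auto intro: tst_smooth)
  have tst': "tst (c * l - d) (c * u - d) (\<lambda>s. f (1 / c * s + d / c))" if "tst l u f" for f l u d
    unfolding tst_def
  proof (intro conjI allI impI)
    show "smooth (\<lambda>s. f (1 / c * s + d / c))" by (rule smooth_affine[OF tst_smooth[OF that]])
    fix s assume "f (1 / c * s + d / c) \<noteq> 0"
    then have "l \<le> 1 / c * s + d / c" "1 / c * s + d / c \<le> u" using that by (auto simp: tst_def)
    then show "c * l - d \<le> s" "s \<le> c * u - d" using c by (auto simp: field_simps)
  qed
  have "tint ((deriv ^^ fst \<alpha>) a) ((deriv ^^ snd \<alpha>) b) (\<lambda>x. w (c *\<^sub>R x - t))
    = 1 / c\<^sup>2 * tint (\<lambda>s. (deriv ^^ fst \<alpha>) a (1 / c * s + fst t / c)) (\<lambda>s. (deriv ^^ snd \<alpha>) b (1 / c * s + snd t / c)) w"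
    by (rule tint_affine[OF c m(1)]) (intro smooth_funpow_deriv sm)+
  also have "tint (\<lambda>s. (deriv ^^ fst \<alpha>) a (1 / c * s + fst t / c)) (\<lambda>s. (deriv ^^ snd \<alpha>) b (1 / c * s + snd t / c)) w
    = (LINT z|lborel. c ^ ?r * (tens ((deriv ^^ fst \<alpha>) ?a) ((deriv ^^ snd \<alpha>) ?b) z * w z))"
    unfolding tint_def funpow_deriv_affine[OF sm(1)] funpow_deriv_affine[OF sm(2)]
    using c by (intro Bochner_Integration.integral_cong refl) (simp add: tens_def power_add power_one_over field_simps)
  also have "\<dots> = c ^ ?r * tint ((deriv ^^ fst \<alpha>) ?a) ((deriv ^^ snd \<alpha>) ?b) w"
    by (simp add: tint_def)
  also have "tint ((deriv ^^ fst \<alpha>) ?a) ((deriv ^^ snd \<alpha>) ?b) w = (-1) ^ ?r * tint ?a ?b g"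
    using wg tst'[OF ab(1)] tst'[OF ab(2)] unfolding tensor_weak_deriv_def by blast
  also have "1 / c\<^sup>2 * (c ^ ?r * ((-1) ^ ?r * tint ?a ?b g)) = (-1) ^ ?r * (c ^ ?r * (1 / c\<^sup>2 * tint ?a ?b g))" by simp
  also have "1 / c\<^sup>2 * tint ?a ?b g = tint a b (\<lambda>x. g (c *\<^sub>R x - t))"
    by (rule tint_affine[OF c m(2) sm, symmetric])
  also have "c ^ ?r * \<dots> = tint a b (\<lambda>x. c ^ ?r * g (c *\<^sub>R x - t))"
    unfolding tint_def by (simp only: mult.left_commute[of "tens a b _" "c ^ _"] integral_mult_right_zero)
  finally show "tint ((deriv ^^ fst \<alpha>) a) ((deriv ^^ snd \<alpha>) b) (\<lambda>x. w (c *\<^sub>R x - t))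
    = (-1) ^ ?r * tint a b (\<lambda>x. c ^ ?r * g (c *\<^sub>R x - t))" .
qed

text \<open>For compactly supported \<open>w\<close> and \<open>g\<close> a cutoff admits arbitrary smooth test functions.\<close>

lemma tensor_weak_deriv_smooth:
  assumes wg: "tensor_weak_deriv \<alpha> w g" and R: "0 \<le> R"
    and m: "w \<in> borel_measurable borel" "g \<in> borel_measurable borel"
    and van: "AE z in lborel. z \<notin> Qbox R \<longrightarrow> w z = 0" "AE z in lborel. z \<notin> Qbox R \<longrightarrow> g z = 0"
    and AB: "smooth A" "smooth B"
  shows "tint ((deriv ^^ fst \<alpha>) A) ((deriv ^^ snd \<alpha>) B) w = (-1) ^ (fst \<alpha> + snd \<alpha>) * tint A B g"
proof -
  \<comment> \<open>The radius R + 1 makes the cutoff equal to 1 on an open neighbourhood of [-R,R],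
    so all derivatives of the truncated factors agree there with those of A and B.\<close>
  let ?c = "cutoff (R + 1)"
  let ?a = "\<lambda>x. ?c x * A x" and ?b = "\<lambda>x. ?c x * B x"
  have tst: "tst (- (R + 1 + 1)) (R + 1 + 1) ?a" "tst (- (R + 1 + 1)) (R + 1 + 1) ?b"
    by (intro tst_mult_smooth tst_cutoff AB)+
  note [measurable] = m
  have eq: "tint ((deriv ^^ r) ?a) ((deriv ^^ s) ?b) h = tint ((deriv ^^ r) A) ((deriv ^^ s) B) h"
    if [measurable]: "h \<in> borel_measurable borel" and h: "AE z in lborel. z \<notin> Qbox R \<longrightarrow> h z = 0" for h r s
    unfolding tint_def
  proof (rule integral_cong_AE)
    have loc: "(deriv ^^ k) (\<lambda>x. ?c x * C x) x = (deriv ^^ k) C x" if "\<bar>x\<bar> \<le> R" for C k x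
      by (rule funpow_deriv_cong_open[where S="{-(R+1)<..<R+1}"]) (use that in \<open>auto simp: cutoff_1\<close>)
    show "AE z in lborel. tens ((deriv ^^ r) ?a) ((deriv ^^ s) ?b) z * h z = tens ((deriv ^^ r) A) ((deriv ^^ s) B) z * h z"
      using h
    proof eventually_elim
      case (elim z)
      show ?case
      proof (cases "z \<in> Qbox R")
        case True
        then have "\<bar>fst z\<bar> \<le> R" "\<bar>snd z\<bar> \<le> R" by (auto simp: mem_cbox_point)
        then show ?thesis by (simp add: tens_def loc)
      qed (use elim in simp)
    qed
    have [measurable]: "tens ((deriv ^^ r) ?a) ((deriv ^^ s) ?b) \<in> borel_measurable borel"
      "tens ((deriv ^^ r) A) ((deriv ^^ s) B) \<in> borel_measurable borel"
      by (intro tens_measurable smooth_funpow_deriv tst_smooth[OF tst(1)] tst_smooth[OF tst(2)] AB)+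
    show "(\<lambda>z. tens ((deriv ^^ r) ?a) ((deriv ^^ s) ?b) z * h z) \<in> borel_measurable lborel"
      "(\<lambda>z. tens ((deriv ^^ r) A) ((deriv ^^ s) B) z * h z) \<in> borel_measurable lborel" by measurable
  qed
  have "tint ((deriv ^^ fst \<alpha>) ?a) ((deriv ^^ snd \<alpha>) ?b) w = (-1) ^ (fst \<alpha> + snd \<alpha>) * tint ?a ?b g"
    using wg tst unfolding tensor_weak_deriv_def by blast
  then show ?thesis
    using eq[OF m(1) van(1)] eq[OF m(2) van(2), of 0 0] by simp
qed

text \<open>Repeated integration from the base point L. The vanishing clause serves to locate
  supports, the integral bound, with a factor 2R per integration, to prove boundedness of weak
  primitives.\<close>

lemma iterated_primitive:
  assumes a: "smooth a"
  obtains A where "smooth A" "(deriv ^^ r) A = a"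
    "\<And>T. convex T \<Longrightarrow> L \<in> T \<Longrightarrow> \<forall>x\<in>T. a x = 0 \<Longrightarrow> \<forall>x\<in>T. A x = 0"
    "\<And>R. \<bar>L\<bar> \<le> R \<Longrightarrow> (LINT x|lborel. indicator {-R..R} x * \<bar>A x\<bar>) \<le> (2 * R) ^ r * (LINT x|lborel. indicator {-R..R} x * \<bar>a x\<bar>)"
proof -
  have int: "integrable lborel (\<lambda>x. indicator {x0..x1} x * f x)" if "smooth f" for f x0 x1
    using borel_integrable_compact[of "{x0..x1}" f] smooth_continuous[OF that] by simp
  have "\<exists>A. smooth A \<and> (deriv ^^ r) A = a
    \<and> (\<forall>T. convex T \<longrightarrow> L \<in> T \<longrightarrow> (\<forall>x\<in>T. a x = 0) \<longrightarrow> (\<forall>x\<in>T. A x = 0))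
    \<and> (\<forall>R. \<bar>L\<bar> \<le> R \<longrightarrow> (LINT x|lborel. indicator {-R..R} x * \<bar>A x\<bar>) \<le> (2 * R) ^ r * (LINT x|lborel. indicator {-R..R} x * \<bar>a x\<bar>))"
  proof (induction r)
    case 0
    then show ?case using a by (intro exI[of _ a]) auto
  next
    case (Suc r)
    then obtain A where A0: "smooth A \<and> (deriv ^^ r) A = a
      \<and> (\<forall>T. convex T \<longrightarrow> L \<in> T \<longrightarrow> (\<forall>x\<in>T. a x = 0) \<longrightarrow> (\<forall>x\<in>T. A x = 0))
      \<and> (\<forall>R. \<bar>L\<bar> \<le> R \<longrightarrow> (LINT x|lborel. indicator {-R..R} x * \<bar>A x\<bar>) \<le> (2 * R) ^ r * (LINT x|lborel. indicator {-R..R} x * \<bar>a x\<bar>))"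
      by (rule exE)
    have A: "smooth A" "(deriv ^^ r) A = a"
      "\<And>T x. convex T \<Longrightarrow> L \<in> T \<Longrightarrow> (\<forall>x\<in>T. a x = 0) \<Longrightarrow> x \<in> T \<Longrightarrow> A x = 0"
      "\<And>R. \<bar>L\<bar> \<le> R \<Longrightarrow> (LINT x|lborel. indicator {-R..R} x * \<bar>A x\<bar>) \<le> (2 * R) ^ r * (LINT x|lborel. indicator {-R..R} x * \<bar>a x\<bar>)"
      using A0 by simp_all
    obtain A' where A': "smooth A'" "deriv A' = A" "A' L = 0" using antiderivative_exists[OF A(1)] by blast
    have dA': "(A' has_real_derivative A x) (at x)" for x using smooth_has_deriv[OF A'(1)] A'(2) by simp
    have "(deriv ^^ Suc r) A' = a" using A(2) A'(2) by (simp add: funpow_Suc_right del: funpow.simps)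
    moreover have "A' x = 0" if T: "convex T" "L \<in> T" "\<forall>x\<in>T. a x = 0" "x \<in> T" for T x
    proof -
      have "\<exists>c. \<forall>x\<in>T. A' x = c"
        using T(1) by (rule has_field_derivative_zero_constant)
          (use dA' A(3)[OF T(1-3)] in \<open>metis has_field_derivative_at_within\<close>)
      then show ?thesis using A'(3) T(2,4) by auto
    qed
    moreover have "(LINT x|lborel. indicator {-R..R} x * \<bar>A' x\<bar>) \<le> (2 * R) ^ Suc r * (LINT x|lborel. indicator {-R..R} x * \<bar>a x\<bar>)"
      if R: "\<bar>L\<bar> \<le> R" for R
    proof -
      have R0: "0 \<le> R" using R by linarith
      let ?I = "LINT x|lborel. indicator {-R..R} x * \<bar>A x\<bar>"
      have iA: "integrable lborel (\<lambda>x. indicator {-R..R} x * \<bar>A x\<bar>)"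
        using integrable_abs[OF int[OF A(1), of "-R" R]] by (simp add: abs_mult)
      have sub: "\<bar>LINT t|lborel. indicator {x..y} t * deriv A' t\<bar> \<le> ?I" if "-R \<le> x" "y \<le> R" for x y
      proof -
        have "\<bar>LINT t|lborel. indicator {x..y} t * deriv A' t\<bar> \<le> (LINT t|lborel. \<bar>indicator {x..y} t * A t\<bar>)"
          unfolding A'(2) by (rule integral_abs_bound)
        also have "\<dots> \<le> ?I"
          by (intro integral_mono iA integrable_abs int A(1)) (use that in \<open>auto simp: indicator_def\<close>)
        finally show ?thesis .
      qed
      have bd: "\<bar>A' x\<bar> \<le> ?I" if "-R \<le> x" "x \<le> R" for x
      proof (cases "L \<le> x")
        case True
        then show ?thesis using FTC_smooth[OF A'(1) True] sub[of L x] that R A'(3) by auto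
      next
        case False
        then show ?thesis using FTC_smooth[OF A'(1), of x L] sub[of x L] that R A'(3) by auto
      qed
      have "(LINT x|lborel. indicator {-R..R} x * \<bar>A' x\<bar>) \<le> (LINT x|lborel. indicator {-R..R} x * ?I)"
      proof (rule integral_mono)
        show "integrable lborel (\<lambda>x. indicator {-R..R} x * \<bar>A' x\<bar>)"
          using integrable_abs[OF int[OF A'(1), of "-R" R]] by (simp add: abs_mult)
        show "integrable lborel (\<lambda>x. indicator {-R..R} x * ?I)"
          using int[OF smooth_const, of "-R" R ?I] by simp
        show "indicator {-R..R} x * \<bar>A' x\<bar> \<le> indicator {-R..R} x * ?I" for x
          using bd[of x] by (auto simp: indicator_def)
      qed
      also have "\<dots> = 2 * R * ?I" using R0 by simp
      also have "\<dots> \<le> 2 * R * ((2 * R) ^ r * (LINT x|lborel. indicator {-R..R} x * \<bar>a x\<bar>))"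
        using R0 A(4)[OF R] by (intro mult_left_mono) auto
      finally show ?thesis by (simp add: mult.assoc)
    qed
    ultimately show ?case using A'(1) by blast
  qed
  then obtain A where A0: "smooth A \<and> (deriv ^^ r) A = a
    \<and> (\<forall>T. convex T \<longrightarrow> L \<in> T \<longrightarrow> (\<forall>x\<in>T. a x = 0) \<longrightarrow> (\<forall>x\<in>T. A x = 0))
    \<and> (\<forall>R. \<bar>L\<bar> \<le> R \<longrightarrow> (LINT x|lborel. indicator {-R..R} x * \<bar>A x\<bar>) \<le> (2 * R) ^ r * (LINT x|lborel. indicator {-R..R} x * \<bar>a x\<bar>))"
    by (rule exE)
  show ?thesis by (rule that[of A]) (use A0 in simp_all)
qed

lemma AE_zero_if_tint_zero:
  fixes f :: "point \<Rightarrow> real"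
  assumes U: "U = {a1<..<b1} \<times> {a2<..<b2}" and f: "integrable lborel f"
    and zero: "\<And>a b l1 u1 l2 u2. tst l1 u1 a \<Longrightarrow> tst l2 u2 b \<Longrightarrow> cbox (l1, l2) (u1, u2) \<subseteq> U \<Longrightarrow> tint a b f = 0"
  shows "AE z in lborel. z \<in> U \<longrightarrow> f z = 0"
proof -
  have [measurable]: "U \<in> sets borel" unfolding U by (rule rect_borel) auto
  have i: "integrable lborel (\<lambda>z. indicator U z * f z)" "integrable lborel (\<lambda>z. indicator U z * (- f z))"
    using integrable_mult_indicator[OF _ f, of U] integrable_mult_indicator[OF _ integrable_minus[OF f], of U] by simp_all
  have "tint a b (\<lambda>z. - f z) = - tint a b f" for a b by (simp add: tint_def)
  then have "AE z in lborel. z \<in> U \<longrightarrow> 0 \<le> f z" "AE z in lborel. z \<in> U \<longrightarrow> 0 \<le> - f z"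
    using AE_nonneg_if_tint_nonneg[OF U i(1)] AE_nonneg_if_tint_nonneg[OF U i(2)] zero by auto
  then show ?thesis by eventually_elim auto
qed

text \<open>By duality: for nonnegative a and b with iterated primitives A and B, the integral of w
  against a(x) b(y) equals, up to sign, that of g against A(x) B(y), which is at most M' times the
  product of the integrals of a and b. Positivity of M' + w and M' - w follows.\<close>

lemma weak_primitive_bounded:
  assumes wg: "tensor_weak_deriv \<alpha> w g" and g: "bcs R M g"
    and w: "integrable lborel w" and van: "AE z in lborel. z \<notin> Qbox R \<longrightarrow> w z = 0"
  shows "\<exists>R M. bcs R M w"
proof -
  have R0: "0 \<le> R" and M0: "0 \<le> M" using g by (auto simp: bcs_def)
  note [measurable] = borel_measurable_integrable[OF w] bcs_measurable[OF g]
  \<comment> \<open>The enlargement gives an open square U containing the closed one outside which w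
    vanishes.\<close>
  define R' where "R' = R + 1"
  define U where "U = {-R'<..<R'} \<times> {-R'<..<R'}"
  have U_borel [measurable]: "U \<in> sets borel" unfolding U_def by (rule rect_borel) auto
  define M' where "M' = M * (2 * R') ^ (fst \<alpha> + snd \<alpha>)"
  have int1: "integrable lborel (\<lambda>x. indicator {x0..x1} x * \<bar>f x\<bar>)" if "smooth f" for f and x0 x1 :: real
    using borel_integrable_compact[of "{x0..x1}" "\<lambda>x. \<bar>f x\<bar>"] smooth_continuous[OF that]
    by (simp add: continuous_on_rabs)
  have key: "\<bar>tint a b w\<bar> \<le> tint a b (\<lambda>z. M')"
    if ab: "tst l1 u1 a" "tst l2 u2 b" and nn: "\<And>x. 0 \<le> a x" "\<And>x. 0 \<le> b x" for a b l1 u1 l2 u2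
  proof -
    have R'0: "\<bar>0::real\<bar> \<le> R'" using R0 by (simp add: R'_def)
    obtain A where A: "smooth A" "(deriv ^^ fst \<alpha>) A = a"
      "(LINT x|lborel. indicator {-R'..R'} x * \<bar>A x\<bar>) \<le> (2 * R') ^ fst \<alpha> * (LINT x|lborel. indicator {-R'..R'} x * \<bar>a x\<bar>)"
      by (rule iterated_primitive[OF tst_smooth[OF ab(1)], of "fst \<alpha>" 0]) (rule that, use R'0 in simp_all)
    obtain B where B: "smooth B" "(deriv ^^ snd \<alpha>) B = b"
      "(LINT x|lborel. indicator {-R'..R'} x * \<bar>B x\<bar>) \<le> (2 * R') ^ snd \<alpha> * (LINT x|lborel. indicator {-R'..R'} x * \<bar>b x\<bar>)"
      by (rule iterated_primitive[OF tst_smooth[OF ab(2)], of "snd \<alpha>" 0]) (rule that, use R'0 in simp_all)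
    have le1: "(LINT x|lborel. indicator {-R'..R'} x * \<bar>f x\<bar>) \<le> (LINT x|lborel. f x)"
      if "tst l u f" "\<And>x. 0 \<le> f x" for f l u
      by (intro integral_mono int1 tst_smooth[OF that(1)] tst_integrable[OF that(1)])
         (use that(2) in \<open>auto simp: indicator_def\<close>)
    have nnA: "0 \<le> (LINT x|lborel. indicator {-R'..R'} x * \<bar>f x\<bar>)"
      for f :: "real \<Rightarrow> real"
      by (intro Bochner_Integration.integral_nonneg) auto
    have "\<bar>tint a b w\<bar> = \<bar>tint A B g\<bar>"
      using tensor_weak_deriv_smooth[OF wg R0 _ _ van bcs_vanish[OF g] A(1) B(1)] A(2) B(2)
      by (simp add: abs_mult)
    also have "\<dots> \<le> (LINT z|lborel. \<bar>tens A B z * g z\<bar>)"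
      unfolding tint_def by (rule integral_abs_bound)
    also have "\<dots> \<le> (LINT z|lborel. M * ((indicator {-R'..R'} (fst z) * \<bar>A (fst z)\<bar>) * (indicator {-R'..R'} (snd z) * \<bar>B (snd z)\<bar>)))"
    proof (rule integral_mono_AE)
      show "integrable lborel (\<lambda>z. \<bar>tens A B z * g z\<bar>)"
        by (intro integrable_abs bcs_continuous_mult_integrable[OF g] continuous_on_tens A B)
      show "integrable lborel (\<lambda>z. M * ((indicator {-R'..R'} (fst z) * \<bar>A (fst z)\<bar>) * (indicator {-R'..R'} (snd z) * \<bar>B (snd z)\<bar>)))"
        by (intro integrable_mult_right integral_tensor(1) int1 A B)
      have "AE z in lborel. \<bar>g z\<bar> \<le> M * indicator (Qbox R) z" using g by (simp add: bcs_def)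
      then show "AE z in lborel. \<bar>tens A B z * g z\<bar>
          \<le> M * ((indicator {-R'..R'} (fst z) * \<bar>A (fst z)\<bar>) * (indicator {-R'..R'} (snd z) * \<bar>B (snd z)\<bar>))"
      proof eventually_elim
        case (elim z)
        show ?case
        proof (cases "z \<in> Qbox R")
          case True
          then have "fst z \<in> {-R'..R'}" "snd z \<in> {-R'..R'}" by (auto simp: mem_cbox_point R'_def)
          then show ?thesis
            using elim True mult_left_mono[of "\<bar>g z\<bar>" M "\<bar>A (fst z)\<bar> * \<bar>B (snd z)\<bar>"]
            by (simp add: tens_def abs_mult ac_simps)
        next
          case False
          then show ?thesis using elim M0 by simp
        qed
      qed
    qed
    also have "\<dots> = M * ((LINT x|lborel. indicator {-R'..R'} x * \<bar>A x\<bar>) * (LINT x|lborel. indicator {-R'..R'} x * \<bar>B x\<bar>))"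
      using integral_tensor(2)[OF int1[OF A(1)] int1[OF B(1)]] by simp
    also have "\<dots> \<le> M * (((2 * R') ^ fst \<alpha> * (LINT x|lborel. a x)) * ((2 * R') ^ snd \<alpha> * (LINT x|lborel. b x)))"
    proof (intro mult_left_mono mult_mono M0 nnA)
      have "0 \<le> 2 * R'" using R0 by (simp add: R'_def)
      then have pw: "0 \<le> (2 * R') ^ k" for k by simp
      show "(LINT x|lborel. indicator {-R'..R'} x * \<bar>A x\<bar>) \<le> (2 * R') ^ fst \<alpha> * (LINT x|lborel. a x)"
        by (rule order_trans[OF A(3)]) (intro mult_left_mono pw, use le1[OF ab(1) nn(1)] nn in simp)
      show "(LINT x|lborel. indicator {-R'..R'} x * \<bar>B x\<bar>) \<le> (2 * R') ^ snd \<alpha> * (LINT x|lborel. b x)"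
        by (rule order_trans[OF B(3)]) (intro mult_left_mono pw, use le1[OF ab(2) nn(2)] nn in simp)
      show "0 \<le> (2 * R') ^ fst \<alpha> * (LINT x|lborel. a x)"
        using nn by (intro mult_nonneg_nonneg pw Bochner_Integration.integral_nonneg) auto
    qed
    also have "\<dots> = M' * ((LINT x|lborel. a x) * (LINT x|lborel. b x))"
      by (simp add: M'_def power_add)
    also have "\<dots> = tint a b (\<lambda>z. M')"
      using integral_tensor(2)[OF tst_integrable[OF ab(1)] tst_integrable[OF ab(2)]] by (simp add: tint_def tens_def)
    finally show ?thesis .
  qed
  have sgn: "AE z in lborel. z \<in> U \<longrightarrow> 0 \<le> M' + c * w z" if c: "c = 1 \<or> c = - 1" for c
  proof (rule AE_nonneg_if_tint_nonneg[OF U_def])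
    have "emeasure lborel U < \<infinity>" by (rule emeasure_bounded_finite) (simp add: U_def bounded_Times)
    then have iM: "integrable lborel (\<lambda>z. indicator U z * M')" by simp
    have iw: "integrable lborel (\<lambda>z. indicator U z * w z)"
      using integrable_mult_indicator[OF _ w, of U] by simp
    show "integrable lborel (\<lambda>z. indicator U z * (M' + c * w z))"
      using iM integrable_mult_right[OF iw, of c] by (simp add: distrib_left mult.left_commute)
    fix a b l1 u1 l2 u2 assume t: "tst l1 u1 a" "tst l2 u2 b" "cbox (l1, l2) (u1, u2) \<subseteq> U"
      and nn: "\<And>x. 0 \<le> a x" "\<And>x. 0 \<le> b x"
    have "tint a b (\<lambda>z. M' + c * w z) = tint a b (\<lambda>z. M') + c * tint a b w"
      using tens_integrable[OF t iM] tens_integrable[OF t iw] by (simp add: tint_def distrib_left mult.left_commute)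
    then show "0 \<le> tint a b (\<lambda>z. M' + c * w z)" using key[OF t(1,2) nn] c by auto
  qed
  have "AE z in lborel. \<bar>w z\<bar> \<le> M' * indicator (Qbox R) z"
    using sgn[of 1, simplified] sgn[of "-1", simplified] van
  proof eventually_elim
    case (elim z)
    show ?case
    proof (cases "z \<in> Qbox R")
      case True
      then have "z \<in> U" by (cases z) (auto simp: U_def R'_def mem_cbox_point)
      then show ?thesis using elim True by auto
    qed (use elim in simp)
  qed
  then have "bcs R M' w" using R0 M0 by (simp add: bcs_def M'_def R'_def)
  then show ?thesis by blast
qed

text \<open>The box hull of the support does not grow under taking compactly supported primitives:
  integrate away from the hull.\<close>

lemma weak_primitive_support:
  assumes wg: "tensor_weak_deriv \<alpha> w g" and w: "bcs R M w" and g: "bcs R M g"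
    and supp: "AE z in lborel. z \<notin> closure Omega \<longrightarrow> g z = 0"
  shows "AE z in lborel. z \<notin> closure Omega \<longrightarrow> w z = 0"
proof -
  have R0: "0 \<le> R" using g by (auto simp: bcs_def)
  note [measurable] = bcs_measurable[OF w] bcs_measurable[OF g]
  \<comment> \<open>The base points lie in S and T, so A vanishes on S and B on T. If S or T
    contains [0,1], then A(x) B(y) vanishes on the closed square, where g lives.\<close>
  have zero: "tint a b w = 0"
    if ab: "smooth a" "smooth b" and T: "convex S" "L1 \<in> S" "\<And>x. x \<in> S \<Longrightarrow> a x = 0 "
      "convex T" "L2 \<in> T" "\<And>x. x \<in> T \<Longrightarrow> b x = 0" and ST: "{0..1} \<subseteq> S \<or> {0..1} \<subseteq> T" for a b L1 L2 S T
  proof -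
    obtain A where A: "smooth A" "(deriv ^^ fst \<alpha>) A = a" "\<And>x. x \<in> S \<Longrightarrow> A x = 0"
    proof (rule iterated_primitive[OF ab(1), of "fst \<alpha>" L1])
      fix A assume A: "smooth A" "(deriv ^^ fst \<alpha>) A = a"
        and van: "\<And>T. convex T \<Longrightarrow> L1 \<in> T \<Longrightarrow> \<forall>x\<in>T. a x = 0 \<Longrightarrow> \<forall>x\<in>T. A x = 0"
      have "\<forall>x\<in>S. A x = 0" using T(3) by (intro van[OF T(1,2)]) auto
      then show thesis by (intro that[OF A]) auto
    qed
    obtain B where B: "smooth B" "(deriv ^^ snd \<alpha>) B = b" "\<And>x. x \<in> T \<Longrightarrow> B x = 0"
    proof (rule iterated_primitive[OF ab(2), of "snd \<alpha>" L2])
      fix B assume B: "smooth B" "(deriv ^^ snd \<alpha>) B = b"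
        and van: "\<And>T. convex T \<Longrightarrow> L2 \<in> T \<Longrightarrow> \<forall>x\<in>T. b x = 0 \<Longrightarrow> \<forall>x\<in>T. B x = 0"
      have "\<forall>x\<in>T. B x = 0" using T(6) by (intro van[OF T(4,5)]) auto
      then show thesis by (intro that[OF B]) auto
    qed
    have "tint A B g = 0"
      unfolding tint_def
    proof (rule integral_eq_zero_AE)
      show "AE z in lborel. tens A B z * g z = 0"
        using supp
      proof eventually_elim
        case (elim z)
        show ?case
        proof (cases "z \<in> closure Omega")
          case True
          then have "fst z \<in> {0..1}" "snd z \<in> {0..1}" by (auto simp: closure_Omega mem_cbox_point)
          then show ?thesis using ST A(3) B(3) by (auto simp: tens_def)
        qed (use elim in simp)
      qed
    qed
    then show ?thesis
      using tensor_weak_deriv_smooth[OF wg R0 _ _ bcs_vanish[OF w] bcs_vanish[OF g] A(1) B(1)] A(2) B(2) by simp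
  qed
  define R' where "R' = R + 2"
  have iw: "integrable lborel w" by (rule bcs_integrable[OF w])
  \<comment> \<open>In the coordinate without a constraint any base point where f vanishes will do;
    u + 1 is one.\<close>
  have ex: "\<exists>L T. convex T \<and> L \<in> T \<and> (\<forall>x\<in>T. f x = 0)" if "tst l u f" for f :: "real \<Rightarrow> real" and l u
    using that by (intro exI[of _ "u + 1"] exI[of _ "{u+1}"]) (force simp: tst_def)
  have in_lu: "l \<le> u \<Longrightarrow> l' \<le> u' \<Longrightarrow> cbox (l, l') (u, u') \<subseteq> {s1<..<t1} \<times> {s2<..<t2} \<Longrightarrow> s1 < l \<and> u < t1 \<and> s2 < l' \<and> u' < t2"
    for l u l' u' s1 t1 s2 t2 :: real
    using subsetD[of "cbox (l, l') (u, u')" "{s1<..<t1} \<times> {s2<..<t2}" "(l, l')"]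
      subsetD[of "cbox (l, l') (u, u')" "{s1<..<t1} \<times> {s2<..<t2}" "(u, u')"]
    by (auto simp: mem_cbox_point)
  have trivial: "tint a b w = 0" if "tst l1 u1 a" "tst l2 u2 b" "\<not> (l1 \<le> u1 \<and> l2 \<le> u2)" for a b l1 u1 l2 u2
  proof -
    have "a = (\<lambda>x. 0) \<or> b = (\<lambda>x. 0)" using that unfolding tst_def by fastforce
    then have "tens a b = (\<lambda>z. 0)" by (auto simp: tens_def fun_eq_iff)
    then show ?thesis by (simp add: tint_def)
  qed
  \<comment> \<open>Four open strips, beyond each side of the square, cover the part of the box of
    radius R outside the closed square. For each strip the primitive is integrated from the opposite
    direction, starting at the side of the square.\<close>
  have 1: "AE z in lborel. z \<in> {1<..<R'} \<times> {-R'<..<R'} \<longrightarrow> w z = 0"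
  proof (rule AE_zero_if_tint_zero[OF refl iw])
    fix a b l1 u1 l2 u2 assume t: "tst l1 u1 a" "tst l2 u2 b" "cbox (l1, l2) (u1, u2) \<subseteq> {1<..<R'} \<times> {-R'<..<R'}"
    show "tint a b w = 0"
    proof (cases "l1 \<le> u1 \<and> l2 \<le> u2")
      case True
      obtain L T where LT: "convex T" "L \<in> T" "\<forall>x\<in>T. b x = 0" using ex[OF t(2)] by blast
      show ?thesis
        by (rule zero[of a b "{..1}" 1 T L]) (use t True LT in_lu[OF _ _ t(3)] in \<open>force simp: tst_def\<close>)+
    qed (use trivial t in blast)
  qed
  have 2: "AE z in lborel. z \<in> {-R'<..<0} \<times> {-R'<..<R'} \<longrightarrow> w z = 0"
  proof (rule AE_zero_if_tint_zero[OF refl iw])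
    fix a b l1 u1 l2 u2 assume t: "tst l1 u1 a" "tst l2 u2 b" "cbox (l1, l2) (u1, u2) \<subseteq> {-R'<..<0} \<times> {-R'<..<R'}"
    show "tint a b w = 0"
    proof (cases "l1 \<le> u1 \<and> l2 \<le> u2")
      case True
      obtain L T where LT: "convex T" "L \<in> T" "\<forall>x\<in>T. b x = 0" using ex[OF t(2)] by blast
      show ?thesis
        by (rule zero[of a b "{0..}" 0 T L]) (use t True LT in_lu[OF _ _ t(3)] in \<open>force simp: tst_def\<close>)+
    qed (use trivial t in blast)
  qed
  have 3: "AE z in lborel. z \<in> {-R'<..<R'} \<times> {1<..<R'} \<longrightarrow> w z = 0"
  proof (rule AE_zero_if_tint_zero[OF refl iw])
    fix a b l1 u1 l2 u2 assume t: "tst l1 u1 a" "tst l2 u2 b" "cbox (l1, l2) (u1, u2) \<subseteq> {-R'<..<R'} \<times> {1<..<R'}"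
    show "tint a b w = 0"
    proof (cases "l1 \<le> u1 \<and> l2 \<le> u2")
      case True
      obtain L T where LT: "convex T" "L \<in> T" "\<forall>x\<in>T. a x = 0" using ex[OF t(1)] by blast
      show ?thesis
        by (rule zero[of a b T L "{..1}" 1]) (use t True LT in_lu[OF _ _ t(3)] in \<open>force simp: tst_def\<close>)+
    qed (use trivial t in blast)
  qed
  have 4: "AE z in lborel. z \<in> {-R'<..<R'} \<times> {-R'<..<0} \<longrightarrow> w z = 0"
  proof (rule AE_zero_if_tint_zero[OF refl iw])
    fix a b l1 u1 l2 u2 assume t: "tst l1 u1 a" "tst l2 u2 b" "cbox (l1, l2) (u1, u2) \<subseteq> {-R'<..<R'} \<times> {-R'<..<0}"
    show "tint a b w = 0"
    proof (cases "l1 \<le> u1 \<and> l2 \<le> u2")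
      case True
      obtain L T where LT: "convex T" "L \<in> T" "\<forall>x\<in>T. a x = 0" using ex[OF t(1)] by blast
      show ?thesis
        by (rule zero[of a b T L "{0..}" 0]) (use t True LT in_lu[OF _ _ t(3)] in \<open>force simp: tst_def\<close>)+
    qed (use trivial t in blast)
  qed
  show ?thesis
    using 1 2 3 4 bcs_vanish[OF w]
  proof eventually_elim
    case (elim z)
    show ?case
    proof
      assume z: "z \<notin> closure Omega"
      show "w z = 0"
      proof (cases "z \<in> Qbox R")
        case True
        then have "- R' < fst z" "fst z < R'" "- R' < snd z" "snd z < R'" by (auto simp: mem_cbox_point R'_def)
        moreover have "fst z < 0 \<or> 1 < fst z \<or> snd z < 0 \<or> 1 < snd z"
          using z by (auto simp: closure_Omega mem_cbox_point)
        ultimately show ?thesis using elim by (cases z) auto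
      qed (use elim in simp)
    qed
  qed
qed

section \<open>Framelet systems\<close>

definition pw :: "nat \<Rightarrow> real \<Rightarrow> real" where "pw r x = x ^ r / fact r"

lemma smooth_pw: "smooth (pw r)"
  using smooth_cmult[OF smooth_power[OF smooth_ident], of "1 / fact r" r] by (simp add: pw_def[abs_def])

lemma funpow_deriv_pw: "(deriv ^^ r) (pw r) = (\<lambda>x. 1)"
proof (induction r)
  case (Suc r)
  have "deriv (pw (Suc r)) = pw r"
  proof
    fix x
    have "(pw (Suc r) has_real_derivative real (Suc r) * x ^ r / fact (Suc r)) (at x)"
      unfolding pw_def by (rule DERIV_cong, rule DERIV_cdivide, rule DERIV_pow) simp
    also have "real (Suc r) * x ^ r / fact (Suc r) = pw r x" by (simp add: pw_def field_simps del: of_nat_Suc)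
    finally show "deriv (pw (Suc r)) x = pw r x" by (rule DERIV_imp_deriv)
  qed
  then show ?case using Suc by (simp add: funpow_Suc_right del: funpow.simps)
qed (simp add: pw_def fun_eq_iff)

text \<open>\<open>pw r\<close> is x^r / r!, whose r-th derivative is 1. Testing the weak derivative
  with these polynomials therefore reads off the integral of the primitive.\<close>

lemma weak_primitive_integral:
  assumes wg: "tensor_weak_deriv \<alpha> w g" and w: "bcs R M w" and g: "bcs R' M' g"
  shows "(LINT z|lborel. w z) = (-1) ^ (fst \<alpha> + snd \<alpha>) * tint (pw (fst \<alpha>)) (pw (snd \<alpha>)) g"
proof -
  have w': "bcs (max R R') M w" and g': "bcs (max R R') M' g" using w g by (auto intro: bcs_mono)
  have "0 \<le> max R R'" using w by (auto simp: bcs_def)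
  from tensor_weak_deriv_smooth[OF wg this bcs_measurable[OF w] bcs_measurable[OF g] bcs_vanish[OF w'] bcs_vanish[OF g'] smooth_pw smooth_pw,
      of "fst \<alpha>" "snd \<alpha>"]
  show ?thesis unfolding funpow_deriv_pw by (simp add: tint_def tens_def)
qed

text \<open>After substituting in each term, the filters act on shifted monomials. By
  \<open>shifted_moment\<close> the result is constant in y, so only the integral of \<Phi> and the
  leading moments remain. The factor 1/4 is the Jacobian of the dilation by 2.\<close>

lemma tint_refined_sum:
  assumes h1: "is_filter m r1 h1" "r1 \<le> m" and h2: "is_filter m r2 h2" "r2 \<le> m" and \<Phi>: "bcs R M \<Phi>"
  defines "S \<equiv> {k. h1 k \<noteq> 0} \<times> {k. h2 k \<noteq> 0}"
  shows "tint (pw r1) (pw r2) (\<lambda>x. C * (\<Sum>k\<in>S. h1 (fst k) * h2 (snd k) * \<Phi> (2 *\<^sub>R x - t *\<^sub>R embed k)))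
    = C / 4 * (t / 2) ^ (r1 + r2) * (moment h1 r1 / fact r1) * (moment h2 r2 / fact r2) * (LINT z|lborel. \<Phi> z)"
proof -
  note [measurable] = bcs_measurable[OF \<Phi>]
  have tm [measurable]: "tens (pw r1) (pw r2) \<in> borel_measurable borel"
    by (intro tens_measurable smooth_pw)
  let ?T = "tens (pw r1) (pw r2)"
  have fin: "finite S" unfolding S_def using filter_moments(3)[OF h1] filter_moments(3)[OF h2] by auto
  have i: "integrable lborel (\<lambda>x. ?T x * \<Phi> (2 *\<^sub>R x - t *\<^sub>R embed k))" for k
  proof -
    obtain R' where "bcs R' M (\<lambda>x. \<Phi> (2 *\<^sub>R x - t *\<^sub>R embed k))"
      using bcs_affine[OF \<Phi> zero_less_numeral, of _ "t *\<^sub>R embed k"] by blast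
    then show ?thesis by (rule bcs_continuous_mult_integrable) (intro continuous_on_tens smooth_pw)
  qed
  have cont: "continuous_on UNIV (\<lambda>y. ?T ((1/2) *\<^sub>R (y + t *\<^sub>R embed k)))" for k
    by (rule continuous_on_compose2[OF continuous_on_tens[OF smooth_pw smooth_pw, of UNIV]]) (auto intro!: continuous_intros)
  have i2: "integrable lborel (\<lambda>y. ?T ((1/2) *\<^sub>R (y + t *\<^sub>R embed k)) * \<Phi> y)" for k
    by (rule bcs_continuous_mult_integrable[OF \<Phi> cont])
  have each: "(LINT x|lborel. ?T x * \<Phi> (2 *\<^sub>R x - t *\<^sub>R embed k))
      = 1 / 4 * (LINT y|lborel. ?T ((1/2) *\<^sub>R (y + t *\<^sub>R embed k)) * \<Phi> y)" for k
  proof -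
    have [measurable]: "(\<lambda>y. ?T ((1/2) *\<^sub>R (y + t *\<^sub>R embed k))) \<in> borel_measurable borel"
      by (rule borel_measurable_continuous_onI[OF cont])
    have "(LINT x|lborel. ?T x * \<Phi> (2 *\<^sub>R x - t *\<^sub>R embed k))
      = (LINT x|lborel. (\<lambda>y. ?T ((1/2) *\<^sub>R (y + t *\<^sub>R embed k)) * \<Phi> y) (2 *\<^sub>R x - t *\<^sub>R embed k))" by simp
    also have "\<dots> = 1 / 4 * (LINT y|lborel. ?T ((1/2) *\<^sub>R (y + t *\<^sub>R embed k)) * \<Phi> y)"
      by (subst integral_affine_diff) auto
    finally show ?thesis .
  qed
  have alg: "(\<Sum>k\<in>S. h1 (fst k) * h2 (snd k) * ?T ((1/2) *\<^sub>R (y + t *\<^sub>R embed k)))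
      = (t / 2) ^ (r1 + r2) * (moment h1 r1 / fact r1) * (moment h2 r2 / fact r2)" for y
  proof -
    have "(\<Sum>k\<in>S. h1 (fst k) * h2 (snd k) * ?T ((1/2) *\<^sub>R (y + t *\<^sub>R embed k)))
      = (\<Sum>k\<in>S. (1/2) ^ (r1 + r2) / (fact r1 * fact r2) *
          ((h1 (fst k) * (fst y + t * real_of_int (fst k)) ^ r1) * (h2 (snd k) * (snd y + t * real_of_int (snd k)) ^ r2)))"
      by (intro sum.cong refl) (simp add: tens_def pw_def embed_def power_add power_divide power_mult_distrib ac_simps)
    also have "\<dots> = (1/2) ^ (r1 + r2) / (fact r1 * fact r2) *
        ((\<Sum>k | h1 k \<noteq> 0. h1 k * (fst y + t * real_of_int k) ^ r1) * (\<Sum>k | h2 k \<noteq> 0. h2 k * (snd y + t * real_of_int k) ^ r2))"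
    proof -
      have cp: "(\<Sum>k\<in>X \<times> Y. u (fst k) * v (snd k)) = (\<Sum>k\<in>X. u k) * (\<Sum>k\<in>Y. v k)" for u v :: "int \<Rightarrow> real" and X Y
        unfolding sum_product sum.cartesian_product by (simp add: case_prod_beta')
      show ?thesis unfolding S_def sum_distrib_left[symmetric, of "(1/2) ^ (r1 + r2) / (fact r1 * fact r2)"] by (subst cp) (rule refl)
    qed
    also have "\<dots> = (t / 2) ^ (r1 + r2) * (moment h1 r1 / fact r1) * (moment h2 r2 / fact r2)"
      unfolding shifted_moment[OF h1] shifted_moment[OF h2] by (simp add: power_add power_divide ac_simps)
    finally show ?thesis .
  qed
  have "tint (pw r1) (pw r2) (\<lambda>x. C * (\<Sum>k\<in>S. h1 (fst k) * h2 (snd k) * \<Phi> (2 *\<^sub>R x - t *\<^sub>R embed k)))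
    = (LINT x|lborel. C * (\<Sum>k\<in>S. h1 (fst k) * h2 (snd k) * (?T x * \<Phi> (2 *\<^sub>R x - t *\<^sub>R embed k))))"
    unfolding tint_def by (intro Bochner_Integration.integral_cong refl) (simp add: sum_distrib_left ac_simps)
  also have "\<dots> = C * (\<Sum>k\<in>S. h1 (fst k) * h2 (snd k) * (LINT x|lborel. ?T x * \<Phi> (2 *\<^sub>R x - t *\<^sub>R embed k)))"
    using i by (subst integral_mult_right_zero, subst Bochner_Integration.integral_sum) auto
  also have "\<dots> = C / 4 * (\<Sum>k\<in>S. h1 (fst k) * h2 (snd k) * (LINT y|lborel. ?T ((1/2) *\<^sub>R (y + t *\<^sub>R embed k)) * \<Phi> y))"
    unfolding each by (simp add: sum_distrib_left)
  also have "\<dots> = C / 4 * (LINT y|lborel. (\<Sum>k\<in>S. h1 (fst k) * h2 (snd k) * (?T ((1/2) *\<^sub>R (y + t *\<^sub>R embed k)) * \<Phi> y)))"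
    using i2 by (subst Bochner_Integration.integral_sum) auto
  also have "\<dots> = C / 4 * (LINT y|lborel. (\<Sum>k\<in>S. h1 (fst k) * h2 (snd k) * ?T ((1/2) *\<^sub>R (y + t *\<^sub>R embed k))) * \<Phi> y)"
    by (simp add: sum_distrib_right mult.assoc)
  also have "\<dots> = C / 4 * (t / 2) ^ (r1 + r2) * (moment h1 r1 / fact r1) * (moment h2 r2 / fact r2) * (LINT z|lborel. \<Phi> z)"
    unfolding alg by simp
  finally show ?thesis .
qed

lemma AE_fst_snd:
  assumes "AE x in lborel. P (x::real)"
  shows "AE z in (lborel :: point measure). P (fst z)" "AE z in (lborel :: point measure). P (snd z)"
proof -
  from assms obtain N where N: "{x \<in> space lborel. \<not> P x} \<subseteq> N" "N \<in> null_sets lborel"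
    by (auto elim!: AE_E simp: null_sets_def)
  have nN: "AE x in lborel. x \<notin> N" by (rule AE_not_in[OF N(2)])
  have [measurable]: "N \<in> sets borel" using N(2) by auto
  have "{z \<in> space (lborel \<Otimes>\<^sub>M lborel). fst z \<notin> N} = (- N) \<times> (UNIV :: real set)"
    "{z \<in> space (lborel \<Otimes>\<^sub>M lborel). snd z \<notin> N} = (UNIV :: real set) \<times> (- N)"
    by (auto simp: space_pair_measure)
  then have sets: "{z \<in> space (lborel \<Otimes>\<^sub>M (lborel :: real measure)). fst z \<notin> N} \<in> sets (lborel \<Otimes>\<^sub>M lborel)"
    "{z \<in> space ((lborel :: real measure) \<Otimes>\<^sub>M lborel). snd z \<notin> N} \<in> sets (lborel \<Otimes>\<^sub>M lborel)"
    by (simp_all add: pair_measureI)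
  have "AE z in lborel \<Otimes>\<^sub>M (lborel :: real measure). fst z \<notin> N"
    by (rule lborel_pair.AE_pair_measure[where P="\<lambda>z. fst z \<notin> N", OF sets(1)]) (use nN in \<open>auto elim!: eventually_mono\<close>)
  then show "AE z in (lborel :: point measure). P (fst z)"
    unfolding lborel_prod by eventually_elim (use N(1) in auto)
  have "AE z in (lborel :: real measure) \<Otimes>\<^sub>M lborel. snd z \<notin> N"
    by (rule lborel_pair.AE_pair_measure[where P="\<lambda>z. snd z \<notin> N", OF sets(2)]) (use nN in simp)
  then show "AE z in (lborel :: point measure). P (snd z)"
    unfolding lborel_prod by eventually_elim (use N(1) in auto)
qed

lemma locally_integrable_UNIV_measurable:
  fixes f :: "point \<Rightarrow> real"
  assumes "locally_integrable UNIV f"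
  shows "f \<in> borel_measurable borel"
proof (rule borel_measurable_LIMSEQ_metric[where f="\<lambda>n z. indicator (Qbox (real n)) z *\<^sub>R f z"])
  show "(\<lambda>z. indicator (Qbox (real n)) z *\<^sub>R f z) \<in> borel_measurable borel" for n
    using assms borel_measurable_integrable[of lborel "\<lambda>z. indicator (Qbox (real n)) z *\<^sub>R f z"]
    unfolding locally_integrable_def set_integrable_def by auto
  fix z :: point
  obtain N where N: "norm z \<le> real N" using real_arch_simple by blast
  have "\<forall>\<^sub>F n in sequentially. indicator (Qbox (real n)) z *\<^sub>R f z = f z"
  proof (rule eventually_sequentiallyI[of N])
    fix n assume "N \<le> n"
    then have "\<bar>fst z\<bar> \<le> real n" "\<bar>snd z\<bar> \<le> real n"
      using N norm_fst_le[of "fst z" "snd z"] norm_snd_le[of "snd z" "fst z"] by (auto simp: prod.collapse)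
    then have "z \<in> Qbox (real n)" by (auto simp: mem_cbox_point)
    then show "indicator (Qbox (real n)) z *\<^sub>R f z = f z" by simp
  qed
  then show "(\<lambda>n. indicator (Qbox (real n)) z *\<^sub>R f z) \<longlonglongrightarrow> f z" by (rule tendsto_eventually)
qed

lemma compact_ess_supp_vanish:
  assumes "compact (ess_supp f)"
  shows "\<exists>R\<ge>0. AE z in lborel. z \<notin> Qbox R \<longrightarrow> f z = 0"
proof -
  obtain B where B: "\<And>z. z \<in> ess_supp f \<Longrightarrow> norm z \<le> B"
    using compact_imp_bounded[OF assms] by (auto simp: bounded_iff)
  have sub: "z \<in> Qbox (max 0 B)" if "z \<in> ess_supp f" for z
  proof -
    have "\<bar>fst z\<bar> \<le> B" "\<bar>snd z\<bar> \<le> B"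
      using B[OF that] norm_fst_le[of "fst z" "snd z"] norm_snd_le[of "snd z" "fst z"] by (auto simp: prod.collapse)
    then show ?thesis unfolding mem_cbox_point by linarith
  qed
  have "AE z in lborel. z \<notin> Qbox (max 0 B) \<longrightarrow> f z = 0"
    using ess_supp_AE[of f] by eventually_elim (use sub in blast)
  then show ?thesis by (intro exI[of _ "max 0 B"]) simp
qed

text \<open>Local integrability and compact support together give integrability, which the duality
  bound requires.\<close>

lemma weak_primitive_bcs:
  assumes wd: "has_weak_deriv UNIV \<alpha> w g" and c: "compact (ess_supp w)" and g: "bcs R M g"
  shows "\<exists>R M. bcs R M w"
proof -
  have li: "locally_integrable UNIV w" using wd by (simp add: has_weak_deriv_def)
  have [measurable]: "w \<in> borel_measurable borel" by (rule locally_integrable_UNIV_measurable[OF li])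
  obtain R' where R': "0 \<le> R'" "AE z in lborel. z \<notin> Qbox R' \<longrightarrow> w z = 0" using compact_ess_supp_vanish[OF c] by blast
  have van: "AE z in lborel. z \<notin> Qbox (max R R') \<longrightarrow> w z = 0"
    using R'(2) by eventually_elim (use Qbox_mono[OF max.cobounded2, of R' R] in blast)
  have "integrable lborel (\<lambda>z. indicator (Qbox (max R R')) z *\<^sub>R w z)"
    using li unfolding locally_integrable_def set_integrable_def by auto
  then have "integrable lborel w"
    by (rule integrable_cong_AE_imp) (use van in \<open>auto elim!: eventually_mono simp: indicator_def\<close>)
  then show ?thesis
    using bcs_mono[OF g, of "max R R'" M] van
    by (intro weak_primitive_bounded[OF has_weak_deriv_UNIV_tensor[OF wd]]) auto
qed

lemma finite_bcs_uniform:
  assumes "finite I" "\<And>i. i \<in> I \<Longrightarrow> \<exists>R M. bcs R M (f i)"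
  shows "\<exists>R M. 1 \<le> R \<and> 0 \<le> M \<and> (\<forall>i\<in>I. bcs R M (f i))"
  using assms
proof (induction I rule: finite_induct)
  case empty
  then show ?case by (intro exI[of _ 1]) auto
next
  case (insert i I)
  then obtain R M where R: "1 \<le> R" "0 \<le> M" "\<forall>i\<in>I. bcs R M (f i)" by auto
  obtain R' M' where R': "bcs R' M' (f i)" using insert.prems[of i] by auto
  have "\<forall>k\<in>insert i I. bcs (max R R') (max M M') (f k)"
    using R(3) R' by (auto intro: bcs_mono)
  then show ?case using R by (intro exI[of _ "max R R'"] exI[of _ "max M M'"]) auto
qed

locale framelets =
  fixes F :: "('j::finite) framelet_data"
  assumes sys: "framelet_system F"
begin

lemma order_ge_1: "1 \<le> spline_order F"
  and ops_le: "fst (ops F j) \<le> spline_order F" "snd (ops F j) \<le> spline_order F"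
  and bspline: "is_bspline (spline_order F) (bspl F)"
  and filters: "r \<le> spline_order F \<Longrightarrow> is_filter (spline_order F) r (filt F r)"
  and prim_compact: "compact (ess_supp (prim F j))"
  and prim_weak: "has_weak_deriv UNIV (ops F j) (prim F j) (framelet F j)"
  and prim2_compact: "compact (ess_supp (prim2 F i j))"
  and prim2_weak: "has_weak_deriv UNIV (ops F i) (prim2 F i j)
          (\<lambda>x. 4 / c1 F j * (\<Sum>k \<in> fsupp (tensor_filt F (ops F i)).
             tensor_filt F (ops F i) k * prim F j (2 *\<^sub>R x - (1 / 2) *\<^sub>R embed k)))"
  and admissible: "dil_admissible F"
  using sys unfolding framelet_system_def by blast+

lemma fsupp_tensor: "fsupp (tensor_filt F \<alpha>) = {k. filt F (fst \<alpha>) k \<noteq> 0} \<times> {k. filt F (snd \<alpha>) k \<noteq> 0}"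
  by (auto simp: fsupp_def tensor_filt_def)

lemma tensor_filt_apply: "tensor_filt F \<alpha> k = filt F (fst \<alpha>) (fst k) * filt F (snd \<alpha>) (snd k)"
  by (simp add: tensor_filt_def case_prod_beta')

lemma finite_fsupp:
  assumes "fst \<alpha> \<le> spline_order F" "snd \<alpha> \<le> spline_order F"
  shows "finite (fsupp (tensor_filt F \<alpha>))"
  unfolding fsupp_tensor using filter_moments(3)[OF filters[OF assms(1)] assms(1)]
    filter_moments(3)[OF filters[OF assms(2)] assms(2)] by auto

lemma refinable_apply: "refinable F z = bspl F (fst z) * bspl F (snd z)"
  by (simp add: refinable_def case_prod_beta')

lemma refinable_bcs: "bcs (real (spline_order F) + 1) 1 (refinable F)"
  and refinable_integral: "(LINT z|lborel. refinable F z) = 1"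
proof -
  note B = bspline_properties[OF bspline order_ge_1]
  let ?R = "real (spline_order F) + 1"
  have [measurable]: "bspl F \<in> borel_measurable borel" using borel_measurable_integrable[OF B(1)] by simp
  show "(LINT z|lborel. refinable F z) = 1"
    unfolding refinable_apply integral_tensor(2)[OF B(1) B(1)] B(2) by simp
  have "AE z in lborel. \<bar>refinable F z\<bar> \<le> 1 * indicator (Qbox ?R) z"
    using AE_fst_snd(1)[OF B(3)] AE_fst_snd(2)[OF B(3)]
  proof eventually_elim
    case (elim z)
    have "\<bar>refinable F z\<bar> \<le> indicator {- ?R..?R} (fst z) * indicator {- ?R..?R} (snd z)"
      unfolding refinable_apply abs_mult using elim by (intro mult_mono) auto
    also have "\<dots> \<le> 1 * indicator (Qbox ?R) z"
      using mem_cbox_point[of z "- ?R" "- ?R" ?R ?R] by (auto simp: indicator_def)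
    finally show ?case .
  qed
  moreover have "refinable F \<in> borel_measurable borel"
    unfolding refinable_apply[abs_def] by measurable
  ultimately show "bcs ?R 1 (refinable F)" by (simp add: bcs_def)
qed

lemma refined_sum_bcs:
  assumes "\<exists>R M. bcs R M \<Phi>"
  shows "\<exists>R M. bcs R M (\<lambda>x. C * (\<Sum>k \<in> S. h k * \<Phi> (2 *\<^sub>R x - t *\<^sub>R embed k)))"
proof -
  obtain R M where \<Phi>: "bcs R M \<Phi>" using assms by blast
  have "\<exists>R M. bcs R M (\<lambda>x. h k * \<Phi> (2 *\<^sub>R x - t *\<^sub>R embed k))" for k
    using bcs_affine[OF \<Phi>, of 2 "t *\<^sub>R embed k"] bcs_cmult by force
  then have "\<exists>R M. bcs R M (\<lambda>x. \<Sum>k \<in> S. h k * \<Phi> (2 *\<^sub>R x - t *\<^sub>R embed k))"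
    by (intro bcs_sum)
  then show ?thesis using bcs_cmult by blast
qed

lemma framelet_eq: "framelet F j = (\<lambda>x. 4 * (\<Sum>k \<in> fsupp (tensor_filt F (ops F j)).
     tensor_filt F (ops F j) k * refinable F (2 *\<^sub>R x - 1 *\<^sub>R embed k)))"
  by (simp add: framelet_def fun_eq_iff)

lemma framelet_bcs: "\<exists>R M. bcs R M (framelet F j)"
  unfolding framelet_eq using refinable_bcs by (intro refined_sum_bcs) blast

lemma prim_bcs: "\<exists>R M. bcs R M (prim F j)"
proof -
  obtain R M where "bcs R M (framelet F j)" using framelet_bcs by blast
  then show ?thesis by (rule weak_primitive_bcs[OF prim_weak prim_compact])
qed

lemma prim2_rhs_bcs: "\<exists>R M. bcs R M (\<lambda>x. 4 / c1 F j * (\<Sum>k \<in> fsupp (tensor_filt F (ops F i)).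
     tensor_filt F (ops F i) k * prim F j (2 *\<^sub>R x - (1 / 2) *\<^sub>R embed k)))"
  using prim_bcs by (intro refined_sum_bcs)

lemma prim2_bcs: "\<exists>R M. bcs R M (prim2 F i j)"
proof -
  obtain R M where "bcs R M (\<lambda>x. 4 / c1 F j * (\<Sum>k \<in> fsupp (tensor_filt F (ops F i)).
     tensor_filt F (ops F i) k * prim F j (2 *\<^sub>R x - (1 / 2) *\<^sub>R embed k)))" using prim2_rhs_bcs by blast
  then show ?thesis by (rule weak_primitive_bcs[OF prim2_weak prim2_compact])
qed

text \<open>Testing with the polynomials of degree equal to the order expresses c_j, up to sign, as
  2^(-s_j) times the two leading filter moments over factorials; the integral of the refinable
  function is 1.\<close>

lemma c1_nonzero: "c1 F j \<noteq> 0"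
proof -
  let ?\<alpha> = "ops F j"
  obtain R M where p: "bcs R M (prim F j)" using prim_bcs by blast
  obtain R' M' where g: "bcs R' M' (framelet F j)" using framelet_bcs by blast
  have "c1 F j = (-1) ^ (fst ?\<alpha> + snd ?\<alpha>) * tint (pw (fst ?\<alpha>)) (pw (snd ?\<alpha>)) (framelet F j)"
    unfolding c1_def by (rule weak_primitive_integral[OF has_weak_deriv_UNIV_tensor[OF prim_weak] p g])
  also have "tint (pw (fst ?\<alpha>)) (pw (snd ?\<alpha>)) (framelet F j)
     = 4 / 4 * (1 / 2) ^ (fst ?\<alpha> + snd ?\<alpha>) * (moment (filt F (fst ?\<alpha>)) (fst ?\<alpha>) / fact (fst ?\<alpha>))
       * (moment (filt F (snd ?\<alpha>)) (snd ?\<alpha>) / fact (snd ?\<alpha>)) * (LINT z|lborel. refinable F z)"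
    unfolding framelet_eq fsupp_tensor tensor_filt_apply
    by (rule tint_refined_sum[OF filters[OF ops_le(1)] ops_le(1) filters[OF ops_le(2)] ops_le(2) refinable_bcs])
  finally show ?thesis
    using filter_moments(2)[OF filters[OF ops_le(1)] ops_le(1)] filter_moments(2)[OF filters[OF ops_le(2)] ops_le(2)]
    by (simp add: refinable_integral)
qed

text \<open>As for c_j, with shifts by half integers (t = 1/2). The factor 1/c_j in the defining
  relation cancels the integral c_j of the primitive.\<close>

lemma c2_nonzero: "c2 F i j \<noteq> 0"
proof -
  let ?\<alpha> = "ops F i"
  let ?g = "\<lambda>x. 4 / c1 F j * (\<Sum>k \<in> fsupp (tensor_filt F (ops F i)).
     tensor_filt F (ops F i) k * prim F j (2 *\<^sub>R x - (1 / 2) *\<^sub>R embed k))"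
  obtain R M where p: "bcs R M (prim2 F i j)" using prim2_bcs by blast
  obtain R' M' where g: "bcs R' M' ?g" using prim2_rhs_bcs by blast
  obtain R'' M'' where p1: "bcs R'' M'' (prim F j)" using prim_bcs by blast
  have "c2 F i j = (-1) ^ (fst ?\<alpha> + snd ?\<alpha>) * tint (pw (fst ?\<alpha>)) (pw (snd ?\<alpha>)) ?g"
    unfolding c2_def by (rule weak_primitive_integral[OF has_weak_deriv_UNIV_tensor[OF prim2_weak] p g])
  also have "tint (pw (fst ?\<alpha>)) (pw (snd ?\<alpha>)) ?g
     = 4 / c1 F j / 4 * (1 / 2 / 2) ^ (fst ?\<alpha> + snd ?\<alpha>) * (moment (filt F (fst ?\<alpha>)) (fst ?\<alpha>) / fact (fst ?\<alpha>))
       * (moment (filt F (snd ?\<alpha>)) (snd ?\<alpha>) / fact (snd ?\<alpha>)) * (LINT z|lborel. prim F j z)"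
    unfolding fsupp_tensor tensor_filt_apply
    by (rule tint_refined_sum[OF filters[OF ops_le(1)] ops_le(1) filters[OF ops_le(2)] ops_le(2) p1])
  finally show ?thesis
    using filter_moments(2)[OF filters[OF ops_le(1)] ops_le(1)] filter_moments(2)[OF filters[OF ops_le(2)] ops_le(2)]
      c1_nonzero[of j]
    by (simp add: c1_def)
qed

text \<open>The sampling functions in the form \<open>\<Phi>(2\<^bsup>n\<^esup> x - k)\<close> with \<open>\<integral>\<Phi> = 1\<close>.\<close>

definition ker_S :: "'j \<Rightarrow> point \<Rightarrow> real" where
  "ker_S j y = 1 / (4 * c1 F j) * prim F j ((1 / 2) *\<^sub>R y - 0)"

definition ker_W :: "'j \<Rightarrow> 'j \<Rightarrow> point \<Rightarrow> real" where
  "ker_W i j y = 1 / (16 * c2 F i j) * prim2 F i j ((1 / 4) *\<^sub>R y - 0)"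

lemma ker_S_bcs: "\<exists>R M. bcs R M (ker_S j)" and ker_W_bcs: "\<exists>R M. bcs R M (ker_W i j)"
proof -
  have pos: "(0::real) < 1 / 2" "(0::real) < 1 / 4" by simp_all
  obtain R M where "bcs R M (prim F j)" using prim_bcs by blast
  from bcs_affine[OF this pos(1)] obtain R' where "bcs R' M (\<lambda>x. prim F j ((1 / 2) *\<^sub>R x - 0))" by blast
  from bcs_cmult[OF this] show "\<exists>R M. bcs R M (ker_S j)"
    unfolding ker_S_def[abs_def] by blast
  obtain R M where "bcs R M (prim2 F i j)" using prim2_bcs by blast
  from bcs_affine[OF this pos(2)] obtain R' where "bcs R' M (\<lambda>x. prim2 F i j ((1 / 4) *\<^sub>R x - 0))" by blast
  from bcs_cmult[OF this] show "\<exists>R M. bcs R M (ker_W i j)"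
    unfolding ker_W_def[abs_def] by blast
qed

text \<open>The numbers 4 and 16 in the kernels are the Jacobians of the dilations by 1/2 and 1/4 in
  the plane; dividing by c_j and c_ij, which are nonzero, gives mass 1.\<close>

lemma ker_S_integral: "(LINT y|lborel. ker_S j y) = 1" and ker_W_integral: "(LINT y|lborel. ker_W i j y) = 1"
proof -
  have m: "prim F j \<in> borel_measurable borel" "prim2 F i j \<in> borel_measurable borel"
    using prim_bcs[of j] prim2_bcs[of i j] bcs_measurable by blast+
  have "(LINT y|lborel. prim F j ((1 / 2) *\<^sub>R y - 0)) = 4 * c1 F j"
    unfolding c1_def by (subst integral_affine_diff[OF _ m(1)]) (auto simp: power2_eq_square)
  then show "(LINT y|lborel. ker_S j y) = 1" unfolding ker_S_def using c1_nonzero[of j] by simp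
  have "(LINT y|lborel. prim2 F i j ((1 / 4) *\<^sub>R y - 0)) = 16 * c2 F i j"
    unfolding c2_def by (subst integral_affine_diff[OF _ m(2)]) (auto simp: power2_eq_square)
  then show "(LINT y|lborel. ker_W i j y) = 1" unfolding ker_W_def using c2_nonzero[of i j] by simp
qed

lemma kernels_uniform:
  obtains R M where "1 \<le> R" "0 \<le> M" "bcs R M (refinable F)" "\<And>j. bcs R M (ker_S j)" "\<And>i j. bcs R M (ker_W i j)"
proof -
  obtain R1 M1 where 1: "1 \<le> R1" "0 \<le> M1" "\<forall>j\<in>UNIV. bcs R1 M1 (ker_S j)"
    using finite_bcs_uniform[of UNIV ker_S] ker_S_bcs by auto
  obtain R2 M2 where 2: "1 \<le> R2" "0 \<le> M2" "\<forall>i\<in>UNIV. bcs R2 M2 (case_prod ker_W i)"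
    using finite_bcs_uniform[of UNIV "case_prod ker_W"] ker_W_bcs by auto
  define R where "R = max (max R1 R2) (real (spline_order F) + 1)"
  define M where "M = max (max M1 M2) 1"
  have "bcs R M (refinable F)" by (rule bcs_mono[OF refinable_bcs]) (auto simp: R_def M_def)
  moreover have "bcs R M (ker_S j)" for j
    by (rule bcs_mono[of R1 M1]) (use 1(3) in \<open>auto simp: R_def M_def\<close>)
  moreover have "bcs R M (ker_W i j)" for i j
    by (rule bcs_mono[of R2 M2]) (use 2(3)[THEN bspec, of "(i, j)"] in \<open>auto simp: R_def M_def\<close>)
  ultimately show ?thesis using 1 by (intro that[of R M]) (auto simp: R_def M_def)
qed

lemma M_set_vanish: "k \<in> M_set F n \<Longrightarrow> AE x in lborel. x \<notin> closure Omega \<longrightarrow> refinable_nk F n k x = 0"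
  using ess_supp_AE[of "refinable_nk F n k"] by (auto simp: M_set_def elim!: eventually_mono)

text \<open>Otherwise the support condition and the compact support of the refinable function would
  make the translate vanish almost everywhere, against its nonzero integral.\<close>

lemma M_set_near:
  assumes k: "k \<in> M_set F n" and R: "bcs R M (refinable F)"
  shows "\<exists>y\<in>closure Omega. \<bar>2 ^ n * fst y - real_of_int (fst k)\<bar> \<le> R \<and> \<bar>2 ^ n * snd y - real_of_int (snd k)\<bar> \<le> R"
proof (rule ccontr)
  assume no: "\<not> ?thesis"
  have "AE x in lborel. 2 ^ n *\<^sub>R x - embed k \<notin> Qbox R \<longrightarrow> refinable F (2 ^ n *\<^sub>R x - embed k) = 0"
    by (rule AE_affine_diff[OF _ bcs_vanish[OF R]]) simp
  then have "AE x in lborel. refinable F (2 ^ n *\<^sub>R x - embed k) = 0"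
    using M_set_vanish[OF k]
  proof eventually_elim
    case (elim x)
    show ?case
    proof (cases "x \<in> closure Omega")
      case True
      then have "2 ^ n *\<^sub>R x - embed k \<notin> Qbox R"
        using no by (auto simp: mem_cbox_point embed_def abs_le_iff)
      then show ?thesis using elim by simp
    qed (use elim in \<open>simp add: refinable_nk_def\<close>)
  qed
  then have "(LINT x|lborel. refinable F (2 ^ n *\<^sub>R x - embed k)) = 0" by (rule integral_eq_zero_AE)
  moreover have "(LINT x|lborel. refinable F (2 ^ n *\<^sub>R x - embed k)) = 1 / (2 ^ n)\<^sup>2"
    by (subst integral_affine_diff) (auto simp: bcs_measurable[OF R] refinable_integral power2_eq_square)
  ultimately show False by simp
qed

lemma M_set_I:
  assumes R: "bcs R M (refinable F)"
    and near: "\<And>x. \<bar>2 ^ n * fst x - real_of_int (fst k)\<bar> \<le> R \<Longrightarrow> \<bar>2 ^ n * snd x - real_of_int (snd k)\<bar> \<le> R \<Longrightarrow> x \<in> closure Omega"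
  shows "k \<in> M_set F n"
  unfolding M_set_def
proof (intro CollectI ess_supp_subset closed_closure)
  have "AE x in lborel. 2 ^ n *\<^sub>R x - embed k \<notin> Qbox R \<longrightarrow> refinable F (2 ^ n *\<^sub>R x - embed k) = 0"
    by (rule AE_affine_diff[OF _ bcs_vanish[OF R]]) simp
  then show "AE x in lborel. x \<notin> closure Omega \<longrightarrow> refinable_nk F n k x = 0"
  proof eventually_elim
    case (elim x)
    have "2 ^ n *\<^sub>R x - embed k \<in> Qbox R \<Longrightarrow> x \<in> closure Omega"
      using near[of x] by (auto simp: mem_cbox_point embed_def abs_le_iff)
    with elim show ?case by (auto simp: refinable_nk_def)
  qed
qed

lemma filter_supports_bounded:
  obtains L where "0 \<le> L" "\<And>\<alpha> l. \<alpha> \<in> insert (0, 0) (range (ops F)) \<Longrightarrow> l \<in> fsupp (tensor_filt F \<alpha>) \<Longrightarrow> \<bar>fst l\<bar> \<le> L \<and> \<bar>snd l\<bar> \<le> L"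
proof -
  define S where "S = (\<Union>r\<le>spline_order F. {k. filt F r k \<noteq> 0})"
  have "finite S" unfolding S_def using filter_moments(3)[OF filters] by auto
  then have fin: "finite (abs ` S)" by simp
  define L where "L = Max (insert 0 (abs ` S))"
  have L: "k \<in> S \<Longrightarrow> \<bar>k\<bar> \<le> L" "0 \<le> L" for k unfolding L_def using fin by (auto intro!: Max_ge)
  show ?thesis
  proof (rule that[OF L(2)])
    fix \<alpha> l assume \<alpha>: "\<alpha> \<in> insert (0, 0) (range (ops F))" and l: "l \<in> fsupp (tensor_filt F \<alpha>)"
    have "fst \<alpha> \<le> spline_order F" "snd \<alpha> \<le> spline_order F" using \<alpha> ops_le by auto
    then have "fst l \<in> S" "snd l \<in> S" using l unfolding fsupp_tensor S_def by auto
    then show "\<bar>fst l\<bar> \<le> L \<and> \<bar>snd l\<bar> \<le> L" using L(1) by blast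
  qed
qed

lemma sampling_sets_K_set:
  assumes R: "bcs R M (refinable F)" "1 \<le> R"
  shows "sampling_sets (K_set F) R"
proof
  show "1 \<le> R" by (rule R(2))
  show "\<exists>y\<in>closure Omega. \<bar>2 ^ n * fst y - real_of_int (fst k)\<bar> \<le> R \<and> \<bar>2 ^ n * snd y - real_of_int (snd k)\<bar> \<le> R"
    if "k \<in> K_set F n" for k n
    using that by (intro M_set_near[OF _ R(1)]) (auto simp: K_set_def)
  fix x assume x: "x \<in> Omega"
  obtain L where L: "0 \<le> L" "\<And>\<alpha> l. \<alpha> \<in> insert (0, 0) (range (ops F)) \<Longrightarrow> l \<in> fsupp (tensor_filt F \<alpha>) \<Longrightarrow> \<bar>fst l\<bar> \<le> L \<and> \<bar>snd l\<bar> \<le> L"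
    using filter_supports_bounded by metis
  \<comment> \<open>Largest coordinate displacement occurring in the definition of
    \<open>K_set\<close>. An index displaced by at most D from the cell of x, with a support of
    radius R and rounding error 1, stays inside the square as soon as R + 1 + D < 2^n d.\<close>
  define D where "D = real (dil F) * real_of_int L"
  have D0: "0 \<le> D" using L(1) by (simp add: D_def)
  define d where "d = min (min (fst x) (1 - fst x)) (min (snd x) (1 - snd x))"
  have d: "0 < d" using x by (auto simp: d_def Omega_def)
  have "(\<lambda>n. (R + 1 + D) * (1 / 2) ^ n) \<longlonglongrightarrow> (R + 1 + D) * 0"
    by (intro tendsto_intros LIMSEQ_realpow_zero) auto
  then have "\<forall>\<^sub>F n in sequentially. (R + 1 + D) * (1 / 2) ^ n < d"
    using d by (intro order_tendstoD) auto
  then show "\<forall>\<^sub>F n in sequentially. cell n x \<in> K_set F n"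
  proof eventually_elim
    case (elim n)
    have lt: "R + 1 + D < 2 ^ n * d" using elim by (simp add: power_one_over field_simps)
    have M: "k \<in> M_set F n" if k: "\<bar>real_of_int (fst k) - real_of_int (fst (cell n x))\<bar> \<le> D"
      "\<bar>real_of_int (snd k) - real_of_int (snd (cell n x))\<bar> \<le> D" for k
    proof (rule M_set_I[OF R(1)])
      fix y assume y: "\<bar>2 ^ n * fst y - real_of_int (fst k)\<bar> \<le> R" "\<bar>2 ^ n * snd y - real_of_int (snd k)\<bar> \<le> R"
      have "\<bar>2 ^ n * fst y - 2 ^ n * fst x\<bar> < 2 ^ n * d" "\<bar>2 ^ n * snd y - 2 ^ n * snd x\<bar> < 2 ^ n * d"
        using y k cell_bounds[of n x] lt by linarith+
      then have "2 ^ n * \<bar>fst y - fst x\<bar> < 2 ^ n * d" "2 ^ n * \<bar>snd y - snd x\<bar> < 2 ^ n * d"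
        by (simp_all add: abs_mult flip: right_diff_distrib)
      then have "\<bar>fst y - fst x\<bar> < d" "\<bar>snd y - snd x\<bar> < d" by simp_all
      then show "y \<in> closure Omega"
        unfolding closure_Omega mem_cbox_point d_def by auto
    qed
    show ?case unfolding K_set_def
    proof (intro CollectI conjI ballI)
      show "cell n x \<in> M_set F n" by (rule M) (use D0 in auto)
      fix \<alpha> l assume "\<alpha> \<in> insert (0, 0) (range (ops F))" "l \<in> fsupp (tensor_filt F \<alpha>)"
      from L(2)[OF this] have "\<bar>real_of_int (fst l)\<bar> \<le> real_of_int L" "\<bar>real_of_int (snd l)\<bar> \<le> real_of_int L"
        by (simp_all flip: of_int_abs)
      then have "real (dil F) * \<bar>real_of_int (fst l)\<bar> \<le> D" "real (dil F) * \<bar>real_of_int (snd l)\<bar> \<le> D"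
        unfolding D_def by (auto intro!: mult_left_mono)
      then show "cell n x + (int (dil F) * fst l, int (dil F) * snd l) \<in> M_set F n"
        by (intro M) (auto simp: abs_mult)
    qed
  qed
qed

end

section \<open>Integration by parts on the unit square\<close>

lemma integrable_tensor_kernel:
  fixes v w :: "point \<Rightarrow> real" and E :: "point \<Rightarrow> point \<Rightarrow> real"
  assumes v: "integrable lborel v" and w: "integrable lborel w"
    and E: "(\<lambda>z. E (fst z) (snd z)) \<in> borel_measurable (lborel \<Otimes>\<^sub>M lborel)" "\<And>x y. \<bar>E x y\<bar> \<le> B"
  shows "integrable (lborel \<Otimes>\<^sub>M lborel) (\<lambda>(x, y). v x * w y * E x y)"
proof -
  note [measurable] = borel_measurable_integrable[OF v] borel_measurable_integrable[OF w] E(1)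
  have "integrable (lborel \<Otimes>\<^sub>M lborel) (\<lambda>(x, y). v x * w y)"
  proof (rule lborel_pair.Fubini_integrable)
    show "integrable lborel (\<lambda>x. (LINT y|lborel. norm (case (x, y) of (x, y) \<Rightarrow> v x * w y)))"
      using v w by (simp add: abs_mult)
  qed (use w in auto)
  then have i: "integrable (lborel \<Otimes>\<^sub>M lborel) (\<lambda>z. B * (v (fst z) * w (snd z)))"
    by (simp add: case_prod_beta')
  have "integrable (lborel \<Otimes>\<^sub>M lborel) (\<lambda>z. v (fst z) * w (snd z) * E (fst z) (snd z))"
  proof (rule Bochner_Integration.integrable_bound[OF i])
    show "AE z in lborel \<Otimes>\<^sub>M lborel. norm (v (fst z) * w (snd z) * E (fst z) (snd z)) \<le> norm (B * (v (fst z) * w (snd z)))"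
    proof (rule AE_I2)
      fix z
      have "\<bar>E (fst z) (snd z)\<bar> \<le> \<bar>B\<bar>" using E(2)[of "fst z" "snd z"] by linarith
      then have "\<bar>v (fst z) * w (snd z)\<bar> * \<bar>E (fst z) (snd z)\<bar> \<le> \<bar>v (fst z) * w (snd z)\<bar> * \<bar>B\<bar>"
        by (intro mult_left_mono) auto
      then show "norm (v (fst z) * w (snd z) * E (fst z) (snd z)) \<le> norm (B * (v (fst z) * w (snd z)))"
        by (simp add: abs_mult ac_simps)
    qed
  qed measurable
  then show ?thesis by (simp add: case_prod_beta')
qed

abbreviation bump :: "real \<Rightarrow> real" where "bump \<equiv> deriv step"

text \<open>The mollifier at scale \<open>e\<close>, centred so that its support in \<open>x\<close> lies inside the open square
  whenever \<open>y\<close> is in the closed one; \<open>r\<close> and \<open>s\<close> count derivatives.\<close>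

definition moll :: "real \<Rightarrow> nat \<Rightarrow> nat \<Rightarrow> point \<Rightarrow> point \<Rightarrow> real" where
  "moll e r s x y = (deriv ^^ r) bump (1 / e * fst x + (- ((1 - 4 * e) / e * fst y) - 2))
     * (deriv ^^ s) bump (1 / e * snd x + (- ((1 - 4 * e) / e * snd y) - 2))"

lemma smooth_bump: "smooth bump"
  by (rule smooth_deriv[OF step_smooth])

lemma tst_bump: "tst 0 1 bump"
  by (rule tst_deriv_step)

lemma moll_measurable: "(\<lambda>z. moll e r s (fst z) (snd z)) \<in> borel_measurable (lborel \<Otimes>\<^sub>M lborel)"
proof -
  have [measurable]: "(deriv ^^ r) bump \<in> borel_measurable borel" for r
    by (intro smooth_measurable smooth_funpow_deriv smooth_bump)
  show ?thesis unfolding moll_def by measurable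
qed

lemma moll_bounded: "\<exists>B. \<forall>x y. \<bar>moll e r s x y\<bar> \<le> B"
proof -
  obtain A B where "\<And>t. \<bar>(deriv ^^ r) bump t\<bar> \<le> A" "\<And>t. \<bar>(deriv ^^ s) bump t\<bar> \<le> B"
    using tst_bounded[OF tst_funpow_deriv[OF tst_bump]] by metis
  then have "\<bar>moll e r s x y\<bar> \<le> A * B" for x y
    unfolding moll_def abs_mult by (intro mult_mono) (auto intro: order_trans[OF abs_ge_zero])
  then show ?thesis by blast
qed

lemma moll_integrable:
  assumes "integrable lborel v" "integrable lborel w"
  shows "integrable (lborel \<Otimes>\<^sub>M lborel) (\<lambda>(x, y). v x * w y * moll e r s x y)"
proof -
  obtain B where "\<And>x y. \<bar>moll e r s x y\<bar> \<le> B" using moll_bounded by blast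
  then show ?thesis by (rule integrable_tensor_kernel[OF assms moll_measurable])
qed

lemma moll_Fubini:
  assumes "integrable lborel v" "integrable lborel w"
  shows "(LINT y|lborel. (LINT x|lborel. v x * w y * moll e r s x y)) = (LINT x|lborel. (LINT y|lborel. v x * w y * moll e r s x y))"
  by (rule lborel_pair.Fubini_integral[OF moll_integrable[OF assms]])

text \<open>As a function of y the kernel is contracted by (1 - 4e)/e, not by 1/e; hence the mass
  (e/(1 - 4e))^2.\<close>

lemma moll_integral_y:
  assumes e: "0 < e" "e \<le> 1 / 8"
  shows "(LINT y|lborel. moll e 0 0 x y) = (e / (1 - 4 * e))\<^sup>2" "integrable lborel (moll e 0 0 x)" "0 \<le> moll e 0 0 x y"
proof -
  define k where "k = - ((1 - 4 * e) / e)"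
  have k: "k \<noteq> 0" "\<bar>k\<bar> = (1 - 4 * e) / e" using e by (auto simp: k_def abs_if field_simps)
  have 1: "integrable lborel (\<lambda>t. bump (s + k * t))" "(LINT t|lborel. bump (s + k * t)) = e / (1 - 4 * e)" for s
  proof -
    show "integrable lborel (\<lambda>t. bump (s + k * t))"
      by (rule lborel_integrable_real_affine[OF tst_integrable[OF tst_bump] k(1)])
    have "1 = \<bar>k\<bar> * (LINT t|lborel. bump (s + k * t))"
      using lborel_integral_real_affine[OF k(1), of bump s] integral_deriv_step by simp
    then show "(LINT t|lborel. bump (s + k * t)) = e / (1 - 4 * e)"
      unfolding k(2) using e by (simp add: field_simps)
  qed
  have eq: "moll e 0 0 x = (\<lambda>y. bump ((1 / e * fst x - 2) + k * fst y) * bump ((1 / e * snd x - 2) + k * snd y))"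
    by (auto simp: moll_def k_def fun_eq_iff algebra_simps)
  show "(LINT y|lborel. moll e 0 0 x y) = (e / (1 - 4 * e))\<^sup>2" "integrable lborel (moll e 0 0 x)"
    unfolding eq using integral_tensor[OF 1(1) 1(1)] 1(2) by (auto simp: power2_eq_square)
  show "0 \<le> moll e 0 0 x y" by (simp add: moll_def deriv_step_nonneg)
qed

text \<open>Substituting for x turns the inner integral into an average of H over points e z + (1 -
  4e) y + 2e, which tend to y. Since w lives on the closed square and the boundary is null, only
  interior y matter.\<close>

lemma moll_limit_continuous:
  assumes H: "continuous_on UNIV H" "\<And>z. \<bar>H z\<bar> \<le> B"
    and w: "bcs R M w" and ws: "AE y in lborel. y \<notin> closure Omega \<longrightarrow> w y = 0"
    and e: "\<And>i. 0 < e i" "\<And>i. e i \<le> 1 / 8" "e \<longlonglongrightarrow> 0"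
  shows "(\<lambda>i. 1 / (e i)\<^sup>2 * (LINT y|lborel. (LINT x|lborel. (indicator Omega x * H x) * w y * moll (e i) 0 0 x y)))
    \<longlonglongrightarrow> (LINT y|lborel. (indicator Omega y * H y) * w y)"
proof -
  let ?v = "\<lambda>x. indicator Omega x * H x :: real"
  let ?b = "tens bump bump"
  have [measurable]: "H \<in> borel_measurable borel" by (rule borel_measurable_continuous_onI[OF H(1)])
  have [measurable]: "?b \<in> borel_measurable borel" by (intro tens_measurable smooth_bump)
  note [measurable] = bcs_measurable[OF w]
  have b: "integrable lborel ?b" "(LINT z|lborel. ?b z) = 1" "0 \<le> ?b z" for z
    using integral_tensor[OF tst_integrable[OF tst_bump] tst_integrable[OF tst_bump]]
    by (auto simp: tens_def[abs_def] integral_deriv_step deriv_step_nonneg)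
  have B0: "0 \<le> B" using H(2)[of 0] by linarith
  have vB: "\<bar>?v z\<bar> \<le> B" for z using H(2)[of z] B0 by (auto simp: indicator_def)
  let ?p = "\<lambda>i y z. e i *\<^sub>R (z + ((1 - 4 * e i) / e i * fst y + 2, (1 - 4 * e i) / e i * snd y + 2))"
  have inner: "1 / (e i)\<^sup>2 * (LINT x|lborel. ?v x * w y * moll (e i) 0 0 x y) = w y * (LINT z|lborel. ?v (?p i y z) * ?b z)" for i y
  proof -
    let ?t = "((1 - 4 * e i) / e i * fst y + 2, (1 - 4 * e i) / e i * snd y + 2)"
    have arg: "a + (- b - 2) = a - (b + 2)" for a b :: real by simp
    have eqm: "moll (e i) 0 0 x y = ?b ((1 / e i) *\<^sub>R x - ?t)" for x
      unfolding moll_def tens_def arg by simp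
    have p: "?p i y ((1 / e i) *\<^sub>R x - ?t) = x" for x using e(1)[of i] by simp
    have "(LINT x|lborel. ?v x * w y * moll (e i) 0 0 x y)
      = (LINT x|lborel. (\<lambda>z. w y * (?v (?p i y z) * ?b z)) ((1 / e i) *\<^sub>R x - ?t))"
      unfolding p eqm by (simp only: ac_simps)
    also have "\<dots> = (e i)\<^sup>2 * (LINT z|lborel. w y * (?v (?p i y z) * ?b z))"
      using e(1)[of i] by (subst integral_affine_diff) (auto simp: power2_eq_square)
    finally show ?thesis using e(1)[of i] by simp
  qed
  have lim: "(\<lambda>i. w y * (LINT z|lborel. ?v (?p i y z) * ?b z)) \<longlonglongrightarrow> w y * H y" if y: "y \<in> Omega" for y
  proof -
    have "(\<lambda>i. LINT z|lborel. ?v (?p i y z) * ?b z) \<longlonglongrightarrow> (LINT z|lborel. H y * ?b z)"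
    proof (rule integral_dominated_convergence[where w="\<lambda>z. B * ?b z"])
      show "AE z in lborel. (\<lambda>i. ?v (?p i y z) * ?b z) \<longlonglongrightarrow> H y * ?b z"
      proof (intro AE_I2 tendsto_intros)
        fix z
        have "?p i y z = (e i * fst z + ((1 - 4 * e i) * fst y + 2 * e i), e i * snd z + ((1 - 4 * e i) * snd y + 2 * e i))" for i
          using e(1)[of i] by (auto simp: prod_eq_iff distrib_left)
        moreover have "(\<lambda>i. (e i * fst z + ((1 - 4 * e i) * fst y + 2 * e i), e i * snd z + ((1 - 4 * e i) * snd y + 2 * e i)))
          \<longlonglongrightarrow> (0 * fst z + ((1 - 4 * 0) * fst y + 2 * 0), 0 * snd z + ((1 - 4 * 0) * snd y + 2 * 0))"
          by (intro tendsto_intros e(3))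
        ultimately have p: "(\<lambda>i. ?p i y z) \<longlonglongrightarrow> y" by simp
        have "(\<lambda>i. H (?p i y z)) \<longlonglongrightarrow> H y"
          using continuous_on_tendsto_compose[OF H(1) p] by simp
        moreover have "\<forall>\<^sub>F i in sequentially. H (?p i y z) = ?v (?p i y z)"
          using topological_tendstoD[OF p open_Omega y] by eventually_elim simp
        ultimately show "(\<lambda>i. ?v (?p i y z)) \<longlonglongrightarrow> H y" by (rule Lim_transform_eventually)
      qed
      show "AE z in lborel. norm (?v (?p i y z) * ?b z) \<le> B * ?b z" for i
      proof (rule AE_I2)
        fix z
        show "norm (?v (?p i y z) * ?b z) \<le> B * ?b z"
          unfolding real_norm_def abs_mult[of _ "?b z"] abs_of_nonneg[OF b(3)] by (intro mult_right_mono vB b(3))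
      qed
      show "integrable lborel (\<lambda>z. B * ?b z)" using b(1) by simp
    qed measurable
    then have "(\<lambda>i. LINT z|lborel. ?v (?p i y z) * ?b z) \<longlonglongrightarrow> H y" using b(2) by simp
    then show ?thesis by (intro tendsto_intros)
  qed
  have bdd: "\<bar>LINT z|lborel. ?v (?p i y z) * ?b z\<bar> \<le> B" for i y
  proof -
    have "\<bar>LINT z|lborel. ?v (?p i y z) * ?b z\<bar> \<le> (LINT z|lborel. \<bar>?v (?p i y z) * ?b z\<bar>)" by (rule integral_abs_bound)
    also have "\<dots> \<le> (LINT z|lborel. B * ?b z)"
    proof (rule integral_mono)
      show le: "\<bar>?v (?p i y z) * ?b z\<bar> \<le> B * ?b z" for z
        unfolding abs_mult[of _ "?b z"] abs_of_nonneg[OF b(3)] by (intro mult_right_mono vB b(3))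
      show iB: "integrable lborel (\<lambda>z. B * ?b z)" using b(1) by simp
      show "integrable lborel (\<lambda>z. \<bar>?v (?p i y z) * ?b z\<bar>)"
      proof (rule Bochner_Integration.integrable_bound[OF iB])
        show "AE z in lborel. norm \<bar>?v (?p i y z) * ?b z\<bar> \<le> norm (B * ?b z)"
        proof (rule AE_I2)
          fix z show "norm \<bar>?v (?p i y z) * ?b z\<bar> \<le> norm (B * ?b z)" using le[of z] by simp
        qed
      qed measurable
    qed
    finally show ?thesis using b(2) by simp
  qed
  have "(\<lambda>i. LINT y|lborel. w y * (LINT z|lborel. ?v (?p i y z) * ?b z)) \<longlonglongrightarrow> (LINT y|lborel. ?v y * w y)"
  proof (rule integral_dominated_convergence[where w="\<lambda>y. B * \<bar>w y\<bar>"])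
    show "AE y in lborel. (\<lambda>i. w y * (LINT z|lborel. ?v (?p i y z) * ?b z)) \<longlonglongrightarrow> ?v y * w y"
      using ws AE_Omega_or_outside
    proof eventually_elim
      case (elim y)
      show ?case
      proof (cases "y \<in> Omega")
        case True
        then show ?thesis using lim[OF True] by (simp add: mult.commute)
      qed (use elim in simp)
    qed
    show "AE y in lborel. norm (w y * (LINT z|lborel. ?v (?p i y z) * ?b z)) \<le> B * \<bar>w y\<bar>" for i
    proof (rule AE_I2)
      fix y
      show "norm (w y * (LINT z|lborel. ?v (?p i y z) * ?b z)) \<le> B * \<bar>w y\<bar>"
        unfolding real_norm_def abs_mult[of "w y"] using mult_right_mono[OF bdd, of "\<bar>w y\<bar>"] by (simp add: mult.commute)
    qed
    show "integrable lborel (\<lambda>y. B * \<bar>w y\<bar>)" using bcs_integrable[OF w] by auto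
  qed measurable
  then show ?thesis by (simp only: inner[symmetric] integral_mult_right_zero)
qed

text \<open>Integrating in y first uses only the bound M on w and the mass of the kernel. Thus the
  pairing is controlled by the L_1 norm of v, uniformly in e, as the density argument
  requires.\<close>

lemma moll_bound:
  assumes v: "integrable lborel v" and w: "bcs R M w" and e: "0 < e" "e \<le> 1 / 8"
  shows "\<bar>1 / e\<^sup>2 * (LINT y|lborel. (LINT x|lborel. v x * w y * moll e 0 0 x y))\<bar> \<le> 4 * M * (LINT x|lborel. \<bar>v x\<bar>)"
proof -
  note [measurable] = bcs_measurable[OF w] borel_measurable_integrable[OF v]
  have M0: "0 \<le> M" using w by (simp add: bcs_def)
  have inner: "\<bar>LINT y|lborel. v x * w y * moll e 0 0 x y\<bar> \<le> \<bar>v x\<bar> * (M * (e / (1 - 4 * e))\<^sup>2)" for x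
  proof -
    note my = moll_integral_y[OF e, of x]
    have le: "AE y in lborel. \<bar>w y * moll e 0 0 x y\<bar> \<le> M * moll e 0 0 x y"
    proof -
      have "AE y in lborel. \<bar>w y\<bar> \<le> M * indicator (Qbox R) y" using w by (simp add: bcs_def)
      then show ?thesis
      proof eventually_elim
        case (elim y)
        then have "\<bar>w y\<bar> \<le> M" using M0 by (cases "y \<in> Qbox R") simp_all
        then show ?case unfolding abs_mult abs_of_nonneg[OF my(3)] by (intro mult_right_mono my(3))
      qed
    qed
    have im: "integrable lborel (\<lambda>y. M * moll e 0 0 x y)" using my(2) by simp
    note [measurable] = borel_measurable_integrable[OF my(2)]
    have iw: "integrable lborel (\<lambda>y. w y * moll e 0 0 x y)"
    proof (rule Bochner_Integration.integrable_bound[OF im])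
      show "AE y in lborel. norm (w y * moll e 0 0 x y) \<le> norm (M * moll e 0 0 x y)"
        using le by eventually_elim simp
    qed measurable
    have "\<bar>LINT y|lborel. w y * moll e 0 0 x y\<bar> \<le> (LINT y|lborel. \<bar>w y * moll e 0 0 x y\<bar>)" by (rule integral_abs_bound)
    also have "\<dots> \<le> (LINT y|lborel. M * moll e 0 0 x y)"
      by (intro integral_mono_AE integrable_abs iw im le)
    also have "\<dots> = M * (e / (1 - 4 * e))\<^sup>2" using my(1) by simp
    finally show ?thesis by (simp add: mult.assoc abs_mult mult_left_mono)
  qed
  have int: "integrable lborel (\<lambda>x. (LINT y|lborel. v x * w y * moll e 0 0 x y))"
    by (rule lborel_pair.integrable_fst[OF moll_integrable[OF v bcs_integrable[OF w]]])
  have "\<bar>LINT y|lborel. (LINT x|lborel. v x * w y * moll e 0 0 x y)\<bar>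
      = \<bar>LINT x|lborel. (LINT y|lborel. v x * w y * moll e 0 0 x y)\<bar>"
    by (simp only: moll_Fubini[OF v bcs_integrable[OF w]])
  also have "\<dots> \<le> (LINT x|lborel. \<bar>LINT y|lborel. v x * w y * moll e 0 0 x y\<bar>)" by (rule integral_abs_bound)
  also have "\<dots> \<le> (LINT x|lborel. \<bar>v x\<bar> * (M * (e / (1 - 4 * e))\<^sup>2))"
    using v by (intro integral_mono integrable_abs int inner) auto
  also have "\<dots> = (M * (e / (1 - 4 * e))\<^sup>2) * (LINT x|lborel. \<bar>v x\<bar>)" by simp
  finally have le: "\<bar>LINT y|lborel. (LINT x|lborel. v x * w y * moll e 0 0 x y)\<bar> \<le> (M * (e / (1 - 4 * e))\<^sup>2) * (LINT x|lborel. \<bar>v x\<bar>)" .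
  \<comment> \<open>Here e \<le> 1/8 enters: it keeps 1 - 4e at least 1/2.\<close>
  have "(e / (1 - 4 * e))\<^sup>2 \<le> (2 * e)\<^sup>2"
    using e by (intro power_mono) (auto simp: field_simps)
  then have "M * (e / (1 - 4 * e))\<^sup>2 * (LINT x|lborel. \<bar>v x\<bar>) \<le> M * (4 * e\<^sup>2) * (LINT x|lborel. \<bar>v x\<bar>)"
    using M0 by (intro mult_right_mono mult_left_mono) (auto simp: power_mult_distrib intro!: Bochner_Integration.integral_nonneg)
  also have "M * (4 * e\<^sup>2) * (LINT x|lborel. \<bar>v x\<bar>) = e\<^sup>2 * (4 * M * (LINT x|lborel. \<bar>v x\<bar>))" by (simp add: ac_simps)
  finally have "\<bar>LINT y|lborel. (LINT x|lborel. v x * w y * moll e 0 0 x y)\<bar> \<le> e\<^sup>2 * (4 * M * (LINT x|lborel. \<bar>v x\<bar>))"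
    using le by linarith
  then have "1 / e\<^sup>2 * \<bar>LINT y|lborel. (LINT x|lborel. v x * w y * moll e 0 0 x y)\<bar> \<le> 1 / e\<^sup>2 * (e\<^sup>2 * (4 * M * (LINT x|lborel. \<bar>v x\<bar>)))"
    by (intro mult_left_mono) auto
  then show ?thesis using e by (simp add: abs_mult)
qed

lemma moll_tendsto:
  assumes v: "integrable lborel v" and vs: "\<And>x. x \<notin> Omega \<Longrightarrow> v x = 0"
    and w: "bcs R M w" and ws: "AE y in lborel. y \<notin> closure Omega \<longrightarrow> w y = 0"
    and e: "\<And>i. 0 < e i" "\<And>i. e i \<le> 1 / 8" "e \<longlonglongrightarrow> 0"
  shows "(\<lambda>i. 1 / (e i)\<^sup>2 * (LINT y|lborel. (LINT x|lborel. v x * w y * moll (e i) 0 0 x y)))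
    \<longlonglongrightarrow> (LINT y|lborel. v y * w y)"
proof (rule LIMSEQ_I)
  fix \<epsilon> :: real assume \<epsilon>: "0 < \<epsilon>"
  have M0: "0 \<le> M" using w by (simp add: bcs_def)
  \<comment> \<open>The approximation error is multiplied by 4M in the mollified pairings and by M
    in the limit pairing; 5M + 1 also covers M = 0.\<close>
  define \<delta> where "\<delta> = \<epsilon> / (2 * (5 * M + 1))"
  have \<delta>: "0 < \<delta>" using \<epsilon> M0 by (simp add: \<delta>_def)
  have "v \<in> LpM lborel 1" using v by (auto simp: LpM_def)
  from continuous_dense_LpM[OF this _ bounded_Omega Omega_borel vs \<delta>]
  obtain H where H: "continuous_on UNIV H" "bounded (range H)"
    "(\<lambda>x. indicator Omega x *\<^sub>R H x) \<in> LpM lborel 1"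
    "LpN lborel 1 (\<lambda>x. v x - indicator Omega x *\<^sub>R H x) < \<delta>" by auto
  obtain B where B: "\<And>z. \<bar>H z\<bar> \<le> B" using H(2) by (auto simp: bounded_iff)
  let ?H = "\<lambda>x. indicator Omega x * H x"
  let ?J = "\<lambda>v i. 1 / (e i)\<^sup>2 * (LINT y|lborel. (LINT x|lborel. v x * w y * moll (e i) 0 0 x y))"
  have iH: "integrable lborel ?H"
  proof -
    have "integrable lborel (\<lambda>x. \<bar>?H x\<bar>)" "?H \<in> borel_measurable lborel" using H(3) by (auto simp: LpM_def)
    then show ?thesis by (simp add: integrable_abs_iff)
  qed
  have id: "integrable lborel (\<lambda>x. v x - ?H x)" using v iH by simp
  have d: "(LINT x|lborel. \<bar>v x - ?H x\<bar>) < \<delta>" using H(4) by (simp add: LpN_def)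
  note iw = bcs_integrable[OF w]
  have Jd: "?J (\<lambda>x. v x - ?H x) i = ?J v i - ?J ?H i" for i
  proof -
    have iy: "integrable lborel (\<lambda>y. (LINT x|lborel. u x * w y * moll (e i) 0 0 x y))" if "integrable lborel u" for u
      by (rule lborel_pair.integrable_snd[OF moll_integrable[OF that iw]])
    have ae: "AE y in lborel. integrable lborel (\<lambda>x. u x * w y * moll (e i) 0 0 x y)" if "integrable lborel u" for u
      using lborel_pair.AE_integrable_snd[OF moll_integrable[OF that iw]] .
    have "(LINT y|lborel. (LINT x|lborel. (v x - ?H x) * w y * moll (e i) 0 0 x y))
      = (LINT y|lborel. (LINT x|lborel. v x * w y * moll (e i) 0 0 x y) - (LINT x|lborel. ?H x * w y * moll (e i) 0 0 x y))"
    proof (rule integral_cong_AE)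
      show "AE y in lborel. (LINT x|lborel. (v x - ?H x) * w y * moll (e i) 0 0 x y)
        = (LINT x|lborel. v x * w y * moll (e i) 0 0 x y) - (LINT x|lborel. ?H x * w y * moll (e i) 0 0 x y)"
        using ae[OF v] ae[OF iH] by eventually_elim (simp add: left_diff_distrib)
    qed (use borel_measurable_integrable[OF iy[OF id]] borel_measurable_integrable[OF iy[OF v]] borel_measurable_integrable[OF iy[OF iH]] in auto)
    then show ?thesis using iy[OF v] iy[OF iH] by (simp add: right_diff_distrib)
  qed
  have i1: "integrable lborel (\<lambda>y. u y * w y)" if u: "integrable lborel u" for u
  proof -
    note [measurable] = borel_measurable_integrable[OF u] bcs_measurable[OF w]
    have "integrable lborel (\<lambda>y. M * u y)" using u by simp
    then show ?thesis
    proof (rule Bochner_Integration.integrable_bound)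
      have "AE y in lborel. \<bar>w y\<bar> \<le> M * indicator (Qbox R) y" using w by (simp add: bcs_def)
      then show "AE y in lborel. norm (u y * w y) \<le> norm (M * u y)"
      proof eventually_elim
        case (elim y)
        then have "\<bar>w y\<bar> \<le> M" using M0 by (cases "y \<in> Qbox R") simp_all
        then have "\<bar>u y\<bar> * \<bar>w y\<bar> \<le> \<bar>u y\<bar> * M" by (intro mult_left_mono) auto
        then show ?case using M0 by (simp add: abs_mult mult.commute)
      qed
    qed measurable
  qed
  have lim_d: "\<bar>(LINT y|lborel. v y * w y) - (LINT y|lborel. ?H y * w y)\<bar> \<le> M * \<delta>"
  proof -
    have "\<bar>(LINT y|lborel. v y * w y) - (LINT y|lborel. ?H y * w y)\<bar> = \<bar>LINT y|lborel. (v y - ?H y) * w y\<bar>"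
      using i1[OF v] i1[OF iH] by (simp add: left_diff_distrib)
    also have "\<dots> \<le> (LINT y|lborel. \<bar>(v y - ?H y) * w y\<bar>)" by (rule integral_abs_bound)
    also have "\<dots> \<le> (LINT y|lborel. M * \<bar>v y - ?H y\<bar>)"
    proof (intro integral_mono_AE integrable_abs i1 id integrable_mult_right)
      have "AE y in lborel. \<bar>w y\<bar> \<le> M * indicator (Qbox R) y" using w by (simp add: bcs_def)
      then show "AE y in lborel. \<bar>(v y - ?H y) * w y\<bar> \<le> M * \<bar>v y - ?H y\<bar>"
      proof eventually_elim
        case (elim y)
        then have "\<bar>w y\<bar> \<le> M" using M0 by (cases "y \<in> Qbox R") simp_all
        then show ?case unfolding abs_mult by (subst mult.commute) (rule mult_right_mono, auto)
      qed
    qed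
    also have "\<dots> \<le> M * \<delta>" using d M0 by (simp add: mult_left_mono)
    finally show ?thesis .
  qed
  obtain N where N: "\<And>i. i \<ge> N \<Longrightarrow> norm (?J ?H i - (LINT y|lborel. ?H y * w y)) < \<epsilon> / 2"
    using LIMSEQ_D[OF moll_limit_continuous[OF H(1) B w ws e], of "\<epsilon> / 2"] \<epsilon> by auto
  have "norm (?J v i - (LINT y|lborel. v y * w y)) < \<epsilon>" if "i \<ge> N" for i
  proof -
    have "\<bar>?J v i - ?J ?H i\<bar> \<le> 4 * M * (LINT x|lborel. \<bar>v x - ?H x\<bar>)"
      using moll_bound[OF id w e(1) e(2), of i] unfolding Jd .
    also have "\<dots> \<le> 4 * M * \<delta>" using d M0 by (intro mult_left_mono) auto
    finally have "\<bar>?J v i - ?J ?H i\<bar> \<le> 4 * M * \<delta>" .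
    moreover have "4 * M * \<delta> + M * \<delta> < \<epsilon> / 2"
    proof -
      have "(5 * M + 1) * \<delta> = \<epsilon> / 2" using M0 unfolding \<delta>_def by (simp add: divide_simps)
      then show ?thesis using \<delta> by (simp add: algebra_simps)
    qed
    ultimately show ?thesis using N[OF that] lim_d unfolding real_norm_def by linarith
  qed
  then show "\<exists>N. \<forall>i\<ge>N. norm (?J v i - (LINT y|lborel. v y * w y)) < \<epsilon>" by blast
qed

text \<open>The kernel depends on x and y only through x/e - (1 - 4e) y/e, so its x- and
  y-derivatives are proportional. Its x-derivatives are moved onto u, where it is an admissible test
  function in the open square, and its y-derivatives onto w, whose weak derivative holds on the
  whole plane. The factor (-(1 - 4e))^n left over, with n the order, tends to the sign
  (-1)^n.\<close>

theorem integration_by_parts: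
  fixes u d :: "point \<Rightarrow> real"
  assumes ud: "has_weak_deriv Omega \<alpha> u d"
    and u: "integrable lborel (\<lambda>z. indicator Omega z * u z)" and d: "integrable lborel (\<lambda>z. indicator Omega z * d z)"
    and wg: "tensor_weak_deriv \<alpha> w g" and w: "bcs R M w" and g: "bcs R M g"
    and ws: "AE y in lborel. y \<notin> closure Omega \<longrightarrow> w y = 0" and gs: "AE y in lborel. y \<notin> closure Omega \<longrightarrow> g y = 0"
  shows "(LINT z|lborel. indicator Omega z * u z * g z) = (-1) ^ (fst \<alpha> + snd \<alpha>) * (LINT z|lborel. indicator Omega z * d z * w z)"
proof -
  let ?u = "\<lambda>z. indicator Omega z * u z" and ?d = "\<lambda>z. indicator Omega z * d z"
  let ?r = "fst \<alpha>" and ?s = "snd \<alpha>"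
  let ?n = "fst \<alpha> + snd \<alpha>"
  note iw = bcs_integrable[OF w] and ig = bcs_integrable[OF g]
  have key: "1 / e\<^sup>2 * (LINT y|lborel. (LINT x|lborel. ?u x * g y * moll e 0 0 x y))
      = (- (1 - 4 * e)) ^ ?n * (1 / e\<^sup>2 * (LINT y|lborel. (LINT x|lborel. ?d x * w y * moll e 0 0 x y)))"
    if e: "0 < e" "e \<le> 1 / 8" for e
  proof -
    define k where "k = (1 - 4 * e) / e"
    have kpos: "k > 0" using e by (simp add: k_def)
    have tens_support0: "indicator Omega z * t * h = t * h" if "z \<notin> Omega \<Longrightarrow> t = 0" for z and t h :: real
      using that by (cases "z \<in> Omega") auto
    have x_side: "(1 / e) ^ ?n * (LINT x|lborel. ?u x * w y * moll e ?r ?s x y) = (-1) ^ ?n * (LINT x|lborel. ?d x * w y * moll e 0 0 x y)"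
      if y: "y \<in> closure Omega" for y
    proof -
      let ?a = "\<lambda>t. bump (1 / e * t + (- (k * fst y) - 2))" and ?b = "\<lambda>t. bump (1 / e * t + (- (k * snd y) - 2))"
      have yb: "0 \<le> fst y" "fst y \<le> 1" "0 \<le> snd y" "snd y \<le> 1" using y by (auto simp: closure_Omega mem_cbox_point)
      \<comment> \<open>The bump lives on [0,1], so t lies between (1 - 4e) y0 + 2e and (1 - 4e) y0
        + 3e. For y0 in [0,1] this is contained in [2e, 1 - e], a compact subinterval of
        (0,1).\<close>
      have sup: "2 * e \<le> t \<and> t \<le> 1 - e" if b: "bump (1 / e * t + (- (k * y0) - 2)) \<noteq> 0" and y0: "0 \<le> y0" "y0 \<le> 1" for t y0
      proof -
        have "0 \<le> 1 / e * t + (- (k * y0) - 2)" "1 / e * t + (- (k * y0) - 2) \<le> 1"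
          using b tst_bump by (auto simp: tst_def)
        then have "e * (k * y0 + 2) \<le> t" "t \<le> e * (k * y0 + 3)" using e by (simp_all add: field_simps)
        moreover have "e * (k * y0) = (1 - 4 * e) * y0" using e by (simp add: k_def)
        moreover have "0 \<le> (1 - 4 * e) * y0" "(1 - 4 * e) * y0 \<le> 1 - 4 * e" using e y0 by (auto simp: mult_left_le)
        ultimately show ?thesis unfolding distrib_left by linarith
      qed
      have t: "tst (2 * e) (1 - e) ?a" "tst (2 * e) (1 - e) ?b"
        unfolding tst_def using sup yb by (intro conjI allI impI smooth_affine smooth_bump; blast)+
      have sub: "cbox (2 * e, 2 * e) (1 - e, 1 - e) \<subseteq> Omega"
        using e by (auto simp: Omega_def mem_cbox_point)
      have D: "tens ((deriv ^^ ?r) ?a) ((deriv ^^ ?s) ?b) x = (1 / e) ^ ?n * moll e ?r ?s x y" for x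
        unfolding funpow_deriv_affine[OF smooth_bump] by (simp add: tens_def moll_def k_def power_add)
      have D0: "tens ?a ?b x = moll e 0 0 x y" for x by (simp add: tens_def moll_def k_def)
      have off: "x \<notin> Omega \<Longrightarrow> tens ((deriv ^^ r) ?a) ((deriv ^^ s) ?b) x = 0" for r s x
        using tens_support[OF tst_funpow_deriv[OF t(1)] tst_funpow_deriv[OF t(2)]] sub by blast
      have "(1 / e) ^ ?n * (LINT x|lborel. ?u x * w y * moll e ?r ?s x y)
          = (LINT x|lborel. w y * (tens ((deriv ^^ ?r) ?a) ((deriv ^^ ?s) ?b) x * u x))"
      proof -
        have "(1 / e) ^ ?n * (?u x * w y * moll e ?r ?s x y) = w y * (tens ((deriv ^^ ?r) ?a) ((deriv ^^ ?s) ?b) x * u x)" for x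
          using off[of x ?r ?s] unfolding D by (cases "x \<in> Omega") (auto simp: ac_simps)
        then show ?thesis by (simp only: integral_mult_right_zero[symmetric])
      qed
      also have "\<dots> = w y * tint ((deriv ^^ ?r) ?a) ((deriv ^^ ?s) ?b) u" by (simp add: tint_def)
      also have "\<dots> = w y * ((-1) ^ ?n * tint ?a ?b d)"
        using has_weak_deriv_tint[OF ud Omega_borel t sub] by simp
      also have "\<dots> = (-1) ^ ?n * (LINT x|lborel. ?d x * w y * moll e 0 0 x y)"
      proof -
        have off0: "x \<notin> Omega \<Longrightarrow> moll e 0 0 x y = 0" for x
          using off[of x 0 0] D0[of x] by simp
        have "w y * (tens ?a ?b x * d x) = ?d x * w y * moll e 0 0 x y" for x
          unfolding D0 using off0[of x] by (cases "x \<in> Omega") (auto simp: ac_simps)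
        then have "w y * tint ?a ?b d = (LINT x|lborel. ?d x * w y * moll e 0 0 x y)"
          unfolding tint_def by (simp only: integral_mult_right_zero[symmetric])
        then show ?thesis by (simp add: mult.left_commute)
      qed
      finally show ?thesis .
    qed
    \<comment> \<open>No restriction on x is needed: in the variable y the kernel is a test function
      on the plane, whatever its support.\<close>
    have y_side: "(- k) ^ ?n * (LINT y|lborel. ?u x * w y * moll e ?r ?s x y) = (-1) ^ ?n * (LINT y|lborel. ?u x * g y * moll e 0 0 x y)" for x
    proof -
      let ?a = "\<lambda>t. bump ((- k) * t + (1 / e * fst x - 2))" and ?b = "\<lambda>t. bump ((- k) * t + (1 / e * snd x - 2))"
      have tst': "tst ((c - 3) / k) ((c - 2) / k) (\<lambda>t. bump ((- k) * t + (c - 2)))" for c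
        unfolding tst_def
      proof (intro conjI allI impI)
        show "smooth (\<lambda>t. bump ((- k) * t + (c - 2)))" by (rule smooth_affine[OF smooth_bump])
        fix t assume "bump ((- k) * t + (c - 2)) \<noteq> 0"
        then have "0 \<le> (- k) * t + (c - 2)" "(- k) * t + (c - 2) \<le> 1" using tst_bump by (auto simp: tst_def)
        then show "(c - 3) / k \<le> t" "t \<le> (c - 2) / k" using kpos by (auto simp: field_simps)
      qed
      have arg: "(- k) * b + (a - 2) = a + (- (k * b) - 2)" for a b :: real by simp
      have D: "tens ((deriv ^^ ?r) ?a) ((deriv ^^ ?s) ?b) y = (- k) ^ ?n * moll e ?r ?s x y" for y
        unfolding funpow_deriv_affine[OF smooth_bump] unfolding arg by (simp add: tens_def moll_def k_def power_add)
      have D0: "tens ?a ?b y = moll e 0 0 x y" for y unfolding arg by (simp add: tens_def moll_def k_def)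
      have "tint ((deriv ^^ ?r) ?a) ((deriv ^^ ?s) ?b) w = (-1) ^ ?n * tint ?a ?b g"
        using wg tst' unfolding tensor_weak_deriv_def by blast
      then have "(LINT y|lborel. (- k) ^ ?n * moll e ?r ?s x y * w y) = (-1) ^ ?n * (LINT y|lborel. moll e 0 0 x y * g y)"
        unfolding tint_def D D0 .
      then have eq: "(- k) ^ ?n * (LINT y|lborel. moll e ?r ?s x y * w y) = (-1) ^ ?n * (LINT y|lborel. moll e 0 0 x y * g y)"
        by (simp only: mult.assoc integral_mult_right_zero)
      have pull: "(LINT y|lborel. ?u x * h y * moll e r s x y) = ?u x * (LINT y|lborel. moll e r s x y * h y)" for h r s
        unfolding integral_mult_right_zero[symmetric] by (simp only: ac_simps)
      show ?thesis
        unfolding pull mult.left_commute[of "(- k) ^ ?n" "?u x"] mult.left_commute[of "(-1) ^ ?n" "?u x"] eq ..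
    qed
    let ?I = "LINT y|lborel. (LINT x|lborel. ?u x * w y * moll e ?r ?s x y)"
    let ?Jdw = "LINT y|lborel. (LINT x|lborel. ?d x * w y * moll e 0 0 x y)"
    let ?Jug = "LINT y|lborel. (LINT x|lborel. ?u x * g y * moll e 0 0 x y)"
    have A: "(1 / e) ^ ?n * ?I = (-1) ^ ?n * ?Jdw"
    proof -
      note [measurable] = borel_measurable_integrable[OF lborel_pair.integrable_snd[OF moll_integrable[OF u iw]]]
        borel_measurable_integrable[OF lborel_pair.integrable_snd[OF moll_integrable[OF d iw]]]
      have "(LINT y|lborel. (1 / e) ^ ?n * (LINT x|lborel. ?u x * w y * moll e ?r ?s x y))
          = (LINT y|lborel. (-1) ^ ?n * (LINT x|lborel. ?d x * w y * moll e 0 0 x y))"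
      \<comment> \<open>The x-identity is available only for y in the closed square; for almost all
        other y both sides vanish with w y.\<close>
      proof (rule integral_cong_AE)
        show "AE y in lborel. (1 / e) ^ ?n * (LINT x|lborel. ?u x * w y * moll e ?r ?s x y) = (-1) ^ ?n * (LINT x|lborel. ?d x * w y * moll e 0 0 x y)"
          using ws
        proof eventually_elim
          case (elim y)
          show ?case
          proof (cases "y \<in> closure Omega")
            case True then show ?thesis by (rule x_side)
          next
            case False
            then have "w y = 0" using elim by simp
            then show ?thesis by simp
          qed
        qed
      qed measurable
      then show ?thesis by (simp only: integral_mult_right_zero)
    qed
    have "(- k) ^ ?n * ?I = (- k) ^ ?n * (LINT x|lborel. (LINT y|lborel. ?u x * w y * moll e ?r ?s x y))"
      by (simp only: moll_Fubini[OF u iw])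
    also have "\<dots> = (-1) ^ ?n * (LINT x|lborel. (LINT y|lborel. ?u x * g y * moll e 0 0 x y))"
    proof -
      have "(LINT x|lborel. (- k) ^ ?n * (LINT y|lborel. ?u x * w y * moll e ?r ?s x y))
        = (LINT x|lborel. (-1) ^ ?n * (LINT y|lborel. ?u x * g y * moll e 0 0 x y))"
        by (simp only: y_side)
      then show ?thesis by (simp only: integral_mult_right_zero)
    qed
    also have "\<dots> = (-1) ^ ?n * ?Jug" by (simp only: moll_Fubini[OF u ig])
    finally have Bq: "(-1) ^ ?n * ?Jug = (- k) ^ ?n * ?I" by simp
    have pk: "(- k) ^ ?n = (- (1 - 4 * e)) ^ ?n * (1 / e) ^ ?n"
    proof -
      have "- k = - (1 - 4 * e) * (1 / e)" unfolding k_def by (simp only: mult_minus_left minus_divide_left times_divide_eq_right mult_1_right)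
      then show ?thesis by (simp only: power_mult_distrib)
    qed
    have C: "(-1) ^ ?n * ?Jug = (- (1 - 4 * e)) ^ ?n * ((-1) ^ ?n * ?Jdw)"
      unfolding Bq pk mult.assoc[of "(- (1 - 4 * e)) ^ ?n" "(1 / e) ^ ?n"] A ..
    have sq: "(-1) ^ ?n * ((-1) ^ ?n * x) = x" for x :: real
      by (simp add: mult.assoc[symmetric] power_mult_distrib[symmetric])
    have "?Jug = (-1) ^ ?n * ((-1) ^ ?n * ?Jug)" by (rule sq[symmetric])
    also have "\<dots> = (-1) ^ ?n * ((- (1 - 4 * e)) ^ ?n * ((-1) ^ ?n * ?Jdw))" by (simp only: C)
    also have "\<dots> = (- (1 - 4 * e)) ^ ?n * ((-1) ^ ?n * ((-1) ^ ?n * ?Jdw))" by (rule mult.left_commute)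
    also have "\<dots> = (- (1 - 4 * e)) ^ ?n * ?Jdw" by (simp only: sq)
    finally have J: "?Jug = (- (1 - 4 * e)) ^ ?n * ?Jdw" .
    show ?thesis unfolding J by (rule mult.left_commute)
  qed
  define e where "e i = 1 / (8 * real (Suc i))" for i
  have e: "0 < e i" "e i \<le> 1 / 8" for i by (auto simp: e_def field_simps)
  have "(\<lambda>i. 1 / 8 * (1 / real (Suc i))) \<longlonglongrightarrow> 1 / 8 * 0"
    using LIMSEQ_inverse_real_of_nat by (intro tendsto_intros) (simp add: inverse_eq_divide)
  then have e0: "e \<longlonglongrightarrow> 0" by (simp add: e_def[abs_def])
  have off: "x \<notin> Omega \<Longrightarrow> ?u x = 0" "x \<notin> Omega \<Longrightarrow> ?d x = 0" for x by auto
  have "(\<lambda>i. 1 / (e i)\<^sup>2 * (LINT y|lborel. (LINT x|lborel. ?u x * g y * moll (e i) 0 0 x y))) \<longlonglongrightarrow> (LINT y|lborel. ?u y * g y)"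
    by (rule moll_tendsto[OF u off(1) g gs e e0])
  moreover have "(\<lambda>i. (- (1 - 4 * e i)) ^ ?n * (1 / (e i)\<^sup>2 * (LINT y|lborel. (LINT x|lborel. ?d x * w y * moll (e i) 0 0 x y))))
      \<longlonglongrightarrow> (- (1 - 4 * 0)) ^ ?n * (LINT y|lborel. ?d y * w y)"
    by (intro tendsto_intros e0 moll_tendsto[OF d off(2) w ws e e0])
  ultimately show ?thesis unfolding key[OF e] by (simp add: LIMSEQ_unique)
qed

section \<open>Uniform boundedness on $L_p$ of a probability space\<close>

lemma LpN_Fatou:
  fixes f :: "nat \<Rightarrow> 'x \<Rightarrow> real"
  assumes f: "\<And>k. f k \<in> LpM M p" and p: "1 \<le> p" and c: "\<And>k. LpN M p (f k) \<le> c"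
    and [measurable]: "g \<in> borel_measurable M" and lim: "AE x in M. (\<lambda>k. f k x) \<longlonglongrightarrow> g x"
  shows "g \<in> LpM M p" "LpN M p g \<le> c"
proof -
  have c0: "0 \<le> c" using c[of 0] LpN_nonneg[of M p "f 0"] by linarith
  have [measurable]: "f k \<in> borel_measurable M" for k by (rule LpM_measurable[OF f])
  have "(\<integral>\<^sup>+x. ennreal (norm (g x) powr p) \<partial>M) = (\<integral>\<^sup>+x. liminf (\<lambda>k. ennreal (norm (f k x) powr p)) \<partial>M)"
  proof (rule nn_integral_cong_AE)
    show "AE x in M. ennreal (norm (g x) powr p) = liminf (\<lambda>k. ennreal (norm (f k x) powr p))"
      using lim
    proof eventually_elim
      case (elim x)
      have "(\<lambda>k. ennreal (norm (f k x) powr p)) \<longlonglongrightarrow> ennreal (norm (g x) powr p)"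
        using p by (intro tendsto_ennrealI tendsto_powr' tendsto_norm elim tendsto_const) auto
      then show ?case by (rule lim_imp_Liminf[OF trivial_limit_sequentially, symmetric])
    qed
  qed
  also have "\<dots> \<le> liminf (\<lambda>k. \<integral>\<^sup>+x. ennreal (norm (f k x) powr p) \<partial>M)"
    by (rule nn_integral_liminf) measurable
  also have "\<dots> \<le> ennreal (c powr p)"
  proof -
    have "(\<integral>\<^sup>+x. ennreal (norm (f k x) powr p) \<partial>M) \<le> ennreal (c powr p)" for k
    proof -
      have "(LINT x|M. norm (f k x) powr p) \<le> c powr p"
        using c[of k] p c0 by (subst (asm) LpN_le_iff) auto
      then show ?thesis using LpM_integrable[OF f[of k]] by (subst nn_integral_eq_integral) auto
    qed
    then have "liminf (\<lambda>k. \<integral>\<^sup>+x. ennreal (norm (f k x) powr p) \<partial>M) \<le> liminf (\<lambda>k::nat. ennreal (c powr p))"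
      by (intro Liminf_mono always_eventually allI)
    then show ?thesis by (simp add: Liminf_const)
  qed
  finally have le: "(\<integral>\<^sup>+x. ennreal (norm (g x) powr p) \<partial>M) \<le> ennreal (c powr p)" .
  have "(\<integral>\<^sup>+x. ennreal (norm (g x) powr p) \<partial>M) < \<infinity>"
    by (rule le_less_trans[OF le]) simp
  then have int: "integrable M (\<lambda>x. norm (g x) powr p)"
    by (intro integrableI_bounded) auto
  then show "g \<in> LpM M p" by (simp add: LpM_def)
  have "ennreal (LINT x|M. norm (g x) powr p) \<le> ennreal (c powr p)"
    using le int by (subst (asm) nn_integral_eq_integral) auto
  then show "LpN M p g \<le> c" using p c0 by (subst LpN_le_iff) auto
qed

text \<open>Completeness in the form required, with functions instead of classes. On a probability
  space the L_1 norms are summable too, so the series converges absolutely almost everywhere; Fatou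
  transfers the tail estimates to the limit.\<close>

lemma Riesz_Fischer:
  fixes y :: "nat \<Rightarrow> 'x \<Rightarrow> real"
  assumes M: "prob_space M" and p: "1 \<le> p" and y: "\<And>i. y i \<in> LpM M p"
    and b: "\<And>i. LpN M p (y i) \<le> b i" and sb: "summable b"
  obtains x where "x \<in> LpM M p" "\<And>m. LpN M p (\<lambda>\<omega>. x \<omega> - (\<Sum>i<m. y i \<omega>)) \<le> (\<Sum>i. b (i + m))"
proof -
  have [measurable]: "y i \<in> borel_measurable M" for i by (rule LpM_measurable[OF y])
  have b0: "0 \<le> b i" for i using b[of i] LpN_nonneg[of M p "y i"] by linarith
  have y1: "y i \<in> LpM M 1" "LpN M 1 (y i) \<le> b i" for i
    using LpM_mono_exponent[OF y[of i] order_refl p M] b[of i] by auto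
  have "(\<integral>\<^sup>+\<omega>. (\<Sum>i. ennreal \<bar>y i \<omega>\<bar>) \<partial>M) = (\<Sum>i. \<integral>\<^sup>+\<omega>. ennreal \<bar>y i \<omega>\<bar> \<partial>M)"
    by (rule nn_integral_suminf) measurable
  also have "\<dots> \<le> (\<Sum>i. ennreal (b i))"
  proof (rule suminf_le)
    fix i
    have i: "integrable M (\<lambda>\<omega>. \<bar>y i \<omega>\<bar>)" using LpM_integrable[OF y1(1)[of i]] by simp
    have "(LINT \<omega>|M. \<bar>y i \<omega>\<bar>) \<le> b i" using y1(2)[of i] by (simp add: LpN_def)
    then show "(\<integral>\<^sup>+\<omega>. ennreal \<bar>y i \<omega>\<bar> \<partial>M) \<le> ennreal (b i)"
      using i by (subst nn_integral_eq_integral) (auto intro: ennreal_leI)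
  qed auto
  also have "\<dots> = ennreal (\<Sum>i. b i)" by (rule suminf_ennreal2[OF b0 sb])
  finally have "(\<integral>\<^sup>+\<omega>. (\<Sum>i. ennreal \<bar>y i \<omega>\<bar>) \<partial>M) \<noteq> \<infinity>" by (auto simp: top_unique)
  then have "AE \<omega> in M. (\<Sum>i. ennreal \<bar>y i \<omega>\<bar>) \<noteq> \<infinity>"
    by (intro nn_integral_PInf_AE) measurable
  then have sum_AE: "AE \<omega> in M. summable (\<lambda>i. y i \<omega>)"
  proof eventually_elim
    case (elim \<omega>)
    then have "summable (\<lambda>i. \<bar>y i \<omega>\<bar>)" by (intro summable_suminf_not_top) auto
    then show ?case by (rule summable_rabs_cancel)
  qed
  define x where "x \<omega> = (\<Sum>i. y i \<omega>)" for \<omega>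
  have [measurable]: "x \<in> borel_measurable M" unfolding x_def by measurable
  have S: "(\<lambda>\<omega>. \<Sum>i\<in>I. y i \<omega>) \<in> LpM M p" for I by (intro LpM_sum y p)
  have tail: "LpN M p (\<lambda>\<omega>. (\<Sum>i<k + m. y i \<omega>) - (\<Sum>i<m. y i \<omega>)) \<le> (\<Sum>i. b (i + m))" for k m
  proof -
    have "(\<Sum>i<k + m. y i \<omega>) - (\<Sum>i<m. y i \<omega>) = (\<Sum>i\<in>{m..<k + m}. y i \<omega>)" for \<omega>
      using sum_diff_nat_ivl[of 0 m "k + m" "\<lambda>i. y i \<omega>"] by (simp add: lessThan_atLeast0)
    then have "LpN M p (\<lambda>\<omega>. (\<Sum>i<k + m. y i \<omega>) - (\<Sum>i<m. y i \<omega>)) = LpN M p (\<lambda>\<omega>. \<Sum>i\<in>{m..<k + m}. y i \<omega>)" by simp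
    also have "\<dots> \<le> (\<Sum>i\<in>{m..<k + m}. LpN M p (y i))" by (intro LpN_sum_le y p)
    also have "\<dots> \<le> (\<Sum>i\<in>{m..<k + m}. b i)" by (intro sum_mono b)
    also have "\<dots> = (\<Sum>i<k. b (i + m))"
      using sum.shift_bounds_nat_ivl[of b 0 m k] by (simp add: lessThan_atLeast0)
    also have "\<dots> \<le> (\<Sum>i. b (i + m))"
      using sb b0 by (intro sum_le_suminf) (auto simp: summable_iff_shift)
    finally show ?thesis .
  qed
  have lim: "AE \<omega> in M. (\<lambda>k. (\<Sum>i<k + m. y i \<omega>) - (\<Sum>i<m. y i \<omega>)) \<longlonglongrightarrow> x \<omega> - (\<Sum>i<m. y i \<omega>)" for m
    using sum_AE
  proof eventually_elim
    case (elim \<omega>)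
    have "(\<lambda>k. \<Sum>i<k. y i \<omega>) \<longlonglongrightarrow> x \<omega>" unfolding x_def by (rule summable_LIMSEQ[OF elim])
    then have "(\<lambda>k. \<Sum>i<k + m. y i \<omega>) \<longlonglongrightarrow> x \<omega>" by (rule LIMSEQ_ignore_initial_segment)
    then show ?case by (intro tendsto_intros)
  qed
  note F = LpN_Fatou[OF LpM_diff[OF S S p] p tail _ lim]
  show ?thesis
  proof (rule that)
    have "(\<lambda>\<omega>. x \<omega> - (\<Sum>i<0. y i \<omega>)) \<in> LpM M p" by (rule F(1)) measurable
    then show "x \<in> LpM M p" by simp
    show "LpN M p (\<lambda>\<omega>. x \<omega> - (\<Sum>i<m. y i \<omega>)) \<le> (\<Sum>i. b (i + m))" for m by (rule F(2)) measurable
  qed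
qed

text \<open>Sokal's elementary proof: perturbing \<open>x\<^sub>i\<close> by \<open>\<plusminus>\<xi>\<^sub>i\<close>, one of the signs gives \<open>N (x\<^sub>i \<plusminus> \<xi>\<^sub>i) \<ge> N \<xi>\<^sub>i\<close>.\<close>

theorem uniform_boundedness_LpM:
  fixes N :: "nat \<Rightarrow> ('x \<Rightarrow> real) \<Rightarrow> real"
  assumes M: "prob_space M" and p: "1 \<le> p"
    and add: "\<And>n f g. f \<in> LpM M p \<Longrightarrow> g \<in> LpM M p \<Longrightarrow> N n (\<lambda>\<omega>. f \<omega> + g \<omega>) \<le> N n f + N n g"
    and scale: "\<And>n f c. f \<in> LpM M p \<Longrightarrow> N n (\<lambda>\<omega>. c * f \<omega>) = \<bar>c\<bar> * N n f"
    and bound: "\<And>n. \<exists>C. \<forall>f\<in>LpM M p. N n f \<le> C * LpN M p f"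
    and pointwise: "\<And>f. f \<in> LpM M p \<Longrightarrow> \<exists>B. \<forall>n. N n f \<le> B"
  shows "\<exists>C\<ge>0. \<forall>n. \<forall>f\<in>LpM M p. N n f \<le> C * LpN M p f"
proof (rule ccontr)
  assume neg: "\<not> ?thesis"
  have sc: "(\<lambda>\<omega>. c * f \<omega>) \<in> LpM M p" "LpN M p (\<lambda>\<omega>. c * f \<omega>) = \<bar>c\<bar> * LpN M p f" if "f \<in> LpM M p" for f c
    using LpM_scaleR[OF that, of c] LpN_scaleR[of p M c f] p by simp_all
  have diff: "(\<lambda>\<omega>. f \<omega> - g \<omega>) \<in> LpM M p" "N n (\<lambda>\<omega>. f \<omega> - g \<omega>) \<le> N n f + N n g"
    if "f \<in> LpM M p" "g \<in> LpM M p" for f g n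
  proof -
    show "(\<lambda>\<omega>. f \<omega> - g \<omega>) \<in> LpM M p" by (rule LpM_diff[OF that p])
    show "N n (\<lambda>\<omega>. f \<omega> - g \<omega>) \<le> N n f + N n g"
      using add[OF that(1) sc(1)[OF that(2), of "-1"], of n] scale[OF that(2), of n "-1"] by simp
  qed
  define S where "S n = {N n f | f. f \<in> LpM M p \<and> LpN M p f \<le> 1}" for n
  \<comment> \<open>The operator norm of the n-th seminorm. If the claim fails, these norms are
    unbounded, and an index n i with norm above 4^i exists for every i.\<close>
  define opn where "opn n = Sup (S n)" for n
  have bdd: "bdd_above (S n)" for n
  proof -
    obtain C where C: "\<And>f. f \<in> LpM M p \<Longrightarrow> N n f \<le> C * LpN M p f" using bound[of n] by blast
    have "N n f \<le> \<bar>C\<bar>" if "f \<in> LpM M p" "LpN M p f \<le> 1" for f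
    proof -
      have "C * LpN M p f \<le> \<bar>C\<bar> * 1"
        using that(2) LpN_nonneg[of M p f] by (intro mult_mono) auto
      then show ?thesis using C[OF that(1)] by linarith
    qed
    then show ?thesis unfolding S_def by (auto intro!: bdd_aboveI)
  qed
  have N0: "N n (\<lambda>\<omega>. 0) = 0" for n using scale[of "\<lambda>\<omega>. 0" n 0] by simp
  have S0: "0 \<in> S n" for n
    unfolding S_def using N0[of n] by (auto intro!: exI[of _ "\<lambda>\<omega>. 0"] simp: LpN_def)
  have o0: "0 \<le> opn n" for n unfolding opn_def by (rule cSup_upper[OF S0 bdd])
  have No: "N n f \<le> opn n * LpN M p f" if f: "f \<in> LpM M p" for n f
  proof (cases "LpN M p f = 0")
    case True
    then show ?thesis using bound[of n] f by fastforce
  next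
    case False
    then have pos: "LpN M p f > 0" using LpN_nonneg[of M p f] by linarith
    let ?c = "1 / LpN M p f"
    have "N n (\<lambda>\<omega>. ?c * f \<omega>) \<in> S n"
      unfolding S_def using sc[OF f, of ?c] pos by (auto intro!: exI[of _ "\<lambda>\<omega>. ?c * f \<omega>"])
    then have "?c * N n f \<le> opn n"
      using cSup_upper[OF _ bdd] scale[OF f, of n ?c] pos unfolding opn_def by auto
    then show ?thesis using pos by (simp add: field_simps)
  qed
  have "\<exists>n. opn n > 4 ^ i" for i :: nat
  proof (rule ccontr)
    assume "\<nexists>n. opn n > 4 ^ i"
    then have le: "opn n \<le> 4 ^ i" for n by (simp add: not_less)
    have "N n f \<le> 4 ^ i * LpN M p f" if "f \<in> LpM M p" for n f
      by (rule order_trans[OF No[OF that] mult_right_mono[OF le LpN_nonneg]])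
    then show False using neg by (meson zero_le_numeral zero_le_power)
  qed
  then obtain n where n: "\<And>i::nat. opn (n i) > 4 ^ i" by metis
  \<comment> \<open>Perturbations of size 3^(-i) that nearly attain the operator norm; 2/3 is any
    factor below 1 that still exceeds the tail ratio 1/2 below.\<close>
  have "\<exists>\<xi>. \<xi> \<in> LpM M p \<and> LpN M p \<xi> \<le> (1/3) ^ i \<and> N (n i) \<xi> \<ge> 2/3 * (1/3) ^ i * opn (n i)" for i
  proof -
    have "0 < opn (n i)" using n[of i] by (smt (verit) zero_less_power)
    then have "2/3 * opn (n i) < Sup (S (n i))" unfolding opn_def by simp
    then obtain s where "s \<in> S (n i)" "2/3 * opn (n i) < s"
      using less_cSup_iff[OF _ bdd] S0 by blast
    then obtain f where f: "f \<in> LpM M p" "LpN M p f \<le> 1" "2/3 * opn (n i) < N (n i) f" by (auto simp: S_def)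
    have "(1/3) ^ i * (2/3 * opn (n i)) \<le> (1/3) ^ i * N (n i) f" using f(3) by (intro mult_left_mono) auto
    moreover have "(1/3) ^ i * LpN M p f \<le> (1/3) ^ i * 1" using f(2) by (intro mult_left_mono) auto
    ultimately show ?thesis
      using sc[OF f(1), of "(1/3) ^ i"] scale[OF f(1), of "n i" "(1/3) ^ i"]
      by (intro exI[of _ "\<lambda>\<omega>. (1/3) ^ i * f \<omega>"]) (auto simp: ac_simps)
  qed
  then obtain \<xi> where \<xi>: "\<And>i. \<xi> i \<in> LpM M p" "\<And>i. LpN M p (\<xi> i) \<le> (1/3) ^ i" "\<And>i. N (n i) (\<xi> i) \<ge> 2/3 * (1/3) ^ i * opn (n i)"
    by metis
  define dir where "dir i x = (if N (n i) (\<lambda>\<omega>. x \<omega> + \<xi> i \<omega>) \<ge> N (n i) (\<xi> i) then 1 else - 1 :: real)" for i x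
  define X where "X = rec_nat (\<lambda>\<omega>. 0) (\<lambda>i x \<omega>. x \<omega> + dir i x * \<xi> i \<omega>)"
  have X0: "X 0 = (\<lambda>\<omega>. 0)" and XS: "X (Suc i) = (\<lambda>\<omega>. X i \<omega> + dir i (X i) * \<xi> i \<omega>)" for i
    by (auto simp: X_def)
  define y where "y i \<omega> = dir i (X i) * \<xi> i \<omega>" for i \<omega>
  have st: "\<bar>dir i x\<bar> = 1" for i x by (auto simp: dir_def)
  have y: "y i \<in> LpM M p" "LpN M p (y i) \<le> (1/3) ^ i" for i
    using sc[OF \<xi>(1)[of i], of "dir i (X i)"] \<xi>(2)[of i] st unfolding y_def[abs_def] by auto
  have X_sum: "X m = (\<lambda>\<omega>. \<Sum>i<m. y i \<omega>)" for m
    by (induction m) (auto simp: X0 XS y_def)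
  have X: "X m \<in> LpM M p" for m unfolding X_sum by (intro LpM_sum y p)
  have big: "N (n i) (X (Suc i)) \<ge> N (n i) (\<xi> i)" for i
  proof (cases "N (n i) (\<lambda>\<omega>. X i \<omega> + \<xi> i \<omega>) \<ge> N (n i) (\<xi> i)")
    case True
    then show ?thesis by (simp add: XS dir_def)
  next
    case False
    have "2 * N (n i) (\<xi> i) = N (n i) (\<lambda>\<omega>. (X i \<omega> + \<xi> i \<omega>) - (X i \<omega> - \<xi> i \<omega>))"
      using scale[OF \<xi>(1)[of i], of "n i" 2] by simp
    also have "\<dots> \<le> N (n i) (\<lambda>\<omega>. X i \<omega> + \<xi> i \<omega>) + N (n i) (\<lambda>\<omega>. X i \<omega> - \<xi> i \<omega>)"
      by (intro diff LpM_add LpM_diff X \<xi>(1) p)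
    finally show ?thesis using False by (simp add: XS dir_def)
  qed
  have summ: "summable (\<lambda>i. (1/3) ^ i :: real)" by (rule summable_geometric) simp
  obtain x where x: "x \<in> LpM M p" "\<And>m. LpN M p (\<lambda>\<omega>. x \<omega> - (\<Sum>i<m. y i \<omega>)) \<le> (\<Sum>i. (1/3) ^ (i + m))"
    using Riesz_Fischer[OF M p y(1) y(2) summ] by blast
  \<comment> \<open>The later perturbations sum to at most 3^(-i)/2. Subtracting their effect leaves
    (2/3 - 1/2) 3^(-i) \<open>opn (n i)\<close>, which exceeds (4/3)^i / 6 and is unbounded.\<close>
  have tail: "LpN M p (\<lambda>\<omega>. X (Suc i) \<omega> - x \<omega>) \<le> 1/2 * (1/3) ^ i" for i
  proof -
    have "(\<Sum>k. (1/3) ^ (k + Suc i)) = (\<Sum>k. (1/3) ^ k * (1/3 :: real) ^ Suc i)" by (simp add: power_add)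
    also have "\<dots> = (\<Sum>k. (1/3) ^ k) * (1/3 :: real) ^ Suc i" by (rule suminf_mult2[OF summ, symmetric])
    also have "\<dots> = 1/2 * (1/3) ^ i" by (subst suminf_geometric) auto
    finally show ?thesis using x(2)[of "Suc i"] LpN_minus[of M p x "X (Suc i)"] by (simp add: X_sum)
  qed
  obtain B where B: "\<And>k. N k x \<le> B" using pointwise[OF x(1)] by blast
  have low: "(4/3) ^ i / 6 \<le> B" for i :: nat
  proof -
    have "N (n i) (X (Suc i)) \<le> N (n i) (\<lambda>\<omega>. X (Suc i) \<omega> - x \<omega>) + N (n i) x"
      using add[OF diff(1)[OF X[of "Suc i"] x(1)] x(1), of "n i"] by simp
    moreover have "N (n i) (\<lambda>\<omega>. X (Suc i) \<omega> - x \<omega>) \<le> opn (n i) * (1/2 * (1/3) ^ i)"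
      by (rule order_trans[OF No[OF diff(1)[OF X x(1)]] mult_left_mono[OF tail o0]])
    ultimately have "2/3 * (1/3) ^ i * opn (n i) - 1/2 * (1/3) ^ i * opn (n i) \<le> B"
      using \<xi>(3)[of i] big[of i] B[of "n i"] by (simp add: ac_simps)
    moreover have "(1/3) ^ i * 4 ^ i \<le> (1/3) ^ i * opn (n i)" using n[of i] by (intro mult_left_mono) auto
    moreover have "(1/3) ^ i * 4 ^ i = (4/3 :: real) ^ i" by (simp flip: power_mult_distrib)
    moreover have "2/3 * (1/3) ^ i * opn (n i) - 1/2 * (1/3) ^ i * opn (n i) = 1/6 * ((1/3) ^ i * opn (n i))"
      by (simp add: algebra_simps)
    ultimately show ?thesis by linarith
  qed
  obtain i where "(4/3) ^ i > 6 * B" using real_arch_pow[of "4/3" "6 * B"] by auto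
  then show False using low[of i] by simp
qed

section \<open>Sampling of weak derivatives\<close>

lemma LpM_ext:
  fixes f :: "point \<Rightarrow> 'a::euclidean_space"
  assumes "0 < p"
  shows "f \<in> LpM (meas_on Omega) p \<longleftrightarrow> (\<lambda>z. indicator Omega z *\<^sub>R f z) \<in> LpM lborel p"
    "LpN (meas_on Omega) p f = LpN lborel p (\<lambda>z. indicator Omega z *\<^sub>R f z)"
proof -
  have eq: "indicator Omega z *\<^sub>R (norm (f z) powr p) = norm (indicator Omega z *\<^sub>R f z) powr p" for z
    by (simp add: indicator_def)
  show "f \<in> LpM (meas_on Omega) p \<longleftrightarrow> (\<lambda>z. indicator Omega z *\<^sub>R f z) \<in> LpM lborel p"
    unfolding LpM_def
    by (simp add: borel_measurable_restrict_space_iff integrable_restrict_space eq del: norm_scaleR real_scaleR_def)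
  show "LpN (meas_on Omega) p f = LpN lborel p (\<lambda>z. indicator Omega z *\<^sub>R f z)"
    unfolding LpN_def by (simp add: integral_restrict_space eq del: norm_scaleR real_scaleR_def)
qed

lemma LpM_Omega_integrable:
  fixes f :: "point \<Rightarrow> real"
  assumes "f \<in> LpM (meas_on Omega) p" "1 \<le> p"
  shows "integrable lborel (\<lambda>z. indicator Omega z * f z)"
proof -
  have "f \<in> LpM (meas_on Omega) 1"
    by (rule LpM_mono_exponent(1)[OF assms(1) order_refl assms(2) prob_space_Omega])
  then have "integrable (meas_on Omega) (\<lambda>z. \<bar>f z\<bar>)" "f \<in> borel_measurable (meas_on Omega)"
    by (auto simp: LpM_def)
  then have "integrable (meas_on Omega) f" by (simp add: integrable_abs_iff)
  then show ?thesis by (simp add: integrable_restrict_space)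
qed

lemma bcs_mult_integrable:
  assumes u: "integrable lborel u" and w: "bcs R M w"
  shows "integrable lborel (\<lambda>z. u z * w z :: real)"
proof -
  note [measurable] = borel_measurable_integrable[OF u] bcs_measurable[OF w]
  have M0: "0 \<le> M" using w by (simp add: bcs_def)
  have "integrable lborel (\<lambda>y. M * u y)" using u by simp
  then show ?thesis
  proof (rule Bochner_Integration.integrable_bound)
    have "AE y in lborel. \<bar>w y\<bar> \<le> M * indicator (Qbox R) y" using w by (simp add: bcs_def)
    then show "AE y in lborel. norm (u y * w y) \<le> norm (M * u y)"
    proof eventually_elim
      case (elim y)
      then have "\<bar>w y\<bar> \<le> M" using M0 by (cases "y \<in> Qbox R") simp_all
      then have "\<bar>u y\<bar> * \<bar>w y\<bar> \<le> \<bar>u y\<bar> * M" by (intro mult_left_mono) auto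
      then show ?case using M0 by (simp add: abs_mult mult.commute)
    qed
  qed measurable
qed

text \<open>The filter sum over shifted sampling functions is the derivative of the primitive; integrate
  by parts.\<close>

lemma filtered_samples:
  fixes u d :: "point \<Rightarrow> real"
  assumes ud: "has_weak_deriv Omega \<alpha> u d"
    and u: "integrable lborel (\<lambda>z. indicator Omega z * u z)" and d: "integrable lborel (\<lambda>z. indicator Omega z * d z)"
    and wg: "tensor_weak_deriv \<alpha> w g"
    and g_eq: "g = (\<lambda>y. C * (\<Sum>m\<in>S. h m * \<Phi> (2 *\<^sub>R y - t *\<^sub>R embed m)))"
    and w: "bcs R1 M1 w" and \<Phi>: "bcs R2 M2 \<Phi>" and c: "0 < c"
    and van: "\<And>m. m \<in> S \<Longrightarrow> AE x in lborel. x \<notin> closure Omega \<longrightarrow> \<Phi> ((2 * c) *\<^sub>R x - t *\<^sub>R embed (k + m)) = 0"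
    and fin: "finite S"
  shows "(-1) ^ (fst \<alpha> + snd \<alpha>) * c ^ (fst \<alpha> + snd \<alpha>) * C *
      (\<Sum>m\<in>S. h m * (LINT x|lborel. indicator Omega x * u x * \<Phi> ((2 * c) *\<^sub>R x - t *\<^sub>R embed (k + m))))
    = (LINT x|lborel. indicator Omega x * d x * w (c *\<^sub>R x - (t / 2) *\<^sub>R embed k))"
proof -
  let ?n = "fst \<alpha> + snd \<alpha>"
  let ?W = "\<lambda>x. w (c *\<^sub>R x - (t / 2) *\<^sub>R embed k)"
  let ?P = "\<lambda>m x. \<Phi> ((2 * c) *\<^sub>R x - t *\<^sub>R embed (k + m))"
  let ?G = "\<lambda>x. c ^ ?n * g (c *\<^sub>R x - (t / 2) *\<^sub>R embed k)"
  \<comment> \<open>The inner dilation by 2 in the refinement relation doubles the shift (t/2) k to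
    t k, so filter index m and sampling index k combine to k + m.\<close>
  have shift: "2 *\<^sub>R (c *\<^sub>R x - (t / 2) *\<^sub>R embed k) - t *\<^sub>R embed m = (2 * c) *\<^sub>R x - t *\<^sub>R embed (k + m)" for x m
    by (simp add: embed_def prod_eq_iff algebra_simps)
  have G_eq: "?G x = c ^ ?n * C * (\<Sum>m\<in>S. h m * ?P m x)" for x
    unfolding g_eq shift by (simp add: mult.assoc)
  have P: "\<exists>R. bcs R M2 (?P m)" for m
    using bcs_affine[OF \<Phi>, of "2 * c" "t *\<^sub>R embed (k + m)"] c by simp
  have "\<exists>R M. bcs R M (\<lambda>x. h m * ?P m x)" for m using P[of m] bcs_cmult by blast
  then have "\<exists>R M. bcs R M (\<lambda>x. \<Sum>m\<in>S. h m * ?P m x)" by (intro bcs_sum)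
  then obtain R3 M3 where "bcs R3 M3 (\<lambda>x. \<Sum>m\<in>S. h m * ?P m x)" by blast
  from bcs_cmult[OF this, of "c ^ ?n * C"] have G: "bcs R3 (\<bar>c ^ ?n * C\<bar> * M3) ?G" unfolding G_eq .
  obtain R4 where W: "bcs R4 M1 ?W" using bcs_affine[OF w c] by blast
  define R where "R = max R3 R4"
  define M where "M = max (\<bar>c ^ ?n * C\<bar> * M3) M1"
  have GR: "bcs R M ?G" by (rule bcs_mono[OF G]) (auto simp: R_def M_def)
  have WR: "bcs R M ?W" by (rule bcs_mono[OF W]) (auto simp: R_def M_def)
  have gm: "g \<in> borel_measurable borel"
  proof -
    have [measurable]: "\<Phi> \<in> borel_measurable borel" by (rule bcs_measurable[OF \<Phi>])
    show ?thesis unfolding g_eq by measurable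
  qed
  have WG: "tensor_weak_deriv \<alpha> ?W ?G"
    by (rule tensor_weak_deriv_affine[OF wg c bcs_measurable[OF w] gm])
  have Gs: "AE x in lborel. x \<notin> closure Omega \<longrightarrow> ?G x = 0"
  proof -
    have "AE x in lborel. \<forall>m\<in>S. x \<notin> closure Omega \<longrightarrow> ?P m x = 0"
      using van fin by (intro AE_finite_allI) auto
    then show ?thesis unfolding G_eq by eventually_elim simp
  qed
  \<comment> \<open>Only the sampling functions entering the filter sum are known to live in the
    closed square; the primitive inherits this from them.\<close>
  have Ws: "AE x in lborel. x \<notin> closure Omega \<longrightarrow> ?W x = 0"
    by (rule weak_primitive_support[OF WG WR GR Gs])
  have i: "integrable lborel (\<lambda>x. indicator Omega x * u x * ?P m x)" for m
    using bcs_mult_integrable[OF u] P[of m] by blast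
  have "(LINT x|lborel. indicator Omega x * u x * ?G x)
      = (LINT x|lborel. c ^ ?n * C * (\<Sum>m\<in>S. h m * (indicator Omega x * u x * ?P m x)))"
    unfolding G_eq by (simp add: sum_distrib_left ac_simps)
  also have "\<dots> = c ^ ?n * C * (\<Sum>m\<in>S. h m * (LINT x|lborel. indicator Omega x * u x * ?P m x))"
    using i by (subst integral_mult_right_zero, subst Bochner_Integration.integral_sum) auto
  finally have L: "(LINT x|lborel. indicator Omega x * u x * ?G x)
      = c ^ ?n * C * (\<Sum>m\<in>S. h m * (LINT x|lborel. indicator Omega x * u x * ?P m x))" .
  have ibp: "(LINT x|lborel. indicator Omega x * u x * ?G x) = (-1) ^ ?n * (LINT x|lborel. indicator Omega x * d x * ?W x)"
    by (rule integration_by_parts[OF ud u d WG WR GR Ws Gs])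
  have sq: "(-1) ^ ?n * ((-1) ^ ?n * x) = x" for x :: real
    by (simp add: mult.assoc[symmetric] power_mult_distrib[symmetric])
  have "(-1) ^ ?n * (c ^ ?n * C * (\<Sum>m\<in>S. h m * (LINT x|lborel. indicator Omega x * u x * ?P m x)))
    = (LINT x|lborel. indicator Omega x * d x * ?W x)"
    unfolding L[symmetric] ibp sq ..
  then show ?thesis by (simp only: mult.assoc)
qed

lemma sum_reindex_shift:
  fixes a :: "int \<times> int \<Rightarrow> real"
  shows "(\<Sum>l | l - k \<in> S. h (l - k) * a l) = (\<Sum>m\<in>S. h m * a (k + m))"
  by (rule sum.reindex_bij_witness[of _ "\<lambda>m. k + m" "\<lambda>l. l - k"]) auto

lemma two_powi:
  "2 powi (int n - 1) = (2::real) ^ n / 2" "2 powi (int n - 2) = (2::real) ^ n / 4"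
  by (simp_all add: power_int_diff)

context framelets
begin

lemma T_op_eq: "T_op F n g k = 4 ^ n * (LINT x|lborel. indicator Omega x * g x * refinable F (2 ^ n *\<^sub>R x - embed k))"
proof -
  have "T_op F n g k = 2 ^ n * (LINT x|lborel. 2 ^ n * (indicator Omega x * g x * refinable F (2 ^ n *\<^sub>R x - embed k)))"
    unfolding T_op_def refinable_nk_def by (simp add: integral_restrict_space ac_simps)
  then show ?thesis by (simp add: four_power power2_eq_square)
qed

lemma ker_S_shift: "ker_S j (2 ^ n *\<^sub>R x - embed k) = 1 / (4 * c1 F j) * prim F j ((2 ^ n / 2) *\<^sub>R x - (1 / 2) *\<^sub>R embed k)"
  by (simp add: ker_S_def scaleR_diff_right)

lemma ker_W_shift: "ker_W i j (2 ^ n *\<^sub>R x - embed k) = 1 / (16 * c2 F i j) * prim2 F i j ((2 ^ n / 4) *\<^sub>R x - (1 / 4) *\<^sub>R embed k)"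
  by (simp add: ker_W_def scaleR_diff_right)

lemma S_op_eq: "S_op F n v j k = 4 ^ n * (LINT x|lborel. indicator Omega x * (v x $ j) * ker_S j (2 ^ n *\<^sub>R x - embed k))"
proof -
  have "S_op F n v j k = 2 ^ n * (LINT x|lborel. 2 ^ n * (indicator Omega x * (v x $ j) * ker_S j (2 ^ n *\<^sub>R x - embed k)))"
    unfolding S_op_def prim_nk_def two_powi ker_S_shift
    by (simp add: integral_restrict_space field_simps)
  then show ?thesis by (simp add: four_power power2_eq_square)
qed

text \<open>The filtering identity at dilation c = 2^(n-1) with t = 1: the weight 2^((n-1) s_j) is
  the chain rule factor c^(s_j), and the factor 4 of the framelet cancels the 4 in
  \<open>ker_S\<close>.\<close>

lemma W1_op_T_op:
  assumes k: "k \<in> K_set F n" and ud: "has_weak_deriv Omega (ops F j) u d"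
    and u: "integrable lborel (\<lambda>z. indicator Omega z * u z)" and d: "integrable lborel (\<lambda>z. indicator Omega z * d z)"
  shows "W1_op F n (T_op F n u) j k = 4 ^ n * (LINT x|lborel. indicator Omega x * d x * ker_S j (2 ^ n *\<^sub>R x - embed k))"
proof -
  let ?\<alpha> = "ops F j" and ?S = "fsupp (tensor_filt F (ops F j))"
  let ?n = "ord_of F j"
  let ?I = "\<lambda>m. LINT x|lborel. indicator Omega x * u x * refinable F ((2 * (2 ^ n / 2)) *\<^sub>R x - 1 *\<^sub>R embed (k + m))"
  obtain R M where p: "bcs R M (prim F j)" using prim_bcs by blast
  have van: "AE x in lborel. x \<notin> closure Omega \<longrightarrow> refinable F ((2 * (2 ^ n / 2)) *\<^sub>R x - 1 *\<^sub>R embed (k + m)) = 0"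
    if m: "m \<in> ?S" for m
  proof -
    have "(k + m) - k \<in> ?S" using m by simp
    then have "ess_supp (refinable_nk F n (k + m)) \<subseteq> closure Omega"
      using admissible k unfolding dil_admissible_def by blast
    then show ?thesis
      using ess_supp_AE[of "refinable_nk F n (k + m)"] by (auto simp: refinable_nk_def elim!: eventually_mono)
  qed
  have "(-1) ^ ?n * (2 ^ n / 2) ^ ?n * 4 * (\<Sum>m\<in>?S. tensor_filt F ?\<alpha> m * ?I m)
    = (LINT x|lborel. indicator Omega x * d x * prim F j ((2 ^ n / 2) *\<^sub>R x - (1 / 2) *\<^sub>R embed k))"
    unfolding ord_of_def
    by (rule filtered_samples[OF ud u d has_weak_deriv_UNIV_tensor[OF prim_weak] framelet_eq p refinable_bcs _ van])
       (auto intro: finite_fsupp ops_le)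
  then have key: "(LINT x|lborel. indicator Omega x * d x * ker_S j (2 ^ n *\<^sub>R x - embed k))
    = 1 / (4 * c1 F j) * ((-1) ^ ?n * (2 ^ n / 2) ^ ?n * 4 * (\<Sum>m\<in>?S. tensor_filt F ?\<alpha> m * ?I m))"
    unfolding ker_S_shift by (simp add: mult.left_commute[of _ "1 / (4 * c1 F j)"])
  have pw: "2 powi ((int n - 1) * int ?n) = ((2::real) ^ n / 2) ^ ?n"
    by (simp add: power_int_mult two_powi)
  have T: "T_op F n u (k + m) = 4 ^ n * ?I m" for m by (simp add: T_op_eq)
  show ?thesis
    unfolding W1_op_def sum_reindex_shift T key pw by (simp add: sum_distrib_left ac_simps)
qed

text \<open>The same identity one level further down: c = 2^(n-2) and t = 1/2, so the primitive
  \<open>prim2\<close> appears with shift k/4.\<close>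

lemma W2_op_S_op:
  assumes k: "k \<in> K_set F n" and vd: "has_weak_deriv Omega (ops F i) (\<lambda>x. v x $ j) d"
    and v: "integrable lborel (\<lambda>z. indicator Omega z * (v z $ j))" and d: "integrable lborel (\<lambda>z. indicator Omega z * d z)"
  shows "W2_op F n (S_op F n v) i j k = 4 ^ n * (LINT x|lborel. indicator Omega x * d x * ker_W i j (2 ^ n *\<^sub>R x - embed k))"
proof -
  let ?\<alpha> = "ops F i" and ?S = "fsupp (tensor_filt F (ops F i))"
  let ?n = "ord_of F i"
  let ?I = "\<lambda>m. LINT x|lborel. indicator Omega x * (v x $ j) * prim F j ((2 * (2 ^ n / 4)) *\<^sub>R x - (1 / 2) *\<^sub>R embed (k + m))"
  obtain R M where p: "bcs R M (prim F j)" using prim_bcs by blast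
  obtain R' M' where p2: "bcs R' M' (prim2 F i j)" using prim2_bcs by blast
  have van: "AE x in lborel. x \<notin> closure Omega \<longrightarrow> prim F j ((2 * (2 ^ n / 4)) *\<^sub>R x - (1 / 2) *\<^sub>R embed (k + m)) = 0"
    if m: "m \<in> ?S" for m
  proof -
    have "(k + m) - k \<in> ?S" using m by simp
    then have "ess_supp (prim_nk F j n (k + m)) \<subseteq> closure Omega"
      using admissible k unfolding dil_admissible_def by blast
    then show ?thesis
      using ess_supp_AE[of "prim_nk F j n (k + m)"] by (auto simp: prim_nk_def two_powi elim!: eventually_mono)
  qed
  have "(-1) ^ ?n * (2 ^ n / 4) ^ ?n * (4 / c1 F j) * (\<Sum>m\<in>?S. tensor_filt F ?\<alpha> m * ?I m)
    = (LINT x|lborel. indicator Omega x * d x * prim2 F i j ((2 ^ n / 4) *\<^sub>R x - (1 / 2 / 2) *\<^sub>R embed k))"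
    unfolding ord_of_def
    by (rule filtered_samples[OF vd v d has_weak_deriv_UNIV_tensor[OF prim2_weak] refl p2 p _ van])
       (auto intro: finite_fsupp ops_le)
  then have key: "(LINT x|lborel. indicator Omega x * d x * ker_W i j (2 ^ n *\<^sub>R x - embed k))
    = 1 / (16 * c2 F i j) * ((-1) ^ ?n * (2 ^ n / 4) ^ ?n * (4 / c1 F j) * (\<Sum>m\<in>?S. tensor_filt F ?\<alpha> m * ?I m))"
    unfolding ker_W_shift by (simp add: mult.left_commute[of _ "1 / (16 * c2 F i j)"])
  have pw: "2 powi ((int n - 2) * int ?n) = ((2::real) ^ n / 4) ^ ?n"
    by (simp add: power_int_mult two_powi)
  have S: "S_op F n v j (k + m) = 4 ^ n / (4 * c1 F j) * ?I m" for m
    unfolding S_op_eq ker_S_shift by (simp add: mult.left_commute[of _ "1 / (4 * c1 F j)"])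
  show ?thesis
    unfolding W2_op_def sum_reindex_shift S key pw by (simp add: sum_distrib_left ac_simps)
qed

end

section \<open>Discrete functionals as sampled norms\<close>

text \<open>\<open>sample\<close> labels kernels by basis vectors; this recovers the index. Its
  value matters only on basis vectors.\<close>

definition vec_index :: "real ^ 'j::finite \<Rightarrow> 'j" where
  "vec_index b = (THE j. b = axis j 1)"

definition mat_index :: "real ^ 'j ^ 'i \<Rightarrow> 'i::finite \<times> 'j::finite" where
  "mat_index b = (THE ij. b = axis (fst ij) (axis (snd ij) 1))"

lemma vec_index_axis [simp]: "vec_index (axis j 1) = j"
  unfolding vec_index_def by (rule the_equality) (auto simp: axis_eq_axis)

lemma mat_index_axis [simp]: "mat_index (axis i (axis j 1)) = (i, j)"
  unfolding mat_index_def by (rule the_equality) (auto simp: axis_eq_axis axis_eq_0_iff)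

lemma axis_Basis: "axis j (1::real) \<in> Basis" "axis i (axis j (1::real)) \<in> Basis"
  by (auto simp: axis_in_Basis_iff)

lemma sample_inner:
  "b \<in> Basis \<Longrightarrow> sample \<Phi> n G k \<bullet> b = 4 ^ n * (LINT x|lborel. (G x \<bullet> b) * \<Phi> b (2 ^ n *\<^sub>R x - embed k))"
  by (simp add: sample_def inner_sum_left inner_Basis if_distrib cong: if_cong)

lemma lp_norm_cong: "(\<And>k. k \<in> K \<Longrightarrow> a k = b k) \<Longrightarrow> lp_norm n K p a = lp_norm n K p b"
  unfolding lp_norm_def by (metis (no_types, lifting) sum.cong)

text \<open>The embedding is applied to each component, after passing from L_p to L_1 on the unit
  square. W comes from the weight on f and the 2 from the two first derivatives; the constant
  depends on neither r nor p.\<close>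

lemma sobolev_W11:
  fixes f :: "point \<Rightarrow> 'a::euclidean_space"
  assumes f: "f \<in> sobolev Omega r p" and r: "1 \<le> r" and p: "1 \<le> p" and W: "1 \<le> W" "\<And>x. unit_bump x \<le> W"
  shows "f \<in> LpM (meas_on Omega) 2"
    "LpN (meas_on Omega) 2 f \<le> real DIM('a) * (W + 2) * sobolev_norm Omega r p f"
proof -
  let ?M = "meas_on Omega"
  let ?d = "\<lambda>\<alpha>. weak_deriv Omega \<alpha> f"
  have \<alpha>: "fst (0::nat, 0::nat) + snd (0::nat, 0::nat) \<le> r" "fst (1::nat, 0::nat) + snd (1::nat, 0::nat) \<le> r"
    "fst (0::nat, 1::nat) + snd (0::nat, 1::nat) \<le> r" using r by auto
  note wd = sobolev_weak_deriv[OF f \<alpha>(2)] sobolev_weak_deriv[OF f \<alpha>(3)]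
  have n1: "g \<in> LpM ?M 1" "LpN ?M 1 g \<le> LpN ?M p g" if "g \<in> LpM ?M p" for g :: "point \<Rightarrow> 'a"
    using LpM_mono_exponent[OF that order_refl p prob_space_Omega] by auto
  have comp: "(\<lambda>z. g z \<bullet> b) \<in> LpM ?M 1" "LpN ?M 1 (\<lambda>z. g z \<bullet> b) \<le> LpN ?M p g"
    if g: "g \<in> LpM ?M p" and b: "b \<in> Basis" for g :: "point \<Rightarrow> 'a" and b
  proof -
    have m: "(\<lambda>z. g z \<bullet> b) \<in> borel_measurable ?M" using LpM_measurable[OF g] by measurable
    have le: "AE z in ?M. norm (g z \<bullet> b) \<le> norm (g z)" using b by (intro AE_I2) (simp add: Basis_le_norm)
    show "(\<lambda>z. g z \<bullet> b) \<in> LpM ?M 1" by (rule LpM_dominated[OF n1(1)[OF g] m le]) simp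
    show "LpN ?M 1 (\<lambda>z. g z \<bullet> b) \<le> LpN ?M p g"
      using LpN_mono[OF n1(1)[OF g] m le] n1(2)[OF g] by simp
  qed
  have f0: "LpN ?M p f \<le> sobolev_norm Omega r p f"
  proof -
    have "LpN ?M p f = LpN ?M p (?d (0, 0))"
      using weak_deriv_unique[OF has_weak_deriv_0[OF sobolev_locally_integrable[OF f]] sobolev_weak_deriv(1)[OF f \<alpha>(1)]]
        LpM_measurable[OF sobolev_LpM[OF f]] LpM_measurable[OF sobolev_weak_deriv(2)[OF f \<alpha>(1)]]
      by (intro LpN_cong_AE) (auto simp: AE_meas_on_Omega)
    then show ?thesis using LpN_weak_deriv_le_sobolev_norm[OF \<alpha>(1) p] by simp
  qed
  have each: "(\<lambda>z. f z \<bullet> b) \<in> LpM ?M 2" "LpN ?M 2 (\<lambda>z. f z \<bullet> b) \<le> (W + 2) * sobolev_norm Omega r p f"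
    if b: "b \<in> Basis" for b
  proof -
    note E = W11_embeds_L2[OF comp(1)[OF sobolev_LpM[OF f] b] comp(1)[OF wd(2) b] comp(1)[OF wd(4) b]
        has_weak_deriv_inner[OF wd(1) Omega_borel, of b] has_weak_deriv_inner[OF wd(3) Omega_borel, of b] W]
    show "(\<lambda>z. f z \<bullet> b) \<in> LpM ?M 2" by (rule E(1))
    have "LpN ?M 2 (\<lambda>z. f z \<bullet> b) \<le> W * LpN ?M 1 (\<lambda>z. f z \<bullet> b) + LpN ?M 1 (\<lambda>z. ?d (1, 0) z \<bullet> b) + LpN ?M 1 (\<lambda>z. ?d (0, 1) z \<bullet> b)"
      by (rule E(2))
    also have "\<dots> \<le> W * sobolev_norm Omega r p f + sobolev_norm Omega r p f + sobolev_norm Omega r p f"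
      using W(1) order_trans[OF comp(2)[OF sobolev_LpM[OF f] b] f0]
        order_trans[OF comp(2)[OF wd(2) b] LpN_weak_deriv_le_sobolev_norm[OF \<alpha>(2) p]]
        order_trans[OF comp(2)[OF wd(4) b] LpN_weak_deriv_le_sobolev_norm[OF \<alpha>(3) p]]
      by (intro add_mono mult_left_mono) auto
    finally show "LpN ?M 2 (\<lambda>z. f z \<bullet> b) \<le> (W + 2) * sobolev_norm Omega r p f" by (simp add: algebra_simps)
  qed
  have sc: "(\<lambda>z. (f z \<bullet> b) *\<^sub>R b) \<in> LpM ?M 2" "LpN ?M 2 (\<lambda>z. (f z \<bullet> b) *\<^sub>R b) = LpN ?M 2 (\<lambda>z. f z \<bullet> b)"
    if "b \<in> Basis" for b
    using each(1)[OF that] that by (auto simp: LpM_def LpN_def)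
  have rep: "f = (\<lambda>z. \<Sum>b\<in>Basis. (f z \<bullet> b) *\<^sub>R b)" by (simp add: euclidean_representation)
  show "f \<in> LpM ?M 2" by (subst rep) (intro LpM_sum sc, auto)
  have "LpN ?M 2 f \<le> (\<Sum>b\<in>(Basis::'a set). LpN ?M 2 (\<lambda>z. (f z \<bullet> b) *\<^sub>R b))"
    by (subst rep) (intro LpN_sum_le sc, auto)
  also have "\<dots> \<le> (\<Sum>b\<in>(Basis::'a set). (W + 2) * sobolev_norm Omega r p f)"
    using each(2) sc(2) by (intro sum_mono) simp
  finally show "LpN ?M 2 f \<le> real DIM('a) * (W + 2) * sobolev_norm Omega r p f" by (simp add: mult.assoc)
qed

lemma LpM_vec:
  fixes f :: "'x \<Rightarrow> real ^ 'j::finite"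
  assumes "\<And>j. (\<lambda>x. f x $ j) \<in> LpM M p" "1 \<le> p"
  shows "f \<in> LpM M p" "LpN M p f \<le> (\<Sum>j\<in>UNIV. LpN M p (\<lambda>x. f x $ j))"
proof -
  have rep: "f = (\<lambda>x. \<Sum>j\<in>UNIV. (f x $ j) *\<^sub>R axis j 1)"
    by (rule ext, rule vec_eq_iff[THEN iffD2]) (auto simp: axis_def if_distrib cong: if_cong)
  have sc: "(\<lambda>x. (f x $ j) *\<^sub>R (axis j 1 :: real ^ 'j)) \<in> LpM M p"
    "LpN M p (\<lambda>x. (f x $ j) *\<^sub>R (axis j 1 :: real ^ 'j)) = LpN M p (\<lambda>x. f x $ j)" for j
    using assms(1)[of j] by (auto simp: LpM_def LpN_def)
  show "f \<in> LpM M p" by (subst rep) (intro LpM_sum sc assms)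
  have "LpN M p f \<le> (\<Sum>j\<in>UNIV. LpN M p (\<lambda>x. (f x $ j) *\<^sub>R (axis j 1 :: real ^ 'j)))"
    by (subst rep) (intro LpN_sum_le sc assms)
  then show "LpN M p f \<le> (\<Sum>j\<in>UNIV. LpN M p (\<lambda>x. f x $ j))" by (simp add: sc(2))
qed

lemma LpM_mat:
  fixes f :: "'x \<Rightarrow> real ^ 'j::finite ^ 'i::finite"
  assumes "\<And>i j. (\<lambda>x. f x $ i $ j) \<in> LpM M p" "1 \<le> p"
  shows "f \<in> LpM M p" "LpN M p f \<le> (\<Sum>i\<in>UNIV. \<Sum>j\<in>UNIV. LpN M p (\<lambda>x. f x $ i $ j))"
proof -
  have rep: "f = (\<lambda>x. \<Sum>i\<in>UNIV. axis i (f x $ i))"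
    by (rule ext, rule vec_eq_iff[THEN iffD2]) (auto simp: axis_def if_distrib cong: if_cong)
  note row = LpM_vec[OF assms(1,2)]
  have m: "(\<lambda>x. axis i (f x $ i) :: real ^ 'j ^ 'i) \<in> borel_measurable M" for i
  proof -
    have "linear (\<lambda>y. axis i y :: real ^ 'j ^ 'i)"
      by (rule linearI) (auto simp: vec_eq_iff axis_def)
    then have "continuous_on UNIV (\<lambda>y. axis i y :: real ^ 'j ^ 'i)"
      using linear_continuous_on linear_conv_bounded_linear by blast
    from borel_measurable_continuous_onI[OF this] show ?thesis
      by (rule measurable_compose[OF LpM_measurable[OF row(1)]])
  qed
  have sc: "(\<lambda>x. axis i (f x $ i) :: real ^ 'j ^ 'i) \<in> LpM M p"
    "LpN M p (\<lambda>x. axis i (f x $ i) :: real ^ 'j ^ 'i) = LpN M p (\<lambda>x. f x $ i)" for i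
    using m[of i] row(1)[of i] by (auto simp: LpM_def LpN_def norm_eq_sqrt_inner inner_axis_axis)
  show "f \<in> LpM M p" by (subst rep) (intro LpM_sum sc assms)
  have "LpN M p f \<le> (\<Sum>i\<in>UNIV. LpN M p (\<lambda>x. axis i (f x $ i) :: real ^ 'j ^ 'i))"
    by (subst rep) (intro LpN_sum_le sc assms)
  also have "\<dots> \<le> (\<Sum>i\<in>UNIV. \<Sum>j\<in>UNIV. LpN M p (\<lambda>x. f x $ i $ j))"
    unfolding sc(2) by (intro sum_mono row(2))
  finally show "LpN M p f \<le> (\<Sum>i\<in>UNIV. \<Sum>j\<in>UNIV. LpN M p (\<lambda>x. f x $ i $ j))" .
qed

lemma vec_nth_sobolev:
  fixes v :: "point \<Rightarrow> real ^ 'i::finite"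
  assumes v: "v \<in> sobolev Omega r p" and p: "1 \<le> p"
  shows "(\<lambda>x. v x $ j) \<in> sobolev Omega r p"
proof -
  have c: "(\<lambda>x. g x $ j) \<in> LpM (meas_on Omega) p" if g: "g \<in> LpM (meas_on Omega) p" for g :: "point \<Rightarrow> real ^ 'i"
  proof (rule LpM_dominated[OF g])
    have "(\<lambda>x. g x \<bullet> axis j 1) \<in> borel_measurable (meas_on Omega)" using LpM_measurable[OF g] by measurable
    then show "(\<lambda>x. g x $ j) \<in> borel_measurable (meas_on Omega)" by (simp add: inner_axis)
  qed (use p component_le_norm_cart in auto)
  have d: "has_weak_deriv Omega \<alpha> (\<lambda>x. v x $ j) (\<lambda>x. g x $ j)" if "has_weak_deriv Omega \<alpha> v g" for \<alpha> g
    using has_weak_deriv_inner[OF that Omega_borel, of "axis j 1"] by (simp add: inner_axis)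
  show ?thesis
    unfolding sobolev_def Lp_eq_LpM
  proof (intro CollectI conjI allI impI)
    show "(\<lambda>x. v x $ j) \<in> LpM (meas_on Omega) p" by (rule c[OF sobolev_LpM[OF v]])
    fix \<alpha> :: "nat \<times> nat" assume \<alpha>: "fst \<alpha> + snd \<alpha> \<le> r"
    show "\<exists>g\<in>LpM (meas_on Omega) p. has_weak_deriv Omega \<alpha> (\<lambda>x. v x $ j) g"
      using c[OF sobolev_weak_deriv(2)[OF v \<alpha>]] d[OF sobolev_weak_deriv(1)[OF v \<alpha>]] by blast
  qed
qed

text \<open>\<open>D2_op\<close> differentiates the components, while the Sobolev norm of v uses a
  derivative of the vector function; the two independent choices agree almost everywhere.\<close>

lemma vec_nth_weak_deriv:
  fixes v :: "point \<Rightarrow> real ^ 'i::finite"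
  assumes v: "v \<in> sobolev Omega r p" and \<alpha>: "fst \<alpha> + snd \<alpha> \<le> r" and p: "1 \<le> p"
  shows "AE x in meas_on Omega. weak_deriv Omega \<alpha> (\<lambda>x. v x $ j) x = weak_deriv Omega \<alpha> v x $ j"
proof -
  have "has_weak_deriv Omega \<alpha> (\<lambda>x. v x $ j) (\<lambda>x. weak_deriv Omega \<alpha> v x $ j)"
    using has_weak_deriv_inner[OF sobolev_weak_deriv(1)[OF v \<alpha>] Omega_borel, of "axis j 1"] by (simp add: inner_axis)
  then show ?thesis
    using weak_deriv_unique_real[OF sobolev_weak_deriv(1)[OF vec_nth_sobolev[OF v p] \<alpha>]]
    by (simp add: AE_meas_on_Omega)
qed

text \<open>Function and level vary together. The uniform operator bound replaces the moving
  function by its limit, for which convergence along all levels is known.\<close>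

lemma (in sampling) sample_norm_tendsto_seq:
  assumes G: "\<And>i. G i \<in> LpM (meas_on Omega) p" and H: "H \<in> LpM (meas_on Omega) p" and p: "1 \<le> p"
    and lim: "(\<lambda>i. LpN (meas_on Omega) p (\<lambda>x. G i x - H x)) \<longlonglongrightarrow> 0" and \<rho>: "strict_mono \<rho>"
  shows "(\<lambda>i. lp_norm (\<rho> i) (K (\<rho> i)) p (sample \<Phi> (\<rho> i) (\<lambda>x. indicator Omega x *\<^sub>R G i x)))
    \<longlonglongrightarrow> LpN (meas_on Omega) p H"
proof -
  have p0: "0 < p" using p by simp
  let ?e = "\<lambda>G x. indicator Omega x *\<^sub>R G x"
  let ?N = "\<lambda>i. LpN (scaled_count (\<rho> i) (K (\<rho> i))) p"
  have e: "?e (G i) \<in> LpM lborel p" "?e H \<in> LpM lborel p" for i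
    using G[of i] H LpM_ext(1)[OF p0] by blast+
  have le: "\<bar>lp_norm (\<rho> i) (K (\<rho> i)) p (sample \<Phi> (\<rho> i) (?e (G i))) - lp_norm (\<rho> i) (K (\<rho> i)) p (sample \<Phi> (\<rho> i) (?e H))\<bar>
    \<le> real DIM('a) * op_bound p * LpN (meas_on Omega) p (\<lambda>x. G i x - H x)" for i
  proof -
    have "\<bar>?N i (sample \<Phi> (\<rho> i) (?e (G i))) - ?N i (sample \<Phi> (\<rho> i) (?e H))\<bar>
      \<le> ?N i (\<lambda>k. sample \<Phi> (\<rho> i) (?e (G i)) k - sample \<Phi> (\<rho> i) (?e H) k)"
      by (rule LpN_triangle_diff[OF LpM_scaled_count LpM_scaled_count p]) (rule finite_K)+
    also have "(\<lambda>k. sample \<Phi> (\<rho> i) (?e (G i)) k - sample \<Phi> (\<rho> i) (?e H) k)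
      = sample \<Phi> (\<rho> i) (\<lambda>x. ?e (G i) x - ?e H x)"
      by (rule ext) (rule sample_diff[OF e p, symmetric])
    also have "?N i \<dots> \<le> real DIM('a) * op_bound p * LpN lborel p (\<lambda>x. ?e (G i) x - ?e H x)"
      using sample_bound[OF LpM_diff[OF e p] p, of "\<rho> i"] by (simp only: lp_norm_eq_LpN[OF finite_K])
    also have "LpN lborel p (\<lambda>x. ?e (G i) x - ?e H x) = LpN (meas_on Omega) p (\<lambda>x. G i x - H x)"
      unfolding LpM_ext(2)[OF p0] by (simp only: scaleR_diff_right)
    finally show ?thesis by (simp only: lp_norm_eq_LpN[OF finite_K])
  qed
  have "(\<lambda>n. lp_norm n (K n) p (sample \<Phi> n (?e H))) \<longlonglongrightarrow> LpN lborel p (?e H)"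
    by (rule sample_norm_tendsto[OF e(2) p]) simp
  then have "(\<lambda>i. lp_norm (\<rho> i) (K (\<rho> i)) p (sample \<Phi> (\<rho> i) (?e H))) \<longlonglongrightarrow> LpN (meas_on Omega) p H"
    using LIMSEQ_subseq_LIMSEQ[OF _ \<rho>] unfolding LpM_ext(2)[OF p0] o_def by blast
  moreover have "(\<lambda>i. lp_norm (\<rho> i) (K (\<rho> i)) p (sample \<Phi> (\<rho> i) (?e (G i))) - lp_norm (\<rho> i) (K (\<rho> i)) p (sample \<Phi> (\<rho> i) (?e H))) \<longlonglongrightarrow> 0"
    by (rule Lim_null_comparison[OF _ tendsto_mult_right_zero[OF lim, of "real DIM('a) * op_bound p"]])
       (use le in \<open>simp add: always_eventually\<close>)
  ultimately show ?thesis by (rule Lim_transform)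
qed

context framelets
begin

lemma ord_le_max_ord: "fst (ops F j) + snd (ops F j) \<le> max_ord F"
  unfolding max_ord_def ord_of_def[symmetric] by (rule Max_ge) auto

lemma max_ord_ge_1: "1 \<le> max_ord F"
proof -
  have "ops F undefined \<noteq> (0, 0)" using sys unfolding framelet_system_def by blast
  then have "1 \<le> fst (ops F undefined) + snd (ops F undefined)"
    by (cases "ops F undefined") auto
  then show ?thesis using ord_le_max_ord[of undefined] by linarith
qed

lemma D1_op_LpM:
  assumes u: "u \<in> sobolev Omega (2 * max_ord F) p" and p: "1 \<le> p"
  shows "D1_op F u \<in> LpM (meas_on Omega) p"
proof (rule LpM_vec(1)[OF _ p])
  fix j
  have "fst (ops F j) + snd (ops F j) \<le> 2 * max_ord F" using ord_le_max_ord[of j] by simp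
  from sobolev_weak_deriv(2)[OF u this] show "(\<lambda>x. D1_op F u x $ j) \<in> LpM (meas_on Omega) p"
    by (simp add: D1_op_def)
qed

lemma D1_op_diff_le:
  assumes u: "u \<in> sobolev Omega (2 * max_ord F) p" "v \<in> sobolev Omega (2 * max_ord F) p" and p: "1 \<le> p"
  shows "LpN (meas_on Omega) p (\<lambda>x. D1_op F u x - D1_op F v x)
    \<le> real CARD('j) * sobolev_norm Omega (2 * max_ord F) p (\<lambda>x. u x - v x)"
proof -
  have r: "fst (ops F j) + snd (ops F j) \<le> 2 * max_ord F" for j
    using ord_le_max_ord[of j] by simp
  note wu = sobolev_weak_deriv[OF u(1) r] and wv = sobolev_weak_deriv[OF u(2) r]
  have "LpN (meas_on Omega) p (\<lambda>x. D1_op F u x - D1_op F v x)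
    \<le> (\<Sum>j\<in>UNIV. LpN (meas_on Omega) p (\<lambda>x. (D1_op F u x - D1_op F v x) $ j))"
    by (rule LpM_vec(2)[OF _ p]) (use LpM_diff[OF wu(2) wv(2) p] in \<open>simp add: D1_op_def\<close>)
  also have "\<dots> \<le> (\<Sum>j\<in>(UNIV::'j set). sobolev_norm Omega (2 * max_ord F) p (\<lambda>x. u x - v x))"
    using LpN_diff_weak_deriv_le[OF u p r wu wv] by (intro sum_mono) (simp add: D1_op_def)
  finally show ?thesis by simp
qed

lemma D2_op_LpM:
  assumes v: "v \<in> sobolev Omega (max_ord F) q" and q: "1 \<le> q"
  shows "D2_op F v \<in> LpM (meas_on Omega) q"
  by (rule LpM_mat(1)[OF _ q])
     (use sobolev_weak_deriv(2)[OF vec_nth_sobolev[OF v q] ord_le_max_ord] in \<open>simp add: D2_op_def\<close>)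

lemma D2_op_diff_le:
  assumes v: "v \<in> sobolev Omega (max_ord F) q" "w \<in> sobolev Omega (max_ord F) q" and q: "1 \<le> q"
  shows "LpN (meas_on Omega) q (\<lambda>x. D2_op F v x - D2_op F w x)
    \<le> real (CARD('j) * CARD('j)) * sobolev_norm Omega (max_ord F) q (\<lambda>x. v x - w x)"
proof -
  let ?M = "meas_on Omega"
  note s = vec_nth_sobolev[OF v(1) q] vec_nth_sobolev[OF v(2) q]
  note cv = sobolev_weak_deriv[OF s(1) ord_le_max_ord] and cw = sobolev_weak_deriv[OF s(2) ord_le_max_ord]
  note dv = sobolev_weak_deriv[OF v(1) ord_le_max_ord] and dw = sobolev_weak_deriv[OF v(2) ord_le_max_ord]
  have each: "LpN ?M q (\<lambda>x. weak_deriv Omega (ops F i) (\<lambda>x. v x $ j) x - weak_deriv Omega (ops F i) (\<lambda>x. w x $ j) x)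
    \<le> sobolev_norm Omega (max_ord F) q (\<lambda>x. v x - w x)" for i j
  proof -
    have m: "(\<lambda>x. weak_deriv Omega (ops F i) (\<lambda>x. v x $ j) x - weak_deriv Omega (ops F i) (\<lambda>x. w x $ j) x) \<in> borel_measurable ?M"
      using LpM_measurable[OF LpM_diff[OF cv(2) cw(2) q]] .
    have "AE x in ?M. norm (weak_deriv Omega (ops F i) (\<lambda>x. v x $ j) x - weak_deriv Omega (ops F i) (\<lambda>x. w x $ j) x)
      \<le> norm (weak_deriv Omega (ops F i) v x - weak_deriv Omega (ops F i) w x)"
      using vec_nth_weak_deriv[OF v(1) ord_le_max_ord q, of i j] vec_nth_weak_deriv[OF v(2) ord_le_max_ord q, of i j]
    proof eventually_elim
      case (elim x)
      then show ?case
        using component_le_norm_cart[of "weak_deriv Omega (ops F i) v x - weak_deriv Omega (ops F i) w x" j] by simp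
    qed
    then have "LpN ?M q (\<lambda>x. weak_deriv Omega (ops F i) (\<lambda>x. v x $ j) x - weak_deriv Omega (ops F i) (\<lambda>x. w x $ j) x)
      \<le> LpN ?M q (\<lambda>x. weak_deriv Omega (ops F i) v x - weak_deriv Omega (ops F i) w x)"
      using q by (intro LpN_mono LpM_diff[OF dv(2) dw(2) q] m) auto
    also have "\<dots> \<le> sobolev_norm Omega (max_ord F) q (\<lambda>x. v x - w x)"
      by (rule LpN_diff_weak_deriv_le[OF v q ord_le_max_ord dv dw])
    finally show ?thesis .
  qed
  have "LpN ?M q (\<lambda>x. D2_op F v x - D2_op F w x)
    \<le> (\<Sum>i\<in>UNIV. \<Sum>j\<in>UNIV. LpN ?M q (\<lambda>x. (D2_op F v x - D2_op F w x) $ i $ j))"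
    by (rule LpM_mat(2)[OF _ q]) (use LpM_diff[OF cv(2) cw(2) q] in \<open>simp add: D2_op_def\<close>)
  also have "\<dots> \<le> (\<Sum>i\<in>(UNIV::'j set). \<Sum>j\<in>(UNIV::'j set). sobolev_norm Omega (max_ord F) q (\<lambda>x. v x - w x))"
    using each by (intro sum_mono) (simp add: D2_op_def)
  finally show ?thesis by simp
qed

lemma sampling_refinable:
  assumes "1 \<le> R" "0 \<le> M" "bcs R M (refinable F)"
  shows "sampling (K_set F) R (\<lambda>_::real. refinable F) M"
  by (rule sampling.intro[OF sampling_sets_K_set[OF assms(3,1)]], unfold_locales)
     (use assms refinable_integral in \<open>simp_all add: bcs_def\<close>)

lemma sampling_ker_S:
  assumes "1 \<le> R" "0 \<le> M" "bcs R M (refinable F)" "\<And>j. bcs R M (ker_S j)"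
  shows "sampling (K_set F) R (\<lambda>b::real ^ 'j. ker_S (vec_index b)) M"
  by (rule sampling.intro[OF sampling_sets_K_set[OF assms(3,1)]], unfold_locales)
     (use assms ker_S_integral in \<open>simp_all add: bcs_def\<close>)

lemma sampling_ker_W:
  assumes "1 \<le> R" "0 \<le> M" "bcs R M (refinable F)" "\<And>i j. bcs R M (ker_W i j)"
  shows "sampling (K_set F) R (\<lambda>b::real ^ 'j ^ 'j. case_prod ker_W (mat_index b)) M"
  by (rule sampling.intro[OF sampling_sets_K_set[OF assms(3,1)]], unfold_locales)
     (use assms ker_W_integral in \<open>simp_all add: bcs_def case_prod_beta\<close>)

lemma T_op_eq_sample: "T_op F n g k = sample (\<lambda>_::real. refinable F) n (\<lambda>x. indicator Omega x *\<^sub>R g x) k"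
  by (simp add: sample_def T_op_eq)

lemma W1_diff_eq_sample:
  assumes k: "k \<in> K_set F n" and u: "u \<in> sobolev Omega (2 * max_ord F) p" and p: "1 \<le> p"
    and v: "v \<in> LpM (meas_on Omega) p"
  shows "(\<chi> j. W1_op F n (T_op F n u) j k - S_op F n v j k)
    = sample (\<lambda>b::real ^ 'j. ker_S (vec_index b)) n (\<lambda>x. indicator Omega x *\<^sub>R (D1_op F u x - v x)) k"
proof (rule vec_eq_iff[THEN iffD2], rule allI)
  fix j
  let ?d = "weak_deriv Omega (ops F j) u"
  let ?k = "\<lambda>x. ker_S j (2 ^ n *\<^sub>R x - embed k)"
  obtain R M where "1 \<le> R" "0 \<le> M" "bcs R M (refinable F)" "\<And>j. bcs R M (ker_S j)" "\<And>i j. bcs R M (ker_W i j)"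
    using kernels_uniform by blast
  note R = this
  from R(1-4) interpret S: sampling "K_set F" R "\<lambda>b::real ^ 'j. ker_S (vec_index b)" M by (rule sampling_ker_S)
  have r: "fst (ops F j) + snd (ops F j) \<le> 2 * max_ord F"
    using ord_le_max_ord[of j] by simp
  note d = sobolev_weak_deriv[OF u r]
  have p0: "0 < p" using p by simp
  have b: "axis j (1::real) \<in> Basis" by (rule axis_Basis)
  have vj: "(\<lambda>x. indicator Omega x *\<^sub>R (v x $ j)) \<in> LpM lborel p"
    using S.LpM_inner[OF LpM_ext(1)[THEN iffD1, OF p0 v] _ b] p by (simp add: inner_axis)
  have dj: "(\<lambda>x. indicator Omega x *\<^sub>R ?d x) \<in> LpM lborel p"
    by (rule LpM_ext(1)[THEN iffD1, OF p0 d(2)])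
  have i: "integrable lborel (\<lambda>x. indicator Omega x * (v x $ j) * ?k x)" "integrable lborel (\<lambda>x. indicator Omega x * ?d x * ?k x)"
    using S.sample_coeff(1)[OF vj p b, of n k] S.sample_coeff(1)[OF dj p b, of n k] by simp_all
  have "W1_op F n (T_op F n u) j k - S_op F n v j k
    = 4 ^ n * (LINT x|lborel. indicator Omega x * ?d x * ?k x) - 4 ^ n * (LINT x|lborel. indicator Omega x * (v x $ j) * ?k x)"
    unfolding S_op_eq
    by (subst W1_op_T_op[OF k d(1) LpM_Omega_integrable[OF sobolev_LpM[OF u] p] LpM_Omega_integrable[OF d(2) p]]) (rule refl)
  also have "\<dots> = 4 ^ n * (LINT x|lborel. indicator Omega x * ?d x * ?k x - indicator Omega x * (v x $ j) * ?k x)"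
    using i by (simp add: right_diff_distrib)
  also have "\<dots> = sample (\<lambda>b::real ^ 'j. ker_S (vec_index b)) n (\<lambda>x. indicator Omega x *\<^sub>R (D1_op F u x - v x)) k \<bullet> axis j 1"
    by (simp add: sample_inner[OF b]) (simp add: inner_axis D1_op_def algebra_simps)
  finally show "(\<chi> j. W1_op F n (T_op F n u) j k - S_op F n v j k) $ j
    = sample (\<lambda>b::real ^ 'j. ker_S (vec_index b)) n (\<lambda>x. indicator Omega x *\<^sub>R (D1_op F u x - v x)) k $ j"
    by (simp add: inner_axis)
qed

lemma W2_eq_sample:
  assumes k: "k \<in> K_set F n" and v: "v \<in> sobolev Omega (max_ord F) q" and q: "1 \<le> q"
  shows "(\<chi> i j. W2_op F n (S_op F n v) i j k)
    = sample (\<lambda>b::real ^ 'j ^ 'j. case_prod ker_W (mat_index b)) n (\<lambda>x. indicator Omega x *\<^sub>R D2_op F v x) k"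
proof (rule vec_eq_iff[THEN iffD2], rule allI, rule vec_eq_iff[THEN iffD2], rule allI)
  fix i j
  let ?S = "sample (\<lambda>b::real ^ 'j ^ 'j. case_prod ker_W (mat_index b)) n (\<lambda>x. indicator Omega x *\<^sub>R D2_op F v x) k"
  note s = vec_nth_sobolev[OF v q, of j]
  note d = sobolev_weak_deriv[OF s ord_le_max_ord, of i]
  have b: "axis i (axis j (1::real)) \<in> (Basis :: (real ^ 'j ^ 'j) set)" by (rule axis_Basis)
  have "W2_op F n (S_op F n v) i j k = 4 ^ n * (LINT x|lborel. indicator Omega x * weak_deriv Omega (ops F i) (\<lambda>x. v x $ j) x * ker_W i j (2 ^ n *\<^sub>R x - embed k))"
    by (rule W2_op_S_op[OF k d(1) LpM_Omega_integrable[OF sobolev_LpM[OF s] q] LpM_Omega_integrable[OF d(2) q]])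
  also have "\<dots> = ?S \<bullet> axis i (axis j 1)"
    by (simp add: sample_inner[OF b]) (simp add: inner_axis D2_op_def algebra_simps)
  finally show "(\<chi> i j. W2_op F n (S_op F n v) i j k) $ i $ j = ?S $ i $ j"
    by (simp add: inner_axis)
qed

lemma sobolev_L2:
  "\<exists>C. \<forall>(f :: point \<Rightarrow> 'a::euclidean_space) r p. f \<in> sobolev Omega r p \<longrightarrow> 1 \<le> r \<longrightarrow> 1 \<le> p \<longrightarrow>
    f \<in> LpM (meas_on Omega) 2 \<and> LpN (meas_on Omega) 2 f \<le> C * sobolev_norm Omega r p f"
proof -
  obtain W where W: "1 \<le> W" "\<And>x. unit_bump x \<le> W" using unit_bump_bounded by blast
  show ?thesis
    by (rule exI[of _ "real DIM('a) * (W + 2)"], intro allI impI conjI) (rule sobolev_W11[OF _ _ _ W], assumption+)+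
qed

end

section \<open>Equicontinuity and convergence of the fidelity term\<close>

lemma linear_operator_arrays_sum:
  assumes L: "linear_operator_arrays K L" and "finite K" and k: "k \<in> K"
  shows "L a k = (\<Sum>l\<in>K. a l * L (\<lambda>m. of_bool (m = l)) k)"
proof -
  have cong: "\<And>a b. (\<And>k. k \<in> K \<Longrightarrow> a k = b k) \<Longrightarrow> L a k = L b k"
    and add: "\<And>a b. L (\<lambda>l. a l + b l) k = L a k + L b k"
    and scale: "\<And>c a. L (\<lambda>l. c * a l) k = c * L a k"
    using L k unfolding linear_operator_arrays_def by blast+
  have "L (\<lambda>m. \<Sum>l\<in>S. a l * of_bool (m = l)) k = (\<Sum>l\<in>S. a l * L (\<lambda>m. of_bool (m = l)) k)" if "finite S" for S
    using that
  proof induction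
    case empty
    show ?case using scale[of 0 "\<lambda>l. 0"] by simp
  next
    case (insert l S)
    have "L (\<lambda>m. \<Sum>l\<in>insert l S. a l * of_bool (m = l)) k
      = L (\<lambda>m. a l * of_bool (m = l) + (\<Sum>l\<in>S. a l * of_bool (m = l))) k"
      by (simp only: sum.insert[OF insert.hyps])
    also have "\<dots> = a l * L (\<lambda>m. of_bool (m = l)) k + (\<Sum>l\<in>S. a l * L (\<lambda>m. of_bool (m = l)) k)"
      by (simp only: add scale insert.IH)
    finally show ?case by (simp only: sum.insert[OF insert.hyps])
  qed
  from this[OF \<open>finite K\<close>] have "(\<Sum>l\<in>K. a l * L (\<lambda>m. of_bool (m = l)) k) = L (\<lambda>m. \<Sum>l\<in>K. a l * of_bool (m = l)) k" ..
  also have "\<dots> = L a k" by (rule cong) (use \<open>finite K\<close> in \<open>simp add: if_distrib of_bool_def cong: if_cong\<close>)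
  finally show ?thesis ..
qed

lemma abs_le_lp_norm:
  assumes "finite K" "l \<in> K"
  shows "\<bar>a l\<bar> \<le> 2 ^ n * lp_norm n K 2 (a :: _ \<Rightarrow> real)"
proof -
  have c: "(2::real) powi (- 2 * int n) = (1 / 2 ^ n) ^ 2"
    by (simp add: power_int_minus power_int_mult power_int_def field_simps nat_mult_distrib flip: power_mult)
  have "\<bar>a l\<bar> ^ 2 \<le> (\<Sum>k\<in>K. \<bar>a k\<bar> ^ 2)" using assms by (intro member_le_sum) auto
  then have "((1 / 2 ^ n) * \<bar>a l\<bar>) ^ 2 \<le> (1 / 2 ^ n) ^ 2 * (\<Sum>k\<in>K. \<bar>a k\<bar> ^ 2)"
    unfolding power_mult_distrib by (rule mult_left_mono) simp
  then have "(1 / 2 ^ n) * \<bar>a l\<bar> \<le> sqrt ((1 / 2 ^ n) ^ 2 * (\<Sum>k\<in>K. \<bar>a k\<bar> ^ 2))"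
    by (rule real_le_rsqrt)
  also have "\<dots> = lp_norm n K 2 a"
    unfolding lp_norm_def c by (simp add: powr_half_sqrt sum_nonneg)
  finally show ?thesis by (simp add: field_simps)
qed

lemma lp_norm_triangle:
  assumes "finite K" "1 \<le> p"
  shows "lp_norm n K p (\<lambda>k. a k + b k) \<le> lp_norm n K p a + lp_norm n K p b"
  using LpN_triangle[OF LpM_scaled_count LpM_scaled_count] assms by (simp add: lp_norm_eq_LpN)

lemma lp_norm_triangle_diff:
  assumes "finite K" "1 \<le> p"
  shows "\<bar>lp_norm n K p a - lp_norm n K p b\<bar> \<le> lp_norm n K p (\<lambda>k. a k - b k)"
  using LpN_triangle_diff[OF LpM_scaled_count LpM_scaled_count] assms by (simp add: lp_norm_eq_LpN)

context framelets
begin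

text \<open>Uniform boundedness for the seminorms u -> norm of A_n T_n u. Each is bounded because
  arrays on \<open>K_set F n\<close> form a finite-dimensional space. For fixed u they are bounded
  because T_n A u is bounded in n and differs from A_n T_n u by a null sequence.\<close>

lemma fidelity_equicontinuous:
  fixes A :: "(point \<Rightarrow> real) \<Rightarrow> point \<Rightarrow> real"
  assumes A: "\<And>u. u \<in> LpM (meas_on Omega) 2 \<Longrightarrow> A u \<in> LpM (meas_on Omega) 2"
    and An: "\<And>n. linear_operator_arrays (K_set F n) (An n)"
    and lim: "\<And>u. u \<in> LpM (meas_on Omega) 2 \<Longrightarrow>
      (\<lambda>n. lp_norm n (K_set F n) 2 (\<lambda>k. T_op F n (A u) k - An n (T_op F n u) k)) \<longlonglongrightarrow> 0"
  obtains C where "0 \<le> C" "\<And>n u. u \<in> LpM (meas_on Omega) 2 \<Longrightarrow>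
      lp_norm n (K_set F n) 2 (An n (T_op F n u)) \<le> C * LpN (meas_on Omega) 2 u"
proof -
  let ?M = "meas_on Omega"
  obtain R M where R: "1 \<le> R" "0 \<le> M" "bcs R M (refinable F)" "\<And>j. bcs R M (ker_S j)" "\<And>i j. bcs R M (ker_W i j)"
    using kernels_uniform by blast
  interpret T: sampling "K_set F" R "\<lambda>_::real. refinable F" M by (rule sampling_refinable[OF R(1-3)])
  note fin = T.finite_K
  define N where "N n u = lp_norm n (K_set F n) 2 (An n (T_op F n u))" for n u
  have T_int: "integrable lborel (\<lambda>x. indicator Omega x * u x * refinable F (2 ^ n *\<^sub>R x - embed k))"
    if "u \<in> LpM ?M 2" for u n k
    using T.sample_coeff(1)[OF LpM_ext(1)[THEN iffD1, OF _ that], of 1 n k] by simp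
  have T_add: "T_op F n (\<lambda>x. u x + v x) = (\<lambda>k. T_op F n u k + T_op F n v k)"
    if "u \<in> LpM ?M 2" "v \<in> LpM ?M 2" for u v n
    using T_int[OF that(1), of n] T_int[OF that(2), of n] by (simp add: fun_eq_iff T_op_eq algebra_simps)
  have T_scale: "T_op F n (\<lambda>x. c * u x) = (\<lambda>k. c * T_op F n u k)" for n c u
    by (simp add: fun_eq_iff T_op_eq mult.left_commute[of _ c] mult.assoc)
  have T_bound: "lp_norm n (K_set F n) 2 (T_op F n u) \<le> T.op_bound 2 * LpN ?M 2 u" if "u \<in> LpM ?M 2" for n u
  proof -
    have "lp_norm n (K_set F n) 2 (sample (\<lambda>_::real. refinable F) n (\<lambda>x. indicator Omega x *\<^sub>R u x))
      \<le> real DIM(real) * T.op_bound 2 * LpN lborel 2 (\<lambda>x. indicator Omega x *\<^sub>R u x)"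
      by (rule T.sample_bound[OF LpM_ext(1)[THEN iffD1, OF _ that]]) auto
    moreover have "T_op F n u = sample (\<lambda>_::real. refinable F) n (\<lambda>x. indicator Omega x *\<^sub>R u x)"
      by (rule ext) (rule T_op_eq_sample)
    ultimately show ?thesis by (simp add: LpM_ext(2)[of 2 u])
  qed
  have "\<exists>C\<ge>0. \<forall>n. \<forall>u\<in>LpM ?M 2. N n u \<le> C * LpN ?M 2 u"
  proof (rule uniform_boundedness_LpM[OF prob_space_Omega])
    fix n and u v :: "point \<Rightarrow> real" assume uv: "u \<in> LpM ?M 2" "v \<in> LpM ?M 2"
    have "N n (\<lambda>x. u x + v x) = lp_norm n (K_set F n) 2 (\<lambda>k. An n (T_op F n u) k + An n (T_op F n v) k)"
      unfolding N_def T_add[OF uv] using An[of n] unfolding linear_operator_arrays_def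
      by (intro lp_norm_cong) blast
    then show "N n (\<lambda>x. u x + v x) \<le> N n u + N n v"
      using lp_norm_triangle[OF fin, where p=2 and a="An n (T_op F n u)" and b="An n (T_op F n v)"]
      by (simp add: N_def)
  next
    fix n c and u :: "point \<Rightarrow> real" assume "u \<in> LpM ?M 2"
    have "N n (\<lambda>x. c * u x) = lp_norm n (K_set F n) 2 (\<lambda>k. c *\<^sub>R An n (T_op F n u) k)"
      unfolding N_def T_scale real_scaleR_def using An[of n] unfolding linear_operator_arrays_def
      by (intro lp_norm_cong) blast
    then show "N n (\<lambda>x. c * u x) = \<bar>c\<bar> * N n u"
      unfolding N_def lp_norm_eq_LpN[OF fin] by (simp only: LpN_scaleR)
  next
    fix n
    \<comment> \<open>Sum of the norms of the matrix columns; 2^n bounds a single entry by the array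
      norm. Its growth with n is harmless, as only boundedness for fixed n is claimed here.\<close>
    let ?c = "\<Sum>l\<in>K_set F n. 2 ^ n * lp_norm n (K_set F n) 2 (An n (\<lambda>m. of_bool (m = l)))"
    have "N n u \<le> (?c * T.op_bound 2) * LpN ?M 2 u" if u: "u \<in> LpM ?M 2" for u
    proof -
      let ?N = "LpN (scaled_count n (K_set F n)) 2"
      let ?t = "lp_norm n (K_set F n) 2 (T_op F n u)"
      have "N n u = lp_norm n (K_set F n) 2 (\<lambda>k. \<Sum>l\<in>K_set F n. T_op F n u l *\<^sub>R An n (\<lambda>m. of_bool (m = l)) k)"
        unfolding N_def real_scaleR_def by (intro lp_norm_cong linear_operator_arrays_sum[OF An fin])
      also have "\<dots> \<le> (\<Sum>l\<in>K_set F n. ?N (\<lambda>k. T_op F n u l *\<^sub>R An n (\<lambda>m. of_bool (m = l)) k))"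
        unfolding lp_norm_eq_LpN[OF fin] by (intro LpN_sum_le LpM_scaled_count fin) simp
      also have "\<dots> \<le> (\<Sum>l\<in>K_set F n. (2 ^ n * ?t) * ?N (An n (\<lambda>m. of_bool (m = l))))"
        by (intro sum_mono) (simp add: LpN_scaleR mult_right_mono abs_le_lp_norm[OF fin] del: real_scaleR_def)
      also have "\<dots> = ?c * ?t"
        unfolding lp_norm_eq_LpN[OF fin] sum_distrib_right by (intro sum.cong refl) (simp only: ac_simps)
      also have "\<dots> \<le> ?c * (T.op_bound 2 * LpN ?M 2 u)"
        by (intro mult_left_mono T_bound u sum_nonneg) (simp add: lp_norm_eq_LpN[OF fin])
      finally show ?thesis by (simp only: mult.assoc)
    qed
    then show "\<exists>C. \<forall>u\<in>LpM ?M 2. N n u \<le> C * LpN ?M 2 u" by blast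
  next
    fix u :: "point \<Rightarrow> real" assume u: "u \<in> LpM ?M 2"
    let ?a = "\<lambda>n k. T_op F n (A u) k - An n (T_op F n u) k"
    obtain B where B: "\<And>n. lp_norm n (K_set F n) 2 (?a n) \<le> B"
    proof -
      obtain B where "\<And>n. norm (lp_norm n (K_set F n) 2 (?a n)) \<le> B"
        using convergent_imp_Bseq[OF convergentI[OF lim[OF u]]] unfolding Bseq_def by blast
      then show ?thesis unfolding real_norm_def by (intro that) (rule order_trans[OF abs_ge_self])
    qed
    have "N n u \<le> B + T.op_bound 2 * LpN ?M 2 (A u)" for n
      using lp_norm_triangle_diff[where n=n and p=2 and K="K_set F n" and a="T_op F n (A u)" and b="An n (T_op F n u)", OF fin]
        B[of n] T_bound[OF A[OF u], of n]
      unfolding N_def by (simp add: abs_le_iff)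
    then show "\<exists>B. \<forall>n. N n u \<le> B" by blast
  qed simp
  then show ?thesis using that unfolding N_def by blast
qed

lemma fidelity_tendsto:
  fixes A :: "(point \<Rightarrow> real) \<Rightarrow> point \<Rightarrow> real"
  assumes A: "\<And>u. u \<in> LpM (meas_on Omega) 2 \<Longrightarrow> A u \<in> LpM (meas_on Omega) 2"
    and An: "\<And>n. linear_operator_arrays (K_set F n) (An n)"
    and lim: "\<And>u. u \<in> LpM (meas_on Omega) 2 \<Longrightarrow>
      (\<lambda>n. lp_norm n (K_set F n) 2 (\<lambda>k. T_op F n (A u) k - An n (T_op F n u) k)) \<longlonglongrightarrow> 0"
    and f: "f \<in> LpM (meas_on Omega) 2"
    and U: "\<And>i. U i \<in> LpM (meas_on Omega) 2" and u: "u \<in> LpM (meas_on Omega) 2"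
    and conv: "(\<lambda>i. LpN (meas_on Omega) 2 (\<lambda>x. U i x - u x)) \<longlonglongrightarrow> 0" and \<rho>: "strict_mono \<rho>"
  shows "(\<lambda>i. lp_norm (\<rho> i) (K_set F (\<rho> i)) 2 (\<lambda>k. An (\<rho> i) (T_op F (\<rho> i) (U i)) k - T_op F (\<rho> i) f k))
    \<longlonglongrightarrow> LpN (meas_on Omega) 2 (\<lambda>x. A u x - f x)"
proof -
  let ?M = "meas_on Omega"
  let ?L = "\<lambda>i. lp_norm (\<rho> i) (K_set F (\<rho> i)) 2"
  obtain R M where R: "1 \<le> R" "0 \<le> M" "bcs R M (refinable F)" "\<And>j. bcs R M (ker_S j)" "\<And>i j. bcs R M (ker_W i j)"
    using kernels_uniform by blast
  interpret T: sampling "K_set F" R "\<lambda>_::real. refinable F" M by (rule sampling_refinable[OF R(1-3)])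
  note fin = T.finite_K
  obtain C where C: "0 \<le> C" "\<And>n u. u \<in> LpM ?M 2 \<Longrightarrow>
      lp_norm n (K_set F n) 2 (An n (T_op F n u)) \<le> C * LpN ?M 2 u"
    using fidelity_equicontinuous[OF A An lim] by blast
  have T_diff: "T_op F n (\<lambda>x. u x - v x) k = T_op F n u k - T_op F n v k"
    if "u \<in> LpM ?M 2" "v \<in> LpM ?M 2" for u v n k
    unfolding T_op_eq_sample scaleR_diff_right
    by (rule T.sample_diff[OF LpM_ext(1)[THEN iffD1, OF _ that(1)] LpM_ext(1)[THEN iffD1, OF _ that(2)]]) auto
  have An_diff: "An n (\<lambda>l. a l - b l) k = An n a k - An n b k" if "k \<in> K_set F n" for n a b k
  proof -
    have "An n (\<lambda>l. (a l - b l) + b l) k = An n (\<lambda>l. a l - b l) k + An n b k"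
      by (rule An[of n, unfolded linear_operator_arrays_def, THEN conjunct2, THEN conjunct1, THEN spec, THEN spec, THEN bspec, OF that])
    then show ?thesis by simp
  qed
  have 1: "(\<lambda>i. ?L i (\<lambda>k. T_op F (\<rho> i) (\<lambda>x. A u x - f x) k)) \<longlonglongrightarrow> LpN ?M 2 (\<lambda>x. A u x - f x)"
    using T.sample_norm_tendsto_seq[OF _ LpM_diff[OF A[OF u] f] _ _ \<rho>, of "\<lambda>i x. A u x - f x"] LpM_diff[OF A[OF u] f]
    unfolding T_op_eq_sample by (simp add: LpN_def)
  have 2: "(\<lambda>i. C * LpN ?M 2 (\<lambda>x. U i x - u x) + ?L i (\<lambda>k. T_op F (\<rho> i) (A u) k - An (\<rho> i) (T_op F (\<rho> i) u) k)) \<longlonglongrightarrow> 0"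
    using tendsto_add[OF tendsto_mult_right_zero[OF conv, of C] LIMSEQ_subseq_LIMSEQ[OF lim[OF u] \<rho>]] by (simp add: o_def)
  have "(\<lambda>i. ?L i (\<lambda>k. An (\<rho> i) (T_op F (\<rho> i) (U i)) k - T_op F (\<rho> i) f k) - ?L i (\<lambda>k. T_op F (\<rho> i) (\<lambda>x. A u x - f x) k)) \<longlonglongrightarrow> 0"
  proof (rule Lim_null_comparison[OF _ 2], rule always_eventually, rule allI)
    fix i
    let ?n = "\<rho> i"
    have "\<bar>?L i (\<lambda>k. An ?n (T_op F ?n (U i)) k - T_op F ?n f k) - ?L i (\<lambda>k. T_op F ?n (\<lambda>x. A u x - f x) k)\<bar>
      \<le> ?L i (\<lambda>k. (An ?n (T_op F ?n (U i)) k - T_op F ?n f k) - T_op F ?n (\<lambda>x. A u x - f x) k)"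
      by (rule lp_norm_triangle_diff[OF fin]) simp
    \<comment> \<open>The terms with f cancel. What remains is the moving part, controlled by
      equicontinuity, and the consistency error at the fixed limit u.\<close>
    also have "\<dots> = ?L i (\<lambda>k. An ?n (T_op F ?n (\<lambda>x. U i x - u x)) k + (An ?n (T_op F ?n u) k - T_op F ?n (A u) k))"
    proof (rule lp_norm_cong)
      fix k assume k: "k \<in> K_set F ?n"
      have "T_op F ?n (\<lambda>x. U i x - u x) = (\<lambda>l. T_op F ?n (U i) l - T_op F ?n u l)"
        by (rule ext) (rule T_diff[OF U u])
      then show "(An ?n (T_op F ?n (U i)) k - T_op F ?n f k) - T_op F ?n (\<lambda>x. A u x - f x) k
        = An ?n (T_op F ?n (\<lambda>x. U i x - u x)) k + (An ?n (T_op F ?n u) k - T_op F ?n (A u) k)"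
        by (simp add: An_diff[OF k] T_diff[OF A[OF u] f])
    qed
    also have "\<dots> \<le> ?L i (An ?n (T_op F ?n (\<lambda>x. U i x - u x))) + ?L i (\<lambda>k. An ?n (T_op F ?n u) k - T_op F ?n (A u) k)"
      by (rule lp_norm_triangle[OF fin]) simp
    also have "\<dots> \<le> C * LpN ?M 2 (\<lambda>x. U i x - u x) + ?L i (\<lambda>k. T_op F ?n (A u) k - An ?n (T_op F ?n u) k)"
      using C(2)[OF LpM_diff[OF U[of i] u], of ?n] LpN_minus[of _ 2 "An ?n (T_op F ?n u)" "T_op F ?n (A u)"]
      by (simp add: lp_norm_eq_LpN[OF fin])
    finally show "norm (?L i (\<lambda>k. An ?n (T_op F ?n (U i)) k - T_op F ?n f k) - ?L i (\<lambda>k. T_op F ?n (\<lambda>x. A u x - f x) k))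
      \<le> C * LpN ?M 2 (\<lambda>x. U i x - u x) + ?L i (\<lambda>k. T_op F ?n (A u) k - An ?n (T_op F ?n u) k)"
      by simp
  qed
  with 1 show ?thesis by (rule Lim_transform)
qed

text \<open>Continuous convergence of E_n to E along a subsequence of levels. It serves twice: for
  the optimal points tending to the cluster point, and with constant sequences for
  competitors.\<close>

lemma E_n_tendsto:
  fixes A :: "(point \<Rightarrow> real) \<Rightarrow> point \<Rightarrow> real" and V :: "nat \<Rightarrow> point \<Rightarrow> real ^ 'j"
  assumes p: "1 \<le> p" "p \<le> 2" and q: "1 \<le> q"
    and A: "\<And>u. u \<in> LpM (meas_on Omega) 2 \<Longrightarrow> A u \<in> LpM (meas_on Omega) 2"
    and An: "\<And>n. linear_operator_arrays (K_set F n) (An n)"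
    and lim: "\<And>u. u \<in> LpM (meas_on Omega) 2 \<Longrightarrow>
      (\<lambda>n. lp_norm n (K_set F n) 2 (\<lambda>k. T_op F n (A u) k - An n (T_op F n u) k)) \<longlonglongrightarrow> 0"
    and f: "f \<in> LpM (meas_on Omega) 2"
    and UV: "\<And>i. (U i, V i) \<in> W_space (max_ord F) p q" and uv: "(u, v) \<in> W_space (max_ord F) p q"
    and conv: "(\<lambda>i. sobolev_norm Omega (2 * max_ord F) p (\<lambda>x. U i x - u x)) \<longlonglongrightarrow> 0"
      "(\<lambda>i. sobolev_norm Omega (max_ord F) q (\<lambda>x. V i x - v x)) \<longlonglongrightarrow> 0"
    and \<rho>: "strict_mono \<rho>"
  shows "(\<lambda>i. E_n F p q \<nu>1 \<nu>2 An f (\<rho> i) (U i, V i)) \<longlonglongrightarrow> E_lim F p q \<nu>1 \<nu>2 A f (u, v)"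
proof -
  let ?M = "meas_on Omega"
  have U: "\<And>i. U i \<in> sobolev Omega (2 * max_ord F) p" "u \<in> sobolev Omega (2 * max_ord F) p"
    and V: "\<And>i. V i \<in> sobolev Omega (max_ord F) q" "v \<in> sobolev Omega (max_ord F) q"
    using UV uv by (auto simp: W_space_def)
  have r: "1 \<le> 2 * max_ord F" "1 \<le> max_ord F" using max_ord_ge_1 by auto
  obtain R M where R: "1 \<le> R" "0 \<le> M" "bcs R M (refinable F)" "\<And>j. bcs R M (ker_S j)" "\<And>i j. bcs R M (ker_W i j)"
    using kernels_uniform by blast
  interpret S: sampling "K_set F" R "\<lambda>b::real ^ 'j. ker_S (vec_index b)" M by (rule sampling_ker_S[OF R(1-4)])
  interpret W: sampling "K_set F" R "\<lambda>b::real ^ 'j ^ 'j. case_prod ker_W (mat_index b)" M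
    by (rule sampling_ker_W[OF R(1-3,5)])
  obtain Cu where "\<forall>(f :: point \<Rightarrow> real) r p. f \<in> sobolev Omega r p \<longrightarrow> 1 \<le> r \<longrightarrow> 1 \<le> p \<longrightarrow>
      f \<in> LpM ?M 2 \<and> LpN ?M 2 f \<le> Cu * sobolev_norm Omega r p f"
    using sobolev_L2 ..
  note Cu = this[rule_format]
  obtain Cv where "\<forall>(f :: point \<Rightarrow> real ^ 'j) r p. f \<in> sobolev Omega r p \<longrightarrow> 1 \<le> r \<longrightarrow> 1 \<le> p \<longrightarrow>
      f \<in> LpM ?M 2 \<and> LpN ?M 2 f \<le> Cv * sobolev_norm Omega r p f"
    using sobolev_L2 ..
  note Cv = this[rule_format]
  note dU = sobolev_diff[OF U p(1)] and dV = sobolev_diff[OF V q]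
  \<comment> \<open>The detour through L_2 covers the case q < p, in which L_q integrability alone
    would not give L_p.\<close>
  have Vp: "V i \<in> LpM ?M p" "v \<in> LpM ?M p" for i
    by (rule LpM_mono_exponent(1)[OF conjunct1[OF Cv[OF V(1) r(2) q]] p prob_space_Omega])
       (rule LpM_mono_exponent(1)[OF conjunct1[OF Cv[OF V(2) r(2) q]] p prob_space_Omega])
  have u2: "(\<lambda>i. LpN ?M 2 (\<lambda>x. U i x - u x)) \<longlonglongrightarrow> 0"
  proof (rule tendsto_sandwich[OF _ _ tendsto_const tendsto_mult_right_zero[OF conv(1), of Cu]])
    show "\<forall>\<^sub>F i in sequentially. LpN ?M 2 (\<lambda>x. U i x - u x) \<le> Cu * sobolev_norm Omega (2 * max_ord F) p (\<lambda>x. U i x - u x)"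
      using Cu[OF dU r(1) p(1)] by (simp add: always_eventually)
  qed (simp add: always_eventually)
  have v2: "(\<lambda>i. LpN ?M p (\<lambda>x. V i x - v x)) \<longlonglongrightarrow> 0"
  proof (rule tendsto_sandwich[OF _ _ tendsto_const tendsto_mult_right_zero[OF conv(2), of Cv]])
    have "LpN ?M p (\<lambda>x. V i x - v x) \<le> Cv * sobolev_norm Omega (max_ord F) q (\<lambda>x. V i x - v x)" for i
      using LpM_mono_exponent(2)[OF _ p prob_space_Omega] Cv[OF dV[of i] r(2) q] by (meson order_trans)
    then show "\<forall>\<^sub>F i in sequentially. LpN ?M p (\<lambda>x. V i x - v x) \<le> Cv * sobolev_norm Omega (max_ord F) q (\<lambda>x. V i x - v x)"
      by (simp add: always_eventually)
  qed (simp add: always_eventually)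
  note D1 = D1_op_LpM[OF U(1) p(1)] D1_op_LpM[OF U(2) p(1)]
  note G = LpM_diff[OF D1(1) Vp(1) p(1)] LpM_diff[OF D1(2) Vp(2) p(1)]
  have 1: "(\<lambda>i. LpN ?M p (\<lambda>x. (D1_op F (U i) x - V i x) - (D1_op F u x - v x))) \<longlonglongrightarrow> 0"
  proof (rule tendsto_sandwich[OF _ _ tendsto_const])
    show "(\<lambda>i. real CARD('j) * sobolev_norm Omega (2 * max_ord F) p (\<lambda>x. U i x - u x) + LpN ?M p (\<lambda>x. V i x - v x)) \<longlonglongrightarrow> 0"
      using tendsto_add[OF tendsto_mult_right_zero[OF conv(1), of "real CARD('j)"] v2] by simp
    have "LpN ?M p (\<lambda>x. (D1_op F (U i) x - V i x) - (D1_op F u x - v x))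
      \<le> real CARD('j) * sobolev_norm Omega (2 * max_ord F) p (\<lambda>x. U i x - u x) + LpN ?M p (\<lambda>x. V i x - v x)" for i
    proof -
      have "(\<lambda>x. (D1_op F (U i) x - V i x) - (D1_op F u x - v x))
        = (\<lambda>x. (D1_op F (U i) x - D1_op F u x) + (v x - V i x))" by (simp add: algebra_simps)
      then show ?thesis
        using LpN_triangle[OF LpM_diff[OF D1(1) D1(2) p(1)] LpM_diff[OF Vp(2) Vp(1) p(1)] p(1), of i i]
          D1_op_diff_le[OF U p(1), of i] LpN_minus[of ?M p v "V i"] by simp
    qed
    then show "\<forall>\<^sub>F i in sequentially. LpN ?M p (\<lambda>x. (D1_op F (U i) x - V i x) - (D1_op F u x - v x))
      \<le> real CARD('j) * sobolev_norm Omega (2 * max_ord F) p (\<lambda>x. U i x - u x) + LpN ?M p (\<lambda>x. V i x - v x)"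
      by (simp add: always_eventually)
  qed (simp add: always_eventually)
  have 2: "(\<lambda>i. LpN ?M q (\<lambda>x. D2_op F (V i) x - D2_op F v x)) \<longlonglongrightarrow> 0"
  proof (rule tendsto_sandwich[OF _ _ tendsto_const tendsto_mult_right_zero[OF conv(2), of "real (CARD('j) * CARD('j))"]])
    show "\<forall>\<^sub>F i in sequentially. LpN ?M q (\<lambda>x. D2_op F (V i) x - D2_op F v x)
      \<le> real (CARD('j) * CARD('j)) * sobolev_norm Omega (max_ord F) q (\<lambda>x. V i x - v x)"
      using D2_op_diff_le[OF V q] by (intro always_eventually allI)
  qed (simp add: always_eventually)
  have e1: "(\<lambda>i. lp_norm (\<rho> i) (K_set F (\<rho> i)) p
      (\<lambda>k. (\<chi> j. W1_op F (\<rho> i) (T_op F (\<rho> i) (U i)) j k - S_op F (\<rho> i) (V i) j k) :: real ^ 'j))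
      \<longlonglongrightarrow> LpN ?M p (\<lambda>x. D1_op F u x - v x)"
  proof -
    have "lp_norm (\<rho> i) (K_set F (\<rho> i)) p
      (\<lambda>k. (\<chi> j. W1_op F (\<rho> i) (T_op F (\<rho> i) (U i)) j k - S_op F (\<rho> i) (V i) j k) :: real ^ 'j)
      = lp_norm (\<rho> i) (K_set F (\<rho> i)) p (sample (\<lambda>b::real ^ 'j. ker_S (vec_index b)) (\<rho> i)
          (\<lambda>x. indicator Omega x *\<^sub>R (D1_op F (U i) x - V i x)))" for i
      by (rule lp_norm_cong) (rule W1_diff_eq_sample[OF _ U(1) p(1) Vp(1)])
    then show ?thesis using S.sample_norm_tendsto_seq[OF G p(1) 1 \<rho>] by (simp only:)
  qed
  have e2: "(\<lambda>i. lp_norm (\<rho> i) (K_set F (\<rho> i)) q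
      (\<lambda>k. (\<chi> i' j. W2_op F (\<rho> i) (S_op F (\<rho> i) (V i)) i' j k) :: real ^ 'j ^ 'j))
      \<longlonglongrightarrow> LpN ?M q (D2_op F v)"
  proof -
    have "lp_norm (\<rho> i) (K_set F (\<rho> i)) q
      (\<lambda>k. (\<chi> i' j. W2_op F (\<rho> i) (S_op F (\<rho> i) (V i)) i' j k) :: real ^ 'j ^ 'j)
      = lp_norm (\<rho> i) (K_set F (\<rho> i)) q (sample (\<lambda>b::real ^ 'j ^ 'j. case_prod ker_W (mat_index b)) (\<rho> i)
          (\<lambda>x. indicator Omega x *\<^sub>R D2_op F (V i) x))" for i
      by (rule lp_norm_cong) (rule W2_eq_sample[OF _ V(1) q])
    then show ?thesis
      using W.sample_norm_tendsto_seq[OF D2_op_LpM[OF V(1) q] D2_op_LpM[OF V(2) q] q 2 \<rho>] by (simp only:)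
  qed
  have e3: "(\<lambda>i. lp_norm (\<rho> i) (K_set F (\<rho> i)) 2 (\<lambda>k. An (\<rho> i) (T_op F (\<rho> i) (U i)) k - T_op F (\<rho> i) f k))
    \<longlonglongrightarrow> LpN ?M 2 (\<lambda>x. A u x - f x)"
    by (rule fidelity_tendsto[OF A An lim f _ _ u2 \<rho>]) (use Cu[OF U(1) r(1) p(1)] Cu[OF U(2) r(1) p(1)] in auto)
  have pos: "0 \<le> lp_norm n K s a" for n K s and a :: "int \<times> int \<Rightarrow> 'b::euclidean_space"
    by (simp add: lp_norm_def)
  show ?thesis
    unfolding E_n_def E_lim_def Lp_norm_eq_LpN prod.case
    using p q by (intro tendsto_intros tendsto_powr' e1 e2 e3) (auto simp: pos always_eventually)
qed

end

theorem corollary3p1: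
  fixes F :: "('j::finite) framelet_data"
    and p q \<nu>1 \<nu>2 :: real
    and f :: "point \<Rightarrow> real"
    and A :: "(point \<Rightarrow> real) \<Rightarrow> point \<Rightarrow> real"
    and A\<^sub>n :: "nat \<Rightarrow> (int \<times> int \<Rightarrow> real) \<Rightarrow> int \<times> int \<Rightarrow> real"
  assumes "framelet_system F"
    and "1 \<le> p" "p \<le> 2" "1 \<le> q" "q \<le> 2"
    and "\<nu>1 > 0" "\<nu>2 > 0"
    and "f \<in> Lp Omega 2"
    and "linear_operator_L2 A"
    and "\<And>n. linear_operator_arrays (K_set F n) (A\<^sub>n n)"
    and "\<And>u. u \<in> Lp Omega 2 \<Longrightarrow>
      (\<lambda>n. lp_norm n (K_set F n) 2 (\<lambda>k. T_op F n (A u) k - A\<^sub>n n (T_op F n u) k)) \<longlonglongrightarrow> 0"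
  shows "(\<forall>\<epsilon> > 0. \<forall>(w :: nat \<Rightarrow> (point \<Rightarrow> real) \<times> (point \<Rightarrow> real ^ 'j)) z.
           (\<forall>n. eps_optimal (W_space (max_ord F) p q) \<epsilon> (E_n F p q \<nu>1 \<nu>2 A\<^sub>n f n) (w n)) \<longrightarrow>
           cluster_point (max_ord F) p q w z \<longrightarrow>
           eps_optimal (W_space (max_ord F) p q) \<epsilon> (E_lim F p q \<nu>1 \<nu>2 A f) z)
       \<and> (\<forall>(w :: nat \<Rightarrow> (point \<Rightarrow> real) \<times> (point \<Rightarrow> real ^ 'j)) z.
           (\<forall>n. minimizer (W_space (max_ord F) p q) (E_n F p q \<nu>1 \<nu>2 A\<^sub>n f n) (w n)) \<longrightarrow>
           cluster_point (max_ord F) p q w z \<longrightarrow>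
           minimizer (W_space (max_ord F) p q) (E_lim F p q \<nu>1 \<nu>2 A f) z)"
proof -
  interpret framelets F by standard fact
  let ?X = "W_space (max_ord F) p q :: ((point \<Rightarrow> real) \<times> (point \<Rightarrow> real ^ 'j)) set"
  let ?E = "E_lim F p q \<nu>1 \<nu>2 A f"
  let ?En = "E_n F p q \<nu>1 \<nu>2 A\<^sub>n f"
  have A: "A u \<in> LpM (meas_on Omega) 2" if "u \<in> LpM (meas_on Omega) 2" for u
    using assms(9) that by (simp add: linear_operator_L2_def Lp_eq_LpM)
  note tendsto = E_n_tendsto[OF assms(2-4) A assms(10) assms(11)[unfolded Lp_eq_LpM] assms(8)[unfolded Lp_eq_LpM]]
  \<comment> \<open>Needed for constant sequences. The chosen derivative of the zero function
    vanishes only almost everywhere, by uniqueness.\<close>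
  have zero: "sobolev_norm Omega r s (\<lambda>x. y x - y x) = 0" if "y \<in> sobolev Omega r s" "1 \<le> s"
    for y :: "point \<Rightarrow> 'b::euclidean_space" and r s
  proof -
    have "LpN (meas_on Omega) s (weak_deriv Omega \<alpha> (\<lambda>x. y x - y x)) = 0" if \<alpha>: "fst \<alpha> + snd \<alpha> \<le> r" for \<alpha>
    proof -
      note d = sobolev_weak_deriv[OF sobolev_diff[OF \<open>y \<in> sobolev Omega r s\<close> \<open>y \<in> sobolev Omega r s\<close> \<open>1 \<le> s\<close>] \<alpha>]
      have "LpN (meas_on Omega) s (weak_deriv Omega \<alpha> (\<lambda>x. y x - y x)) = LpN (meas_on Omega) s (\<lambda>x. 0 :: 'b)"
        using weak_deriv_unique[OF d(1), of "\<lambda>x. 0"] LpM_measurable[OF d(2)]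
        by (intro LpN_cong_AE) (auto simp: AE_meas_on_Omega has_weak_deriv_def locally_integrable_def set_integrable_def)
      then show ?thesis by (simp add: LpN_def)
    qed
    then show ?thesis using that(2) by (simp add: sobolev_norm_def Lp_norm_eq_LpN)
  qed
  \<comment> \<open>The tolerance is an arbitrary real, so the value 0 yields the statement on
    minimizers.\<close>
  have main: "eps_optimal ?X \<epsilon> ?E z"
    if opt: "\<forall>n. eps_optimal ?X \<epsilon> (?En n) (w n)" and cl: "cluster_point (max_ord F) p q w z" for \<epsilon> w z
  proof -
    obtain u v where z: "z = (u, v)" by (cases z)
    obtain \<rho> where zX: "z \<in> ?X" and \<rho>: "strict_mono \<rho>" and
      lim: "(\<lambda>i. W_norm (max_ord F) p q (\<lambda>x. fst (w (\<rho> i)) x - fst z x, \<lambda>x. snd (w (\<rho> i)) x - snd z x)) \<longlonglongrightarrow> 0"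
      using cl unfolding cluster_point_def by blast
    have wX: "w n \<in> ?X" for n using opt by (simp add: eps_optimal_def)
    have pos: "0 \<le> sobolev_norm Omega r s y" for r s and y :: "point \<Rightarrow> 'b::euclidean_space"
      by (simp add: sobolev_norm_def)
    have "(\<lambda>i. sobolev_norm Omega (2 * max_ord F) p (\<lambda>x. fst (w (\<rho> i)) x - u x)) \<longlonglongrightarrow> 0"
      "(\<lambda>i. sobolev_norm Omega (max_ord F) q (\<lambda>x. snd (w (\<rho> i)) x - v x)) \<longlonglongrightarrow> 0"
      by (rule tendsto_sandwich[OF _ _ tendsto_const lim], simp_all add: pos always_eventually W_norm_def z)+
    then have lim_w: "(\<lambda>i. ?En (\<rho> i) (w (\<rho> i))) \<longlonglongrightarrow> ?E z"
      using tendsto[where U="\<lambda>i. fst (w (\<rho> i))" and V="\<lambda>i. snd (w (\<rho> i))" and u=u and v=v and \<rho>=\<rho>] wX zX \<rho>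
      by (simp add: z)
    \<comment> \<open>A real infimum lies below the values only for families bounded below;
      nonnegativity of the weights provides this.\<close>
    have En_pos: "0 \<le> ?En n y" for n y
      using assms(6,7) by (cases y) (simp add: E_n_def)
    have "?E z - \<epsilon> \<le> ?E y" if y: "y \<in> ?X" for y
    proof -
      obtain y1 y2 where y12: "y = (y1, y2)" by (cases y)
      have s: "y1 \<in> sobolev Omega (2 * max_ord F) p" "y2 \<in> sobolev Omega (max_ord F) q"
        using y by (auto simp: y12 W_space_def)
      have lim_y: "(\<lambda>i. ?En (\<rho> i) y + \<epsilon>) \<longlonglongrightarrow> ?E y + \<epsilon>"
        using tendsto[where U="\<lambda>_. y1" and V="\<lambda>_. y2" and u=y1 and v=y2 and \<rho>=\<rho>] y \<rho> zero[OF s(1) assms(2)] zero[OF s(2) assms(4)]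
        by (intro tendsto_intros) (simp add: y12)
      have "?En n (w n) \<le> ?En n y + \<epsilon>" for n
      proof -
        have "(INF y\<in>?X. ?En n y) \<le> ?En n y"
          using En_pos y by (intro cINF_lower bdd_belowI2[of _ 0])
        then show ?thesis using opt unfolding eps_optimal_def by (smt (verit))
      qed
      then have "?E z \<le> ?E y + \<epsilon>" by (intro LIMSEQ_le[OF lim_w lim_y]) auto
      then show ?thesis by simp
    qed
    then have "?E z - \<epsilon> \<le> (INF y\<in>?X. ?E y)" using zX by (intro cINF_greatest) auto
    then show ?thesis using zX by (simp add: eps_optimal_def)
  qed
  then show ?thesis by blast
qed

end
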